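(* Let $f(x)=c_1+c_2x^{a_2}+c_3x^{a_3}\in\mathbb{Z}[x]$ be a trinomial with integer exponents $0<a_2<a_3=:d$ and all coefficients $c_1,c_2,c_3\in\{-H,\ldots,-1,1,\ldots,H\}$, where $H\in\mathbb{N}$, and assume that $f$ is not ill-conditioned. Then (given the $c_i$, $a_i$ and $H$ in binary) one can find, in deterministic time $\log^{4+o(1)}(dH)$ (bit operations in the classical Turing model), a set $\left\{\frac{r_1}{s_1},\ldots,\frac{r_m}{s_m}\right\}\subset\mathbb{Q}$ of cardinality $m=m(f)$ (with $r_j,s_j\in\mathbb{Z}$, $s_j\neq 0$) such that: (1) For all $j$, if $r_j\neq 0$ then $\log|r_j|=O(\log(dH))$ and $\log|s_j|=O(\log(dH))$. (2) For each $j$, setting $z_0:=r_j/s_j$, $f$ has a root $\zeta_j\in\mathbb{R}$ such that the sequence of Newton iterates, given for $i\geq 0$ by $z_{i+1}:=N_{f'}(z_i)$ if $\zeta_j$ is a degenerate root of $f$ and by $z_{i+1}:=N_f(z_i)$ otherwise, satisfies $|z_i-\zeta_j|\leq (1/2)^{2^{i-1}}|z_0-\zeta_j|$ for all $i\geq 1$. (3) $m=\#\{\zeta_1,\ldots,\zeta_m\}$ is the number of real roots of $f$. In particular, if the exponents $a_2$ and $a_3$ are fixed (and distinct), then at most a fraction of $\frac{1}{\log(dH)}+\frac{1}{H}$ of the triples $(c_1,c_2,c_3)\in\{-H,\ldots,H\}^3$ yield an $f(x)=c_1+c_2x^{a_2}+c_3x^{a_3}$ that is ill-conditioned.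
   Context: The notation $\#S$ denotes the cardinality of a set $S$. For a function $g$ analytic on $\mathbb{R}$, the Newton endomorphism is $N_g(z):=z-\frac{g(z)}{g'(z)}$. A root $\zeta$ of $f$ is degenerate if $f(\zeta)=f'(\zeta)=0$. Real roots are counted without multiplicity. A trinomial $f(x)=c_1+c_2x^{a_2}+c_3x^{a_3}\in\mathbb{Z}[x]$ with $0<a_2<a_3=:d$ and all $c_i\in\{-H,\ldots,-1,1,\ldots,H\}$ (so in particular all $c_i$ nonzero) is called ill-conditioned if and only if $$\left|\left|\frac{c_2}{a_3}\right|\left|\frac{a_3-a_2}{c_1}\right|^{(a_3-a_2)/a_3}\left|\frac{a_2}{c_3}\right|^{a_2/a_3}-1\right|<\frac{1}{\log(dH)}$$ and $f$ has no degenerate real roots. Here $\log$ is the natural logarithm. The $O$-constants are absolute. *)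

theory Defs
  imports "HOL-Analysis.Analysis"
begin

section \<open>Deterministic multitape Turing machines\<close>

text \<open>
  The states of a machine are \<open>0, \<dots>, num_states\<close>, where 0 is initial and \<open>num_states\<close> is the
  only halting state; its tape symbols are \<open>0, \<dots>, num_symbols - 1\<close>, where 0 is the blank. Given the
  current state and the symbols under the heads, \<open>delta\<close> yields the new state and, for each tape,
  the symbol to be written and the head movement.
\<close>

datatype move = Move_Left | Stay | Move_Right

record tm =
  num_tapes :: nat
  num_symbols :: nat
  num_states :: nat
  delta :: "nat \<Rightarrow> nat list \<Rightarrow> nat \<times> (nat \<times> move) list"

text \<open>
  Tape 0 holds the input and tape 1 the output. Words use the symbols 1 to 4 (see below), hence
  the bound 5. The values of \<open>delta\<close> are constrained on finitely many arguments only, and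
  no other arguments occur in a computation; so every machine has a finite description.
\<close>

definition valid_tm :: "tm \<Rightarrow> bool" where
  "valid_tm M \<longleftrightarrow> num_tapes M \<ge> 2 \<and> num_symbols M \<ge> 5 \<and>
     (\<forall>q xs. q < num_states M \<and> length xs = num_tapes M \<and> set xs \<subseteq> {..<num_symbols M} \<longrightarrow>
        fst (delta M q xs) \<le> num_states M \<and>
        length (snd (delta M q xs)) = num_tapes M \<and>
        fst ` set (snd (delta M q xs)) \<subseteq> {..<num_symbols M})"

text \<open>A tape is infinite in both directions and is paired with its head position.\<close>

type_synonym tape = "(int \<Rightarrow> nat) \<times> int"
type_synonym config = "nat \<times> tape list"

definition read :: "tape \<Rightarrow> nat" where
  "read T = fst T (snd T)"

fun act :: "nat \<times> move \<Rightarrow> tape \<Rightarrow> tape" where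
  "act (s, mv) (c, p) =
     (c(p := s), (case mv of Move_Left \<Rightarrow> p - 1 | Stay \<Rightarrow> p | Move_Right \<Rightarrow> p + 1))"

fun step :: "tm \<Rightarrow> config \<Rightarrow> config" where
  "step M (q, Ts) =
     (if q < num_states M
      then (let (q', as) = delta M q (map read Ts) in (q', map2 act as Ts))
      else (q, Ts))"

definition tape_contents :: "nat list \<Rightarrow> int \<Rightarrow> nat" where
  "tape_contents w i = (if 0 \<le> i \<and> i < int (length w) then w ! nat i else 0)"

definition initial_config :: "tm \<Rightarrow> nat list \<Rightarrow> config" where
  "initial_config M w =
     (0, (tape_contents w, 0) # replicate (num_tapes M - 1) (tape_contents [], 0))"

definition computes_within :: "tm \<Rightarrow> nat list \<Rightarrow> nat list \<Rightarrow> nat \<Rightarrow> bool" where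
  "computes_within M w v t \<longleftrightarrow>
     (case (step M ^^ t) (initial_config M w) of
        (q, Ts) \<Rightarrow> q = num_states M \<and> fst (Ts ! 1) = tape_contents v)"

section \<open>Binary encoding of lists of integers\<close>

text \<open>Most significant bit first.\<close>

fun binary :: "nat \<Rightarrow> nat list" where
  "binary n = (if n < 2 then [n] else binary (n div 2) @ [n mod 2])"

declare binary.simps [simp del]

text \<open>Symbols: 1 for the bit 0, 2 for the bit 1, 3 for the minus sign, 4 for the separator.\<close>

definition encode_int :: "int \<Rightarrow> nat list" where
  "encode_int z = (if z < 0 then [3] else []) @ map Suc (binary (nat \<bar>z\<bar>))"

definition encode_ints :: "int list \<Rightarrow> nat list" where
  "encode_ints zs = concat (map (\<lambda>z. encode_int z @ [4]) zs)"

definition encode_fractions :: "(int \<times> int) list \<Rightarrow> nat list" where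
  "encode_fractions rs = encode_ints (concat (map (\<lambda>(r, s). [r, s]) rs))"

section \<open>Trinomials and Newton iteration\<close>

definition trinomial :: "int \<Rightarrow> int \<Rightarrow> int \<Rightarrow> nat \<Rightarrow> nat \<Rightarrow> real \<Rightarrow> real" where
  "trinomial c1 c2 c3 a2 a3 x = of_int c1 + of_int c2 * x ^ a2 + of_int c3 * x ^ a3"

definition degenerate_root :: "(real \<Rightarrow> real) \<Rightarrow> real \<Rightarrow> bool" where
  "degenerate_root f \<zeta> \<longleftrightarrow> f \<zeta> = 0 \<and> deriv f \<zeta> = 0"

definition newton :: "(real \<Rightarrow> real) \<Rightarrow> real \<Rightarrow> real" where
  "newton g z = z - g z / deriv g z"

text \<open>
  The first conjunct says that the Newton iterates are defined, i.e. that no division by zero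
  occurs in them.
\<close>

definition newton_converges :: "(real \<Rightarrow> real) \<Rightarrow> real \<Rightarrow> real \<Rightarrow> bool" where
  "newton_converges g z0 \<zeta> \<longleftrightarrow>
     (\<forall>i. deriv g ((newton g ^^ i) z0) \<noteq> 0) \<and>
     (\<forall>i\<ge>1. \<bar>(newton g ^^ i) z0 - \<zeta>\<bar> \<le> (1/2) ^ (2 ^ (i - 1)) * \<bar>z0 - \<zeta>\<bar>)"

definition admissible :: "int \<Rightarrow> int \<Rightarrow> int \<Rightarrow> nat \<Rightarrow> nat \<Rightarrow> nat \<Rightarrow> bool" where
  "admissible c1 c2 c3 a2 a3 H \<longleftrightarrow>
     0 < a2 \<and> a2 < a3 \<and> {c1, c2, c3} \<subseteq> {- int H..int H} - {0}"

definition ill_conditioned :: "int \<Rightarrow> int \<Rightarrow> int \<Rightarrow> nat \<Rightarrow> nat \<Rightarrow> nat \<Rightarrow> bool" where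
  "ill_conditioned c1 c2 c3 a2 a3 H \<longleftrightarrow>
     admissible c1 c2 c3 a2 a3 H \<and>
     \<bar>\<bar>real_of_int c2 / real a3\<bar>
        * \<bar>(real a3 - real a2) / real_of_int c1\<bar> powr ((real a3 - real a2) / real a3)
        * \<bar>real a2 / real_of_int c3\<bar> powr (real a2 / real a3) - 1\<bar>
       < 1 / ln (real (a3 * H)) \<and>
     \<not> (\<exists>\<zeta>. degenerate_root (trinomial c1 c2 c3 a2 a3) \<zeta>)"

end

theory Submission
  imports Defs
begin

text \<open>
  Write \<open>f\<close> for the trinomial, \<open>d\<close> for its degree, \<open>h\<close> for the number of bits of \<open>d\<close> and \<open>H\<close>
  together, and \<open>L = 2 ^ h\<close>, so that \<open>d H < L \<le> 4 d H\<close>. The substitutions \<open>x \<mapsto> - x\<close> and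
  \<open>x \<mapsto> 1 / x\<close> and a change of sign turn \<open>f\<close> into trinomials of the same kind, so it is
  enough to find the roots in the open interval from 0 to 1 when the constant coefficient is
  positive; the roots 1 and \<open>- 1\<close> are tested exactly.

  There are at most two such roots. Two of them can occur only if the signs of the
  coefficients are \<open>+ - +\<close>, and then they are separated by the critical point \<open>\<xi>\<close>, which
  solves a binomial equation. The quantity \<open>W\<close> in the definition of an ill-conditioned
  trinomial measures the value there: \<open>f(\<xi>)\<close> is \<open>c\<^sub>1 (1 - W powr (d / (d - a\<^sub>2)))\<close>. Hence,
  if \<open>f\<close> is not ill-conditioned, then \<open>f(\<xi>)\<close> is either 0, and \<open>\<xi>\<close> is a degenerate root, or
  at least \<open>1 / L\<close> in absolute value (\<open>critical_value_gap\<close>). An approximation of \<open>\<xi>\<close>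
  therefore decides how many roots there are and brackets each of them.

  The roots are found by bisection in fixed-point arithmetic with \<open>24 h\<close> binary digits. A
  small value of \<open>f\<close> means that a root is near only if the slope is not small as well. For
  coefficients with one sign change this is immediate. For two sign changes,
  \<open>f(x) / x ^ a\<^sub>2\<close> is a convex function of \<open>ln x\<close>; since this function is clearly negative
  somewhere, its graph cannot be almost flat where it meets the axis
  (\<open>tri_slope_two_changes\<close>). The second derivative of a trinomial at \<open>z\<close> is at most
  \<open>d\<^sup>2 / z\<^sup>2\<close> times the sum of the absolute values of its two monomials, and it changes
  little when \<open>z\<close> varies by a factor \<open>1 + 1 / d\<close>. So a relative accuracy polynomial in
  \<open>1 / L\<close> suffices for quadratic convergence of Newton's method (\<open>newton_tri\<close>), and the
  accuracy reached, about \<open>L\<close> to the power \<open>- 12\<close>, is ample. At a degenerate root the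
  derivative \<open>f'\<close>, again a trinomial, takes the place of \<open>f\<close>.

  For the running time, bisection needs \<open>O(h)\<close> evaluations, each of them \<open>O(h)\<close>
  multiplications by repeated squaring, each of these \<open>O(h)\<close> additions, and an addition
  takes \<open>O(h)\<close> steps of a Turing machine. The algorithm is written in a language of
  registers whose loops run through the bits of a register; then the exponent 4 is the depth
  of nesting of the loops (\<open>cost_bound\<close>). The constant factor is absorbed in the exponent.

  For the fraction of ill-conditioned trinomials, put \<open>\<delta> = 1 / ln (d H)\<close>. If \<open>\<bar>c\<^sub>1\<bar>\<close> and
  \<open>\<bar>c\<^sub>3\<bar>\<close> are fixed, the condition confines \<open>\<bar>c\<^sub>2\<bar>\<close> to an interval, so their number is at
  most the number of pairs plus the total length of these intervals. The sum of the lengths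
  is compared with an integral. What has to be shown is that the average length is at most
  \<open>\<delta> H\<close>, and there is no room for a constant factor: for \<open>\<delta> \<rightarrow> 0\<close> and \<open>a\<^sub>2 / d \<rightarrow> 0\<close> the
  average is asymptotically \<open>\<delta> H\<close>. If the smaller of \<open>a\<^sub>2 / d\<close> and \<open>1 - a\<^sub>2 / d\<close> is at most
  \<open>2 \<delta> / 3\<close>, then already the mean over one of the two coefficients is at most \<open>\<delta> H\<close>
  (\<open>area_difference_thin\<close>); otherwise the second average makes up for the excess of the
  first (\<open>sum_area_difference_le\<close>).
\<close>

section \<open>Structured tape programs\<close>

text \<open>
  An operation reads all heads at once and prescribes the symbol and the movement on each
  tape. Tests look at the heads as well, so that the control of a program is its only memory
  besides the tapes.
\<close>

datatype prog =
    Op "(nat \<Rightarrow> nat) \<Rightarrow> nat \<Rightarrow> nat \<times> move"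
  | PSkip
  | PSeq prog prog
  | PIf "(nat \<Rightarrow> nat) \<Rightarrow> bool" prog prog
  | PWhile "(nat \<Rightarrow> nat) \<Rightarrow> bool" prog

text \<open>
  Tape 0 is the input, tape 1 the output, tape 2 a scratch tape; the others are registers,
  33 of which are used by the algorithm.
\<close>

definition ntapes :: nat where "ntapes = 40"

definition stay :: "(nat \<Rightarrow> nat) \<Rightarrow> nat \<Rightarrow> nat \<times> move" where
  "stay h i = (h i, Stay)"

text \<open>
  Small steps. What remains to be executed is again a program, and it serves as the state of
  the machine.
\<close>

fun nxt :: "prog \<Rightarrow> (nat \<Rightarrow> nat) \<Rightarrow> prog \<times> (nat \<Rightarrow> nat \<times> move)" where
  "nxt (Op F) h = (PSkip, F h)"
| "nxt PSkip h = (PSkip, stay h)"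
| "nxt (PSeq c d) h =
     (if c = PSkip then (d, stay h) else (PSeq (fst (nxt c h)) d, snd (nxt c h)))"
| "nxt (PIf P c d) h = (if P h then c else d, stay h)"
| "nxt (PWhile P c) h = (if P h then PSeq c (PWhile P c) else PSkip, stay h)"

definition heads :: "(nat \<Rightarrow> tape) \<Rightarrow> nat \<Rightarrow> nat" where
  "heads T i = (if i < ntapes then read (T i) else 0)"

definition acts :: "(nat \<Rightarrow> nat \<times> move) \<Rightarrow> (nat \<Rightarrow> tape) \<Rightarrow> nat \<Rightarrow> tape" where
  "acts A T i = (if i < ntapes then act (A i) (T i) else T i)"

fun pstep :: "prog \<times> (nat \<Rightarrow> tape) \<Rightarrow> prog \<times> (nat \<Rightarrow> tape)" where
  "pstep (c, T) = (fst (nxt c (heads T)), acts (snd (nxt c (heads T))) T)"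

lemma act_stay [simp]: "act (read T, Stay) T = T"
  by (cases T) (simp add: read_def)

lemma acts_stay [simp]: "acts (stay (heads T)) T = T"
  by (rule ext) (simp add: acts_def stay_def heads_def)

text \<open>
  The number of steps is only bounded from above, which makes the rules below compose
  without bookkeeping.
\<close>

definition halts :: "prog \<Rightarrow> (nat \<Rightarrow> tape) \<Rightarrow> nat \<Rightarrow> (nat \<Rightarrow> tape) \<Rightarrow> bool" where
  "halts c T t T' \<longleftrightarrow> (\<exists>n\<le>t. (pstep ^^ n) (c, T) = (PSkip, T'))"

lemma halts_mono: "halts c T t T' \<Longrightarrow> t \<le> u \<Longrightarrow> halts c T u T'"
  unfolding halts_def using le_trans by blast

lemma halts_PSkip: "halts PSkip T 0 T"
  unfolding halts_def by (intro exI[of _ 0]) simp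

lemma halts_step:
  assumes "halts c' (acts (snd (nxt c (heads T))) T) t T'" and "c' = fst (nxt c (heads T))"
  shows "halts c T (Suc t) T'"
proof -
  obtain n where n: "n \<le> t" "(pstep ^^ n) (c', acts (snd (nxt c (heads T))) T) = (PSkip, T')"
    using assms(1) unfolding halts_def by blast
  have "(pstep ^^ Suc n) (c, T) = (PSkip, T')"
    using n(2) assms(2) by (simp add: funpow_Suc_right del: funpow.simps)
  then show ?thesis unfolding halts_def using n(1) by (intro exI[of _ "Suc n"]) simp
qed

lemma halts_Op: "halts (Op F) T 1 (acts (F (heads T)) T)"
  using halts_step[of PSkip "Op F" T 0] halts_PSkip by simp

lemma funpow_pstep_PSkip [simp]: "(pstep ^^ n) (PSkip, T) = (PSkip, T)"
  by (induction n) auto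

lemma halts_PSeq:
  assumes "halts c T t T'" "halts d T' u T''"
  shows "halts (PSeq c d) T (t + u + 1) T''"
proof -
  have start: "halts (PSeq PSkip d) T' (u + 1) T''"
    using halts_step[of d "PSeq PSkip d" T' u T''] assms(2) by simp
  have "(pstep ^^ n) (c, T) = (PSkip, T') \<Longrightarrow> halts (PSeq c d) T (n + u + 1) T''" for n
  proof (induction n arbitrary: c T)
    case 0
    then show ?case using start by simp
  next
    case (Suc n)
    show ?case
    proof (cases "c = PSkip")
      case True
      then have "T = T'" using Suc.prems by (simp del: funpow.simps)
      then show ?thesis using True start halts_mono[OF start, of "Suc n + u + 1"] by simp
    next
      case False
      have "(pstep ^^ n) (fst (nxt c (heads T)), acts (snd (nxt c (heads T))) T) = (PSkip, T')"
        using Suc.prems by (simp add: funpow_Suc_right del: funpow.simps)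
      from Suc.IH[OF this] False
      have "halts (PSeq c d) T (Suc (n + u + 1)) T''"
        by (intro halts_step[where c' = "PSeq (fst (nxt c (heads T))) d"]) simp_all
      then show ?thesis by simp
    qed
  qed
  moreover obtain n where "n \<le> t" "(pstep ^^ n) (c, T) = (PSkip, T')"
    using assms(1) unfolding halts_def by blast
  ultimately have "halts (PSeq c d) T (n + u + 1) T''" by simp
  then show ?thesis by (rule halts_mono) (use \<open>n \<le> t\<close> in simp)
qed

lemma halts_PIf:
  assumes "halts (if P (heads T) then c else d) T t T'"
  shows "halts (PIf P c d) T (Suc t) T'"
  by (rule halts_step[where c' = "if P (heads T) then c else d"]) (use assms in simp_all)

lemma halts_PWhile_False: "\<not> P (heads T) \<Longrightarrow> halts (PWhile P c) T 1 T"
  unfolding One_nat_def by (rule halts_step[where c' = PSkip]) (simp_all add: halts_PSkip)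

lemma halts_PWhile_True:
  assumes "P (heads T)" "halts c T t T'" "halts (PWhile P c) T' u T''"
  shows "halts (PWhile P c) T (t + u + 2) T''"
proof -
  have "halts (PWhile P c) T (Suc (t + u + 1)) T''"
    by (rule halts_step[where c' = "PSeq c (PWhile P c)"])
      (use assms(1) halts_PSeq[OF assms(2,3)] in simp_all)
  then show ?thesis by simp
qed

section \<open>Tape programs as Turing machines\<close>

text \<open>
  A superset of the programs that can remain. It is finite because loops are not unfolded:
  what remains of a loop is the loop itself, possibly preceded by what remains of its body.
\<close>

fun resid :: "prog \<Rightarrow> prog set" where
  "resid (Op F) = {Op F, PSkip}"
| "resid PSkip = {PSkip}"
| "resid (PSeq c d) = (\<lambda>c'. PSeq c' d) ` resid c \<union> resid d"
| "resid (PIf P c d) = insert (PIf P c d) (resid c \<union> resid d)"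
| "resid (PWhile P c) = insert (PWhile P c) (insert PSkip ((\<lambda>c'. PSeq c' (PWhile P c)) ` resid c))"

lemma finite_resid: "finite (resid c)"
  by (induction c) auto

lemma self_in_resid: "c \<in> resid c"
  by (induction c) auto

lemma PSkip_in_resid: "PSkip \<in> resid c"
  by (induction c) auto

lemma PSeq_neq_self [simp]: "c \<noteq> PSeq c d" "PSeq c d \<noteq> c"
  using arg_cong[of c "PSeq c d" size] by auto

lemma nxt_in_resid: "c' \<in> resid c \<Longrightarrow> fst (nxt c' h) \<in> resid c"
proof (induction c arbitrary: c')
  case (PSeq c d)
  then show ?case by (auto simp: self_in_resid)
next
  case (PWhile P c)
  from PWhile.prems consider "c' = PWhile P c" | "c' = PSkip"
    | e where "c' = PSeq e (PWhile P c)" "e \<in> resid c" by auto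
  then show ?case by cases (use PWhile.IH in \<open>auto simp: self_in_resid\<close>)
qed (auto simp: self_in_resid)

definition symbols_ok :: "((nat \<Rightarrow> nat) \<Rightarrow> nat \<Rightarrow> nat \<times> move) \<Rightarrow> bool" where
  "symbols_ok F \<longleftrightarrow> (\<forall>h. (\<forall>i. h i < 5) \<longrightarrow> (\<forall>i. fst (F h i) < 5))"

primrec okp :: "prog \<Rightarrow> bool" where
  "okp (Op F) \<longleftrightarrow> symbols_ok F"
| "okp PSkip \<longleftrightarrow> True"
| "okp (PSeq c d) \<longleftrightarrow> okp c \<and> okp d"
| "okp (PIf P c d) \<longleftrightarrow> okp c \<and> okp d"
| "okp (PWhile P c) \<longleftrightarrow> okp c"

lemma okp_resid: "okp c \<Longrightarrow> c' \<in> resid c \<Longrightarrow> okp c'"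
proof (induction c arbitrary: c')
  case (PSeq c d)
  then show ?case unfolding okp.simps resid.simps by (metis UnE imageE okp.simps(3))
next
  case (PIf P c d)
  then show ?case unfolding okp.simps resid.simps by (metis UnE insertE okp.simps(4))
next
  case (PWhile P c)
  then show ?case unfolding okp.simps resid.simps by (metis imageE insertE okp.simps(2,3,5))
qed auto

lemma okp_nxt: "okp c \<Longrightarrow> (\<And>i. h i < 5) \<Longrightarrow> fst (snd (nxt c h) i) < 5"
  by (induction c) (simp_all add: stay_def symbols_ok_def)

text \<open>
  Symbols outside the given list are read as blanks, as in \<open>heads\<close>; this makes the machine
  below agree with \<open>pstep\<close> on all lists that occur.
\<close>

definition headl :: "nat list \<Rightarrow> nat \<Rightarrow> nat" where
  "headl xs i = (if i < length xs then xs ! i else 0)"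

definition machine_of :: "prog \<Rightarrow> (nat \<Rightarrow> prog) \<Rightarrow> (prog \<Rightarrow> nat) \<Rightarrow> nat \<Rightarrow> tm" where
  "machine_of c g f n = \<lparr>num_tapes = ntapes, num_symbols = 5, num_states = n,
     delta = (\<lambda>q xs. (f (fst (nxt (g q) (headl xs))),
                      map (snd (nxt (g q) (headl xs))) [0..<ntapes]))\<rparr>"

lemma bij_with_ends:
  assumes "finite A" "a \<in> A" "b \<in> A" "a \<noteq> b"
  obtains f :: "'a \<Rightarrow> nat" and n where "bij_betw f A {..n}" "f a = 0" "f b = n" "n > 0"
proof -
  obtain xs where xs: "set xs = A - {a, b}" "distinct xs"
    using finite_distinct_list[of "A - {a, b}"] assms(1) by auto
  define L where "L = a # xs @ [b]"
  define n where "n = Suc (length xs)"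
  have L: "distinct L" "set L = A" "length L = Suc n" "L ! 0 = a" "L ! n = b"
    using xs assms by (auto simp: L_def n_def nth_append)
  have bij: "bij_betw (nth L) {..n} A"
    using bij_betw_nth[OF L(1), of "{..n}" A] L(2,3) by (simp add: lessThan_Suc_atMost)
  show thesis
  proof (rule that)
    show "bij_betw (inv_into {..n} (nth L)) A {..n}"
      using bij by (rule bij_betw_inv_into)
    show "inv_into {..n} (nth L) a = 0" "inv_into {..n} (nth L) b = n"
      using bij L(4,5) by (auto simp: bij_betw_def intro!: inv_into_f_eq)
    show "n > 0" by (simp add: n_def)
  qed
qed

text \<open>
  The remaining programs are numbered such that the initial one becomes 0 and \<open>PSkip\<close> the
  halting state. Then the machine simulates the program step by step.
\<close>

theorem prog_machine:
  assumes "okp c" "c \<noteq> PSkip"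
  obtains M where "valid_tm M"
    and "\<And>w v t T'. \<lbrakk>halts c (\<lambda>i. if i = 0 then (tape_contents w, 0) else (tape_contents [], 0)) t T';
          fst (T' 1) = tape_contents v\<rbrakk> \<Longrightarrow> \<exists>t'\<le>t. computes_within M w v t'"
proof -
  obtain f :: "prog \<Rightarrow> nat" and n where f: "bij_betw f (resid c) {..n}" "f c = 0" "f PSkip = n" "n > 0"
    by (rule bij_with_ends[OF finite_resid self_in_resid PSkip_in_resid assms(2)])
  define g where "g = inv_into (resid c) f"
  have gf: "g (f d) = d" if "d \<in> resid c" for d
    using f(1) that unfolding g_def bij_betw_def by simp
  have gin: "g q \<in> resid c" if "q \<le> n" for q
    using f(1) that unfolding g_def bij_betw_def by (metis atMost_iff inv_into_into)
  have fle: "f d \<le> n" if "d \<in> resid c" for d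
    using f(1) that unfolding bij_betw_def by blast
  have fn: "f d = n \<longleftrightarrow> d = PSkip" if "d \<in> resid c" for d
    using f(3) gf PSkip_in_resid that by metis
  define M where "M = machine_of c g f n"
  have Msel: "num_tapes M = ntapes" "num_symbols M = 5" "num_states M = n"
    "delta M q xs = (f (fst (nxt (g q) (headl xs))), map (snd (nxt (g q) (headl xs))) [0..<ntapes])"
    for q xs by (simp_all add: M_def machine_of_def)
  have "valid_tm M"
    unfolding valid_tm_def Msel
  proof (intro conjI allI impI)
    fix q xs assume a: "q < n \<and> length xs = ntapes \<and> set xs \<subseteq> {..<5::nat}"
    have "xs ! i < 5" if "i < length xs" for i using a nth_mem[OF that] by blast
    then have h: "headl xs i < 5" for i by (simp add: headl_def)
    have gq: "g q \<in> resid c" using a gin by simp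
    have "fst (snd (nxt (g q) (headl xs)) i) < 5" for i
      by (rule okp_nxt[OF okp_resid[OF assms(1) gq] h])
    then show "fst ` set (snd (f (fst (nxt (g q) (headl xs))), map (snd (nxt (g q) (headl xs))) [0..<ntapes])) \<subseteq> {..<5}"
      by auto
    show "fst (f (fst (nxt (g q) (headl xs))), map (snd (nxt (g q) (headl xs))) [0..<ntapes]) \<le> n"
      using fle[OF nxt_in_resid[OF gq]] by simp
  qed (simp_all add: ntapes_def)
  moreover
  have tl: "map (\<lambda>i. heads T i) [0..<ntapes] = map read (map T [0..<ntapes])" for T
    by (simp add: heads_def)
  have hl: "headl (map read (map T [0..<ntapes])) = heads T" for T
    by (rule ext) (simp add: headl_def heads_def)
  have sim1: "step M (f d, map T [0..<ntapes]) = (case pstep (d, T) of (d', T') \<Rightarrow> (f d', map T' [0..<ntapes]))"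
    if "d \<in> resid c" for d T
  proof (cases "d = PSkip")
    case True
    then show ?thesis by (simp add: Msel f(3))
  next
    case False
    then have "f d < n" using fle fn that le_neq_implies_less by metis
    then show ?thesis
      using that by (simp add: Msel gf hl acts_def list_eq_iff_nth_eq Let_def del: map_map)
  qed
  have inres: "fst ((pstep ^^ k) (c, T)) \<in> resid c" for k T
  proof (induction k)
    case (Suc k)
    obtain d T1 where "(pstep ^^ k) (c, T) = (d, T1)" by fastforce
    then show ?case using Suc nxt_in_resid[of d c "heads T1"] by simp
  qed (simp add: self_in_resid)
  have sim: "(step M ^^ k) (f c, map T [0..<ntapes])
      = (case (pstep ^^ k) (c, T) of (d', T') \<Rightarrow> (f d', map T' [0..<ntapes]))" for k T
  proof (induction k)
    case (Suc k)
    obtain d T1 where d: "(pstep ^^ k) (c, T) = (d, T1)" by fastforce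
    then have "d \<in> resid c" using inres[of k T] by simp
    then show ?case using Suc sim1[of d T1] d by simp
  qed simp
  have "\<exists>t'\<le>t. computes_within M w v t'"
    if h: "halts c (\<lambda>i. if i = 0 then (tape_contents w, 0) else (tape_contents [], 0)) t T'"
      and o: "fst (T' 1) = tape_contents v" for w v t T'
  proof -
    let ?T = "\<lambda>i::nat. if i = 0 then (tape_contents w, 0) else (tape_contents [], 0::int)"
    obtain k where k: "k \<le> t" "(pstep ^^ k) (c, ?T) = (PSkip, T')"
      using h unfolding halts_def by blast
    have init: "initial_config M w = (f c, map ?T [0..<ntapes])"
      unfolding initial_config_def Msel f(2)
      by (simp, rule nth_equalityI) (auto simp: ntapes_def nth_Cons split: nat.splits)
    have "computes_within M w v k"
      unfolding computes_within_def init sim k(2)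
      using o by (simp add: Msel f(3) ntapes_def)
    then show ?thesis using k(1) by blast
  qed
  ultimately show thesis using that by blast
qed

section \<open>Numbers on tapes\<close>

definition nth0 :: "nat list \<Rightarrow> nat \<Rightarrow> nat" where
  "nth0 xs k = (if k < length xs then xs ! k else 0)"

text \<open>
  The tape seen from its head: \<open>r\<close> extends to the right, starting with the symbol under the
  head, and \<open>l\<close> to the left. Both are continued by blanks, so \<open>l\<close> and \<open>r\<close> are determined up
  to trailing blanks only.
\<close>

definition tp :: "tape \<Rightarrow> nat list \<Rightarrow> nat list \<Rightarrow> bool" where
  "tp T l r \<longleftrightarrow> (\<forall>k. fst T (snd T + int k) = nth0 r k \<and> fst T (snd T - 1 - int k) = nth0 l k)"

lemma nth0_Nil [simp]: "nth0 [] k = 0"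
  by (simp add: nth0_def)

lemma nth0_Cons [simp]: "nth0 (x # xs) 0 = x" "nth0 (x # xs) (Suc k) = nth0 xs k"
  by (simp_all add: nth0_def)

lemma nth0_tl: "nth0 (tl xs) k = nth0 xs (Suc k)"
  by (cases xs) simp_all

lemma nth0_append_zeros: "nth0 (xs @ replicate m 0) = nth0 xs"
  by (rule ext) (auto simp: nth0_def nth_append)

lemma tp_cong: "tp T l r \<Longrightarrow> nth0 l = nth0 l' \<Longrightarrow> nth0 r = nth0 r' \<Longrightarrow> tp T l' r'"
  by (simp add: tp_def)

lemma read_tp: "tp T l r \<Longrightarrow> read T = nth0 r 0"
  unfolding tp_def read_def by (metis add.right_neutral of_nat_0)

lemma tp_right:
  assumes "tp T l r" shows "tp (act (s, Move_Right) T) (s # l) (tl r)"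
proof -
  obtain c p where T: "T = (c, p)" by fastforce
  have 1: "c (p + int k) = nth0 r k" "c (p - 1 - int k) = nth0 l k" for k
    using assms by (simp_all add: tp_def T)
  have "c (p + 1 + int k) = nth0 (tl r) k" for k
    using 1(1)[of "Suc k"] by (simp add: nth0_tl add_ac)
  moreover have "(c(p := s)) (p - int k) = nth0 (s # l) k" for k
    using 1(2)[of "k - 1"] by (cases k) (auto simp: algebra_simps)
  ultimately show ?thesis by (simp add: tp_def T)
qed

lemma tp_left:
  assumes "tp T l r" shows "tp (act (s, Move_Left) T) (tl l) (nth0 l 0 # s # tl r)"
proof -
  obtain c p where T: "T = (c, p)" by fastforce
  have 1: "c (p + int k) = nth0 r k" "c (p - 1 - int k) = nth0 l k" for k
    using assms by (simp_all add: tp_def T)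
  have "c (p - 2 - int k) = nth0 (tl l) k" for k
    using 1(2)[of "Suc k"] by (simp add: nth0_tl algebra_simps)
  moreover have "(c(p := s)) (p - 1 + int k) = nth0 (nth0 l 0 # s # tl r) k" for k
  proof (cases "k < 2")
    case True
    then show ?thesis using 1(2)[of 0] by (cases k) auto
  next
    case False
    then obtain m where "k = Suc (Suc m)" by (metis Suc_1 add_2_eq_Suc' le_Suc_ex not_less add.commute)
    then show ?thesis using 1(1)[of "Suc m"] by (simp add: nth0_tl add_ac)
  qed
  ultimately show ?thesis by (simp add: tp_def T)
qed

lemma tp_stay:
  assumes "tp T l r" shows "tp (act (s, Stay) T) l (s # tl r)"
proof -
  obtain c p where T: "T = (c, p)" by fastforce
  have 1: "c (p + int k) = nth0 r k" "c (p - 1 - int k) = nth0 l k" for k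
    using assms by (simp_all add: tp_def T)
  have "(c(p := s)) (p + int k) = nth0 (s # tl r) k" for k
    using 1(1)[of k] by (cases k) (auto simp: nth0_tl)
  then show ?thesis using 1(2) by (simp add: tp_def T)
qed

text \<open>
  Least significant bit first, with the symbols 1 and 2 for the bits; zero is the empty
  word. This is the word in a register when the head is at its left end, where halving and
  doubling take place.
\<close>

fun bits :: "nat \<Rightarrow> nat list" where
  "bits n = (if n = 0 then [] else (1 + n mod 2) # bits (n div 2))"

declare bits.simps [simp del]

lemma bits_0 [simp]: "bits 0 = []"
  by (simp add: bits.simps)

lemma bits_pos: "n > 0 \<Longrightarrow> bits n = (1 + n mod 2) # bits (n div 2)"
  by (subst bits.simps) simp

lemma nth0_bits_0: "nth0 (bits n) 0 = (if n = 0 then 0 else 1 + n mod 2)"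
  by (subst bits.simps) simp

lemma tl_bits: "tl (bits n) = bits (n div 2)"
  by (subst bits.simps) simp

lemma set_bits: "set (bits n) \<subseteq> {1, 2}"
  by (induction n rule: bits.induct) (subst bits.simps, auto)

lemma length_bits_le: "n < 2 ^ b \<Longrightarrow> length (bits n) \<le> b"
proof (induction b arbitrary: n)
  case (Suc b)
  have "n div 2 < 2 ^ b" using Suc.prems by auto
  then show ?case using Suc.IH by (subst bits.simps) simp
qed simp

lemma less_length_bits: "n < 2 ^ length (bits n)"
proof (induction n rule: bits.induct)
  case (1 n)
  show ?case
  proof (cases "n = 0")
    case False
    then have "n div 2 < 2 ^ length (bits (n div 2))" using 1 by blast
    then show ?thesis using False by (subst bits.simps) simp
  qed simp
qed

lemma length_bits_ge: "n > 0 \<Longrightarrow> 2 ^ length (bits n) \<le> 2 * n"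
proof (induction n rule: bits.induct)
  case (1 n)
  show ?case
  proof (cases "n = 1")
    case False
    then have "2 ^ length (bits (n div 2)) \<le> 2 * (n div 2)" using 1 by auto
    then show ?thesis using 1(2) by (subst bits.simps) simp
  qed (simp add: bits.simps)
qed

lemma binary_bits: "n > 0 \<Longrightarrow> map Suc (binary n) = rev (bits n)"
proof (induction n rule: bits.induct)
  case (1 n)
  show ?case
  proof (cases "n < 2")
    case True
    then have "n = 1" using 1(2) by simp
    then show ?thesis by (simp add: binary.simps bits.simps)
  next
    case False
    then have "map Suc (binary (n div 2)) = rev (bits (n div 2))" using 1 by simp
    then show ?thesis using False by (subst binary.simps, subst bits.simps) simp
  qed
qed

text \<open>
  The number given by a word that may have leading zeros, as they arise in a subtraction.
\<close>

fun val :: "nat list \<Rightarrow> nat" where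
  "val [] = 0"
| "val (s # u) = (s - 1) + 2 * val u"

lemma val_less: "set u \<subseteq> {1, 2} \<Longrightarrow> val u < 2 ^ length u"
  by (induction u) auto

lemma bits_val:
  "set u \<subseteq> {1, 2} \<Longrightarrow> \<exists>m. u = bits (val u) @ replicate m 1"
proof (induction u)
  case (Cons s u)
  then obtain m where m: "u = bits (val u) @ replicate m 1" by auto
  have s: "s = 1 \<or> s = 2" using Cons.prems by auto
  show ?case
  proof (cases "val (s # u) = 0")
    case True
    then have "s = 1" "val u = 0" using s by auto
    then have "s # u = bits (val (s # u)) @ replicate (Suc m) 1" using m True by simp
    then show ?thesis by blast
  next
    case False
    have "(s - 1 + 2 * val u) div 2 = val u" "(s - 1 + 2 * val u) mod 2 = s - 1" using s by auto
    then have "bits (val (s # u)) = s # bits (val u)"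
      using False s by (subst bits.simps) auto
    then have "s # u = bits (val (s # u)) @ replicate m 1" using m by simp
    then show ?thesis by blast
  qed
qed simp

section \<open>Arithmetic on tapes\<close>

lemma heads_eq [simp]: "i < ntapes \<Longrightarrow> heads T i = read (T i)"
  by (simp add: heads_def)

lemma acts_upd: "i < ntapes \<Longrightarrow> acts (A(i := a)) T = (acts A T)(i := act a (T i))"
  by (rule ext) (simp add: acts_def)

lemmas acts_simps = acts_upd

abbreviation bit_of :: "nat \<Rightarrow> nat" where
  "bit_of s \<equiv> (if s = 2 then 1 else 0)"

text \<open>
  Adds one bit of register \<open>j\<close> to register \<open>i\<close>, or subtracts it. Tape 2 stores the carry or
  borrow. Modulo 2, sum and difference agree.
\<close>

definition arith_op :: "bool \<Rightarrow> nat \<Rightarrow> nat \<Rightarrow> prog" where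
  "arith_op add i j = Op (\<lambda>h. (stay h)
     (i := (1 + (bit_of (h i) + bit_of (h j) + bit_of (h 2)) mod 2, Move_Right),
      j := (h j, Move_Right),
      2 := (if (if add then bit_of (h i) + bit_of (h j) + bit_of (h 2) \<ge> 2
                else bit_of (h i) < bit_of (h j) + bit_of (h 2)) then 2 else 0, Stay)))"

definition arith_loop :: "bool \<Rightarrow> nat \<Rightarrow> nat \<Rightarrow> prog" where
  "arith_loop add i j =
     PWhile (\<lambda>h. h i \<noteq> 0 \<or> h j \<noteq> 0 \<or> add \<and> h 2 \<noteq> 0) (arith_op add i j)"

definition left_op :: "bool \<Rightarrow> nat \<Rightarrow> nat \<Rightarrow> prog" where
  "left_op w i j = Op (\<lambda>h. (stay h)(i := (if w then 0 else h i, Move_Left), j := (h j, Move_Left)))"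

text \<open>
  Moves both heads back to the left end. On the way, leading zeros of the result are erased,
  and the whole result if there is a final borrow, since the difference is then negative and
  is to be replaced by 0.
\<close>

definition finish :: "nat \<Rightarrow> nat \<Rightarrow> prog" where
  "finish i j =
     PSeq (left_op False i j)
     (PSeq (PWhile (\<lambda>h. h i = 1 \<or> h 2 \<noteq> 0 \<and> h i \<noteq> 0) (left_op True i j))
     (PSeq (PWhile (\<lambda>h. h i \<noteq> 0) (left_op False i j))
       (Op (\<lambda>h. (stay h)(i := (h i, Move_Right), j := (h j, Move_Right), 2 := (0, Stay))))))"

text \<open>
  When the numbers have been read, \<open>u\<close> is the result including leading zeros. In a
  subtraction the final borrow \<open>c'\<close> tells whether it has to be discarded.
\<close>

lemma arith_loop_correct:
  assumes ij: "i < ntapes" "j < ntapes" "i > 2" "j > 2" "i \<noteq> j"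
  shows "\<lbrakk>tp (T i) li (bits x); tp (T j) lj (bits y); tp (T 2) [] [2 * c]; c \<le> 1;
          x < 2 ^ b; y < 2 ^ b; add \<Longrightarrow> x + y + c < 2 ^ b\<rbrakk> \<Longrightarrow>
     \<exists>T' u v c'. halts (arith_loop add i j) T (3 * b + 1) T' \<and>
        tp (T' i) (rev u @ li) [] \<and> tp (T' j) (rev v @ lj) [] \<and> tp (T' 2) [] [2 * c'] \<and>
        length u \<le> b \<and> length v = length u \<and> set u \<subseteq> {1, 2} \<and> nth0 v = nth0 (bits y) \<and>
        c' \<le> 1 \<and> (add \<longrightarrow> c' = 0 \<and> val u = x + y + c) \<and>
        (\<not> add \<longrightarrow> val u + y + c = x + c' * 2 ^ length u) \<and>
        (\<forall>k. k \<noteq> i \<longrightarrow> k \<noteq> j \<longrightarrow> k \<noteq> 2 \<longrightarrow> T' k = T k)"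
proof (induction b arbitrary: T li lj x y c)
  case 0
  then have xy: "x = 0" "y = 0" "add \<Longrightarrow> c = 0" by auto
  have "heads T i = 0" "heads T j = 0" "heads T 2 = 2 * c"
    using 0 xy ij read_tp by (auto simp: ntapes_def)
  then have "halts (arith_loop add i j) T 1 T"
    unfolding arith_loop_def using xy by (intro halts_PWhile_False) auto
  then show ?case using 0 xy
    by (intro exI[of _ T] exI[of _ "[]"] exI[of _ c]) auto
next
  case (Suc b)
  have hd: "read (T i) = (if x = 0 then 0 else 1 + x mod 2)"
    "read (T j) = (if y = 0 then 0 else 1 + y mod 2)" "read (T 2) = 2 * c"
    using Suc.prems(1-3) by (auto simp: read_tp nth0_bits_0)
  have n2: "2 < ntapes" by (simp add: ntapes_def)
  show ?case
  proof (cases "x \<noteq> 0 \<or> y \<noteq> 0 \<or> add \<and> c \<noteq> 0")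
    case False
    then have "halts (arith_loop add i j) T 1 T"
      unfolding arith_loop_def using ij n2 hd by (intro halts_PWhile_False) auto
    then show ?thesis using Suc.prems False
      by (intro exI[of _ T] exI[of _ "[]"] exI[of _ c]) (auto intro: halts_mono)
  next
    case True
    let ?s = "x mod 2 + y mod 2 + c"
    define c1 where "c1 = (if (if add then ?s \<ge> 2 else x mod 2 < y mod 2 + c) then 1 else 0 :: nat)"
    have bo: "bit_of (read (T i)) = x mod 2" "bit_of (read (T j)) = y mod 2" "bit_of (read (T 2)) = c"
      using hd \<open>c \<le> 1\<close> by auto
    define T1 where "T1 = T(i := act (1 + ?s mod 2, Move_Right) (T i),
       j := act (read (T j), Move_Right) (T j), 2 := act (2 * c1, Stay) (T 2))"
    have op: "halts (arith_op add i j) T 1 T1"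
    proof -
      have "acts ((stay (heads T))
     (i := (1 + (bit_of (heads T i) + bit_of (heads T j) + bit_of (heads T 2)) mod 2, Move_Right),
      j := (heads T j, Move_Right),
      2 := (if (if add then bit_of (heads T i) + bit_of (heads T j) + bit_of (heads T 2) \<ge> 2
                else bit_of (heads T i) < bit_of (heads T j) + bit_of (heads T 2)) then 2 else 0, Stay))) T = T1"
        unfolding heads_eq[OF ij(1)] heads_eq[OF ij(2)] heads_eq[OF n2] bo T1_def c1_def
        by (simp add: acts_simps ij n2)
      then show ?thesis unfolding arith_op_def
        using halts_Op[of "\<lambda>h. (stay h)
     (i := (1 + (bit_of (h i) + bit_of (h j) + bit_of (h 2)) mod 2, Move_Right),
      j := (h j, Move_Right),
      2 := (if (if add then bit_of (h i) + bit_of (h j) + bit_of (h 2) \<ge> 2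
                else bit_of (h i) < bit_of (h j) + bit_of (h 2)) then 2 else 0, Stay))" T] by metis
    qed
    have t1: "tp (T1 i) ((1 + ?s mod 2) # li) (bits (x div 2))"
      "tp (T1 j) (read (T j) # lj) (bits (y div 2))" "tp (T1 2) [] [2 * c1]"
      using tp_right[OF Suc.prems(1)] tp_right[OF Suc.prems(2)] tp_stay[OF Suc.prems(3)] ij
      by (auto simp: T1_def tl_bits)
    have xd: "x = 2 * (x div 2) + x mod 2" "y = 2 * (y div 2) + y mod 2" by simp_all
    have c1: "c1 \<le> 1" "x div 2 < 2 ^ b" "y div 2 < 2 ^ b"
      using Suc.prems by (auto simp: c1_def)
    have m2: "x mod 2 = 0 \<or> x mod 2 = 1" "y mod 2 = 0 \<or> y mod 2 = 1" "c = 0 \<or> c = 1"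
      using \<open>c \<le> 1\<close> by auto
    have sadd: "?s = 2 * c1 + ?s mod 2" if add
      using m2 that unfolding c1_def by (elim disjE) simp_all
    have ssub: "y mod 2 + c + ?s mod 2 = x mod 2 + 2 * c1" if "\<not> add"
      using m2 that unfolding c1_def by (elim disjE) simp_all
    have addb: "x div 2 + y div 2 + c1 < 2 ^ b" if add
    proof -
      have "x + y + c < 2 * 2 ^ b" using Suc.prems(7)[OF that] by simp
      then show ?thesis using sadd[OF that] xd by linarith
    qed
    obtain T' u v c' where R: "halts (arith_loop add i j) T1 (3 * b + 1) T'"
        "tp (T' i) (rev u @ (1 + ?s mod 2) # li) []" "tp (T' j) (rev v @ read (T j) # lj) []"
        "tp (T' 2) [] [2 * c']"
        "length u \<le> b" "length v = length u" "set u \<subseteq> {1, 2}" "nth0 v = nth0 (bits (y div 2))"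
        "c' \<le> 1" "add \<longrightarrow> c' = 0 \<and> val u = x div 2 + y div 2 + c1"
        "\<not> add \<longrightarrow> val u + y div 2 + c1 = x div 2 + c' * 2 ^ length u"
        "\<And>k. k \<noteq> i \<Longrightarrow> k \<noteq> j \<Longrightarrow> k \<noteq> 2 \<Longrightarrow> T' k = T1 k"
      using Suc.IH[OF t1 c1(1) c1(2) c1(3) addb] by blast
    have H: "halts (arith_loop add i j) T (1 + (3 * b + 1) + 2) T'"
      unfolding arith_loop_def
      by (rule halts_PWhile_True[OF _ op R(1)[unfolded arith_loop_def]])
        (use True ij n2 hd in auto)
    have nv: "nth0 (read (T j) # v) = nth0 (bits y)"
    proof (rule ext)
      fix k show "nth0 (read (T j) # v) k = nth0 (bits y) k"
        using R(8) hd(2) by (cases k) (auto simp: nth0_bits_0 tl_bits[symmetric] nth0_tl)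
    qed
    show ?thesis
    proof (intro exI conjI)
      show "halts (arith_loop add i j) T (3 * Suc b + 1) T'" by (rule halts_mono[OF H]) simp
      show "tp (T' i) (rev ((1 + ?s mod 2) # u) @ li) []" "tp (T' j) (rev (read (T j) # v) @ lj) []"
        using R(2,3) by simp_all
      show "tp (T' 2) [] [2 * c']" by (rule R(4))
      show "nth0 (read (T j) # v) = nth0 (bits y)" by (rule nv)
      show "set ((1 + ?s mod 2) # u) \<subseteq> {1, 2}" using R(7) by auto
      show "add \<longrightarrow> c' = 0 \<and> val ((1 + ?s mod 2) # u) = x + y + c"
      proof (intro impI conjI)
        assume a: add
        then show "c' = 0" using R(10) by simp
        have "val ((1 + ?s mod 2) # u) = ?s mod 2 + 2 * val u" by simp
        moreover have "val u = x div 2 + y div 2 + c1" using R(10) a by simp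
        ultimately show "val ((1 + ?s mod 2) # u) = x + y + c" using sadd[OF a] xd by linarith
      qed
      show "\<not> add \<longrightarrow> val ((1 + ?s mod 2) # u) + y + c = x + c' * 2 ^ length ((1 + ?s mod 2) # u)"
      proof
        assume a: "\<not> add"
        have "val ((1 + ?s mod 2) # u) = ?s mod 2 + 2 * val u" by simp
        moreover have "c' * 2 ^ length ((1 + ?s mod 2) # u) = 2 * (c' * 2 ^ length u)" by simp
        moreover have "val u + y div 2 + c1 = x div 2 + c' * 2 ^ length u" using R(11) a by simp
        ultimately show "val ((1 + ?s mod 2) # u) + y + c = x + c' * 2 ^ length ((1 + ?s mod 2) # u)"
          using ssub[OF a] xd by linarith
      qed
      show "\<forall>k. k \<noteq> i \<longrightarrow> k \<noteq> j \<longrightarrow> k \<noteq> 2 \<longrightarrow> T' k = T k"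
        using R(12) by (simp add: T1_def)
    qed (use R in simp_all)
  qed
qed

lemma left_op_correct:
  assumes "i < ntapes" "j < ntapes" "i > 2" "j > 2" "i \<noteq> j"
  shows "halts (left_op w i j) T 1
     (T(i := act (if w then 0 else read (T i), Move_Left) (T i), j := act (read (T j), Move_Left) (T j)))"
proof -
  have "acts ((stay (heads T))(i := (if w then 0 else heads T i, Move_Left), j := (heads T j, Move_Left))) T
    = T(i := act (if w then 0 else read (T i), Move_Left) (T i), j := act (read (T j), Move_Left) (T j))"
    using assms by (simp add: acts_simps)
  then show ?thesis
    unfolding left_op_def
    using halts_Op[of "\<lambda>h. (stay h)(i := (if w then 0 else h i, Move_Left), j := (h j, Move_Left))" T] by simp
qed

lemma left_loop:
  assumes ij: "i < ntapes" "j < ntapes" "i > 2" "j > 2" "i \<noteq> j"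
  shows "\<lbrakk>tp (T i) (tl (E @ L)) (nth0 (E @ L) 0 # R); tp (T j) (tl (F @ M)) (nth0 (F @ M) 0 # S);
      length F = length E; \<And>e. e \<in> set E \<Longrightarrow> P e (read (T 2)); \<not> P (nth0 L 0) (read (T 2))\<rbrakk> \<Longrightarrow>
    \<exists>T'. halts (PWhile (\<lambda>h. P (h i) (h 2)) (left_op w i j)) T (3 * length E + 1) T' \<and>
      tp (T' i) (tl L) (nth0 L 0 # rev (map (\<lambda>e. if w then 0 else e) E) @ R) \<and>
      tp (T' j) (tl M) (nth0 M 0 # rev F @ S) \<and> (\<forall>k. k \<noteq> i \<longrightarrow> k \<noteq> j \<longrightarrow> T' k = T k)"
proof (induction E arbitrary: T F R S)
  case Nil
  have "read (T i) = nth0 L 0" using read_tp[OF Nil(1)] by simp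
  then have "halts (PWhile (\<lambda>h. P (h i) (h 2)) (left_op w i j)) T 1 T"
    using Nil ij by (intro halts_PWhile_False) (auto simp: ntapes_def)
  then show ?case using Nil by (intro exI[of _ T]) auto
next
  case (Cons e E)
  obtain f F' where F: "F = f # F'" "length F' = length E" using Cons.prems(3) by (cases F) auto
  let ?T = "T(i := act (if w then 0 else read (T i), Move_Left) (T i), j := act (read (T j), Move_Left) (T j))"
  have rd: "read (T i) = e" "read (T j) = f"
    using read_tp[OF Cons.prems(1)] read_tp[OF Cons.prems(2)] F by simp_all
  have P: "P (heads T i) (heads T 2)"
    using Cons.prems(4)[of e] ij rd by (simp add: ntapes_def)
  have t: "tp (?T i) (tl (E @ L)) (nth0 (E @ L) 0 # (if w then 0 else e) # R)"
    "tp (?T j) (tl (F' @ M)) (nth0 (F' @ M) 0 # f # S)"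
    using tp_left[OF Cons.prems(1), of "if w then 0 else e"] tp_left[OF Cons.prems(2), of f] rd ij F
    by (cases w; simp)+
  have r2: "read (?T 2) = read (T 2)" using ij by simp
  have P4: "\<And>x. x \<in> set E \<Longrightarrow> P x (read (T 2))" using Cons.prems(4) by simp
  obtain T' where T': "halts (PWhile (\<lambda>h. P (h i) (h 2)) (left_op w i j)) ?T (3 * length E + 1) T'"
     "tp (T' i) (tl L) (nth0 L 0 # rev (map (\<lambda>e. if w then 0 else e) E) @ (if w then 0 else e) # R)"
     "tp (T' j) (tl M) (nth0 M 0 # rev F' @ f # S)" "\<forall>k. k \<noteq> i \<longrightarrow> k \<noteq> j \<longrightarrow> T' k = ?T k"
    using Cons.IH[OF t F(2), unfolded r2, OF P4 Cons.prems(5)] by blast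
  have "halts (PWhile (\<lambda>h. P (h i) (h 2)) (left_op w i j)) T (1 + (3 * length E + 1) + 2) T'"
    by (rule halts_PWhile_True[OF P left_op_correct[OF ij] T'(1)])
  then have "halts (PWhile (\<lambda>h. P (h i) (h 2)) (left_op w i j)) T (3 * length (e # E) + 1) T'"
    by (rule halts_mono) simp
  then show ?case using T' F by (intro exI[of _ T']) auto
qed

lemma last_bits: "n > 0 \<Longrightarrow> last (bits n) = 2"
proof (induction n rule: bits.induct)
  case (1 n)
  show ?case
  proof (cases "n = 1")
    case True then show ?thesis by (simp add: bits.simps)
  next
    case False
    then have "n div 2 > 0" using 1(2) by auto
    moreover from this have "bits (n div 2) \<noteq> []" by (simp add: bits_pos)
    ultimately show ?thesis using 1 by (subst bits.simps) auto
  qed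
qed

lemma dropWhile_rev_bits: "dropWhile (\<lambda>e. e = 1) (rev (bits n @ replicate m 1)) = rev (bits n)"
proof -
  have "dropWhile (\<lambda>e. e = 1) (replicate m 1 @ rev (bits n)) = dropWhile (\<lambda>e. e = 1) (rev (bits n))"
    by (rule dropWhile_append2) simp
  moreover have "dropWhile (\<lambda>e. e = 1) (rev (bits n)) = rev (bits n)"
  proof (cases "n = 0")
    case False
    then have "rev (bits n) = last (bits n) # rev (butlast (bits n))"
      by (metis append_butlast_last_id bits_pos list.distinct(1) not_gr_zero rev_eq_Cons_iff rev_rev_ident)
    then obtain zs where "rev (bits n) = 2 # zs" using last_bits False by auto
    then show ?thesis by simp
  qed simp
  ultimately show ?thesis by simp
qed

lemma finish_correct:
  assumes ij: "i < ntapes" "j < ntapes" "i > 2" "j > 2" "i \<noteq> j"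
    and t: "tp (T i) (rev u) []" "tp (T j) (rev v) []" "tp (T 2) [] [b]"
    and uv: "length v = length u" "set u \<subseteq> {1, 2}"
  shows "\<exists>T'. halts (finish i j) T (6 * length u + 7) T' \<and>
    tp (T' i) [] (if b = 0 then bits (val u) else []) \<and> tp (T' j) [] v \<and> tp (T' 2) [] [] \<and>
    (\<forall>k. k \<noteq> i \<longrightarrow> k \<noteq> j \<longrightarrow> k \<noteq> 2 \<longrightarrow> T' k = T k)"
proof -
  let ?P = "\<lambda>e b. e = 1 \<or> b \<noteq> 0 \<and> e \<noteq> (0::nat)"
  define E where "E = takeWhile (\<lambda>e. ?P e b) (rev u)"
  define L where "L = dropWhile (\<lambda>e. ?P e b) (rev u)"
  define F where "F = take (length E) (rev v)"
  define M where "M = drop (length E) (rev v)"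
  have EL: "E @ L = rev u" by (simp add: E_def L_def)
  have lenEL: "length E + length L = length u" using arg_cong[OF EL, of length] by simp
  have FM: "F @ M = rev v" "length F = length E" "length M = length L"
    using lenEL uv(1) by (auto simp: F_def M_def)
  have b: "read (T 2) = b" using read_tp[OF t(3)] by simp
  have rd: "read (T i) = 0" "read (T j) = 0" using read_tp[OF t(1)] read_tp[OF t(2)] by simp_all
  let ?T1 = "T(i := act (if False then 0 else read (T i), Move_Left) (T i), j := act (read (T j), Move_Left) (T j))"
  have s1: "halts (left_op False i j) T 1 ?T1" by (rule left_op_correct[OF ij])
  have t1: "tp (?T1 i) (tl (E @ L)) (nth0 (E @ L) 0 # [0])" "tp (?T1 j) (tl (F @ M)) (nth0 (F @ M) 0 # [0])"
    using tp_left[OF t(1), of 0] tp_left[OF t(2), of 0] rd ij EL FM by simp_all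
  have b1: "read (?T1 2) = b" using b ij by simp
  have PL: "\<not> ?P (nth0 L 0) b"
  proof (cases L)
    case (Cons a L')
    then have "\<not> ?P (hd L) b" unfolding L_def by (intro hd_dropWhile) auto
    then show ?thesis using Cons by simp
  qed simp
  have PE: "\<And>e. e \<in> set E \<Longrightarrow> ?P e b" unfolding E_def using set_takeWhileD by fast
  obtain T2 where T2:
     "halts (PWhile (\<lambda>h. ?P (h i) (h 2)) (left_op True i j)) ?T1 (3 * length E + 1) T2"
     "tp (T2 i) (tl L) (nth0 L 0 # rev (map (\<lambda>e. if True then 0 else e) E) @ [0])"
     "tp (T2 j) (tl M) (nth0 M 0 # rev F @ [0])" "\<forall>k. k \<noteq> i \<longrightarrow> k \<noteq> j \<longrightarrow> T2 k = ?T1 k"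
    using left_loop[OF ij t1 FM(2), of ?P True, unfolded b1, OF PE PL] by blast
  have L0: "e \<noteq> 0" if "e \<in> set L" for e
  proof -
    have "e \<in> set (rev u)" using that EL by (metis UnI2 set_append)
    then show ?thesis using uv(2) by auto
  qed
  obtain T3 where T3:
     "halts (PWhile (\<lambda>h. h i \<noteq> 0) (left_op False i j)) T2 (3 * length L + 1) T3"
     "tp (T3 i) [] (0 # rev L @ replicate (length E) 0 @ [0])"
     "tp (T3 j) [] (0 # rev M @ rev F @ [0])" "\<forall>k. k \<noteq> i \<longrightarrow> k \<noteq> j \<longrightarrow> T3 k = T2 k"
  proof -
    have zs: "rev (map (\<lambda>e. if True then 0 else e) E) = replicate (length E) 0"
      by (simp add: map_replicate_const)
    have a1: "tp (T2 i) (tl (L @ [])) (nth0 (L @ []) 0 # replicate (length E) 0 @ [0])"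
      using T2(2) unfolding zs by simp
    have a2: "tp (T2 j) (tl (M @ [])) (nth0 (M @ []) 0 # rev F @ [0])" using T2(3) by simp
    have "\<exists>T'. halts (PWhile (\<lambda>h. h i \<noteq> 0) (left_op False i j)) T2 (3 * length L + 1) T' \<and>
      tp (T' i) (tl []) (nth0 [] 0 # rev (map (\<lambda>e. if False then 0 else e) L) @ replicate (length E) 0 @ [0]) \<and>
      tp (T' j) (tl []) (nth0 [] 0 # rev M @ rev F @ [0]) \<and> (\<forall>k. k \<noteq> i \<longrightarrow> k \<noteq> j \<longrightarrow> T' k = T2 k)"
      by (rule left_loop[where P = "\<lambda>e b. e \<noteq> 0", OF ij a1 a2 FM(3)]) (use L0 in simp_all)
    then show thesis using that by auto
  qed
  let ?T4 = "T3(i := act (read (T3 i), Move_Right) (T3 i), j := act (read (T3 j), Move_Right) (T3 j), 2 := act (0, Stay) (T3 2))"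
  have n2: "2 < ntapes" by (simp add: ntapes_def)
  have s4: "halts (Op (\<lambda>h. (stay h)(i := (h i, Move_Right), j := (h j, Move_Right), 2 := (0, Stay)))) T3 1 ?T4"
  proof -
    have "acts ((stay (heads T3))(i := (heads T3 i, Move_Right), j := (heads T3 j, Move_Right), 2 := (0, Stay))) T3 = ?T4"
      using ij n2 by (simp add: acts_simps)
    then show ?thesis
      using halts_Op[of "\<lambda>h. (stay h)(i := (h i, Move_Right), j := (h j, Move_Right), 2 := (0, Stay))" T3] by simp
  qed
  have "halts (finish i j) T (1 + ((3 * length E + 1) + ((3 * length L + 1) + 1 + 1) + 1) + 1) ?T4"
    unfolding finish_def by (intro halts_PSeq[OF s1] halts_PSeq[OF T2(1)] halts_PSeq[OF T3(1)] s4)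
  then have H: "halts (finish i j) T (6 * length u + 7) ?T4"
    by (rule halts_mono) (use lenEL in simp)
  have rL: "rev L = (if b = 0 then bits (val u) else [])"
  proof (cases "b = 0")
    case True
    obtain m where m: "u = bits (val u) @ replicate m 1" using bits_val[OF uv(2)] by blast
    have "L = dropWhile (\<lambda>e. e = 1) (rev u)" unfolding L_def using True by simp
    also have "\<dots> = rev (bits (val u))" by (subst m) (rule dropWhile_rev_bits)
    finally show ?thesis using True by simp
  next
    case False
    have "\<forall>x\<in>set (rev u). ?P x b" using uv(2) False by auto
    then have "L = []" unfolding L_def by (simp only: dropWhile_eq_Nil_conv)
    then show ?thesis using False by simp
  qed
  have z: "replicate (length E) 0 @ [0] = replicate (Suc (length E)) (0::nat)"
    by (simp add: replicate_append_same)
  have "tp (?T4 i) [0] (rev L @ replicate (length E) 0 @ [0])"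
    using tp_right[OF T3(2)] read_tp[OF T3(2)] ij by simp
  then have ti: "tp (?T4 i) [] (rev L)"
    unfolding z
    by (rule tp_cong) (use nth0_append_zeros[of "[]" 1] nth0_append_zeros[of "rev L" "Suc (length E)"] in simp_all)
  have "tp (?T4 j) [0] (rev M @ rev F @ [0])"
    using tp_right[OF T3(3)] read_tp[OF T3(3)] ij by simp
  moreover have "rev M @ rev F = v" using arg_cong[OF FM(1), of rev] by simp
  ultimately have "tp (?T4 j) [0] (v @ [0])" by (metis append.assoc)
  then have tj: "tp (?T4 j) [] v"
    by (rule tp_cong) (use nth0_append_zeros[of "[]" 1] nth0_append_zeros[of v 1] in simp_all)
  have "T3 2 = T 2" using T3(4) T2(4) ij by auto
  then have "tp (?T4 2) [] [0]" using tp_stay[OF t(3), of 0] ij by simp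
  then have t2: "tp (?T4 2) [] []"
    by (rule tp_cong) (use nth0_append_zeros[of "[]" 1] in simp_all)
  show ?thesis
    by (rule exI[of _ ?T4], intro conjI H) (use ti tj t2 rL T3(4) T2(4) in simp_all)
qed

definition arith :: "bool \<Rightarrow> nat \<Rightarrow> nat \<Rightarrow> prog" where
  "arith add i j = PSeq (arith_loop add i j) (finish i j)"

lemma arith_correct:
  assumes ij: "i < ntapes" "j < ntapes" "i > 2" "j > 2" "i \<noteq> j"
    and t: "tp (T i) [] (bits x)" "tp (T j) [] (bits y)" "tp (T 2) [] []"
    and xy: "x < 2 ^ b" "y < 2 ^ b" "add \<Longrightarrow> x + y < 2 ^ b"
  shows "\<exists>T'. halts (arith add i j) T (9 * b + 9) T' \<and>
    tp (T' i) [] (bits (if add then x + y else x - y)) \<and> tp (T' j) [] (bits y) \<and> tp (T' 2) [] [] \<and>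
    (\<forall>k. k \<noteq> i \<longrightarrow> k \<noteq> j \<longrightarrow> k \<noteq> 2 \<longrightarrow> T' k = T k)"
proof -
  have t2: "tp (T 2) [] [2 * 0]"
    by (rule tp_cong[OF t(3)]) (use nth0_append_zeros[of "[]" 1] in simp_all)
  obtain T' u v c' where R: "halts (arith_loop add i j) T (3 * b + 1) T'"
        "tp (T' i) (rev u) []" "tp (T' j) (rev v) []"
        "tp (T' 2) [] [2 * c']"
        "length u \<le> b" "length v = length u" "set u \<subseteq> {1, 2}" "nth0 v = nth0 (bits y)"
        "c' \<le> 1" "add \<longrightarrow> c' = 0 \<and> val u = x + y"
        "\<not> add \<longrightarrow> val u + y = x + c' * 2 ^ length u"
        "\<And>k. k \<noteq> i \<Longrightarrow> k \<noteq> j \<Longrightarrow> k \<noteq> 2 \<Longrightarrow> T' k = T k"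
    using arith_loop_correct[OF ij t(1,2) t2, where b = b and add = add] xy by auto
  obtain T'' where S: "halts (finish i j) T' (6 * length u + 7) T''"
    "tp (T'' i) [] (if 2 * c' = 0 then bits (val u) else [])" "tp (T'' j) [] v" "tp (T'' 2) [] []"
    "\<forall>k. k \<noteq> i \<longrightarrow> k \<noteq> j \<longrightarrow> k \<noteq> 2 \<longrightarrow> T'' k = T' k"
    using finish_correct[OF ij R(2,3,4,6,7)] by blast
  have res: "(if 2 * c' = 0 then bits (val u) else []) = bits (if add then x + y else x - y)"
  proof (cases "c' = 0")
    case True
    then show ?thesis using R(10,11) by auto
  next
    case False
    then have c: "c' = 1" "\<not> add" using R(9,10) by auto
    then have "x < y" using R(11) val_less[OF R(7)] by simp
    then show ?thesis using c by simp
  qed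
  have "halts (arith add i j) T ((3 * b + 1) + (6 * length u + 7) + 1) T''"
    unfolding arith_def by (rule halts_PSeq[OF R(1) S(1)])
  then have "halts (arith add i j) T (9 * b + 9) T''" by (rule halts_mono) (use R(5) in simp)
  moreover have "tp (T'' j) [] (bits y)" by (rule tp_cong[OF S(3)]) (use R(8) in simp_all)
  ultimately show ?thesis using S R(12) res by (intro exI[of _ T'']) auto
qed

section \<open>A register language\<close>

type_synonym st = "(nat \<Rightarrow> nat) \<times> int list \<times> nat list"

text \<open>
  \<open>Sub\<close> is truncated subtraction. \<open>Push\<close> appends a bit at the least significant end and
  \<open>Halve\<close> removes one. \<open>Get\<close> reads an integer and stores its absolute value in one of two
  registers, according to its sign; \<open>Put\<close> writes a positive number to the output. The body
  of \<open>Loop k\<close> must not change \<open>k\<close>; it is executed once for each bit of \<open>k\<close>, the least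
  significant first, and \<open>k\<close> is halved each time.
\<close>

datatype com =
    Add nat nat
  | Sub nat nat
  | Push bool nat
  | Halve nat
  | Get nat nat
  | Emit nat
  | Put nat
  | Nop
  | Seq com com (infixr ";;" 60)
  | IfPos nat com com
  | IfOdd nat com com
  | Loop nat com

fun iter :: "(st \<Rightarrow> st option) \<Rightarrow> nat \<Rightarrow> nat \<Rightarrow> st \<Rightarrow> st option" where
  "iter f k 0 s = Some s"
| "iter f k (Suc m) s = (case f s of None \<Rightarrow> None | Some (r, inp, out) \<Rightarrow>
     if r k = fst s k then iter f k m (r(k := r k div 2), inp, out) else None)"

text \<open>
  Execution fails if a number with more than \<open>b\<close> bits arises. Running times can then be
  bounded in terms of \<open>b\<close> without further reference to the contents of the registers.
\<close>

primrec run :: "nat \<Rightarrow> com \<Rightarrow> st \<Rightarrow> st option" where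
  "run b (Add i j) = (\<lambda>(r, inp, out).
     if r i + r j < 2 ^ b then Some (r(i := r i + r j), inp, out) else None)"
| "run b (Sub i j) = (\<lambda>(r, inp, out). Some (r(i := r i - r j), inp, out))"
| "run b (Push c i) = (\<lambda>(r, inp, out).
     if 2 * r i + of_bool c < 2 ^ b then Some (r(i := 2 * r i + of_bool c), inp, out) else None)"
| "run b (Halve i) = (\<lambda>(r, inp, out). Some (r(i := r i div 2), inp, out))"
| "run b (Get p n) = (\<lambda>(r, inp, out). case inp of [] \<Rightarrow> None | z # zs \<Rightarrow>
     if z \<noteq> 0 \<and> nat \<bar>z\<bar> < 2 ^ b \<and> r p = 0 \<and> r n = 0
     then Some (r((if z < 0 then n else p) := nat \<bar>z\<bar>), zs, out) else None)"
| "run b (Emit x) = (\<lambda>(r, inp, out). Some (r, inp, out @ [x]))"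
| "run b (Put i) = (\<lambda>(r, inp, out).
     if r i > 0 then Some (r, inp, out @ rev (bits (r i))) else None)"
| "run b Nop = Some"
| "run b (c ;; d) = (\<lambda>s. Option.bind (run b c s) (run b d))"
| "run b (IfPos i c d) = (\<lambda>s. if fst s i > 0 then run b c s else run b d s)"
| "run b (IfOdd i c d) = (\<lambda>s. if odd (fst s i) then run b c s else run b d s)"
| "run b (Loop k c) = (\<lambda>s. iter (run b c) k (length (bits (fst s k))) s)"

definition is_reg :: "nat \<Rightarrow> bool" where
  "is_reg i \<longleftrightarrow> 3 \<le> i \<and> i < ntapes"

primrec okc :: "com \<Rightarrow> bool" where
  "okc (Add i j) \<longleftrightarrow> is_reg i \<and> is_reg j \<and> i \<noteq> j"
| "okc (Sub i j) \<longleftrightarrow> is_reg i \<and> is_reg j \<and> i \<noteq> j"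
| "okc (Push c i) \<longleftrightarrow> is_reg i"
| "okc (Halve i) \<longleftrightarrow> is_reg i"
| "okc (Get p n) \<longleftrightarrow> is_reg p \<and> is_reg n \<and> p \<noteq> n"
| "okc (Emit x) \<longleftrightarrow> x < 5"
| "okc (Put i) \<longleftrightarrow> is_reg i"
| "okc Nop \<longleftrightarrow> True"
| "okc (c ;; d) \<longleftrightarrow> okc c \<and> okc d"
| "okc (IfPos i c d) \<longleftrightarrow> is_reg i \<and> okc c \<and> okc d"
| "okc (IfOdd i c d) \<longleftrightarrow> is_reg i \<and> okc c \<and> okc d"
| "okc (Loop k c) \<longleftrightarrow> is_reg k \<and> okc c"

definition left1 :: "nat \<Rightarrow> prog" where
  "left1 i = Op (\<lambda>h. (stay h)(i := (h i, Move_Left)))"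

definition right1 :: "nat \<Rightarrow> prog" where
  "right1 i = Op (\<lambda>h. (stay h)(i := (h i, Move_Right)))"

definition write1 :: "nat \<Rightarrow> nat \<Rightarrow> move \<Rightarrow> prog" where
  "write1 i x m = Op (\<lambda>h. (stay h)(i := (x, m)))"

definition getbits :: "nat \<Rightarrow> prog" where
  "getbits i = PWhile (\<lambda>h. h 0 \<noteq> 4)
     (PSeq (left1 i) (Op (\<lambda>h. (stay h)(i := (h 0, Stay), 0 := (h 0, Move_Right)))))"

definition out1 :: "nat \<Rightarrow> prog" where
  "out1 i = Op (\<lambda>h. (stay h)(1 := (h i, Move_Right), i := (h i, Move_Left)))"

definition putbits :: "nat \<Rightarrow> prog" where
  "putbits i = PSeq (PWhile (\<lambda>h. h i \<noteq> 0) (right1 i)) (PSeq (left1 i)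
     (PSeq (PWhile (\<lambda>h. h i \<noteq> 0) (out1 i)) (right1 i)))"

primrec compile :: "com \<Rightarrow> prog" where
  "compile (Add i j) = arith True i j"
| "compile (Sub i j) = arith False i j"
| "compile (Push c i) = (if c then PSeq (left1 i) (write1 i 2 Stay)
     else PIf (\<lambda>h. h i \<noteq> 0) (PSeq (left1 i) (write1 i 1 Stay)) PSkip)"
| "compile (Halve i) = write1 i 0 Move_Right"
| "compile (Get p n) = PSeq (PIf (\<lambda>h. h 0 = 3) (PSeq (right1 0) (getbits n)) (getbits p)) (right1 0)"
| "compile (Emit x) = write1 1 x Move_Right"
| "compile (Put i) = putbits i"
| "compile Nop = PSkip"
| "compile (c ;; d) = PSeq (compile c) (compile d)"
| "compile (IfPos i c d) = PIf (\<lambda>h. h i \<noteq> 0) (compile c) (compile d)"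
| "compile (IfOdd i c d) = PIf (\<lambda>h. h i = 2) (compile c) (compile d)"
| "compile (Loop k c) = PWhile (\<lambda>h. h k \<noteq> 0) (PSeq (compile c) (write1 k 0 Move_Right))"

primrec cost :: "nat \<Rightarrow> com \<Rightarrow> nat" where
  "cost b (Add i j) = 9 * b + 9"
| "cost b (Sub i j) = 9 * b + 9"
| "cost b (Push c i) = 4"
| "cost b (Halve i) = 1"
| "cost b (Get p n) = 5 * b + 6"
| "cost b (Emit x) = 1"
| "cost b (Put i) = 6 * b + 7"
| "cost b Nop = 0"
| "cost b (c ;; d) = cost b c + cost b d + 1"
| "cost b (IfPos i c d) = cost b c + cost b d + 1"
| "cost b (IfOdd i c d) = cost b c + cost b d + 1"
| "cost b (Loop k c) = b * (cost b c + 4) + 1"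

definition rep :: "(nat \<Rightarrow> tape) \<Rightarrow> st \<Rightarrow> bool" where
  "rep T s \<longleftrightarrow> (case s of (r, inp, out) \<Rightarrow>
     (\<exists>l. tp (T 0) l (encode_ints inp)) \<and> T 1 = (tape_contents out, int (length out)) \<and>
     tp (T 2) [] [] \<and> (\<forall>i. is_reg i \<longrightarrow> tp (T i) [] (bits (r i))))"

definition small :: "nat \<Rightarrow> st \<Rightarrow> bool" where
  "small b s \<longleftrightarrow> (\<forall>i. fst s i < 2 ^ b)"

lemma is_regD: "is_reg i \<Longrightarrow> i < ntapes" "is_reg i \<Longrightarrow> i > 2" "is_reg i \<Longrightarrow> i \<noteq> 0"
    "is_reg i \<Longrightarrow> i \<noteq> 1" "is_reg i \<Longrightarrow> i \<noteq> 2"  "is_reg i \<Longrightarrow> i \<noteq> Suc 0"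
  by (auto simp: is_reg_def)

lemma io_tapes [simp]: "0 < ntapes" "1 < ntapes" "2 < ntapes" "Suc 0 < ntapes"
  by (simp_all add: ntapes_def)

lemma okp_compile: "okc c \<Longrightarrow> okp (compile c)"
proof (induction c)
  case (Add i j)
  then show ?case by (auto simp: arith_def arith_loop_def arith_op_def finish_def left_op_def
        symbols_ok_def stay_def)
next
  case (Sub i j)
  then show ?case by (auto simp: arith_def arith_loop_def arith_op_def finish_def left_op_def
        symbols_ok_def stay_def)
qed (simp_all add: left1_def right1_def write1_def getbits_def putbits_def out1_def symbols_ok_def stay_def)

lemma left1_correct: "i < ntapes \<Longrightarrow> halts (left1 i) T 1 (T(i := act (read (T i), Move_Left) (T i)))"
  using halts_Op[of "\<lambda>h. (stay h)(i := (h i, Move_Left))" T] unfolding left1_def by (simp add: acts_simps)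

lemma right1_correct: "i < ntapes \<Longrightarrow> halts (right1 i) T 1 (T(i := act (read (T i), Move_Right) (T i)))"
  using halts_Op[of "\<lambda>h. (stay h)(i := (h i, Move_Right))" T] unfolding right1_def by (simp add: acts_simps)

lemma write1_correct: "i < ntapes \<Longrightarrow> halts (write1 i x m) T 1 (T(i := act (x, m) (T i)))"
  using halts_Op[of "\<lambda>h. (stay h)(i := (x, m))" T] unfolding write1_def by (simp add: acts_simps)

lemma tp_push:
  assumes "tp T [] R"
  shows "tp (act (s, Stay) (act (read T, Move_Left) T)) [] (s # R)"
proof -
  have "tp (act (read T, Move_Left) T) [] (0 # read T # tl R)"
    using tp_left[OF assms, of "read T"] by simp
  from tp_stay[OF this, of s] have "tp (act (s, Stay) (act (read T, Move_Left) T)) [] (s # read T # tl R)"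
    by simp
  moreover have "nth0 (s # read T # tl R) k = nth0 (s # R) k" for k
  proof (cases k)
    case (Suc m)
    then show ?thesis using read_tp[OF assms] by (cases m) (simp_all add: nth0_tl)
  qed simp
  ultimately show ?thesis by (auto intro: tp_cong)
qed

lemma tp_pop:
  assumes "tp T [] R"
  shows "tp (act (0, Move_Right) T) [] (tl R)"
  by (rule tp_cong[OF tp_right[OF assms]]) (use nth0_append_zeros[of "[]" 1] in simp_all)

lemma getbits_correct:
  assumes i: "is_reg i"
  shows "\<lbrakk>tp (T 0) l (w @ 4 # rest); tp (T i) [] R; set w \<subseteq> {1, 2}\<rbrakk> \<Longrightarrow>
    \<exists>T' l'. halts (getbits i) T (5 * length w + 1) T' \<and> tp (T' 0) l' (4 # rest) \<and>
      tp (T' i) [] (rev w @ R) \<and> (\<forall>k. k \<noteq> 0 \<longrightarrow> k \<noteq> i \<longrightarrow> T' k = T k)"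
proof (induction w arbitrary: T l R)
  case Nil
  have "halts (getbits i) T 1 T"
    unfolding getbits_def by (rule halts_PWhile_False) (use read_tp[OF Nil(1)] in simp)
  then show ?case using Nil by auto
next
  case (Cons s w)
  note id = is_regD[OF i]
  have s: "s = 1 \<or> s = 2" using Cons.prems(3) by auto
  have rd: "read (T 0) = s" using read_tp[OF Cons.prems(1)] by simp
  let ?T1 = "T(i := act (read (T i), Move_Left) (T i))"
  let ?T2 = "?T1(i := act (s, Stay) (?T1 i), 0 := act (s, Move_Right) (T 0))"
  have "acts ((stay (heads ?T1))(i := (heads ?T1 0, Stay), 0 := (heads ?T1 0, Move_Right))) ?T1 = ?T2"
    using id rd by (simp add: acts_simps)
  then have "halts (Op (\<lambda>h. (stay h)(i := (h 0, Stay), 0 := (h 0, Move_Right)))) ?T1 1 ?T2"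
    using halts_Op[of "\<lambda>h. (stay h)(i := (h 0, Stay), 0 := (h 0, Move_Right))" ?T1] by metis
  from halts_PSeq[OF left1_correct[OF id(1)] this]
  have body: "halts (PSeq (left1 i) (Op (\<lambda>h. (stay h)(i := (h 0, Stay), 0 := (h 0, Move_Right))))) T 3 ?T2"
    by (rule halts_mono) simp
  have t: "tp (?T2 0) (s # l) (w @ 4 # rest)" "tp (?T2 i) [] (s # R)"
    using tp_right[OF Cons.prems(1), of s] tp_push[OF Cons.prems(2), of s] id by simp_all
  have w: "set w \<subseteq> {1, 2}" using Cons.prems(3) by simp
  obtain T' l' where T': "halts (getbits i) ?T2 (5 * length w + 1) T'" "tp (T' 0) l' (4 # rest)"
    "tp (T' i) [] (rev w @ s # R)" "\<forall>k. k \<noteq> 0 \<longrightarrow> k \<noteq> i \<longrightarrow> T' k = ?T2 k"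
    using Cons.IH[of ?T2 "s # l" "s # R"] t w by blast
  have "halts (getbits i) T (3 + (5 * length w + 1) + 2) T'"
    unfolding getbits_def
    by (rule halts_PWhile_True[OF _ body T'(1)[unfolded getbits_def]]) (use rd s in auto)
  then have "halts (getbits i) T (5 * length (s # w) + 1) T'" by (rule halts_mono) simp
  then show ?case using T' by (intro exI[of _ T'] exI[of _ l']) auto
qed

lemma out_act:
  "act (s, Move_Right) (tape_contents out, int (length out))
     = (tape_contents (out @ [s]), int (length (out @ [s])))"
proof -
  have "(tape_contents out)(int (length out) := s) = tape_contents (out @ [s])"
    by (rule ext) (auto simp: tape_contents_def nth_append nat_eq_iff2 split: if_splits)
  then show ?thesis by simp
qed

lemma right_loop:
  assumes i: "is_reg i"
  shows "\<lbrakk>tp (T i) l w; 0 \<notin> set w\<rbrakk> \<Longrightarrow>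
    \<exists>T'. halts (PWhile (\<lambda>h. h i \<noteq> 0) (right1 i)) T (3 * length w + 1) T' \<and>
      tp (T' i) (rev w @ l) [] \<and> (\<forall>k. k \<noteq> i \<longrightarrow> T' k = T k)"
proof (induction w arbitrary: T l)
  case Nil
  have "halts (PWhile (\<lambda>h. h i \<noteq> 0) (right1 i)) T 1 T"
    by (rule halts_PWhile_False) (use read_tp[OF Nil(1)] is_regD[OF i] in simp)
  then show ?case using Nil by auto
next
  case (Cons s w)
  have rd: "read (T i) = s" using read_tp[OF Cons.prems(1)] by simp
  let ?T = "T(i := act (read (T i), Move_Right) (T i))"
  have nw: "0 \<notin> set w" using Cons.prems(2) by simp
  have t: "tp (?T i) (s # l) w" using tp_right[OF Cons.prems(1), of s] rd by simp
  obtain T' where T': "halts (PWhile (\<lambda>h. h i \<noteq> 0) (right1 i)) ?T (3 * length w + 1) T'"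
      "tp (T' i) (rev w @ s # l) []" "\<forall>k. k \<noteq> i \<longrightarrow> T' k = ?T k"
    using Cons.IH[of ?T "s # l"] t nw by blast
  have "halts (PWhile (\<lambda>h. h i \<noteq> 0) (right1 i)) T (1 + (3 * length w + 1) + 2) T'"
    by (rule halts_PWhile_True[OF _ right1_correct T'(1)]) (use rd Cons.prems(2) is_regD[OF i] in auto)
  then have "halts (PWhile (\<lambda>h. h i \<noteq> 0) (right1 i)) T (3 * length (s # w) + 1) T'"
    by (rule halts_mono) simp
  then show ?case using T' by (intro exI[of _ T']) auto
qed

lemma out_loop:
  assumes i: "is_reg i"
  shows "\<lbrakk>tp (T i) (tl w) (nth0 w 0 # R); 0 \<notin> set w; T 1 = (tape_contents out, int (length out))\<rbrakk> \<Longrightarrow>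
    \<exists>T'. halts (PWhile (\<lambda>h. h i \<noteq> 0) (out1 i)) T (3 * length w + 1) T' \<and>
      tp (T' i) [] (0 # rev w @ R) \<and> T' 1 = (tape_contents (out @ w), int (length (out @ w))) \<and>
      (\<forall>k. k \<noteq> 1 \<longrightarrow> k \<noteq> i \<longrightarrow> T' k = T k)"
proof (induction w arbitrary: T R out)
  case Nil
  have "halts (PWhile (\<lambda>h. h i \<noteq> 0) (out1 i)) T 1 T"
    by (rule halts_PWhile_False) (use read_tp[OF Nil(1)] is_regD[OF i] in simp)
  then show ?case using Nil by auto
next
  case (Cons s w)
  note id = is_regD[OF i]
  have rd: "read (T i) = s" using read_tp[OF Cons.prems(1)] by simp
  let ?T = "T(1 := act (s, Move_Right) (T 1), i := act (s, Move_Left) (T i))"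
  have "acts ((stay (heads T))(1 := (heads T i, Move_Right), i := (heads T i, Move_Left))) T = ?T"
    using id rd by (simp add: acts_simps)
  then have op: "halts (out1 i) T 1 ?T"
    unfolding out1_def using halts_Op[of "\<lambda>h. (stay h)(1 := (h i, Move_Right), i := (h i, Move_Left))" T] by metis
  have t: "tp (?T i) (tl w) (nth0 w 0 # s # R)" using tp_left[OF Cons.prems(1), of s] id by simp
  have o: "?T 1 = (tape_contents (out @ [s]), int (length (out @ [s])))"
    using Cons.prems(3) out_act id by simp
  have nw: "0 \<notin> set w" using Cons.prems(2) by simp
  obtain T' where T': "halts (PWhile (\<lambda>h. h i \<noteq> 0) (out1 i)) ?T (3 * length w + 1) T'"
      "tp (T' i) [] (0 # rev w @ s # R)"
      "T' 1 = (tape_contents ((out @ [s]) @ w), int (length ((out @ [s]) @ w)))"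
      "\<forall>k. k \<noteq> 1 \<longrightarrow> k \<noteq> i \<longrightarrow> T' k = ?T k"
    using Cons.IH[of ?T "s # R" "out @ [s]"] t nw o by blast
  have "halts (PWhile (\<lambda>h. h i \<noteq> 0) (out1 i)) T (1 + (3 * length w + 1) + 2) T'"
    by (rule halts_PWhile_True[OF _ op T'(1)]) (use rd Cons.prems(2) id in auto)
  then have "halts (PWhile (\<lambda>h. h i \<noteq> 0) (out1 i)) T (3 * length (s # w) + 1) T'"
    by (rule halts_mono) simp
  then show ?case using T' by (intro exI[of _ T']) auto
qed

lemma putbits_correct:
  assumes i: "is_reg i" and w: "tp (T i) [] w" "0 \<notin> set w"
    and o: "T 1 = (tape_contents out, int (length out))"
  shows "\<exists>T'. halts (putbits i) T (6 * length w + 7) T' \<and> tp (T' i) [] w \<and>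
    T' 1 = (tape_contents (out @ rev w), int (length (out @ rev w))) \<and>
    (\<forall>k. k \<noteq> 1 \<longrightarrow> k \<noteq> i \<longrightarrow> T' k = T k)"
proof -
  note id = is_regD[OF i]
  obtain T1 where T1: "halts (PWhile (\<lambda>h. h i \<noteq> 0) (right1 i)) T (3 * length w + 1) T1"
      "tp (T1 i) (rev w) []" "\<forall>k. k \<noteq> i \<longrightarrow> T1 k = T k"
    using right_loop[OF i, of T "[]" w] w by auto
  let ?T2 = "T1(i := act (read (T1 i), Move_Left) (T1 i))"
  have t2: "tp (?T2 i) (tl (rev w)) (nth0 (rev w) 0 # [read (T1 i)])"
    using tp_left[OF T1(2), of "read (T1 i)"] by simp
  have r1: "read (T1 i) = 0" using read_tp[OF T1(2)] by simp
  have o2: "?T2 1 = (tape_contents out, int (length out))" using T1(3) o id by simp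
  have w2: "0 \<notin> set (rev w)" using w(2) by simp
  obtain T3 where T3: "halts (PWhile (\<lambda>h. h i \<noteq> 0) (out1 i)) ?T2 (3 * length (rev w) + 1) T3"
      "tp (T3 i) [] (0 # rev (rev w) @ [read (T1 i)])"
      "T3 1 = (tape_contents (out @ rev w), int (length (out @ rev w)))"
      "\<forall>k. k \<noteq> 1 \<longrightarrow> k \<noteq> i \<longrightarrow> T3 k = ?T2 k"
    using out_loop[OF i, of ?T2 "rev w" "[read (T1 i)]" out] t2 w2 o2 by blast
  let ?T4 = "T3(i := act (read (T3 i), Move_Right) (T3 i))"
  have "halts (putbits i) T ((3 * length w + 1) + (1 + ((3 * length (rev w) + 1) + 1 + 1) + 1) + 1) ?T4"
    unfolding putbits_def
    by (intro halts_PSeq[OF T1(1)] halts_PSeq[OF left1_correct[OF id(1)]] halts_PSeq[OF T3(1)]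
        right1_correct[OF id(1)])
  then have H: "halts (putbits i) T (6 * length w + 7) ?T4" by (rule halts_mono) simp
  have "tp (?T4 i) [0] (w @ [0])"
    using tp_right[OF T3(2), of "read (T3 i)"] read_tp[OF T3(2)] r1 by simp
  then have "tp (?T4 i) [] w"
    by (rule tp_cong) (use nth0_append_zeros[of "[]" 1] nth0_append_zeros[of w 1] in simp_all)
  then show ?thesis using H T1 T3 id by (intro exI[of _ ?T4]) auto
qed

lemma rep_reg:
  assumes "rep T (r, inp, out)" "is_reg i" "tp (T' i) [] (bits v)" "\<forall>k. k \<noteq> i \<longrightarrow> T' k = T k"
  shows "rep T' (r(i := v), inp, out)"
  using assms is_regD[OF assms(2)] unfolding rep_def by auto

lemma rep_reg_read:
  assumes "rep T s" "is_reg i"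
  shows "read (T i) = (if fst s i = 0 then 0 else 1 + fst s i mod 2)"
  using assms read_tp[of "T i" "[]" "bits (fst s i)"] by (cases s) (auto simp: rep_def nth0_bits_0)

lemma push_correct:
  assumes "rep T (r, inp, out)" "is_reg i" "2 * r i + x > 0" "x \<le> 1"
  shows "\<exists>T'. halts (PSeq (left1 i) (write1 i (1 + x) Stay)) T 3 T' \<and> rep T' (r(i := 2 * r i + x), inp, out)"
proof -
  note id = is_regD[OF assms(2)]
  let ?T1 = "T(i := act (read (T i), Move_Left) (T i))"
  have "halts (PSeq (left1 i) (write1 i (1 + x) Stay)) T (1 + 1 + 1) (?T1(i := act (1 + x, Stay) (?T1 i)))"
    by (intro halts_PSeq[OF left1_correct[OF id(1)]] write1_correct[OF id(1)])
  then have H: "halts (PSeq (left1 i) (write1 i (1 + x) Stay)) T 3 (?T1(i := act (1 + x, Stay) (?T1 i)))"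
    by (rule halts_mono) simp
  have "bits (2 * r i + x) = (1 + x) # bits (r i)"
    using assms(3,4) by (subst bits_pos) auto
  moreover have "tp (T i) [] (bits (r i))" using assms(1,2) by (simp add: rep_def)
  ultimately have "tp (act (1 + x, Stay) (act (read (T i), Move_Left) (T i))) [] (bits (2 * r i + x))"
    using tp_push[of "T i" "bits (r i)" "1 + x"] by simp
  then have "rep (?T1(i := act (1 + x, Stay) (?T1 i))) (r(i := 2 * r i + x), inp, out)"
    by (intro rep_reg[OF assms(1,2)]) simp_all
  then show ?thesis using H by blast
qed

lemma halve_correct:
  assumes "rep T (r, inp, out)" "is_reg i"
  shows "\<exists>T'. halts (write1 i 0 Move_Right) T 1 T' \<and> rep T' (r(i := r i div 2), inp, out)"
proof -
  have "tp (T i) [] (bits (r i))" using assms by (simp add: rep_def)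
  from tp_pop[OF this] have "tp (act (0, Move_Right) (T i)) [] (bits (r i div 2))" by (simp add: tl_bits)
  then have "rep (T(i := act (0, Move_Right) (T i))) (r(i := r i div 2), inp, out)"
    by (intro rep_reg[OF assms]) simp_all
  then show ?thesis using write1_correct[OF is_regD(1)[OF assms(2)]] by blast
qed

lemma arith_rep:
  assumes "rep T (r, inp, out)" "is_reg i" "is_reg j" "i \<noteq> j"
    and "r i < 2 ^ b" "r j < 2 ^ b" "add \<Longrightarrow> r i + r j < 2 ^ b"
  shows "\<exists>T'. halts (arith add i j) T (9 * b + 9) T' \<and>
    rep T' (r(i := if add then r i + r j else r i - r j), inp, out)"
proof -
  note id = is_regD[OF assms(2)] and jd = is_regD[OF assms(3)]
  have t: "tp (T i) [] (bits (r i))" "tp (T j) [] (bits (r j))" "tp (T 2) [] []"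
    using assms(1-3) by (auto simp: rep_def)
  obtain T' where T': "halts (arith add i j) T (9 * b + 9) T'"
     "tp (T' i) [] (bits (if add then r i + r j else r i - r j))" "tp (T' j) [] (bits (r j))"
     "tp (T' 2) [] []" "\<forall>k. k \<noteq> i \<longrightarrow> k \<noteq> j \<longrightarrow> k \<noteq> 2 \<longrightarrow> T' k = T k"
    using arith_correct[OF id(1) jd(1) id(2) jd(2) assms(4) t assms(5-7)] by blast
  have "rep T' (r(i := if add then r i + r j else r i - r j), inp, out)"
    unfolding rep_def prod.case
  proof (intro conjI allI impI)
    show "\<exists>l. tp (T' 0) l (encode_ints inp)" "T' 1 = (tape_contents out, int (length out))"
      using assms(1) T'(5) id jd by (auto simp: rep_def)
    show "tp (T' 2) [] []" by (rule T'(4))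
    fix k assume k: "is_reg k"
    show "tp (T' k) [] (bits ((r(i := if add then r i + r j else r i - r j)) k))"
    proof (cases "k = i \<or> k = j")
      case True then show ?thesis using T'(2,3) assms(4) by auto
    next
      case False
      then have "T' k = T k" using T'(5) is_regD[OF k] by simp
      then show ?thesis using False assms(1) k by (simp add: rep_def)
    qed
  qed
  then show ?thesis using T'(1) by blast
qed

lemma encode_int_pos: "z > 0 \<Longrightarrow> encode_int z = rev (bits (nat z))"
  by (simp add: encode_int_def binary_bits)

lemma encode_int_neg: "z < 0 \<Longrightarrow> encode_int z = 3 # rev (bits (nat \<bar>z\<bar>))"
  by (simp add: encode_int_def binary_bits)

lemma get_correct:
  assumes "rep T (r, z # zs, out)" "is_reg p" "is_reg n" "p \<noteq> n" "z \<noteq> 0" "nat \<bar>z\<bar> < 2 ^ b" "r p = 0" "r n = 0"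
  shows "\<exists>T'. halts (compile (Get p n)) T (5 * b + 6) T' \<and>
    rep T' (r((if z < 0 then n else p) := nat \<bar>z\<bar>), zs, out)"
proof -
  let ?m = "nat \<bar>z\<bar>"
  let ?i = "if z < 0 then n else p"
  have i: "is_reg ?i" using assms by simp
  have w: "set (rev (bits ?m)) \<subseteq> {1, 2}" using set_bits by simp
  have lw: "length (rev (bits ?m)) \<le> b" using length_bits_le[OF assms(6)] by simp
  obtain l where l: "tp (T 0) l (encode_int z @ [4] @ encode_ints zs)"
    using assms(1) by (auto simp: rep_def encode_ints_def)
  have ti: "tp (T ?i) [] []" using assms(1,7,8) i by (auto simp: rep_def)
  have fin: "rep (T1(0 := act (read (T1 0), Move_Right) (T1 0))) (r(?i := ?m), zs, out)" (is "rep ?T2 _")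
    if d: "tp (T1 0) l' (4 # encode_ints zs)" "tp (T1 ?i) [] (bits ?m)"
      "\<forall>k. k \<noteq> 0 \<longrightarrow> k \<noteq> ?i \<longrightarrow> T1 k = T k" for T1 l'
    unfolding rep_def prod.case
  proof (intro conjI allI impI)
    show "\<exists>l. tp (?T2 0) l (encode_ints zs)" using tp_right[OF d(1)] by auto
    show "?T2 1 = (tape_contents out, int (length out))" "tp (?T2 2) [] []"
      using assms(1) d(3) is_regD[OF i] unfolding rep_def by auto
    fix k assume k: "is_reg k"
    show "tp (?T2 k) [] (bits ((r(?i := ?m)) k))"
    proof (cases "k = ?i")
      case True then show ?thesis using d(2) is_regD[OF k] by simp
    next
      case False
      then have "?T2 k = T k" using d(3) is_regD[OF k] by simp
      then show ?thesis using False assms(1) k by (simp add: rep_def)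
    qed
  qed
  let ?c = "if z < 0 then PSeq (right1 0) (getbits n) else getbits p"
  have "\<exists>T1 l'. halts ?c T (5 * b + 3) T1 \<and> tp (T1 0) l' (4 # encode_ints zs) \<and> tp (T1 ?i) [] (bits ?m)
     \<and> (\<forall>k. k \<noteq> 0 \<longrightarrow> k \<noteq> ?i \<longrightarrow> T1 k = T k) \<and> (read (T 0) = 3 \<longleftrightarrow> z < 0)"
  proof (cases "z < 0")
    case True
    have l0: "tp (T 0) l (3 # rev (bits ?m) @ 4 # encode_ints zs)" using l True by (simp add: encode_int_neg)
    have rd: "read (T 0) = 3" using read_tp[OF l0] by simp
    let ?T1 = "T(0 := act (read (T 0), Move_Right) (T 0))"
    have l1: "tp (?T1 0) (3 # l) (rev (bits ?m) @ 4 # encode_ints zs)"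
      using tp_right[OF l0, of 3] rd by simp
    have t1: "tp (?T1 n) [] []" using ti True is_regD[OF assms(3)] by simp
    obtain T2 l' where T2: "halts (getbits n) ?T1 (5 * length (rev (bits ?m)) + 1) T2"
       "tp (T2 0) l' (4 # encode_ints zs)" "tp (T2 n) [] (rev (rev (bits ?m)) @ [])"
       "\<forall>k. k \<noteq> 0 \<longrightarrow> k \<noteq> n \<longrightarrow> T2 k = ?T1 k"
      using getbits_correct[OF assms(3), of ?T1 "3 # l" _ "encode_ints zs" "[]"] l1 t1 w by blast
    have "halts (PSeq (right1 0) (getbits n)) T (1 + (5 * length (rev (bits ?m)) + 1) + 1) T2"
      by (intro halts_PSeq[OF right1_correct] T2(1)) simp
    then have "halts (PSeq (right1 0) (getbits n)) T (5 * b + 3) T2"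
      by (rule halts_mono) (use lw in simp)
    then show ?thesis using T2 True rd by (intro exI[of _ T2] exI[of _ l']) auto
  next
    case False
    then have z: "z > 0" using assms(5) by simp
    have l0: "tp (T 0) l (rev (bits ?m) @ 4 # encode_ints zs)" using l z by (simp add: encode_int_pos)
    have "rev (bits ?m) \<noteq> []" using z by (simp add: bits_pos)
    then obtain a as where a: "rev (bits ?m) = a # as" by (cases "rev (bits ?m)") auto
    have rd: "read (T 0) \<noteq> 3" using read_tp[OF l0] w unfolding a by auto
    have t1: "tp (T p) [] []" using ti False by simp
    obtain T2 l' where T2: "halts (getbits p) T (5 * length (rev (bits ?m)) + 1) T2"
       "tp (T2 0) l' (4 # encode_ints zs)" "tp (T2 p) [] (rev (rev (bits ?m)) @ [])"
       "\<forall>k. k \<noteq> 0 \<longrightarrow> k \<noteq> p \<longrightarrow> T2 k = T k"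
      using getbits_correct[OF assms(2) l0 t1 w] by blast
    have "halts (getbits p) T (5 * b + 3) T2"
      by (rule halts_mono[OF T2(1)]) (use lw in simp)
    then show ?thesis using T2 False rd by (intro exI[of _ T2] exI[of _ l']) auto
  qed
  then obtain T1 l' where T1: "halts ?c T (5 * b + 3) T1" "tp (T1 0) l' (4 # encode_ints zs)"
    "tp (T1 ?i) [] (bits ?m)" "\<forall>k. k \<noteq> 0 \<longrightarrow> k \<noteq> ?i \<longrightarrow> T1 k = T k" "read (T 0) = 3 \<longleftrightarrow> z < 0"
    by blast
  have "halts (PIf (\<lambda>h. h 0 = 3) (PSeq (right1 0) (getbits n)) (getbits p)) T (Suc (5 * b + 3)) T1"
    by (rule halts_PIf) (use T1(1,5) in simp)
  from halts_PSeq[OF this right1_correct[OF io_tapes(1)]]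
  have "halts (compile (Get p n)) T (5 * b + 6) (T1(0 := act (read (T1 0), Move_Right) (T1 0)))"
    unfolding compile.simps by (rule halts_mono) simp
  then show ?thesis using fin[OF T1(2-4)] by blast
qed

lemma halts_PIf_sum:
  assumes "if P (heads T) then halts c T m T' else halts d T n T'"
  shows "halts (PIf P c d) T (Suc (m + n)) T'"
  by (rule halts_PIf) (use assms in \<open>auto intro: halts_mono\<close>)

theorem compile_correct:
  "\<lbrakk>okc c; rep T s; small b s; run b c s = Some s'\<rbrakk> \<Longrightarrow>
     \<exists>T'. halts (compile c) T (cost b c) T' \<and> rep T' s' \<and> small b s'"
proof (induction c arbitrary: T s s')
  case (Add i j)
  obtain r inp out where s: "s = (r, inp, out)" by (cases s)
  have "r i + r j < 2 ^ b" "s' = (r(i := r i + r j), inp, out)"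
    using Add.prems(4) by (auto simp: s split: if_splits)
  then show ?case using arith_rep[of T r inp out i j b True] Add.prems by (auto simp: s small_def)
next
  case (Sub i j)
  obtain r inp out where s: "s = (r, inp, out)" by (cases s)
  have s': "s' = (r(i := r i - r j), inp, out)" using Sub.prems(4) by (auto simp: s)
  have "r i < 2 ^ b" "r j < 2 ^ b" using Sub.prems(3) by (auto simp: s small_def)
  moreover from this have "r i - r j < 2 ^ b" by linarith
  ultimately show ?case
    using arith_rep[of T r inp out i j b False] Sub.prems s' by (auto simp: s small_def)
next
  case (Push c i)
  obtain r inp out where s: "s = (r, inp, out)" by (cases s)
  have v: "2 * r i + of_bool c < 2 ^ b" "s' = (r(i := 2 * r i + of_bool c), inp, out)"
    using Push.prems(4) by (auto simp: s split: if_splits)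
  have rep: "rep T (r, inp, out)" and i: "is_reg i" using Push.prems by (auto simp: s)
  have sm: "small b s'" using v Push.prems(3) by (auto simp: s small_def)
  have rd: "read (T i) = 0 \<longleftrightarrow> r i = 0" using rep_reg_read[OF rep i] by simp
  have iv: "i < ntapes" using i by (rule is_regD)
  show ?case
  proof (cases c)
    case True
    then obtain T' where "halts (compile (Push c i)) T 3 T'" "rep T' s'"
      using push_correct[OF rep i, of 1] v(2) by (auto simp: numeral_2_eq_2)
    moreover from this(1) have "halts (compile (Push c i)) T (cost b (Push c i)) T'"
      by (rule halts_mono) simp
    ultimately show ?thesis using sm by blast
  next
    case False
    have "\<exists>T'. halts (if heads T i \<noteq> 0 then PSeq (left1 i) (write1 i 1 Stay) else PSkip) T 3 T' \<and> rep T' s'"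
    proof (cases "r i = 0")
      case True
      then have "s' = s" using v(2) False s by auto
      then show ?thesis using True rd rep s iv halts_PSkip[of T] by (auto intro: halts_mono)
    next
      case F: False
      then show ?thesis using push_correct[OF rep i, of 0] v(2) False rd iv by auto
    qed
    then obtain T' where T': "halts (if heads T i \<noteq> 0 then PSeq (left1 i) (write1 i 1 Stay) else PSkip) T 3 T'" "rep T' s'"
      by blast
    have "halts (PIf (\<lambda>h. h i \<noteq> 0) (PSeq (left1 i) (write1 i 1 Stay)) PSkip) T (Suc 3) T'"
      by (rule halts_PIf) (rule T'(1))
    from halts_mono[OF this, of 4] have "halts (compile (Push c i)) T (cost b (Push c i)) T'"
      using False by simp
    then show ?thesis using T'(2) sm by blast
  qed
next
  case (Halve i)
  obtain r inp out where s: "s = (r, inp, out)" by (cases s)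
  have "r i div 2 < 2 ^ b" using Halve.prems(3) by (auto simp: s small_def intro: le_less_trans[OF div_le_dividend])
  then show ?case using halve_correct[of T r inp out i] Halve.prems by (auto simp: s small_def)
next
  case (Get p n)
  obtain r inp out where s: "s = (r, inp, out)" by (cases s)
  obtain z zs where inp: "inp = z # zs" using Get.prems(4) by (cases inp) (auto simp: s)
  have v: "z \<noteq> 0" "nat \<bar>z\<bar> < 2 ^ b" "r p = 0" "r n = 0" "s' = (r((if z < 0 then n else p) := nat \<bar>z\<bar>), zs, out)"
    using Get.prems(4) by (auto simp: s inp split: if_splits)
  have sm: "small b s'" using Get.prems(3) v by (auto simp: s small_def)
  show ?case
    using get_correct[of T r z zs out p n b] Get.prems v sm by (auto simp: s inp simp del: compile.simps)
next
  case (Emit x)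
  obtain r inp out where s: "s = (r, inp, out)" by (cases s)
  let ?T = "T(1 := act (x, Move_Right) (T 1))"
  have "halts (compile (Emit x)) T 1 ?T" using write1_correct[of 1] by simp
  moreover have "rep ?T s'"
    using Emit.prems out_act unfolding rep_def by (auto simp: s is_regD)
  ultimately show ?case using Emit.prems by (auto simp: s small_def)
next
  case (Put i)
  obtain r inp out where s: "s = (r, inp, out)" by (cases s)
  have v: "r i > 0" "s' = (r, inp, out @ rev (bits (r i)))"
    using Put.prems(4) by (auto simp: s split: if_splits)
  have i: "is_reg i" using Put.prems by simp
  have t: "tp (T i) [] (bits (r i))" "T 1 = (tape_contents out, int (length out))"
    using Put.prems i by (auto simp: rep_def s)
  have b: "0 \<notin> set (bits (r i))" using set_bits[of "r i"] by auto
  obtain T' where T': "halts (putbits i) T (6 * length (bits (r i)) + 7) T'" "tp (T' i) [] (bits (r i))"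
    "T' 1 = (tape_contents (out @ rev (bits (r i))), int (length (out @ rev (bits (r i)))))"
    "\<forall>k. k \<noteq> 1 \<longrightarrow> k \<noteq> i \<longrightarrow> T' k = T k"
    using putbits_correct[OF i t(1) b t(2)] by blast
  have "length (bits (r i)) \<le> b" using Put.prems(3) by (intro length_bits_le) (auto simp: small_def s)
  then have "halts (compile (Put i)) T (cost b (Put i)) T'" using T'(1) by (auto intro: halts_mono)
  moreover have "rep T' s'"
    unfolding v(2) rep_def prod.case
  proof (intro conjI allI impI)
    show "\<exists>l. tp (T' 0) l (encode_ints inp)" "tp (T' 2) [] []"
      using Put.prems(2) T'(4) is_regD[OF i] by (auto simp: s rep_def)
    show "T' 1 = (tape_contents (out @ rev (bits (r i))), int (length (out @ rev (bits (r i)))))"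
      by (rule T'(3))
    fix k assume k: "is_reg k"
    show "tp (T' k) [] (bits (r k))"
      using T'(2,4) Put.prems(2) k is_regD[OF k] by (cases "k = i") (auto simp: s rep_def)
  qed
  ultimately show ?case using Put.prems(3) v(2) by (auto simp: s small_def)
next
  case Nop
  then show ?case using halts_PSkip by auto
next
  case (Seq c d)
  obtain s1 where s1: "run b c s = Some s1" "run b d s1 = Some s'"
    using Seq.prems(4) by (auto simp: bind_eq_Some_conv)
  obtain T1 where T1: "halts (compile c) T (cost b c) T1" "rep T1 s1" "small b s1"
    using Seq.IH(1)[OF _ Seq.prems(2,3) s1(1)] Seq.prems(1) by auto
  obtain T2 where T2: "halts (compile d) T1 (cost b d) T2" "rep T2 s'" "small b s'"
    using Seq.IH(2)[OF _ T1(2,3) s1(2)] Seq.prems(1) by auto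
  show ?case using halts_PSeq[OF T1(1) T2(1)] T2(2,3) by auto
next
  case (IfPos i c d)
  obtain T' where "if fst s i = 0 then halts (compile d) T (cost b d) T' else halts (compile c) T (cost b c) T'"
    "rep T' s'" "small b s'"
    using IfPos.IH[of T s s'] IfPos.prems by (cases "fst s i = 0") auto
  moreover have "heads T i = 0 \<longleftrightarrow> fst s i = 0"
    using IfPos.prems rep_reg_read[OF IfPos.prems(2)] is_regD[of i] by auto
  ultimately show ?case using halts_PIf_sum[of "\<lambda>h. h i \<noteq> 0" T "compile c" "cost b c" T' "compile d"]
    by (auto split: if_splits)
next
  case (IfOdd i c d)
  obtain T' where "if odd (fst s i) then halts (compile c) T (cost b c) T' else halts (compile d) T (cost b d) T'"
    "rep T' s'" "small b s'"
    using IfOdd.IH[of T s s'] IfOdd.prems by (cases "odd (fst s i)") auto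
  moreover have "heads T i = 2 \<longleftrightarrow> odd (fst s i)"
    using IfOdd.prems rep_reg_read[OF IfOdd.prems(2)] is_regD[of i] by (auto simp: odd_iff_mod_2_eq_one)
  ultimately show ?case using halts_PIf_sum[of "\<lambda>h. h i = 2" T "compile c" "cost b c" T' "compile d"]
    by (auto split: if_splits)
next
  case (Loop k c)
  have k: "is_reg k" and okc: "okc c" using Loop.prems by auto
  note kd = is_regD[OF k]
  let ?W = "PWhile (\<lambda>h. h k \<noteq> 0) (PSeq (compile c) (write1 k 0 Move_Right))"
  have loop: "\<exists>T'. halts ?W T (m * (cost b c + 4) + 1) T' \<and> rep T' s' \<and> small b s'"
    if "rep T s" "small b s" "iter (run b c) k m s = Some s'" "length (bits (fst s k)) = m" for m T s
    using that
  proof (induction m arbitrary: T s)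
    case 0
    then have "fst s k = 0" using bits_pos[of "fst s k"] by (cases "fst s k = 0") auto
    then have "read (T k) = 0" using rep_reg_read[OF 0(1) k] by simp
    then have "halts ?W T 1 T" using kd by (intro halts_PWhile_False) simp
    then show ?case using 0 by auto
  next
    case (Suc m)
    have pos: "fst s k > 0" using Suc.prems(4) by (cases "fst s k = 0") auto
    obtain r inp out where s1: "run b c s = Some (r, inp, out)" "r k = fst s k"
      "iter (run b c) k m (r(k := r k div 2), inp, out) = Some s'"
      using Suc.prems(3) by (auto split: option.splits prod.splits if_splits)
    obtain T1 where T1: "halts (compile c) T (cost b c) T1" "rep T1 (r, inp, out)" "small b (r, inp, out)"
      using Loop.IH[OF okc Suc.prems(1,2) s1(1)] by blast
    obtain T2 where T2: "halts (write1 k 0 Move_Right) T1 1 T2" "rep T2 (r(k := r k div 2), inp, out)"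
      using halve_correct[OF T1(2) k] by blast
    have "r k div 2 < 2 ^ b"
      using T1(3) by (auto simp: small_def intro: le_less_trans[OF div_le_dividend])
    then have sm: "small b (r(k := r k div 2), inp, out)" using T1(3) by (auto simp: small_def)
    have len: "length (bits (fst (r(k := r k div 2), inp, out) k)) = m"
      using Suc.prems(4) pos s1(2) by (simp add: bits_pos)
    obtain T3 where T3: "halts ?W T2 (m * (cost b c + 4) + 1) T3" "rep T3 s'" "small b s'"
      using Suc.IH[OF T2(2) sm s1(3) len] by blast
    have "read (T k) \<noteq> 0" using rep_reg_read[OF Suc.prems(1) k] pos by simp
    then have "halts ?W T (cost b c + 1 + 1 + (m * (cost b c + 4) + 1) + 2) T3"
      using kd by (intro halts_PWhile_True[OF _ halts_PSeq[OF T1(1) T2(1)] T3(1)]) simp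
    then have "halts ?W T (Suc m * (cost b c + 4) + 1) T3" by (rule halts_mono) simp
    then show ?case using T3 by blast
  qed
  let ?m = "length (bits (fst s k))"
  obtain T' where T': "halts ?W T (?m * (cost b c + 4) + 1) T'" "rep T' s'" "small b s'"
    using loop[OF Loop.prems(2,3), of ?m] Loop.prems(4) by auto
  have "?m \<le> b" using Loop.prems(3) by (intro length_bits_le) (auto simp: small_def)
  then have "?m * (cost b c + 4) + 1 \<le> b * (cost b c + 4) + 1" by simp
  from halts_mono[OF T'(1) this] have "halts ?W T (cost b (Loop k c)) T'" by simp
  then show ?case using T' by auto
qed

text \<open>
  The degree in \<open>b\<close> of the running time. Elementary commands count 1, because an addition is
  itself a loop over the bits.
\<close>

primrec depth :: "com \<Rightarrow> nat" where
  "depth (Add i j) = 1"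
| "depth (Sub i j) = 1"
| "depth (Push c i) = 1"
| "depth (Halve i) = 1"
| "depth (Get p n) = 1"
| "depth (Emit x) = 1"
| "depth (Put i) = 1"
| "depth Nop = 1"
| "depth (c ;; d) = max (depth c) (depth d)"
| "depth (IfPos i c d) = max (depth c) (depth d)"
| "depth (IfOdd i c d) = max (depth c) (depth d)"
| "depth (Loop k c) = Suc (depth c)"

lemma polynomial_bound_add:
  fixes f g :: "nat \<Rightarrow> nat"
  assumes "\<exists>C. \<forall>b. f b \<le> C * (b + 1) ^ m" "\<exists>C. \<forall>b. g b \<le> C * (b + 1) ^ n"
  shows "\<exists>C. \<forall>b. f b + g b + 1 \<le> C * (b + 1) ^ max m n"
proof -
  obtain C D where C: "\<And>b. f b \<le> C * (b + 1) ^ m" and D: "\<And>b. g b \<le> D * (b + 1) ^ n"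
    using assms by auto
  have "f b + g b + 1 \<le> (C + D + 1) * (b + 1) ^ max m n" for b
  proof -
    have "f b \<le> C * (b + 1) ^ max m n"
      by (rule order.trans[OF C mult_left_mono[OF power_increasing]]) auto
    moreover have "g b \<le> D * (b + 1) ^ max m n"
      by (rule order.trans[OF D mult_left_mono[OF power_increasing]]) auto
    moreover have "1 \<le> (b + 1) ^ max m n" by simp
    ultimately show ?thesis unfolding distrib_right by linarith
  qed
  then show ?thesis by blast
qed

lemma cost_bound: "\<exists>C. \<forall>b. cost b c \<le> C * (b + 1) ^ depth c"
proof (induction c)
  case (Seq c d)
  from polynomial_bound_add[OF this] show ?case by simp
next
  case (IfPos i c d)
  from polynomial_bound_add[OF this] show ?case by simp
next
  case (IfOdd i c d)
  from polynomial_bound_add[OF this] show ?case by simp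
next
  case (Loop k c)
  then obtain C where C: "\<And>b. cost b c \<le> C * (b + 1) ^ depth c" by blast
  have "cost b (Loop k c) \<le> (C + 5) * (b + 1) ^ depth (Loop k c)" for b
  proof -
    have p: "1 \<le> (b + 1) ^ depth c" by simp
    have "cost b (Loop k c) \<le> b * (C * (b + 1) ^ depth c + 4 * (b + 1) ^ depth c) + (b + 1) ^ depth c"
      using C[of b] p by (simp add: add_mono del: One_nat_def)
    also have "\<dots> \<le> (b + 1) * ((C + 5) * (b + 1) ^ depth c)" by (simp add: algebra_simps)
    finally show ?thesis by (simp add: algebra_simps)
  qed
  then show ?case by blast
qed (rule exI[of _ 18], simp)+

text \<open>
  What the rest needs to know about machines: a program whose execution succeeds with
  numbers below \<open>2 ^ b\<close> is performed by a machine within \<open>cost b c\<close> steps. The machine does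
  not depend on \<open>b\<close>.
\<close>

theorem program_machine:
  assumes "okc c" "compile c \<noteq> PSkip"
  obtains M where "valid_tm M"
    and "\<And>b inp r' inp' out. run b c (\<lambda>_. 0, inp, []) = Some (r', inp', out) \<Longrightarrow>
           \<exists>t\<le>cost b c. computes_within M (encode_ints inp) out t"
proof -
  obtain M where M: "valid_tm M"
    "\<And>w v t T'. \<lbrakk>halts (compile c) (\<lambda>i. if i = 0 then (tape_contents w, 0) else (tape_contents [], 0)) t T';
          fst (T' 1) = tape_contents v\<rbrakk> \<Longrightarrow> \<exists>t'\<le>t. computes_within M w v t'"
    using prog_machine[OF okp_compile[OF assms(1)] assms(2)] by blast
  have "\<exists>t\<le>cost b c. computes_within M (encode_ints inp) out t"
    if run: "run b c (\<lambda>_. 0, inp, []) = Some (r', inp', out)" for b inp r' inp' out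
  proof -
    let ?T = "\<lambda>i::nat. if i = 0 then (tape_contents (encode_ints inp), 0) else (tape_contents [], 0::int)"
    have "tp (tape_contents [], 0) [] []"
      by (simp add: tp_def tape_contents_def)
    moreover have "tp (tape_contents (encode_ints inp), 0) [] (encode_ints inp)"
      by (simp add: tp_def tape_contents_def nth0_def)
    ultimately have "rep ?T (\<lambda>_. 0, inp, [])"
      unfolding rep_def by (auto simp: is_reg_def)
    moreover have "small b (\<lambda>_. 0, inp, [])" by (simp add: small_def)
    ultimately obtain T' where T': "halts (compile c) ?T (cost b c) T'" "rep T' (r', inp', out)"
      using compile_correct[OF assms(1) _ _ run] by blast
    have "fst (T' 1) = tape_contents out" using T'(2) by (simp add: rep_def)
    from M(2)[OF T'(1) this] show ?thesis .
  qed
  then show thesis using that M(1) by blast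
qed

section \<open>Fixed-point arithmetic as register programs\<close>

lemma iter_invariant:
  assumes "\<And>j s. j < m \<Longrightarrow> I j s \<Longrightarrow>
      \<exists>r inp out. f s = Some (r, inp, out) \<and> r k = fst s k \<and> I (Suc j) (r(k := r k div 2), inp, out)"
    and "I 0 s"
  shows "\<exists>s'. iter f k m s = Some s' \<and> I m s'"
  using assms
proof (induction m arbitrary: I s)
  case (Suc m)
  obtain r inp out where 1: "f s = Some (r, inp, out)" "r k = fst s k" "I 1 (r(k := r k div 2), inp, out)"
    using Suc.prems(1)[of 0 s] Suc.prems(2) unfolding One_nat_def by blast
  have "\<exists>s'. iter f k m (r(k := r k div 2), inp, out) = Some s' \<and> I (Suc m) s'"
    by (rule Suc.IH[of "\<lambda>j. I (Suc j)"]) (use Suc.prems(1) 1(3) in auto)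
  then show ?case using 1 by simp
qed simp

text \<open>
  Integers are pairs of registers, of which one is zero: \<open>rP1\<close> and \<open>rN1\<close> hold \<open>c\<^sub>1\<close> if it is
  positive and \<open>- c\<^sub>1\<close> otherwise, and so on. The registers up to \<open>rTH\<close> and \<open>rONE\<close> contain
  the problem and constants: the exponents, \<open>H\<close>, zero, \<open>2 ^ p - 1\<close> (whose bits count \<open>p\<close>
  rounds of a loop), \<open>2 ^ p\<close>, the threshold for the critical value, and 1. The registers 16
  to 28 are used by evaluation and bisection, and 29 to 34 by the case distinctions around
  them.
\<close>

abbreviation (input) "rP1 \<equiv> (3::nat)"
abbreviation (input) "rN1 \<equiv> (4::nat)"
abbreviation (input) "rP2 \<equiv> (5::nat)"
abbreviation (input) "rN2 \<equiv> (6::nat)"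
abbreviation (input) "rP3 \<equiv> (7::nat)"
abbreviation (input) "rN3 \<equiv> (8::nat)"
abbreviation (input) "rA \<equiv> (9::nat)"
abbreviation (input) "rD \<equiv> (10::nat)"
abbreviation (input) "rH \<equiv> (11::nat)"
abbreviation (input) "rZ \<equiv> (12::nat)"
abbreviation (input) "rE \<equiv> (13::nat)"
abbreviation (input) "rDD \<equiv> (14::nat)"
abbreviation (input) "rTH \<equiv> (15::nat)"
abbreviation (input) "rACC \<equiv> (16::nat)"
abbreviation (input) "rCNT \<equiv> (17::nat)"
abbreviation (input) "rV \<equiv> (18::nat)"
abbreviation (input) "rBASE \<equiv> (19::nat)"
abbreviation (input) "rX \<equiv> (20::nat)"
abbreviation (input) "rRP \<equiv> (21::nat)"
abbreviation (input) "rRN \<equiv> (22::nat)"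
abbreviation (input) "rPOS \<equiv> (23::nat)"
abbreviation (input) "rNEG \<equiv> (24::nat)"
abbreviation (input) "rLO \<equiv> (25::nat)"
abbreviation (input) "rHI \<equiv> (26::nat)"
abbreviation (input) "rY \<equiv> (27::nat)"
abbreviation (input) "rCNT2 \<equiv> (28::nat)"
abbreviation (input) "rYS \<equiv> (29::nat)"
abbreviation (input) "rAA \<equiv> (30::nat)"
abbreviation (input) "rDB \<equiv> (31::nat)"
abbreviation (input) "rDM \<equiv> (32::nat)"
abbreviation (input) "rT \<equiv> (33::nat)"
abbreviation (input) "rF1 \<equiv> (34::nat)"
abbreviation (input) "rONE \<equiv> (35::nat)"

definition clr :: "nat \<Rightarrow> com" where
  "clr i = Loop i Nop"

definition mov :: "nat \<Rightarrow> nat \<Rightarrow> com" where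
  "mov i j = clr i ;; Add i j"

lemma run_clr [simp]: "run b (clr i) (r, inp, out) = Some (r(i := 0), inp, out)"
proof -
  have "\<exists>s'. iter (run b Nop) i (length (bits (r i))) (r, inp, out) = Some s' \<and>
     s' = (r(i := r i div 2 ^ length (bits (r i))), inp, out)"
    by (rule iter_invariant[where I = "\<lambda>j s. s = (r(i := r i div 2 ^ j), inp, out)"])
      (auto simp: div_mult2_eq[symmetric] mult.commute)
  then show ?thesis using less_length_bits[of "r i"] by (simp add: clr_def)
qed

lemma run_mov [simp]:
  "i \<noteq> j \<Longrightarrow> r j < 2 ^ b \<Longrightarrow> run b (mov i j) (r, inp, out) = Some (r(i := r j), inp, out)"
  by (simp add: mov_def)

lemma bits_ones: "length (bits (2 ^ p - 1)) = p"
proof (induction p)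
  case (Suc p)
  have "(2 ^ Suc p - 1) div 2 = (2 ^ p - 1 :: nat)" by auto
  moreover have "2 ^ Suc p - 1 > (0::nat)" using one_less_power[of "2::nat" "Suc p"] by simp
  ultimately show ?case using Suc by (subst bits_pos) simp_all
qed simp

lemma ones_div: "(2 ^ p - Suc 0) div 2 ^ p = 0"
  by simp

text \<open>
  Multiplication of fixed-point numbers with \<open>p\<close> binary digits after the point, rounded
  down.
\<close>

definition fmul :: "nat \<Rightarrow> nat \<Rightarrow> nat \<Rightarrow> nat" where
  "fmul p u v = u * v div 2 ^ p"

definition fmulc :: "nat \<Rightarrow> nat \<Rightarrow> com" where
  "fmulc u v = clr rACC ;; mov rV v ;; mov rCNT rE ;;
     Loop rCNT (IfOdd rV (Add rACC u) Nop ;; Halve rACC ;; Halve rV)"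

lemma fmul_le: "v \<le> 2 ^ p \<Longrightarrow> fmul p u v \<le> u"
  using div_le_mono[of "u * v" "u * 2 ^ p" "2 ^ p"] by (simp add: fmul_def)

lemma fmul_less: "u < 2 ^ p \<Longrightarrow> v < 2 ^ p \<Longrightarrow> fmul p u v < 2 ^ p"
  using fmul_le[of v p u] by simp

text \<open>
  The invariant of the multiplication loop. Shifting the accumulator after each addition
  loses nothing: rounding down at each step gives the product of \<open>U\<close> with the bits seen so
  far, rounded down once.
\<close>

lemma fmul_step:
  "(U * (v mod 2 ^ j) div 2 ^ j + (if odd (v div 2 ^ j) then U else 0)) div 2
     = U * (v mod 2 ^ Suc j) div (2 ^ Suc j :: nat)"
proof -
  have "v mod 2 ^ Suc j = 2 ^ j * (v div 2 ^ j mod 2) + v mod 2 ^ j"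
    by (metis mod_mult2_eq power_Suc2)
  then have "U * (v mod 2 ^ Suc j) = U * (v mod 2 ^ j) + 2 ^ j * (U * (v div 2 ^ j mod 2))"
    by (simp add: algebra_simps)
  then have "U * (v mod 2 ^ Suc j) div 2 ^ j = U * (v mod 2 ^ j) div 2 ^ j + U * (v div 2 ^ j mod 2)"
    by simp
  moreover have "U * (v div 2 ^ j mod 2) = (if odd (v div 2 ^ j) then U else 0)"
    by (simp add: odd_iff_mod_2_eq_one)
  ultimately have "U * (v mod 2 ^ Suc j) div 2 ^ j div 2
     = (U * (v mod 2 ^ j) div 2 ^ j + (if odd (v div 2 ^ j) then U else 0)) div 2" by simp
  then show ?thesis by (simp add: div_mult2_eq[symmetric] mult.commute)
qed

lemma run_fmulc:
  assumes "u \<notin> {rACC, rV, rCNT}" "v \<notin> {rACC, rV, rCNT}" "r rE = 2 ^ p - 1" "r v < 2 ^ p"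
    "2 * r u < 2 ^ b" "p \<le> b"
  shows "run b (fmulc u v) (r, inp, out) = Some (r(rACC := fmul p (r u) (r v), rV := 0, rCNT := 0), inp, out)"
proof -
  let ?I = "\<lambda>j s. s = (r(rACC := r u * (r v mod 2 ^ j) div 2 ^ j, rV := r v div 2 ^ j,
     rCNT := (2 ^ p - 1) div 2 ^ j), inp, out)"
  have pb: "(2::nat) ^ p \<le> 2 ^ b" using assms(6) by simp
  have vb: "r v < 2 ^ b" using assms(4) pb by linarith
  have eb: "r rE < 2 ^ b" using assms(3) pb by (metis diff_less less_le_trans pos2 zero_less_one zero_less_power)
  have "\<exists>s'. iter (run b (IfOdd rV (Add rACC u) Nop ;; Halve rACC ;; Halve rV)) rCNT p
      (r(rACC := 0, rV := r v, rCNT := 2 ^ p - 1), inp, out) = Some s' \<and> ?I p s'"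
  proof (rule iter_invariant[where I = ?I])
    fix j s assume s: "?I j s"
    have "r u * (r v mod 2 ^ j) \<le> r u * 2 ^ j" by simp
    then have "r u * (r v mod 2 ^ j) div 2 ^ j \<le> r u"
      by (metis div_le_mono nonzero_mult_div_cancel_right power_not_zero zero_neq_numeral)
    then have le: "r u * (r v mod 2 ^ j) div 2 ^ j + r u < 2 ^ b" using assms(5) by simp
    let ?r = "r(rACC := r u * (r v mod 2 ^ Suc j) div 2 ^ Suc j, rV := r v div 2 ^ Suc j,
      rCNT := (2 ^ p - 1) div 2 ^ j)"
    have "run b (IfOdd rV (Add rACC u) Nop ;; Halve rACC ;; Halve rV) s = Some (?r, inp, out)"
      using assms(1) le s fmul_step[of "r u" "r v" j]
      by (cases "odd (r v div 2 ^ j)") (simp_all add: div_mult2_eq[symmetric] mult.commute fun_eq_iff)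
    moreover have "?I (Suc j) (?r(rCNT := ?r rCNT div 2), inp, out)"
      by (simp add: div_mult2_eq[symmetric] mult.commute fun_eq_iff)
    moreover have "?r rCNT = fst s rCNT" using s by simp
    ultimately show "\<exists>ra inp' out'. run b (IfOdd rV (Add rACC u) Nop ;; Halve rACC ;; Halve rV) s = Some (ra, inp', out') \<and>
            ra rCNT = fst s rCNT \<and> ?I (Suc j) (ra(rCNT := ra rCNT div 2), inp', out')" by blast
  qed simp
  moreover have "2 ^ p - Suc 0 < 2 ^ b" using eb assms(3) by simp
  ultimately show ?thesis
    using assms vb bits_ones[of p] by (auto simp: fmulc_def fmul_def fun_eq_iff)
qed

definition shiftc :: "nat \<Rightarrow> com" where
  "shiftc i = mov rCNT rE ;; Loop rCNT (Push False i)"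

lemma run_shiftc:
  assumes "i \<noteq> rCNT" "i \<noteq> rE" "r rE = 2 ^ p - 1" "r i * 2 ^ p < 2 ^ b" "p \<le> b"
  shows "run b (shiftc i) (r, inp, out) = Some (r(i := r i * 2 ^ p, rCNT := 0), inp, out)"
proof -
  let ?I = "\<lambda>j s. s = (r(i := r i * 2 ^ j, rCNT := (2 ^ p - 1) div 2 ^ j), inp, out)"
  have pb: "(2::nat) ^ p \<le> 2 ^ b" using assms(5) by simp
  have eb: "r rE < 2 ^ b" using assms(3) pb by (metis diff_less less_le_trans pos2 zero_less_one zero_less_power)
  have "\<exists>s'. iter (run b (Push False i)) rCNT p (r(rCNT := 2 ^ p - 1), inp, out) = Some s' \<and> ?I p s'"
  proof (rule iter_invariant[where I = ?I])
    fix j s assume j: "j < p" and s: "?I j s"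
    have "r i * 2 ^ Suc j \<le> r i * 2 ^ p" using j by (intro mult_left_mono power_increasing) auto
    moreover have "r i * 2 ^ Suc j = 2 * (r i * 2 ^ j)" by simp
    ultimately have "2 * (r i * 2 ^ j) < 2 ^ b" using assms(4) by linarith
    let ?r = "r(i := r i * 2 ^ Suc j, rCNT := (2 ^ p - 1) div 2 ^ j)"
    have "run b (Push False i) s = Some (?r, inp, out)"
      using assms(1) s \<open>2 * (r i * 2 ^ j) < 2 ^ b\<close> by (auto simp: mult_ac fun_eq_iff)
    moreover have "?I (Suc j) (?r(rCNT := ?r rCNT div 2), inp, out)"
      using assms(1) by (simp add: div_mult2_eq[symmetric] mult.commute fun_eq_iff)
    moreover have "?r rCNT = fst s rCNT" using s by simp
    ultimately show "\<exists>ra inp' out'. run b (Push False i) s = Some (ra, inp', out') \<and>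
            ra rCNT = fst s rCNT \<and> ?I (Suc j) (ra(rCNT := ra rCNT div 2), inp', out')" by blast
  qed simp
  then have "iter (run b (Push False i)) rCNT p (r(rCNT := 2 ^ p - 1), inp, out)
      = Some (r(i := r i * 2 ^ p, rCNT := 0), inp, out)" using ones_div[of p] by (simp del: run.simps)
  then show ?thesis
    using assms(1-3) eb bits_ones[of p] by (simp add: shiftc_def del: run.simps(3))
qed

fun pw :: "nat \<Rightarrow> nat \<Rightarrow> nat \<Rightarrow> nat \<Rightarrow> nat" where
  "pw p x base t = (if x = 0 then t else
     pw p (x div 2) (fmul p base base) (if odd x then fmul p t base else t))"

declare pw.simps [simp del]

type_synonym term_regs = "nat \<times> nat \<times> nat"

text \<open>
  A term of the trinomial is given by the two registers of its coefficient and the register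
  of its exponent. Positive and negative parts are accumulated separately, so that no signed
  arithmetic is needed.
\<close>

fun pwc :: "term_regs \<Rightarrow> com" where
  "pwc (P, N, e) = mov rX e ;; mov rBASE rY ;; mov rRP P ;; shiftc rRP ;; mov rRN N ;; shiftc rRN ;;
     Loop rX (IfOdd rX (fmulc rRP rBASE ;; mov rRP rACC ;; fmulc rRN rBASE ;; mov rRN rACC) Nop ;;
              fmulc rBASE rBASE ;; mov rBASE rACC) ;;
     Add rPOS rRP ;; Add rNEG rRN"

lemma pw_le: "base < 2 ^ p \<Longrightarrow> pw p x base t \<le> t"
proof (induction p x base t rule: pw.induct)
  case (1 p x base t)
  show ?case
  proof (cases "x = 0")
    case False
    then have "pw p x base t \<le> (if odd x then fmul p t base else t)"
      using 1 fmul_less[OF 1(2) 1(2)] by (subst pw.simps) simp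
    also have "\<dots> \<le> t" using fmul_le[of base p t] 1(2) by simp
    finally show ?thesis .
  qed (simp add: pw.simps)
qed

lemma pw_loop:
  assumes "p + 1 < b"
  shows "\<lbrakk>r rE = 2 ^ p - 1; r rBASE < 2 ^ p; 2 * r rRP < 2 ^ b; 2 * r rRN < 2 ^ b\<rbrakk> \<Longrightarrow>
   \<exists>r'. run b (Loop rX (IfOdd rX (fmulc rRP rBASE ;; mov rRP rACC ;; fmulc rRN rBASE ;; mov rRN rACC) Nop ;;
              fmulc rBASE rBASE ;; mov rBASE rACC)) (r, inp, out) = Some (r', inp, out) \<and>
     r' rRP = pw p (r rX) (r rBASE) (r rRP) \<and> r' rRN = pw p (r rX) (r rBASE) (r rRN) \<and>
     (\<forall>i. i \<notin> {rACC, rCNT, rV, rBASE, rX, rRP, rRN} \<longrightarrow> r' i = r i)"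
proof (induction "length (bits (r rX))" arbitrary: r)
  case 0
  then have "r rX = 0" using bits_pos by (cases "r rX = 0") auto
  then show ?case by (simp add: pw.simps)
next
  case (Suc m)
  let ?B = "IfOdd rX (fmulc rRP rBASE ;; mov rRP rACC ;; fmulc rRN rBASE ;; mov rRN rACC) Nop ;;
              fmulc rBASE rBASE ;; mov rBASE rACC"
  have x: "r rX > 0" using Suc.hyps(2) by (cases "r rX = 0") auto
  have m: "length (bits (r rX div 2)) = m" using Suc.hyps(2) x by (simp add: bits_pos)
  have pb: "2 * 2 ^ p < (2::nat) ^ b"
    using power_strict_increasing[OF assms, of "2::nat"] by simp
  have f: "fmul p (r rBASE) (r rBASE) < 2 ^ p" "fmul p (r rRP) (r rBASE) \<le> r rRP"
    "fmul p (r rRN) (r rBASE) \<le> r rRN"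
    using fmul_less[OF Suc.prems(2) Suc.prems(2)] fmul_le Suc.prems(2) by simp_all
  let ?t = "\<lambda>v. if odd (r rX) then fmul p v (r rBASE) else v"
  have "\<exists>r1. run b ?B (r, inp, out) = Some (r1, inp, out) \<and> r1 rX = r rX \<and>
     r1 rBASE = fmul p (r rBASE) (r rBASE) \<and> r1 rRP = ?t (r rRP) \<and> r1 rRN = ?t (r rRN) \<and>
     (\<forall>i. i \<notin> {rACC, rCNT, rV, rBASE, rRP, rRN} \<longrightarrow> r1 i = r i)"
    using Suc.prems pb f assms
    by (cases "odd (r rX)") (simp_all add: run_fmulc[where p = p])
  then obtain r1 where r1: "run b ?B (r, inp, out) = Some (r1, inp, out)" "r1 rX = r rX"
     "r1 rBASE = fmul p (r rBASE) (r rBASE)" "r1 rRP = ?t (r rRP)" "r1 rRN = ?t (r rRN)"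
     "\<And>i. i \<notin> {rACC, rCNT, rV, rBASE, rRP, rRN} \<Longrightarrow> r1 i = r i" by blast
  let ?r = "r1(rX := r1 rX div 2)"
  have t: "?t v \<le> v" for v using fmul_le[of "r rBASE" p v] Suc.prems(2) by simp
  have "2 * ?t (r rRP) < 2 ^ b" "2 * ?t (r rRN) < 2 ^ b"
    using t[of "r rRP"] t[of "r rRN"] Suc.prems(3,4) by linarith+
  then obtain r' where r': "run b (Loop rX ?B) (?r, inp, out) = Some (r', inp, out)"
     "r' rRP = pw p (?r rX) (?r rBASE) (?r rRP)" "r' rRN = pw p (?r rX) (?r rBASE) (?r rRN)"
     "\<And>i. i \<notin> {rACC, rCNT, rV, rBASE, rX, rRP, rRN} \<Longrightarrow> r' i = ?r i"
    using Suc.hyps(1)[of ?r] m r1 f Suc.prems(1) by auto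
  have "run b (Loop rX ?B) (r, inp, out) = run b (Loop rX ?B) (?r, inp, out)"
    using Suc.hyps(2)[symmetric] r1(1,2) m by (simp del: run.simps(1-11))
  moreover have "pw p (r rX) (r rBASE) v = pw p (r rX div 2) (fmul p (r rBASE) (r rBASE)) (?t v)" for v
    using x by (subst pw.simps) simp
  ultimately show ?case using r' r1 by (intro exI[of _ r']) auto
qed

lemma run_pwc:
  assumes "p + 1 < b" "r rE = 2 ^ p - 1" "r rY < 2 ^ p" "{P, N, e} \<inter> {16..24} = {}"
    "2 * (r P * 2 ^ p) < 2 ^ b" "2 * (r N * 2 ^ p) < 2 ^ b" "r e < 2 ^ b"
    "r rPOS + r P * 2 ^ p < 2 ^ b" "r rNEG + r N * 2 ^ p < 2 ^ b"
  shows "\<exists>r'. run b (pwc (P, N, e)) (r, inp, out) = Some (r', inp, out) \<and>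
    r' rPOS = r rPOS + pw p (r e) (r rY) (r P * 2 ^ p) \<and>
    r' rNEG = r rNEG + pw p (r e) (r rY) (r N * 2 ^ p) \<and> (\<forall>i. i \<notin> {16..24} \<longrightarrow> r' i = r i)"
proof -
  have ne: "P \<notin> {16..24}" "N \<notin> {16..24}" "e \<notin> {16..24}" using assms(4) by auto
  then have ne': "P \<noteq> rX" "P \<noteq> rBASE" "N \<noteq> rX" "N \<noteq> rBASE" "N \<noteq> rRP" "N \<noteq> rCNT" "e \<noteq> rX" "P \<noteq> rRP"
     "N \<noteq> rRN" by auto
  have pb: "(2::nat) ^ p < 2 ^ b" using assms(1) by simp
  have bounds: "r rY < 2 ^ b" "r P < 2 ^ b" "r N < 2 ^ b" "r P * 2 ^ p < 2 ^ b" "r N * 2 ^ p < 2 ^ b"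
  proof -
    have *: "x \<le> x * 2 ^ p" for x :: nat by simp
    show "r rY < 2 ^ b" using assms(3) pb by linarith
    show "r P < 2 ^ b" "r N < 2 ^ b" "r P * 2 ^ p < 2 ^ b" "r N * 2 ^ p < 2 ^ b"
      using assms(5,6) *[of "r P"] *[of "r N"] by linarith+
  qed
  let ?r = "r(rX := r e, rBASE := r rY, rRP := r P * 2 ^ p, rRN := r N * 2 ^ p, rCNT := 0)"
  let ?L = "Loop rX (IfOdd rX (fmulc rRP rBASE ;; mov rRP rACC ;; fmulc rRN rBASE ;; mov rRN rACC) Nop ;;
              fmulc rBASE rBASE ;; mov rBASE rACC)"
  have init: "run b (pwc (P, N, e)) (r, inp, out) =
      Option.bind (run b ?L (?r, inp, out)) (run b (Add rPOS rRP ;; Add rNEG rRN))"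
    using ne' bounds assms(1-3,7)
    by (simp add: run_shiftc[where p = p] fun_upd_twist del: run.simps(10-12)) 
  obtain r' where r': "run b ?L (?r, inp, out) = Some (r', inp, out)"
     "r' rRP = pw p (r e) (r rY) (r P * 2 ^ p)" "r' rRN = pw p (r e) (r rY) (r N * 2 ^ p)"
     "\<And>i. i \<notin> {rACC, rCNT, rV, rBASE, rX, rRP, rRN} \<Longrightarrow> r' i = ?r i"
    using pw_loop[OF assms(1), of ?r inp out] assms(2,3,5,6) by auto
  have le: "r' rRP \<le> r P * 2 ^ p" "r' rRN \<le> r N * 2 ^ p"
    unfolding r' using pw_le[OF assms(3)] by simp_all
  have old: "r' rPOS = r rPOS" "r' rNEG = r rNEG" using r'(4) by simp_all
  have "run b (pwc (P, N, e)) (r, inp, out) =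
      Some (r'(rPOS := r rPOS + r' rRP, rNEG := r rNEG + r' rRN), inp, out)"
    unfolding init r'(1) using le old assms(8,9) by simp
  then show ?thesis using r' by (intro exI[of _ "r'(rPOS := r rPOS + r' rRP, rNEG := r rNEG + r' rRN)"]) auto
qed

definition evalc :: "term_regs \<Rightarrow> term_regs \<Rightarrow> term_regs \<Rightarrow> com" where
  "evalc t1 t2 t3 = clr rPOS ;; clr rNEG ;; pwc t1 ;; pwc t2 ;; pwc t3"

definition evP :: "nat \<Rightarrow> (nat \<Rightarrow> nat) \<Rightarrow> nat \<Rightarrow> term_regs \<Rightarrow> nat" where
  "evP p r y t = (case t of (P, N, e) \<Rightarrow> pw p (r e) y (r P * 2 ^ p))"

definition evN :: "nat \<Rightarrow> (nat \<Rightarrow> nat) \<Rightarrow> nat \<Rightarrow> term_regs \<Rightarrow> nat" where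
  "evN p r y t = (case t of (P, N, e) \<Rightarrow> pw p (r e) y (r N * 2 ^ p))"

definition term_ok :: "nat \<Rightarrow> nat \<Rightarrow> (nat \<Rightarrow> nat) \<Rightarrow> term_regs \<Rightarrow> bool" where
  "term_ok p b r t = (case t of (P, N, e) \<Rightarrow> {P, N, e} \<inter> {16..28} = {} \<and>
     4 * (r P * 2 ^ p) < 2 ^ b \<and> 4 * (r N * 2 ^ p) < 2 ^ b \<and> r e < 2 ^ b)"

definition agree :: "(nat \<Rightarrow> nat) \<Rightarrow> (nat \<Rightarrow> nat) \<Rightarrow> bool" where
  "agree r' r \<longleftrightarrow> (\<forall>i. i \<notin> {16..28} \<longrightarrow> r' i = r i)"

lemma ev_cong:
  assumes "term_ok p b r t" "agree r' r"
  shows "evP p r' y t = evP p r y t" "evN p r' y t = evN p r y t" "term_ok p b r' t"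
  using assms by (cases t; force simp: evP_def evN_def term_ok_def agree_def)+

text \<open>
  A power of a fixed-point number below 1 does not increase the coefficient, so numbers stay
  small during the evaluation.
\<close>

lemma ev_less:
  assumes "term_ok p b r t" "y < 2 ^ p"
  shows "4 * evP p r y t < 2 ^ b" "4 * evN p r y t < 2 ^ b"
proof -
  obtain P N e where t: "t = (P, N, e)" by (cases t)
  show "4 * evP p r y t < 2 ^ b" "4 * evN p r y t < 2 ^ b"
    using assms(1) pw_le[OF assms(2), of "r e" "r P * 2 ^ p"] pw_le[OF assms(2), of "r e" "r N * 2 ^ p"]
    unfolding term_ok_def evP_def evN_def t prod.case by linarith+
qed

lemma run_pwc':
  assumes "p + 1 < b" "r rE = 2 ^ p - 1" "r rY < 2 ^ p" "term_ok p b r t"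
    "4 * r rPOS < 3 * 2 ^ b" "4 * r rNEG < 3 * 2 ^ b"
  shows "\<exists>r'. run b (pwc t) (r, inp, out) = Some (r', inp, out) \<and>
    r' rPOS = r rPOS + evP p r (r rY) t \<and> r' rNEG = r rNEG + evN p r (r rY) t \<and>
    (\<forall>i. i \<notin> {16..24} \<longrightarrow> r' i = r i)"
proof -
  obtain P N e where t: "t = (P, N, e)" by (cases t)
  have ok: "{P, N, e} \<inter> {16..28} = {}" "4 * (r P * 2 ^ p) < 2 ^ b" "4 * (r N * 2 ^ p) < 2 ^ b" "r e < 2 ^ b"
    using assms(4) by (auto simp: term_ok_def t)
  have ok': "{P, N, e} \<inter> {16..24} = {}" using ok(1) by fastforce
  have "r rPOS + r P * 2 ^ p < 2 ^ b" "r rNEG + r N * 2 ^ p < 2 ^ b"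
    "2 * (r P * 2 ^ p) < 2 ^ b" "2 * (r N * 2 ^ p) < 2 ^ b"
    using ok(2,3) assms(5,6) by linarith+
  then show ?thesis using run_pwc[OF assms(1-3) ok', of inp out] ok(4) by (simp add: t evP_def evN_def)
qed

lemma run_evalc:
  assumes "p + 1 < b" "r rE = 2 ^ p - 1" "r rY < 2 ^ p" "term_ok p b r t1" "term_ok p b r t2" "term_ok p b r t3"
  shows "\<exists>r'. run b (evalc t1 t2 t3) (r, inp, out) = Some (r', inp, out) \<and>
    r' rPOS = evP p r (r rY) t1 + evP p r (r rY) t2 + evP p r (r rY) t3 \<and>
    r' rNEG = evN p r (r rY) t1 + evN p r (r rY) t2 + evN p r (r rY) t3 \<and>
    (\<forall>i. i \<notin> {16..24} \<longrightarrow> r' i = r i)"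
proof -
  let ?r0 = "r(rPOS := 0, rNEG := 0)"
  have c0: "agree ?r0 r" by (auto simp: agree_def)
  note e = ev_cong[OF assms(4), OF c0] ev_cong[OF assms(5), OF c0] ev_cong[OF assms(6), OF c0]
  obtain r1 where r1: "run b (pwc t1) (?r0, inp, out) = Some (r1, inp, out)"
    "r1 rPOS = evP p r (r rY) t1" "r1 rNEG = evN p r (r rY) t1" "\<And>i. i \<notin> {16..24} \<Longrightarrow> r1 i = ?r0 i"
    using run_pwc'[of p b ?r0 t1 inp out] assms(1-3) e by auto
  have c1: "agree r1 r" using r1(4) by (auto simp: agree_def)
  note e1 = ev_cong[OF assms(4), OF c1] ev_cong[OF assms(5), OF c1] ev_cong[OF assms(6), OF c1]
  have q1: "r1 rE = 2 ^ p - 1" "r1 rY = r rY" using r1(4) assms(2) by simp_all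
  obtain r2 where r2: "run b (pwc t2) (r1, inp, out) = Some (r2, inp, out)"
    "r2 rPOS = evP p r (r rY) t1 + evP p r (r rY) t2" "r2 rNEG = evN p r (r rY) t1 + evN p r (r rY) t2"
    "\<And>i. i \<notin> {16..24} \<Longrightarrow> r2 i = r1 i"
    using run_pwc'[of p b r1 t2 inp out] assms(1-3) q1 e1 ev_less[OF assms(4,3)] r1(2,3) by auto
  have c2: "agree r2 r" using r2(4) r1(4) by (auto simp: agree_def)
  note e2 = ev_cong[OF assms(4), OF c2] ev_cong[OF assms(5), OF c2] ev_cong[OF assms(6), OF c2]
  have q2: "r2 rE = 2 ^ p - 1" "r2 rY = r rY" using r2(4) q1 by simp_all
  have "4 * r2 rPOS < 3 * 2 ^ b" "4 * r2 rNEG < 3 * 2 ^ b"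
    unfolding r2(2,3) using ev_less[OF assms(4,3)] ev_less[OF assms(5,3)] by auto
  then obtain r3 where r3: "run b (pwc t3) (r2, inp, out) = Some (r3, inp, out)"
    "r3 rPOS = evP p r (r rY) t1 + evP p r (r rY) t2 + evP p r (r rY) t3"
    "r3 rNEG = evN p r (r rY) t1 + evN p r (r rY) t2 + evN p r (r rY) t3"
    "\<And>i. i \<notin> {16..24} \<Longrightarrow> r3 i = r2 i"
    using run_pwc'[of p b r2 t3 inp out] assms(1-3) q2 e2 r2(2,3) by auto
  have "run b (evalc t1 t2 t3) (r, inp, out) = Some (r3, inp, out)"
    using r1(1) r2(1) r3(1) by (simp add: evalc_def del: pwc.simps)
  then show ?thesis using r3 r2(4) r1(4) by auto
qed

text \<open>
  The test \<open>T\<close> is expected to hold at the left end and to fail at the right end of the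
  interval.
\<close>

fun bis :: "(nat \<Rightarrow> bool) \<Rightarrow> nat \<Rightarrow> nat \<Rightarrow> nat \<Rightarrow> nat \<times> nat" where
  "bis T 0 lo hi = (lo, hi)"
| "bis T (Suc k) lo hi = (let m = (lo + hi) div 2 in if T m then bis T k m hi else bis T k lo m)"

definition bisc :: "term_regs \<Rightarrow> term_regs \<Rightarrow> term_regs \<Rightarrow> com" where
  "bisc t1 t2 t3 = mov rCNT2 rE ;;
     Loop rCNT2 (mov rY rLO ;; Add rY rHI ;; Halve rY ;; evalc t1 t2 t3 ;; Sub rPOS rNEG ;;
       IfPos rPOS (mov rLO rY) (mov rHI rY))"

definition tst :: "nat \<Rightarrow> (nat \<Rightarrow> nat) \<Rightarrow> term_regs \<Rightarrow> term_regs \<Rightarrow> term_regs \<Rightarrow> nat \<Rightarrow> bool" where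
  "tst p r t1 t2 t3 y \<longleftrightarrow> evN p r y t1 + evN p r y t2 + evN p r y t3 < evP p r y t1 + evP p r y t2 + evP p r y t3"

lemma tst_cong:
  assumes "term_ok p b r t1" "term_ok p b r t2" "term_ok p b r t3" "agree r' r"
  shows "tst p r' t1 t2 t3 = tst p r t1 t2 t3"
  by (rule ext)
    (simp only: tst_def ev_cong[OF assms(1,4)] ev_cong[OF assms(2,4)] ev_cong[OF assms(3,4)])

lemma bis_loop:
  assumes "p + 1 < b"
  shows "\<lbrakk>r rE = 2 ^ p - 1; term_ok p b r t1; term_ok p b r t2; term_ok p b r t3;
      r rLO \<le> r rHI; r rLO < 2 ^ p; r rHI \<le> 2 ^ p\<rbrakk> \<Longrightarrow>
   \<exists>r'. run b (Loop rCNT2 (mov rY rLO ;; Add rY rHI ;; Halve rY ;; evalc t1 t2 t3 ;; Sub rPOS rNEG ;;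
       IfPos rPOS (mov rLO rY) (mov rHI rY))) (r, inp, out) = Some (r', inp, out) \<and>
     (r' rLO, r' rHI) = bis (tst p r t1 t2 t3) (length (bits (r rCNT2))) (r rLO) (r rHI) \<and>
     (\<forall>i. i \<notin> {16..28} \<longrightarrow> r' i = r i)"
proof (induction "length (bits (r rCNT2))" arbitrary: r)
  case 0
  then show ?case by simp
next
  case (Suc m)
  let ?B = "mov rY rLO ;; Add rY rHI ;; Halve rY ;; evalc t1 t2 t3 ;; Sub rPOS rNEG ;;
       IfPos rPOS (mov rLO rY) (mov rHI rY)"
  have x: "r rCNT2 > 0" using Suc.hyps(2) by (cases "r rCNT2 = 0") auto
  have m: "length (bits (r rCNT2 div 2)) = m" using Suc.hyps(2) x by (simp add: bits_pos)
  let ?m = "(r rLO + r rHI) div 2"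
  have pb: "2 * 2 ^ p < (2::nat) ^ b" using power_strict_increasing[OF assms, of "2::nat"] by simp
  have b1: "r rLO < 2 ^ b" "r rLO + r rHI < 2 ^ b" using Suc.prems pb by linarith+
  have mid: "?m < 2 ^ p" "r rLO \<le> ?m" "?m \<le> r rHI" using Suc.prems by auto
  have mb: "?m < 2 ^ b" using mid(1) pb by linarith
  let ?r0 = "r(rY := ?m)"
  have c0: "agree ?r0 r" by (auto simp: agree_def)
  note e = ev_cong[OF Suc.prems(2), OF c0] ev_cong[OF Suc.prems(3), OF c0] ev_cong[OF Suc.prems(4), OF c0]
  obtain r1 where r1: "run b (evalc t1 t2 t3) (?r0, inp, out) = Some (r1, inp, out)"
    "r1 rPOS = evP p r ?m t1 + evP p r ?m t2 + evP p r ?m t3"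
    "r1 rNEG = evN p r ?m t1 + evN p r ?m t2 + evN p r ?m t3" "\<And>i. i \<notin> {16..24} \<Longrightarrow> r1 i = ?r0 i"
    using run_evalc[OF assms, of ?r0 t1 t2 t3 inp out] Suc.prems(1) mid(1) e by auto
  let ?T = "tst p r t1 t2 t3"
  have T: "r1 rPOS - r1 rNEG > 0 \<longleftrightarrow> ?T ?m" unfolding tst_def r1(2,3) by auto
  have r1y: "r1 rY = ?m" "r1 rLO = r rLO" "r1 rHI = r rHI" "r1 rCNT2 = r rCNT2" using r1(4) by simp_all
  obtain r2 where r2: "run b ?B (r, inp, out) = Some (r2, inp, out)" "r2 rCNT2 = r rCNT2"
    "r2 rLO = (if ?T ?m then ?m else r rLO)" "r2 rHI = (if ?T ?m then r rHI else ?m)" "agree r2 r"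
  proof (cases "?T ?m")
    case True
    show thesis
      by (rule that[of "r1(rPOS := r1 rPOS - r1 rNEG, rLO := ?m)"])
        (use r1(1,4) r1y b1 mb T True in \<open>auto simp: agree_def\<close>)
  next
    case False
    show thesis
      by (rule that[of "r1(rPOS := r1 rPOS - r1 rNEG, rHI := ?m)"])
        (use r1(1,4) r1y b1 mb T False in \<open>auto simp: agree_def\<close>)
  qed
  define r3 where "r3 = r2(rCNT2 := r2 rCNT2 div 2)"
  have c: "agree r3 r" using r2(5) by (auto simp: r3_def agree_def)
  note e' = ev_cong[OF Suc.prems(2) c] ev_cong[OF Suc.prems(3) c] ev_cong[OF Suc.prems(4) c]
  have r3: "r3 rCNT2 = r rCNT2 div 2" "r3 rLO = (if ?T ?m then ?m else r rLO)"
    "r3 rHI = (if ?T ?m then r rHI else ?m)" "r3 rE = 2 ^ p - 1"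
    using r2 Suc.prems(1) by (auto simp: r3_def agree_def)
  have TT: "tst p r3 t1 t2 t3 = ?T" by (rule tst_cong[OF Suc.prems(2-4) c])
  have h: "m = length (bits (r3 rCNT2))" "r3 rLO \<le> r3 rHI" "r3 rLO < 2 ^ p" "r3 rHI \<le> 2 ^ p"
    unfolding r3 using m mid Suc.prems(6,7) by auto
  obtain r' where r': "run b (Loop rCNT2 ?B) (r3, inp, out) = Some (r', inp, out)"
     "(r' rLO, r' rHI) = bis ?T m (r3 rLO) (r3 rHI)" "\<forall>i. i \<notin> {16..28} \<longrightarrow> r' i = r3 i"
    using Suc.hyps(1)[OF h(1) r3(4) e'(3,6,9) h(2-4), unfolded TT] h(1) by metis
  have "run b (Loop rCNT2 ?B) (r, inp, out) = run b (Loop rCNT2 ?B) (r3, inp, out)"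
    using Suc.hyps(2)[symmetric] r2(1,2) m by (simp add: r3_def del: run.simps(1-11))
  moreover have "bis ?T (Suc m) (r rLO) (r rHI) = bis ?T m (r3 rLO) (r3 rHI)"
    unfolding r3 by (simp add: Let_def)
  moreover have "\<forall>i. i \<notin> {16..28} \<longrightarrow> r' i = r i" using c r'(3) unfolding agree_def by auto
  ultimately show ?case using r' Suc.hyps(2) by (intro exI[of _ r']) simp
qed

lemma run_bisc:
  assumes "p + 1 < b" "r rE = 2 ^ p - 1" "term_ok p b r t1" "term_ok p b r t2" "term_ok p b r t3"
      "r rLO \<le> r rHI" "r rLO < 2 ^ p" "r rHI \<le> 2 ^ p"
  shows "\<exists>r'. run b (bisc t1 t2 t3) (r, inp, out) = Some (r', inp, out) \<and>
     (r' rLO, r' rHI) = bis (tst p r t1 t2 t3) p (r rLO) (r rHI) \<and> (\<forall>i. i \<notin> {16..28} \<longrightarrow> r' i = r i)"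
proof -
  let ?r = "r(rCNT2 := 2 ^ p - 1)"
  have c: "agree ?r r" by (auto simp: agree_def)
  note e = ev_cong[OF assms(3), OF c] ev_cong[OF assms(4), OF c] ev_cong[OF assms(5), OF c]
  have pb: "2 ^ p < (2::nat) ^ b" using assms(1) by simp
  then have "r rE < 2 ^ b" using assms(2) by linarith
  then have "run b (bisc t1 t2 t3) (r, inp, out) = run b (Loop rCNT2 (mov rY rLO ;; Add rY rHI ;; Halve rY ;;
       evalc t1 t2 t3 ;; Sub rPOS rNEG ;; IfPos rPOS (mov rLO rY) (mov rHI rY))) (?r, inp, out)"
    unfolding bisc_def using assms(2) by (simp del: run.simps(10-12))
  moreover have "tst p ?r t1 t2 t3 = tst p r t1 t2 t3" by (rule tst_cong[OF assms(3-5) c])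
  ultimately show ?thesis
    using bis_loop[OF assms(1), of ?r t1 t2 t3 inp out] assms(2-) e bits_ones[of p] by auto
qed

definition mulc :: "nat \<Rightarrow> nat \<Rightarrow> com" where
  "mulc u v = clr rACC ;; mov rX u ;; mov rV v ;; Loop rV (IfOdd rV (Add rACC rX) Nop ;; Push False rX)"

lemma run_mulc:
  assumes "u \<notin> {rACC, rV, rX}" "v \<notin> {rACC, rV, rX}" "r v > 0 \<Longrightarrow> r u * (4 * r v) < 2 ^ b" "r u < 2 ^ b" "r v < 2 ^ b"
  shows "\<exists>r'. run b (mulc u v) (r, inp, out) = Some (r', inp, out) \<and> r' rACC = r u * r v \<and>
    (\<forall>i. i \<notin> {rACC, rV, rX} \<longrightarrow> r' i = r i)"
proof -
  let ?n = "length (bits (r v))"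
  let ?I = "\<lambda>j s. s = (r(rACC := r u * (r v mod 2 ^ j), rV := r v div 2 ^ j, rX := r u * 2 ^ j), inp, out)"
  have "\<exists>s'. iter (run b (IfOdd rV (Add rACC rX) Nop ;; Push False rX)) rV ?n
      (r(rACC := 0, rV := r v, rX := r u), inp, out) = Some s' \<and> ?I ?n s'"
  proof (rule iter_invariant[where I = ?I])
    fix j s assume j: "j < ?n" and s: "?I j s"
    have vpos: "r v > 0" using j by (cases "r v = 0") auto
    have "2 ^ Suc j \<le> (2::nat) ^ ?n" using j by (intro power_increasing) auto
    also have "\<dots> \<le> 2 * r v" by (rule length_bits_ge[OF vpos])
    finally have jj: "2 ^ Suc j \<le> 2 * r v" .
    have X: "2 * (r u * 2 ^ j) < 2 ^ b"
    proof -
      have "r u * (2 ^ Suc j) \<le> r u * (4 * r v)" using jj by (intro mult_left_mono) auto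
      moreover have "r u * (2 ^ Suc j) = 2 * (r u * 2 ^ j)" by simp
      ultimately show ?thesis using assms(3)[OF vpos] by linarith
    qed
    have A: "r u * (r v mod 2 ^ j) + r u * 2 ^ j < 2 ^ b"
    proof -
      have "r v mod 2 ^ j \<le> r v" by (rule mod_less_eq_dividend)
      moreover have "2 ^ j \<le> r v" using jj by simp
      ultimately have "r v mod 2 ^ j + 2 ^ j \<le> 4 * r v" by linarith
      then have "r u * (r v mod 2 ^ j + 2 ^ j) \<le> r u * (4 * r v)" by (intro mult_left_mono) auto
      then show ?thesis using assms(3)[OF vpos] by (simp only: distrib_left)
    qed
    have md: "r v mod 2 ^ Suc j = 2 ^ j * (r v div 2 ^ j mod 2) + r v mod 2 ^ j"
      by (metis mod_mult2_eq power_Suc2)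
    have st: "r u * (r v mod 2 ^ Suc j) = r u * (r v mod 2 ^ j) + (if odd (r v div 2 ^ j) then r u * 2 ^ j else 0)"
      unfolding md by (simp add: odd_iff_mod_2_eq_one distrib_left)
    let ?r = "r(rACC := r u * (r v mod 2 ^ Suc j), rV := r v div 2 ^ j, rX := r u * 2 ^ Suc j)"
    have "run b (IfOdd rV (Add rACC rX) Nop ;; Push False rX) s = Some (?r, inp, out)"
      using s X A unfolding st by (cases "odd (r v div 2 ^ j)") (simp_all add: mult_ac fun_eq_iff)
    moreover have "?I (Suc j) (?r(rV := ?r rV div 2), inp, out)"
      by (simp add: div_mult2_eq[symmetric] mult.commute fun_eq_iff)
    moreover have "?r rV = fst s rV" using s by simp
    ultimately show "\<exists>ra inp' out'. run b (IfOdd rV (Add rACC rX) Nop ;; Push False rX) s = Some (ra, inp', out') \<and>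
            ra rV = fst s rV \<and> ?I (Suc j) (ra(rV := ra rV div 2), inp', out')" by blast
  qed simp
  then have "run b (mulc u v) (r, inp, out) = Some (r(rACC := r u * (r v mod 2 ^ ?n), rV := r v div 2 ^ ?n, rX := r u * 2 ^ ?n), inp, out)"
    using assms by (simp add: mulc_def fun_upd_twist)
  then show ?thesis using less_length_bits[of "r v"] by simp
qed

section \<open>The root finder\<close>

definition tval :: "nat \<Rightarrow> nat \<Rightarrow> int \<Rightarrow> nat \<Rightarrow> int" where
  "tval p y c e = int (pw p e y (nat c * 2 ^ p)) - int (pw p e y (nat (- c) * 2 ^ p))"

definition evi :: "nat \<Rightarrow> int \<Rightarrow> int \<Rightarrow> int \<Rightarrow> nat \<Rightarrow> nat \<Rightarrow> nat \<Rightarrow> int" where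
  "evi p c1 c2 c3 a d y = tval p y c1 0 + tval p y c2 a + tval p y c3 d"

definition bisi :: "nat \<Rightarrow> int \<Rightarrow> int \<Rightarrow> int \<Rightarrow> nat \<Rightarrow> nat \<Rightarrow> nat \<Rightarrow> nat \<Rightarrow> nat" where
  "bisi p c1 c2 c3 a d lo hi = fst (bis (\<lambda>y. evi p c1 c2 c3 a d y > 0) p lo hi)"

text \<open>
  The roots of the trinomial between 0 and 1, for \<open>c\<^sub>1 > 0\<close>. If the value at 1 is negative,
  there is exactly one. Otherwise a root requires the signs \<open>+ - +\<close> and a critical point
  less than 1; that point is computed by bisection of the binomial
  \<open>a \<bar>c\<^sub>2\<bar> - d c\<^sub>3 x ^ (d - a)\<close>, and the value \<open>v\<close> there is compared with the threshold. If
  it is neither clearly positive nor clearly negative, the critical point is a degenerate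
  root. If the value at 1 is 0, the second root is 1 itself and is not listed here.
\<close>

definition sub_ys :: "nat \<Rightarrow> nat \<Rightarrow> int \<Rightarrow> int \<Rightarrow> int \<Rightarrow> nat \<Rightarrow> nat \<Rightarrow> nat list" where
  "sub_ys p th c1 c2 c3 a d =
     (if c1 + c2 + c3 < 0 then [bisi p c1 c2 c3 a d 0 (2 ^ p)]
      else if c2 < 0 \<and> c3 > 0 \<and> int a * (- c2) < int d * c3 then
        (let y = bisi p (int a * (- c2)) 0 (- (int d * c3)) 0 (d - a) 0 (2 ^ p);
             v = evi p c1 c2 c3 a d y
         in if v > int th then []
            else if v < - int th then bisi p c1 c2 c3 a d 0 y #
              (if c1 + c2 + c3 > 0 then [bisi p (- c1) (- c2) (- c3) a d y (2 ^ p)] else [])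
            else [y])
      else [])"

definition coef :: "(nat \<Rightarrow> nat) \<Rightarrow> nat \<Rightarrow> nat \<Rightarrow> int \<Rightarrow> bool" where
  "coef r P N c \<longleftrightarrow> r P = nat c \<and> r N = nat (- c)"

definition consts_ok :: "(nat \<Rightarrow> nat) \<Rightarrow> nat \<Rightarrow> nat \<Rightarrow> bool" where
  "consts_ok r p th \<longleftrightarrow> r rZ = 0 \<and> r rE = 2 ^ p - 1 \<and> r rDD = 2 ^ p \<and> r rTH = th \<and> r rONE = 1"

text \<open>
  The state of the registers between the parts of the program: the problem and the
  constants. \<open>bounds\<close> collects what guarantees that no number outgrows \<open>b\<close> bits.
\<close>

definition St :: "(nat \<Rightarrow> nat) \<Rightarrow> int \<Rightarrow> int \<Rightarrow> int \<Rightarrow> nat \<Rightarrow> nat \<Rightarrow> nat \<Rightarrow> nat \<Rightarrow> bool" where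
  "St r c1 c2 c3 a d p th \<longleftrightarrow> coef r rP1 rN1 c1 \<and> coef r rP2 rN2 c2 \<and> coef r rP3 rN3 c3 \<and>
     r rA = a \<and> r rD = d \<and> consts_ok r p th"

definition bounds :: "nat \<Rightarrow> nat \<Rightarrow> nat \<Rightarrow> int \<Rightarrow> int \<Rightarrow> int \<Rightarrow> nat \<Rightarrow> nat \<Rightarrow> bool" where
  "bounds b p th c1 c2 c3 a d \<longleftrightarrow> (\<exists>M. M \<ge> 1 \<and> 4 * (M * 2 ^ p) < (2::nat) ^ b \<and> a < d \<and> d \<le> M \<and>
     d * nat \<bar>c1\<bar> \<le> M \<and> d * nat \<bar>c2\<bar> \<le> M \<and> d * nat \<bar>c3\<bar> \<le> M \<and> th \<le> M * 2 ^ p)"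

lemma boundsD:
  assumes "bounds b p th c1 c2 c3 a d"
  shows "p + 1 < b" "4 * (nat \<bar>c1\<bar> * 2 ^ p) < 2 ^ b" "4 * (nat \<bar>c2\<bar> * 2 ^ p) < 2 ^ b"
    "4 * (nat \<bar>c3\<bar> * 2 ^ p) < 2 ^ b" "4 * (a * nat \<bar>c2\<bar> * 2 ^ p) < 2 ^ b"
    "4 * (d * nat \<bar>c3\<bar> * 2 ^ p) < 2 ^ b"
    "4 * nat \<bar>c1\<bar> < 2 ^ b" "4 * nat \<bar>c2\<bar> < 2 ^ b" "4 * nat \<bar>c3\<bar> < 2 ^ b"
    "4 * (a * nat \<bar>c2\<bar>) < 2 ^ b" "4 * (d * nat \<bar>c3\<bar>) < 2 ^ b" "a < d" "4 * d < 2 ^ b" "th < 2 ^ b"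
    "4 * 2 ^ p < (2 :: nat) ^ b"
proof -
  obtain M where M: "M \<ge> 1" "4 * (M * 2 ^ p) < (2::nat) ^ b" "a < d" "d \<le> M"
     "d * nat \<bar>c1\<bar> \<le> M" "d * nat \<bar>c2\<bar> \<le> M" "d * nat \<bar>c3\<bar> \<le> M" "th \<le> M * 2 ^ p"
    using assms unfolding bounds_def by blast
  have le: "4 * (x * 2 ^ p) < 2 ^ b" "4 * x < 2 ^ b" if "x \<le> M" for x :: nat
  proof -
    have "x * 2 ^ p \<le> M * 2 ^ p" using that by simp
    then show "4 * (x * 2 ^ p) < 2 ^ b" using M(2) by linarith
    moreover have "x \<le> x * 2 ^ p" by simp
    ultimately show "4 * x < 2 ^ b" by linarith
  qed
  have d: "d > 0" using M(3) by simp
  have c: "nat \<bar>c1\<bar> \<le> M" "nat \<bar>c2\<bar> \<le> M" "nat \<bar>c3\<bar> \<le> M" "a * nat \<bar>c2\<bar> \<le> M"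
  proof -
    have *: "x \<le> d * x" for x using d by simp
    show "nat \<bar>c1\<bar> \<le> M" "nat \<bar>c2\<bar> \<le> M" "nat \<bar>c3\<bar> \<le> M"
      using M(5-7) *[of "nat \<bar>c1\<bar>"] *[of "nat \<bar>c2\<bar>"] *[of "nat \<bar>c3\<bar>"] by linarith+
    have "a * nat \<bar>c2\<bar> \<le> d * nat \<bar>c2\<bar>" using M(3) by (intro mult_right_mono) auto
    then show "a * nat \<bar>c2\<bar> \<le> M" using M(6) by linarith
  qed
  have p4: "4 * 2 ^ p < (2 :: nat) ^ b" using le(1)[OF M(1)] by simp
  have "(2::nat) ^ (p + 1) < 2 ^ b" using p4 by simp
  then have pb: "p + 1 < b" by (rule power_less_imp_less_exp[rotated]) simp
  have "th < 2 ^ b" using M(2,8) by linarith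
  then show "p + 1 < b" "4 * (nat \<bar>c1\<bar> * 2 ^ p) < 2 ^ b" "4 * (nat \<bar>c2\<bar> * 2 ^ p) < 2 ^ b"
    "4 * (nat \<bar>c3\<bar> * 2 ^ p) < 2 ^ b" "4 * (a * nat \<bar>c2\<bar> * 2 ^ p) < 2 ^ b"
    "4 * (d * nat \<bar>c3\<bar> * 2 ^ p) < 2 ^ b"
    "4 * nat \<bar>c1\<bar> < 2 ^ b" "4 * nat \<bar>c2\<bar> < 2 ^ b" "4 * nat \<bar>c3\<bar> < 2 ^ b"
    "4 * (a * nat \<bar>c2\<bar>) < 2 ^ b" "4 * (d * nat \<bar>c3\<bar>) < 2 ^ b" "a < d" "4 * d < 2 ^ b" "th < 2 ^ b"
    "4 * 2 ^ p < (2 :: nat) ^ b"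
    using pb p4 le c M(3,4,7) by blast+
qed

definition outc :: "bool \<Rightarrow> bool \<Rightarrow> com" where
  "outc sg rv = (if sg then Emit 3 else Nop) ;; Put (if rv then rDD else rLO) ;; Emit 4 ;;
     Put (if rv then rLO else rDD) ;; Emit 4"

text \<open>
  \<open>sg\<close> stands for the substitution \<open>x \<mapsto> - x\<close> and \<open>rv\<close> for \<open>x \<mapsto> 1 / x\<close>.
\<close>

definition fraction :: "nat \<Rightarrow> bool \<Rightarrow> bool \<Rightarrow> nat \<Rightarrow> int \<times> int" where
  "fraction p sg rv y = ((if sg then - 1 else 1) * (if rv then 2 ^ p else int y), if rv then int y else 2 ^ p)"

lemma encode_fractions_append: "encode_fractions (xs @ ys) = encode_fractions xs @ encode_fractions ys"
  by (simp add: encode_fractions_def encode_ints_def)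

lemma encode_int_nat: "n > 0 \<Longrightarrow> encode_int (int n) = rev (bits n)"
  using encode_int_pos[of "int n"] by simp

lemma encode_int_neg_nat: "n > 0 \<Longrightarrow> encode_int (- int n) = 3 # rev (bits n)"
  using encode_int_neg[of "- int n"] by simp

lemma run_outc:
  assumes "r rLO > 0" "r rDD = 2 ^ p"
  shows "run b (outc sg rv) (r, inp, out) =
    Some (r, inp, out @ encode_fractions [fraction p sg rv (r rLO)])"
proof -
  have "encode_int (2 ^ p) = rev (bits (2 ^ p))" "encode_int (- (2 ^ p)) = 3 # rev (bits (2 ^ p))"
    using encode_int_nat[of "2 ^ p"] encode_int_neg_nat[of "2 ^ p"] by simp_all
  then show ?thesis using assms
    by (simp add: outc_def encode_fractions_def encode_ints_def fraction_def encode_int_nat encode_int_neg_nat)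
qed

definition swap :: "nat \<Rightarrow> nat \<Rightarrow> com" where
  "swap i j = mov rT i ;; mov i j ;; mov j rT"

lemma run_swap:
  assumes "distinct [i, j, rT]" "r i < 2 ^ b" "r j < 2 ^ b"
  shows "run b (swap i j) (r, inp, out) = Some (r(rT := r i, i := r j, j := r i), inp, out)"
  using assms by (simp add: swap_def)

definition "tr1 = (rP1, rN1, rZ)"
definition "tr2 = (rP2, rN2, rA)"
definition "tr3 = (rP3, rN3, rD)"
definition "tn1 = (rN1, rP1, rZ)"
definition "tn2 = (rN2, rP2, rA)"
definition "tn3 = (rN3, rP3, rD)"
definition "td1 = (rAA, rZ, rZ)"
definition "td2 = (rZ, rZ, rZ)"
definition "td3 = (rZ, rDB, rDM)"

lemma nat_abs_parts: "nat c \<le> nat \<bar>c\<bar>" "nat (- c) \<le> nat \<bar>c\<bar>"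
  by auto

lemma tst_tr:
  assumes "St r c1 c2 c3 a d p th" "bounds b p th c1 c2 c3 a d"
  shows "tst p r tr1 tr2 tr3 = (\<lambda>y. evi p c1 c2 c3 a d y > 0)"
    "tst p r tn1 tn2 tn3 = (\<lambda>y. evi p (- c1) (- c2) (- c3) a d y > 0)"
    "term_ok p b r tr1" "term_ok p b r tr2" "term_ok p b r tr3"
    "term_ok p b r tn1" "term_ok p b r tn2" "term_ok p b r tn3"
proof -
  note s = assms(1)[unfolded St_def coef_def consts_ok_def]
  show "tst p r tr1 tr2 tr3 = (\<lambda>y. evi p c1 c2 c3 a d y > 0)"
    "tst p r tn1 tn2 tn3 = (\<lambda>y. evi p (- c1) (- c2) (- c3) a d y > 0)"
    using s by (auto simp: fun_eq_iff tst_def evi_def tval_def evP_def evN_def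
        tr1_def tr2_def tr3_def tn1_def tn2_def tn3_def)
  note B = boundsD(2,3,4,12,13)[OF assms(2)]
  have le: "4 * (nat c * 2 ^ p) < 2 ^ b" "4 * (nat (- c) * 2 ^ p) < 2 ^ b"
    if "4 * (nat \<bar>c\<bar> * 2 ^ p) < 2 ^ b" for c
    using mult_right_mono[OF nat_abs_parts(1)[of c], of "2 ^ p"]
      mult_right_mono[OF nat_abs_parts(2)[of c], of "2 ^ p"] that by linarith+
  note l = le[OF B(1)] le[OF B(2)] le[OF B(3)]
  show "term_ok p b r tr1" "term_ok p b r tr2" "term_ok p b r tr3"
    "term_ok p b r tn1" "term_ok p b r tn2" "term_ok p b r tn3"
    using s l B(4,5) by (simp_all add: term_ok_def tr1_def tr2_def tr3_def tn1_def tn2_def tn3_def)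
qed

lemma run_evalc_tr:
  assumes "St r c1 c2 c3 a d p th" "bounds b p th c1 c2 c3 a d" "r rY < 2 ^ p"
  shows "\<exists>r'. run b (evalc tr1 tr2 tr3) (r, inp, out) = Some (r', inp, out) \<and>
    int (r' rPOS) - int (r' rNEG) = evi p c1 c2 c3 a d (r rY) \<and>  
    r' rPOS < 2 ^ b \<and> r' rNEG < 2 ^ b \<and> agree r' r"
proof -
  note t = tst_tr(3-5)[OF assms(1,2)]
  note s = assms(1)[unfolded St_def coef_def consts_ok_def]
  note pb = boundsD(1)[OF assms(2)]
  obtain r' where r': "run b (evalc tr1 tr2 tr3) (r, inp, out) = Some (r', inp, out)"
    "r' rPOS = evP p r (r rY) tr1 + evP p r (r rY) tr2 + evP p r (r rY) tr3"
    "r' rNEG = evN p r (r rY) tr1 + evN p r (r rY) tr2 + evN p r (r rY) tr3"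
    "\<forall>i. i \<notin> {16..24} \<longrightarrow> r' i = r i"
    using run_evalc[OF pb _ assms(3) t, of inp out] s by auto
  have "r' rPOS < 2 ^ b" "r' rNEG < 2 ^ b"
    unfolding r' using ev_less[OF t(1) assms(3)] ev_less[OF t(2) assms(3)] ev_less[OF t(3) assms(3)] by auto
  moreover have "int (r' rPOS) - int (r' rNEG) = evi p c1 c2 c3 a d (r rY)"
    unfolding r' using s by (simp add: evi_def tval_def evP_def evN_def tr1_def tr2_def tr3_def)
  moreover have "agree r' r" using r'(4) by (auto simp: agree_def)
  ultimately show ?thesis using r'(1) by blast
qed

text \<open>
  Unlike \<open>agree\<close>, this also allows the registers of the case distinctions to change.
\<close>

definition keep :: "(nat \<Rightarrow> nat) \<Rightarrow> (nat \<Rightarrow> nat) \<Rightarrow> bool" where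
  "keep r' r \<longleftrightarrow> (\<forall>i. i \<notin> {16..34} \<longrightarrow> r' i = r i)"

lemma St_keep: "St r c1 c2 c3 a d p th \<Longrightarrow> keep r' r \<Longrightarrow> St r' c1 c2 c3 a d p th"
  by (auto simp: St_def coef_def consts_ok_def keep_def)

lemma bis_range:
  "lo \<le> hi \<Longrightarrow> lo \<le> fst (bis T k lo hi) \<and> fst (bis T k lo hi) \<le> snd (bis T k lo hi) \<and> snd (bis T k lo hi) \<le> hi"
proof (induction k arbitrary: lo hi)
  case (Suc k)
  have m: "lo \<le> (lo + hi) div 2" "(lo + hi) div 2 \<le> hi" using Suc.prems by auto
  show ?case using Suc.IH[OF m(1)] Suc.IH[OF m(2)] m by (auto simp: Let_def)
qed simp

lemma bis_less:
  "lo < hi \<Longrightarrow> fst (bis T k lo hi) < hi"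
proof (induction k arbitrary: lo hi)
  case (Suc k)
  show ?case
  proof (cases "lo < (lo + hi) div 2")
    case True
    have "(lo + hi) div 2 < hi" using Suc.prems by auto
    then show ?thesis using Suc.IH[OF True] Suc.IH[of "(lo + hi) div 2" hi] by (auto simp: Let_def)
  next
    case False
    then have "(lo + hi) div 2 = lo" using Suc.prems by auto
    then show ?thesis using Suc.IH[OF Suc.prems] bis_range[of lo lo T k] Suc.prems by (auto simp: Let_def)
  qed
qed simp

lemma keep_trans: "keep r'' r' \<Longrightarrow> keep r' r \<Longrightarrow> keep r'' r"
  by (auto simp: keep_def)

lemma keep_refl [simp]: "keep r r"
  by (simp add: keep_def)

lemma St_less:
  assumes "St r c1 c2 c3 a d p th" "bounds b p th c1 c2 c3 a d"
  shows "4 * r rP1 < 2 ^ b" "4 * r rN1 < 2 ^ b" "4 * r rP2 < 2 ^ b" "4 * r rN2 < 2 ^ b"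
    "4 * r rP3 < 2 ^ b" "4 * r rN3 < 2 ^ b" "4 * r rA < 2 ^ b" "4 * r rD < 2 ^ b" "4 * r rDD < 2 ^ b"
    "r rTH < 2 ^ b" "r rONE < 2 ^ b" "r rA < r rD" "r rE < 2 ^ b"
proof -
  note s = assms(1)[unfolded St_def coef_def consts_ok_def]
  note B = boundsD[OF assms(2)]
  show "4 * r rP1 < 2 ^ b" "4 * r rN1 < 2 ^ b" "4 * r rP2 < 2 ^ b" "4 * r rN2 < 2 ^ b"
    "4 * r rP3 < 2 ^ b" "4 * r rN3 < 2 ^ b"
  proof -
    have *: "4 * nat c < 2 ^ b \<and> 4 * nat (- c) < 2 ^ b" if "4 * nat \<bar>c\<bar> < 2 ^ b" for c
      by (meson that nat_abs_parts mult_le_mono2 le_less_trans)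
    show "4 * r rP1 < 2 ^ b" "4 * r rN1 < 2 ^ b" "4 * r rP2 < 2 ^ b" "4 * r rN2 < 2 ^ b"
      "4 * r rP3 < 2 ^ b" "4 * r rN3 < 2 ^ b"
      using s *[OF B(7)] *[OF B(8)] *[OF B(9)] by simp_all
  qed
  show "4 * r rA < 2 ^ b" "4 * r rD < 2 ^ b" "4 * r rDD < 2 ^ b" "r rTH < 2 ^ b" "r rONE < 2 ^ b" "r rA < r rD"
    using s B(12-15) by simp_all
  have "r rE \<le> r rDD" using s by simp
  then show "r rE < 2 ^ b" using \<open>4 * r rDD < 2 ^ b\<close> by linarith
qed

definition sumc :: com where
  "sumc = mov rPOS rP1 ;; Add rPOS rP2 ;; Add rPOS rP3 ;; mov rNEG rN1 ;; Add rNEG rN2 ;; Add rNEG rN3 ;;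
     mov rT rPOS ;; Sub rT rNEG ;; Sub rNEG rPOS"

lemma nat_parts_diff: "int x - int y = c \<Longrightarrow> x - y = nat c \<and> y - x = nat (- c)"
  by auto

lemma run_sumc:
  assumes "St r c1 c2 c3 a d p th" "bounds b p th c1 c2 c3 a d"
  shows "\<exists>r'. run b sumc (r, inp, out) = Some (r', inp, out) \<and> r' rT = nat (c1 + c2 + c3) \<and>
     r' rNEG = nat (- (c1 + c2 + c3)) \<and> keep r' r"
proof -
  note s = assms(1)[unfolded St_def coef_def consts_ok_def]
  note l = St_less[OF assms]
  let ?p = "r rP1 + r rP2 + r rP3" and ?n = "r rN1 + r rN2 + r rN3"
  have "int ?p - int ?n = c1 + c2 + c3" using s by auto
  from nat_parts_diff[OF this] have d: "?p - ?n = nat (c1 + c2 + c3)" "?n - ?p = nat (- (c1 + c2 + c3))" by auto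
  have "?p < 2 ^ b" "?n < 2 ^ b" using l by linarith+
  then have "run b sumc (r, inp, out) = Some (r(rPOS := ?p, rNEG := ?n - ?p, rT := ?p - ?n), inp, out)"
    using l by (simp add: sumc_def fun_upd_twist)
  then show ?thesis unfolding d by (intro exI conjI) (assumption, auto simp: keep_def)
qed

text \<open>
  The truncated differences in \<open>rT\<close> and \<open>rNEG\<close> are positive if and only if the value at the
  critical point is above the threshold or below its negative, respectively.
\<close>

definition minc :: com where
  "minc = mov rDM rD ;; Sub rDM rA ;; clr rLO ;; mov rHI rDD ;; bisc td1 td2 td3 ;; mov rYS rLO ;; mov rY rLO ;;
     evalc tr1 tr2 tr3 ;; mov rT rPOS ;; Sub rT rNEG ;; Sub rNEG rPOS ;; Sub rT rTH ;; Sub rNEG rTH"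

definition "min_y p c2 c3 a d = bisi p (int a * (- c2)) 0 (- (int d * c3)) 0 (d - a) 0 (2 ^ p)"

lemma run_minc:
  assumes St: "St r c1 c2 c3 a d p th" and B: "bounds b p th c1 c2 c3 a d" and c: "c2 < 0" "c3 > 0"
    and AB: "r rAA = a * nat (- c2)" "r rDB = d * nat c3"
  shows "\<exists>r'. run b minc (r, inp, out) = Some (r', inp, out) \<and> r' rYS = min_y p c2 c3 a d \<and>
     r' rT = nat (evi p c1 c2 c3 a d (min_y p c2 c3 a d) - int th) \<and>
     r' rNEG = nat (- evi p c1 c2 c3 a d (min_y p c2 c3 a d) - int th) \<and> r' rF1 = r rF1 \<and> keep r' r"
proof -
  note s = St[unfolded St_def coef_def consts_ok_def]
  note l = St_less[OF St B]
  note BB = boundsD[OF B]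
  have DD: "r rDD = 2 ^ p" "r rE = 2 ^ p - 1" "r rZ = 0" "r rA = a" "r rD = d" using s by simp_all
  let ?r1 = "r(rDM := d - a, rLO := 0, rHI := 2 ^ p)"
  have dm: "d - a < 2 ^ b" "d < 2 ^ b" "2 ^ p < (2::nat) ^ b" using BB(13,15) by linarith+
  have c': "nat (- c2) = nat \<bar>c2\<bar>" "nat c3 = nat \<bar>c3\<bar>" using c by auto
  have t: "term_ok p b ?r1 td1" "term_ok p b ?r1 td2" "term_ok p b ?r1 td3"
    using BB(5,6) dm DD AB by (simp_all add: term_ok_def td1_def td2_def td3_def c')
  have E1: "?r1 rE = 2 ^ p - 1" using DD by simp
  have lh: "?r1 rLO \<le> ?r1 rHI" "?r1 rLO < 2 ^ p" "?r1 rHI \<le> 2 ^ p" by simp_all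
  have lohi: "?r1 rLO = 0" "?r1 rHI = 2 ^ p" by simp_all
  have T: "tst p ?r1 td1 td2 td3 = (\<lambda>y. evi p (int a * (- c2)) 0 (- (int d * c3)) 0 (d - a) y > 0)"
  proof (rule ext)
    fix y
    have n: "nat (int a * (- c2)) = a * nat (- c2)" "nat (- (int a * (- c2))) = 0"
      "nat (- (int d * c3)) = 0" "nat (- (- (int d * c3))) = d * nat c3"
      using c nat_mult_distrib[of "int a" "- c2"] nat_mult_distrib[of "int d" c3]
      by (auto simp: mult_le_0_iff zero_le_mult_iff)
    show "tst p ?r1 td1 td2 td3 y \<longleftrightarrow> evi p (int a * (- c2)) 0 (- (int d * c3)) 0 (d - a) y > 0"
      unfolding evi_def tval_def n using DD AB
      by (auto simp: tst_def evP_def evN_def td1_def td2_def td3_def)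
  qed
  obtain r2 where r2: "run b (bisc td1 td2 td3) (?r1, inp, out) = Some (r2, inp, out)"
     "(r2 rLO, r2 rHI) = bis (tst p ?r1 td1 td2 td3) p 0 (2 ^ p)" "\<forall>i. i \<notin> {16..28} \<longrightarrow> r2 i = ?r1 i"
    using run_bisc[OF BB(1) E1 t lh, of inp out] unfolding lohi by blast
  have LO: "r2 rLO = min_y p c2 c3 a d"
    using arg_cong[OF r2(2), of fst] unfolding T min_y_def bisi_def by simp
  have ylt: "min_y p c2 c3 a d < 2 ^ p"
    unfolding min_y_def bisi_def by (rule bis_less) simp
  let ?y = "min_y p c2 c3 a d"
  let ?r3 = "r2(rYS := ?y, rY := ?y)"
  have St3: "St ?r3 c1 c2 c3 a d p th"
    using r2(3) by (intro St_keep[OF St]) (auto simp: keep_def)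
  obtain r4 where r4: "run b (evalc tr1 tr2 tr3) (?r3, inp, out) = Some (r4, inp, out)"
    "int (r4 rPOS) - int (r4 rNEG) = evi p c1 c2 c3 a d ?y" "r4 rPOS < 2 ^ b" "r4 rNEG < 2 ^ b" "agree r4 ?r3"
    using run_evalc_tr[OF St3 B, of inp out] ylt by auto
  note d = nat_parts_diff[OF r4(2)]
  let ?r5 = "r4(rT := r4 rPOS - r4 rNEG - th, rNEG := r4 rNEG - r4 rPOS - th)"
  have th4: "r4 rTH = th" using r4(5) St3 by (simp add: agree_def St_def consts_ok_def)
  have yb: "?y < 2 ^ b" using ylt dm(3) by linarith
  have "run b minc (r, inp, out) = Some (?r5, inp, out)"
    using r2(1) r4(1,3,4) dm DD th4 LO yb
    by (simp add: minc_def fun_upd_twist del: pwc.simps)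
  moreover have "?r5 rYS = ?y" using r4(5) by (simp add: agree_def)
  moreover have "?r5 rT = nat (evi p c1 c2 c3 a d ?y - int th)" "?r5 rNEG = nat (- evi p c1 c2 c3 a d ?y - int th)"
    using d by (simp_all add: nat_diff_distrib')
  moreover have "?r5 rF1 = r rF1" using r4(5) r2(3) by (simp add: agree_def)
  moreover have "keep ?r5 r" using r4(5) r2(3) by (auto simp: agree_def keep_def)
  ultimately show ?thesis by blast
qed

definition bis_out :: "bool \<Rightarrow> bool \<Rightarrow> com" where
  "bis_out sg rv = bisc tr1 tr2 tr3 ;; outc sg rv"

lemma run_bis_out:
  assumes St: "St r c1 c2 c3 a d p th" and B: "bounds b p th c1 c2 c3 a d"
    and lh: "r rLO \<le> r rHI" "r rLO < 2 ^ p" "r rHI \<le> 2 ^ p"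
    and pos: "bisi p c1 c2 c3 a d (r rLO) (r rHI) > 0"
  shows "\<exists>r'. run b (bis_out sg rv) (r, inp, out) =
     Some (r', inp, out @ encode_fractions [fraction p sg rv (bisi p c1 c2 c3 a d (r rLO) (r rHI))]) \<and> agree r' r"
proof -
  have E: "r rE = 2 ^ p - 1" using St by (simp add: St_def consts_ok_def)
  obtain r' where r': "run b (bisc tr1 tr2 tr3) (r, inp, out) = Some (r', inp, out)"
     "(r' rLO, r' rHI) = bis (tst p r tr1 tr2 tr3) p (r rLO) (r rHI)" "\<forall>i. i \<notin> {16..28} \<longrightarrow> r' i = r i"
    using run_bisc[OF boundsD(1)[OF B] E tst_tr(3-5)[OF St B] lh, of inp out] by blast
  have LO: "r' rLO = bisi p c1 c2 c3 a d (r rLO) (r rHI)"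
    using arg_cong[OF r'(2), of fst] unfolding tst_tr(1)[OF St B] bisi_def by simp
  have DD: "r' rDD = 2 ^ p" using r'(3) St by (simp add: St_def consts_ok_def)
  have "run b (outc sg rv) (r', inp, out) =
      Some (r', inp, out @ encode_fractions [fraction p sg rv (r' rLO)])"
    by (rule run_outc) (use LO pos DD in simp_all)
  then show ?thesis using r'(1,3) LO by (auto simp: bis_out_def agree_def)
qed

definition bis_out_neg :: "bool \<Rightarrow> bool \<Rightarrow> com" where
  "bis_out_neg sg rv = bisc tn1 tn2 tn3 ;; outc sg rv"

lemma run_bis_out_neg:
  assumes St: "St r c1 c2 c3 a d p th" and B: "bounds b p th c1 c2 c3 a d"
    and lh: "r rLO \<le> r rHI" "r rLO < 2 ^ p" "r rHI \<le> 2 ^ p"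
    and pos: "bisi p (- c1) (- c2) (- c3) a d (r rLO) (r rHI) > 0"
  shows "\<exists>r'. run b (bis_out_neg sg rv) (r, inp, out) =
     Some (r', inp, out @ encode_fractions [fraction p sg rv (bisi p (- c1) (- c2) (- c3) a d (r rLO) (r rHI))]) \<and> agree r' r"
proof -
  have E: "r rE = 2 ^ p - 1" using St by (simp add: St_def consts_ok_def)
  obtain r' where r': "run b (bisc tn1 tn2 tn3) (r, inp, out) = Some (r', inp, out)"
     "(r' rLO, r' rHI) = bis (tst p r tn1 tn2 tn3) p (r rLO) (r rHI)" "\<forall>i. i \<notin> {16..28} \<longrightarrow> r' i = r i"
    using run_bisc[OF boundsD(1)[OF B] E tst_tr(6-8)[OF St B] lh, of inp out] by blast
  have LO: "r' rLO = bisi p (- c1) (- c2) (- c3) a d (r rLO) (r rHI)"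
    using arg_cong[OF r'(2), of fst] unfolding tst_tr(2)[OF St B] bisi_def by simp
  have DD: "r' rDD = 2 ^ p" using r'(3) St by (simp add: St_def consts_ok_def)
  have "run b (outc sg rv) (r', inp, out) =
      Some (r', inp, out @ encode_fractions [fraction p sg rv (r' rLO)])"
    by (rule run_outc) (use LO pos DD in simp_all)
  then show ?thesis using r'(1,3) LO by (auto simp: bis_out_neg_def agree_def)
qed

definition twoc :: "bool \<Rightarrow> bool \<Rightarrow> com" where
  "twoc sg rv = mulc rA rN2 ;; mov rAA rACC ;; mulc rD rP3 ;; mov rDB rACC ;; mov rPOS rDB ;; Sub rPOS rAA ;;
     IfPos rPOS (minc ;; IfPos rT Nop (IfPos rNEG
        (clr rLO ;; mov rHI rYS ;; bis_out sg rv ;;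
          IfPos rF1 (mov rLO rYS ;; mov rHI rDD ;; bis_out_neg sg rv) Nop)
        (mov rLO rYS ;; outc sg rv))) Nop"

definition subc :: "bool \<Rightarrow> bool \<Rightarrow> com" where
  "subc sg rv = sumc ;; mov rF1 rT ;;
     IfPos rNEG (clr rLO ;; mov rHI rDD ;; bis_out sg rv)
       (IfPos rN2 (IfPos rP3 (twoc sg rv) Nop) Nop)"

lemma run_twoc:
  assumes St: "St r c1 c2 c3 a d p th" and B: "bounds b p th c1 c2 c3 a d" and c: "c2 < 0" "c3 > 0"
    and s: "c1 + c2 + c3 \<ge> 0" "r rF1 = nat (c1 + c2 + c3)"
    and pos: "\<forall>y\<in>set (sub_ys p th c1 c2 c3 a d). y > 0"
  shows "\<exists>r'. run b (twoc sg rv) (r, inp, out) =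
     Some (r', inp, out @ encode_fractions (map (fraction p sg rv) (sub_ys p th c1 c2 c3 a d))) \<and> keep r' r"
proof -
  note ss = St[unfolded St_def coef_def consts_ok_def]
  note l = St_less[OF St B]
  note BB = boundsD[OF B]
  have c': "nat (- c2) = nat \<bar>c2\<bar>" "nat c3 = nat \<bar>c3\<bar>" using c by auto
  have dm: "2 ^ p < (2::nat) ^ b" "th < 2 ^ b" using BB(14,15) by linarith+
  have rA: "r rA = a" "r rN2 = nat (- c2)" "r rD = d" "r rP3 = nat c3" using ss by simp_all
  have m1: "r rA * (4 * r rN2) < 2 ^ b" "r rA < 2 ^ b" "r rN2 < 2 ^ b"
    using BB(10) l(4,7) unfolding rA c' by - (simp add: mult_ac, linarith+)
  obtain r1 where r1: "run b (mulc rA rN2) (r, inp, out) = Some (r1, inp, out)" "r1 rACC = a * nat (- c2)"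
     "\<forall>i. i \<notin> {rACC, rV, rX} \<longrightarrow> r1 i = r i"
    using run_mulc[of rA rN2 r b inp out] m1 unfolding rA by auto
  let ?r1 = "r1(rAA := a * nat (- c2))"
  have rD: "?r1 rD = d" "?r1 rP3 = nat c3" using rA r1(3) by simp_all
  have m2: "?r1 rD * (4 * ?r1 rP3) < 2 ^ b" "?r1 rD < 2 ^ b" "?r1 rP3 < 2 ^ b"
    using BB(11) l(5,8) unfolding rD unfolding rA c' by - (simp add: mult_ac, linarith+)
  obtain r2 where r2: "run b (mulc rD rP3) (?r1, inp, out) = Some (r2, inp, out)" "r2 rACC = d * nat c3"
     "\<forall>i. i \<notin> {rACC, rV, rX} \<longrightarrow> r2 i = ?r1 i"
    using run_mulc[of rD rP3 ?r1 b inp out] m2 unfolding rD by auto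
  define r3 where "r3 = r2(rDB := d * nat c3, rPOS := d * nat c3 - a * nat (- c2))"
  have r3: "St r3 c1 c2 c3 a d p th" "r3 rAA = a * nat (- c2)" "r3 rDB = d * nat c3" "r3 rF1 = r rF1" "keep r3 r"
    "r3 rPOS = d * nat c3 - a * nat (- c2)"
    using r1(3) r2(3) by (auto simp: r3_def keep_def intro!: St_keep[OF St])
  have ab: "a * nat (- c2) < 2 ^ b" "d * nat c3 < 2 ^ b" using BB(10,11) unfolding c' by linarith+
  let ?cont = "IfPos rPOS (minc ;; IfPos rT Nop (IfPos rNEG
        (clr rLO ;; mov rHI rYS ;; bis_out sg rv ;;
          IfPos rF1 (mov rLO rYS ;; mov rHI rDD ;; bis_out_neg sg rv) Nop)
        (mov rLO rYS ;; outc sg rv))) Nop"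
  have start: "run b (twoc sg rv) (r, inp, out) = run b ?cont (r3, inp, out)"
    using r1(1,2) r2 ab by (simp add: twoc_def r3_def del: run.simps(10))
  have cond: "r3 rPOS > 0 \<longleftrightarrow> int a * (- c2) < int d * c3"
  proof -
    have "int (a * nat (- c2)) = int a * (- c2)" "int (d * nat c3) = int d * c3" using c by simp_all
    then show ?thesis unfolding r3(6) by linarith
  qed
  show ?thesis
  proof (cases "int a * (- c2) < int d * c3")
    case False
    then have "sub_ys p th c1 c2 c3 a d = []" using s by (simp add: sub_ys_def)
    moreover have "run b ?cont (r3, inp, out) = Some (r3, inp, out)" using cond False by simp
    ultimately show ?thesis using start r3(5) by (simp add: encode_fractions_def encode_ints_def)
  next
    case True
    let ?y = "min_y p c2 c3 a d"
    let ?v = "evi p c1 c2 c3 a d ?y"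
    obtain r4 where r4: "run b minc (r3, inp, out) = Some (r4, inp, out)" "r4 rYS = ?y"
     "r4 rT = nat (?v - int th)" "r4 rNEG = nat (- ?v - int th)" "r4 rF1 = r3 rF1" "keep r4 r3"
      using run_minc[OF r3(1) B c r3(2,3), of inp out] by blast
    have k4: "keep r4 r" using keep_trans[OF r4(6) r3(5)] .
    have St4: "St r4 c1 c2 c3 a d p th" by (rule St_keep[OF St k4])
    have ylt: "?y < 2 ^ p" unfolding min_y_def bisi_def by (rule bis_less) simp
    have yb: "?y < 2 ^ b" using ylt dm(1) by linarith
    have DD: "r4 rDD = 2 ^ p" using St4 by (simp add: St_def consts_ok_def)
    have sub: "sub_ys p th c1 c2 c3 a d = (if ?v > int th then []
            else if ?v < - int th then bisi p c1 c2 c3 a d 0 ?y #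
              (if c1 + c2 + c3 > 0 then [bisi p (- c1) (- c2) (- c3) a d ?y (2 ^ p)] else [])
            else [?y])"
      using True s c unfolding sub_ys_def by (simp add: Let_def min_y_def)
    consider "?v > int th" | "?v < - int th" | "\<not> ?v > int th" "\<not> ?v < - int th" by linarith
    then show ?thesis
    proof cases
      case 1
      then have "run b ?cont (r3, inp, out) = Some (r4, inp, out)" using cond True r4 by simp
      then show ?thesis using start k4 1 sub by (simp add: encode_fractions_def encode_ints_def)
    next
      case 3
      then have sub3: "sub_ys p th c1 c2 c3 a d = [?y]" using sub by simp
      then have "?y > 0" using pos by simp
      then have "run b (outc sg rv) (r4(rLO := ?y), inp, out) =
        Some (r4(rLO := ?y), inp, out @ encode_fractions [fraction p sg rv ?y])"
        using run_outc[of "r4(rLO := ?y)" p b sg rv inp out] DD by simp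
      then have "run b ?cont (r3, inp, out) = Some (r4(rLO := ?y), inp, out @ encode_fractions [fraction p sg rv ?y])"
        using cond True r4 3 yb by simp
      moreover have "keep (r4(rLO := ?y)) r" using k4 by (simp add: keep_def)
      ultimately show ?thesis using start sub3 by auto
    next
      case 2
      let ?y1 = "bisi p c1 c2 c3 a d 0 ?y"
      let ?r5 = "r4(rLO := 0, rHI := ?y)"
      have St5: "St ?r5 c1 c2 c3 a d p th" by (rule St_keep[OF St4]) (simp add: keep_def)
      have y1: "?y1 > 0" using pos sub 2 by simp
      obtain r6 where r6: "run b (bis_out sg rv) (?r5, inp, out) =
         Some (r6, inp, out @ encode_fractions [fraction p sg rv ?y1])" "agree r6 ?r5"
        using run_bis_out[OF St5 B, of sg rv inp out] ylt y1 by auto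
      have k6: "keep r6 r" using r6(2) k4 by (auto simp: agree_def keep_def)
      have q6: "r6 rF1 = nat (c1 + c2 + c3)" "r6 rYS = ?y" "r6 rDD = 2 ^ p"
        using r6(2) r4(2,5) r3(4) s(2) DD by (simp_all add: agree_def)
      show ?thesis
      proof (cases "c1 + c2 + c3 > 0")
        case False
        then have "run b ?cont (r3, inp, out) = Some (r6, inp, out @ encode_fractions [fraction p sg rv ?y1])"
          using cond True r4 2 yb r6(1) q6 by simp
        then show ?thesis using start k6 2 sub False by simp
      next
        case T: True
        let ?y2 = "bisi p (- c1) (- c2) (- c3) a d ?y (2 ^ p)"
        let ?r7 = "r6(rLO := ?y, rHI := 2 ^ p)"
        let ?out = "out @ encode_fractions [fraction p sg rv ?y1]"
        have St7: "St ?r7 c1 c2 c3 a d p th" by (rule St_keep[OF St]) (use k6 in \<open>simp add: keep_def\<close>)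
        have y2: "?y2 > 0" using pos sub 2 T by simp
        obtain r8 where r8: "run b (bis_out_neg sg rv) (?r7, inp, ?out) =
           Some (r8, inp, ?out @ encode_fractions [fraction p sg rv ?y2])" "agree r8 ?r7"
          using run_bis_out_neg[OF St7 B, of sg rv inp ?out] ylt y2 by auto
        have "run b ?cont (r3, inp, out) = Some (r8, inp, ?out @ encode_fractions [fraction p sg rv ?y2])"
          using cond True r4 2 yb r6(1) q6 T r8(1) dm(1) by simp
        moreover have "keep r8 r" using r8(2) k6 by (auto simp: agree_def keep_def)
        moreover have "encode_fractions [x] @ encode_fractions [z] = encode_fractions [x, z]" for x z
          by (simp add: encode_fractions_append[symmetric])
        ultimately show ?thesis using start 2 sub T by simp
      qed
    qed
  qed
qed

lemma run_subc:
  assumes St: "St r c1 c2 c3 a d p th" and B: "bounds b p th c1 c2 c3 a d"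
    and pos: "\<forall>y\<in>set (sub_ys p th c1 c2 c3 a d). y > 0"
  shows "\<exists>r'. run b (subc sg rv) (r, inp, out) =
     Some (r', inp, out @ encode_fractions (map (fraction p sg rv) (sub_ys p th c1 c2 c3 a d))) \<and> keep r' r"
proof -
  note BB = boundsD[OF B]
  have dm: "2 ^ p < (2::nat) ^ b" using BB(15) by linarith
  obtain r1 where r1: "run b sumc (r, inp, out) = Some (r1, inp, out)" "r1 rT = nat (c1 + c2 + c3)"
     "r1 rNEG = nat (- (c1 + c2 + c3))" "keep r1 r"
    using run_sumc[OF St B, of inp out] by blast
  let ?r2 = "r1(rF1 := r1 rT)"
  have k2: "keep ?r2 r" using r1(4) by (simp add: keep_def)
  have St2: "St ?r2 c1 c2 c3 a d p th" by (rule St_keep[OF St k2])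
  have tb: "r1 rT < 2 ^ b"
  proof -
    have "nat (c1 + c2 + c3) \<le> nat \<bar>c1\<bar> + nat \<bar>c2\<bar> + nat \<bar>c3\<bar>" by linarith
    then show ?thesis using BB(7-9) unfolding r1(2) by linarith
  qed
  let ?cont = "IfPos rNEG (clr rLO ;; mov rHI rDD ;; bis_out sg rv)
       (IfPos rN2 (IfPos rP3 (twoc sg rv) Nop) Nop)"
  have start: "run b (subc sg rv) (r, inp, out) = run b ?cont (?r2, inp, out)"
    using r1(1) tb by (simp add: subc_def del: run.simps(10))
  have DD: "?r2 rDD = 2 ^ p" "?r2 rN2 = nat (- c2)" "?r2 rP3 = nat c3"
    using St2 by (auto simp: St_def consts_ok_def coef_def)
  show ?thesis
  proof (cases "c1 + c2 + c3 < 0")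
    case True
    let ?r3 = "?r2(rLO := 0, rHI := 2 ^ p)"
    have St3: "St ?r3 c1 c2 c3 a d p th" by (rule St_keep[OF St2]) (simp add: keep_def)
    have sub: "sub_ys p th c1 c2 c3 a d = [bisi p c1 c2 c3 a d 0 (2 ^ p)]" using True by (simp add: sub_ys_def)
    then obtain r4 where r4: "run b (bis_out sg rv) (?r3, inp, out) =
         Some (r4, inp, out @ encode_fractions [fraction p sg rv (bisi p c1 c2 c3 a d 0 (2 ^ p))])" "agree r4 ?r3"
      using run_bis_out[OF St3 B, of sg rv inp out] pos by auto
    have "run b ?cont (?r2, inp, out) =
         Some (r4, inp, out @ encode_fractions [fraction p sg rv (bisi p c1 c2 c3 a d 0 (2 ^ p))])"
      using r1(3) True DD dm r4(1) by simp
    moreover have "keep r4 r" using r4(2) k2 by (auto simp: agree_def keep_def)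
    ultimately show ?thesis using start sub by simp
  next
    case False
    show ?thesis
    proof (cases "c2 < 0 \<and> c3 > 0")
      case True
      have "?r2 rF1 = nat (c1 + c2 + c3)" using r1(2) by simp
      then obtain r3 where r3: "run b (twoc sg rv) (?r2, inp, out) =
         Some (r3, inp, out @ encode_fractions (map (fraction p sg rv) (sub_ys p th c1 c2 c3 a d)))" "keep r3 ?r2"
        using run_twoc[OF St2 B _ _ _ _ pos, of sg rv inp out] True False by auto
      have "run b ?cont (?r2, inp, out) = run b (twoc sg rv) (?r2, inp, out)"
        using r1(3) False DD(2,3) True by simp
      then show ?thesis using start r3 keep_trans[OF r3(2) k2] by auto
    next
      case F: False
      then have "sub_ys p th c1 c2 c3 a d = []" using False by (auto simp: sub_ys_def)
      moreover have "run b ?cont (?r2, inp, out) = Some (?r2, inp, out)"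
        using r1(3) False DD(2,3) F by auto
      ultimately show ?thesis using start k2 by (auto simp: encode_fractions_def encode_ints_def)
    qed
  qed
qed

text \<open>
  Multiplication of the trinomial by the sign of its constant coefficient \<open>c\<close>.
\<close>

definition flip :: "int \<Rightarrow> int \<Rightarrow> int" where
  "flip c x = (if c < 0 then - x else x)"

definition nsub :: "nat \<Rightarrow> nat \<Rightarrow> int \<Rightarrow> int \<Rightarrow> int \<Rightarrow> nat \<Rightarrow> nat \<Rightarrow> nat list" where
  "nsub p th c1 c2 c3 a d = sub_ys p th (flip c1 c1) (flip c1 c2) (flip c1 c3) a d"

definition normc :: com where
  "normc = IfPos rN1 (swap rP1 rN1 ;; swap rP2 rN2 ;; swap rP3 rN3) Nop"

definition revc :: com where
  "revc = swap rP1 rP3 ;; swap rN1 rN3 ;; mov rT rD ;; Sub rT rA ;; mov rA rT"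

definition negc :: com where
  "negc = IfOdd rA (swap rP2 rN2) Nop ;; IfOdd rD (swap rP3 rN3) Nop"

definition onec :: "bool \<Rightarrow> com" where
  "onec sg = sumc ;; Add rT rNEG ;; IfPos rT Nop
     ((if sg then Emit 3 else Nop) ;; Put rONE ;; Emit 4 ;; Put rONE ;; Emit 4)"

definition halfc :: "bool \<Rightarrow> com" where
  "halfc sg = onec sg ;; normc ;; subc sg False ;; revc ;; normc ;; subc sg True ;; revc"

lemma bounds_flip: "bounds b p th (flip e c1) (flip e c2) (flip e c3) a d = bounds b p th c1 c2 c3 a d"
  by (simp add: bounds_def flip_def)

lemma bounds_rev: "bounds b p th c1 c2 c3 a d \<Longrightarrow> 0 < a \<Longrightarrow> bounds b p th c3 c2 c1 (d - a) d"
  unfolding bounds_def by auto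

lemma run_normc:
  assumes St: "St r c1 c2 c3 a d p th" and B: "bounds b p th c1 c2 c3 a d"
  shows "\<exists>r'. run b normc (r, inp, out) = Some (r', inp, out) \<and>
    St r' (flip c1 c1) (flip c1 c2) (flip c1 c3) a d p th"
proof (cases "c1 < 0")
  case False
  then have "r rN1 = 0" using St by (simp add: St_def coef_def)
  then show ?thesis using False St by (simp add: normc_def flip_def)
next
  case True
  note l = St_less[OF St B]
  have less: "r rP1 < 2 ^ b" "r rN1 < 2 ^ b" "r rP2 < 2 ^ b" "r rN2 < 2 ^ b" "r rP3 < 2 ^ b" "r rN3 < 2 ^ b"
    using l(1-6) by linarith+
  have "r rN1 > 0" using St True by (simp add: St_def coef_def)
  then have "run b normc (r, inp, out) = Some (r(rP1 := r rN1, rN1 := r rP1, rP2 := r rN2, rN2 := r rP2,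
     rP3 := r rN3, rN3 := r rP3, rT := r rP3), inp, out)"
    using less by (simp add: normc_def run_swap fun_upd_twist)
  moreover have "St (r(rP1 := r rN1, rN1 := r rP1, rP2 := r rN2, rN2 := r rP2,
     rP3 := r rN3, rN3 := r rP3, rT := r rP3)) (flip c1 c1) (flip c1 c2) (flip c1 c3) a d p th"
    using St True by (simp add: St_def coef_def consts_ok_def flip_def)
  ultimately show ?thesis by blast
qed

lemma run_revc:
  assumes St: "St r c1 c2 c3 a d p th" and B: "bounds b p th c1 c2 c3 a d"
  shows "\<exists>r'. run b revc (r, inp, out) = Some (r', inp, out) \<and> St r' c3 c2 c1 (d - a) d p th"
proof -
  note l = St_less[OF St B]
  have less: "r rP1 < 2 ^ b" "r rN1 < 2 ^ b" "r rP3 < 2 ^ b" "r rN3 < 2 ^ b" "r rD < 2 ^ b" "r rD - r rA < 2 ^ b"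
    using l(1,2,5,6,8) by linarith+
  have "run b revc (r, inp, out) = Some (r(rP1 := r rP3, rN1 := r rN3,
     rP3 := r rP1, rN3 := r rN1, rT := r rD - r rA, rA := r rD - r rA), inp, out)"
    using less by (simp add: revc_def run_swap fun_upd_twist)
  moreover have "St (r(rP1 := r rP3, rN1 := r rN3,
     rP3 := r rP1, rN3 := r rN1, rT := r rD - r rA, rA := r rD - r rA)) c3 c2 c1 (d - a) d p th"
    using St by (simp add: St_def coef_def consts_ok_def)
  ultimately show ?thesis by blast
qed

lemma run_negc:
  assumes St: "St r c1 c2 c3 a d p th" and B: "bounds b p th c1 c2 c3 a d"
  shows "\<exists>r'. run b negc (r, inp, out) = Some (r', inp, out) \<and>
    St r' c1 ((- 1) ^ a * c2) ((- 1) ^ d * c3) a d p th"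
proof -
  note l = St_less[OF St B]
  have less: "r rP2 < 2 ^ b" "r rN2 < 2 ^ b" "r rP3 < 2 ^ b" "r rN3 < 2 ^ b"
    using l(3-6) by linarith+
  have ad: "r rA = a" "r rD = d" using St by (auto simp: St_def)
  show ?thesis
    using less St
    by (cases "odd a"; cases "odd d")
      (simp_all add: negc_def run_swap ad St_def coef_def consts_ok_def)
qed

definition one_root :: "bool \<Rightarrow> int \<Rightarrow> (int \<times> int) list" where
  "one_root sg s = (if s = 0 then [(if sg then - 1 else 1, 1)] else [])"

lemma run_onec:
  assumes St: "St r c1 c2 c3 a d p th" and B: "bounds b p th c1 c2 c3 a d"
  shows "\<exists>r'. run b (onec sg) (r, inp, out) =
      Some (r', inp, out @ encode_fractions (one_root sg (c1 + c2 + c3))) \<and> keep r' r"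
proof -
  obtain r1 where r1: "run b sumc (r, inp, out) = Some (r1, inp, out)" "r1 rT = nat (c1 + c2 + c3)"
     "r1 rNEG = nat (- (c1 + c2 + c3))" "keep r1 r"
    using run_sumc[OF St B, of inp out] by blast
  have "nat (c1 + c2 + c3) + nat (- (c1 + c2 + c3)) \<le> nat \<bar>c1\<bar> + nat \<bar>c2\<bar> + nat \<bar>c3\<bar>" by linarith
  then have tb: "nat (c1 + c2 + c3) + nat (- (c1 + c2 + c3)) < 2 ^ b" using boundsD(7-9)[OF B] by linarith
  let ?r = "r1(rT := nat (c1 + c2 + c3) + nat (- (c1 + c2 + c3)))"
  have one: "?r rONE = 1" using r1(4) St by (simp add: keep_def St_def consts_ok_def)
  have "run b (onec sg) (r, inp, out) = Some (?r, inp, out @ encode_fractions (one_root sg (c1 + c2 + c3)))"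
  proof (cases "c1 + c2 + c3 = 0")
    case True
    then show ?thesis using r1(1-3) tb one
      by (simp add: onec_def one_root_def encode_fractions_def encode_ints_def encode_int_def binary_bits
          binary.simps bits_pos)
  next
    case False
    then have "?r rT > 0" by auto
    then show ?thesis using r1(1-3) tb False
      by (simp add: onec_def one_root_def encode_fractions_def encode_ints_def)
  qed
  moreover have "keep ?r r" using r1(4) by (simp add: keep_def)
  ultimately show ?thesis by blast
qed

definition half_fr :: "bool \<Rightarrow> nat \<Rightarrow> nat \<Rightarrow> int \<Rightarrow> int \<Rightarrow> int \<Rightarrow> nat \<Rightarrow> nat \<Rightarrow> (int \<times> int) list" where
  "half_fr sg p th c1 c2 c3 a d = one_root sg (c1 + c2 + c3) @
     map (fraction p sg False) (nsub p th c1 c2 c3 a d) @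
     map (fraction p sg True) (nsub p th c3 c2 c1 (d - a) d)"

lemma flip_flip: "c3 \<noteq> 0 \<Longrightarrow> flip (flip c1 c3) (flip c1 x) = flip c3 x"
  by (auto simp: flip_def)

text \<open>
  The coefficients are reversed twice and normalized in between, so at the end they are the
  original ones up to a common sign, which does not affect the roots.
\<close>

lemma run_halfc:
  assumes St: "St r c1 c2 c3 a d p th" and B: "bounds b p th c1 c2 c3 a d"
    and c: "c1 \<noteq> 0" "c3 \<noteq> 0" "0 < a"
    and pos: "\<forall>y\<in>set (nsub p th c1 c2 c3 a d) \<union> set (nsub p th c3 c2 c1 (d - a) d). y > 0"
  shows "\<exists>r'. run b (halfc sg) (r, inp, out) =
      Some (r', inp, out @ encode_fractions (half_fr sg p th c1 c2 c3 a d)) \<and>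
      St r' (flip c3 c1) (flip c3 c2) (flip c3 c3) a d p th"
proof -
  have ad: "a < d" by (rule boundsD(12)[OF B])
  obtain r1 where r1: "run b (onec sg) (r, inp, out) =
      Some (r1, inp, out @ encode_fractions (one_root sg (c1 + c2 + c3)))" "keep r1 r"
    using run_onec[OF St B, of sg inp out] by blast
  let ?o1 = "out @ encode_fractions (one_root sg (c1 + c2 + c3))"
  obtain r2 where r2: "run b normc (r1, inp, ?o1) = Some (r2, inp, ?o1)"
    "St r2 (flip c1 c1) (flip c1 c2) (flip c1 c3) a d p th"
    using run_normc[OF St_keep[OF St r1(2)] B, of inp ?o1] by blast
  have B2: "bounds b p th (flip c1 c1) (flip c1 c2) (flip c1 c3) a d" using B by (simp add: bounds_flip)
  let ?o2 = "?o1 @ encode_fractions (map (fraction p sg False) (nsub p th c1 c2 c3 a d))"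
  obtain r3 where r3: "run b (subc sg False) (r2, inp, ?o1) = Some (r3, inp, ?o2)" "keep r3 r2"
    using run_subc[OF r2(2) B2, of sg False inp ?o1] pos unfolding nsub_def by auto
  obtain r4 where r4: "run b revc (r3, inp, ?o2) = Some (r4, inp, ?o2)"
    "St r4 (flip c1 c3) (flip c1 c2) (flip c1 c1) (d - a) d p th"
    using run_revc[OF St_keep[OF r2(2) r3(2)] B2, of inp ?o2] by blast
  have B4: "bounds b p th (flip c1 c3) (flip c1 c2) (flip c1 c1) (d - a) d"
    by (rule bounds_rev[OF B2 c(3)])
  obtain r5 where r5: "run b normc (r4, inp, ?o2) = Some (r5, inp, ?o2)"
    "St r5 (flip c3 c3) (flip c3 c2) (flip c3 c1) (d - a) d p th"
    using run_normc[OF r4(2) B4, of inp ?o2] unfolding flip_flip[OF c(2)] by blast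
  have B5: "bounds b p th (flip c3 c3) (flip c3 c2) (flip c3 c1) (d - a) d"
    using bounds_rev[OF B c(3)] by (simp add: bounds_flip)
  let ?o3 = "?o2 @ encode_fractions (map (fraction p sg True) (nsub p th c3 c2 c1 (d - a) d))"
  obtain r6 where r6: "run b (subc sg True) (r5, inp, ?o2) = Some (r6, inp, ?o3)" "keep r6 r5"
    using run_subc[OF r5(2) B5, of sg True inp ?o2] pos unfolding nsub_def by auto
  obtain r7 where r7: "run b revc (r6, inp, ?o3) = Some (r7, inp, ?o3)"
    "St r7 (flip c3 c1) (flip c3 c2) (flip c3 c3) (d - (d - a)) d p th"
    using run_revc[OF St_keep[OF r5(2) r6(2)] B5, of inp ?o3] by blast
  have "run b (halfc sg) (r, inp, out) = Some (r7, inp, ?o3)"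
    using r1(1) r2(1) r3(1) r4(1) r5(1) r6(1) r7(1) by (simp add: halfc_def)
  then show ?thesis using r7(2) ad by (simp add: half_fr_def encode_fractions_append)
qed

section \<open>The complete program\<close>

definition pushn :: "nat \<Rightarrow> nat \<Rightarrow> com" where
  "pushn K i = ((\<lambda>c. Push True i ;; c) ^^ K) Nop"

lemma run_pushn:
  "(r i + 1) * 2 ^ K \<le> 2 ^ b \<Longrightarrow> run b (pushn K i) (r, inp, out) = Some (r(i := (r i + 1) * 2 ^ K - 1), inp, out)"
proof (induction K arbitrary: r)
  case (Suc K)
  have le: "(2 * r i + 2) * 2 ^ K \<le> 2 ^ b" using Suc.prems by (simp add: algebra_simps)
  have "(2 * r i + 2) * 1 \<le> (2 * r i + 2) * 2 ^ K" by (intro mult_left_mono) auto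
  then have "2 * r i + 2 \<le> (2 * r i + 2) * 2 ^ K" by (simp only: mult_1_right)
  from order.trans[OF this le] have "2 * r i + 1 < 2 ^ b" by simp
  moreover have v: "(r(i := 2 * r i + 1)) i + 1 = 2 * r i + 2" by simp
  have "run b (pushn K i) (r(i := 2 * r i + 1), inp, out) =
      Some (r(i := (2 * r i + 2) * 2 ^ K - 1), inp, out)"
    using Suc.IH[of "r(i := 2 * r i + 1)", unfolded v, OF le] by (simp only: fun_upd_upd)
  moreover have "(2 * r i + 2) * 2 ^ K = (r i + 1) * 2 ^ Suc K" by (simp add: algebra_simps)
  ultimately show ?case by (simp add: pushn_def fun_eq_iff mult_ac)
qed (simp add: pushn_def)

text \<open>
  Appends \<open>K\<close> ones to register \<open>i\<close> for each bit of register \<open>j\<close>; with \<open>K = 24\<close> for \<open>d\<close> and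
  for \<open>H\<close> this gives \<open>2 ^ p - 1\<close>, and with \<open>K = 22\<close> the threshold.
\<close>

definition onesc :: "nat \<Rightarrow> nat \<Rightarrow> nat \<Rightarrow> com" where
  "onesc K i j = mov rCNT j ;; Loop rCNT (pushn K i)"

definition bl :: "nat \<Rightarrow> nat" where
  "bl n = length (bits n)"

lemma run_onesc:
  assumes "i \<noteq> rCNT" "i \<noteq> j" "j \<noteq> rCNT" "r j < 2 ^ b" "r i = 2 ^ m - 1" "m + K * bl (r j) \<le> b"
  shows "run b (onesc K i j) (r, inp, out) = Some (r(i := 2 ^ (m + K * bl (r j)) - 1, rCNT := 0), inp, out)"
proof -
  let ?I = "\<lambda>n s. s = (r(i := 2 ^ (m + K * n) - 1, rCNT := r j div 2 ^ n), inp, out)"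
  have "\<exists>s'. iter (run b (pushn K i)) rCNT (bl (r j)) (r(rCNT := r j), inp, out) = Some s' \<and> ?I (bl (r j)) s'"
  proof (rule iter_invariant[where I = ?I])
    fix n s assume n: "n < bl (r j)" and s: "?I n s"
    let ?r = "r(i := 2 ^ (m + K * n) - 1, rCNT := r j div 2 ^ n)"
    have "m + K * Suc n \<le> m + K * bl (r j)" using mult_le_mono2[of "Suc n" "bl (r j)" K] n by simp
    then have "m + K * Suc n \<le> b" using assms(6) by linarith
    then have "(2::nat) ^ (m + K * Suc n) \<le> 2 ^ b" by simp
    moreover have e: "(2 ^ (m + K * n) - 1 + 1) * 2 ^ K = (2::nat) ^ (m + K * Suc n)"
      by (simp add: power_add algebra_simps)
    ultimately have "run b (pushn K i) (?r, inp, out) = Some (?r(i := 2 ^ (m + K * Suc n) - 1), inp, out)"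
      using run_pushn[of ?r i K b inp out] assms(1) by simp
    then show "\<exists>ra inp' out'. run b (pushn K i) s = Some (ra, inp', out') \<and>
            ra rCNT = fst s rCNT \<and> ?I (Suc n) (ra(rCNT := ra rCNT div 2), inp', out')"
      using s assms(1) by (auto simp: fun_upd_twist div_mult2_eq[symmetric] mult.commute)
  qed (use assms in \<open>simp add: fun_eq_iff\<close>)
  moreover have "r j div 2 ^ bl (r j) = 0" using less_length_bits[of "r j"] by (simp add: bl_def)
  ultimately show ?thesis using assms by (simp add: onesc_def bl_def)
qed

definition getc :: com where
  "getc = Get rP1 rN1 ;; Get rP2 rN2 ;; Get rP3 rN3 ;; Get rA rZ ;; Get rD rZ ;; Get rH rZ"

definition setupc :: com where
  "setupc = getc ;; onesc 24 rE rD ;; onesc 24 rE rH ;; onesc 22 rTH rD ;; onesc 22 rTH rH ;;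
     Push True rONE ;; mov rDD rE ;; Add rDD rONE"

definition mainc :: com where
  "mainc = setupc ;; halfc False ;; negc ;; halfc True"

definition size_of :: "nat \<Rightarrow> nat \<Rightarrow> nat" where
  "size_of d H = bl d + bl H"

lemma run_setupc:
  assumes c: "c1 \<noteq> 0" "c2 \<noteq> 0" "c3 \<noteq> 0" "0 < a" "0 < d" "0 < H"
    and b: "nat \<bar>c1\<bar> < 2 ^ b" "nat \<bar>c2\<bar> < 2 ^ b" "nat \<bar>c3\<bar> < 2 ^ b" "a < 2 ^ b" "d < 2 ^ b" "H < 2 ^ b"
      "24 * size_of d H < b"
  shows "\<exists>r'. run b setupc (\<lambda>_. 0, [c1, c2, c3, int a, int d, int H], []) = Some (r', [], []) \<and>
    St r' c1 c2 c3 a d (24 * size_of d H) (2 ^ (22 * size_of d H) - 1)"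
proof -
  let ?r0 = "\<lambda>_. 0 :: nat"
  let ?r1 = "?r0(rP1 := nat c1, rN1 := nat (- c1), rP2 := nat c2, rN2 := nat (- c2),
     rP3 := nat c3, rN3 := nat (- c3), rA := a, rD := d, rH := H)"
  have g: "run b getc (?r0, [c1, c2, c3, int a, int d, int H], []) = Some (?r1, [], [])"
    using c b by (cases "c1 < 0"; cases "c2 < 0"; cases "c3 < 0") (simp_all add: getc_def fun_eq_iff)
  let ?h = "size_of d H"
  have h: "24 * bl d + 24 * bl H < b" "22 * bl d + 22 * bl H < b" using b(7) by (simp_all add: size_of_def)
  let ?e = "(2 :: nat) ^ (24 * ?h)"
  let ?t = "(2 :: nat) ^ (22 * ?h) - 1"
  let ?r2 = "?r1(rE := 2 ^ (24 * bl d) - 1, rCNT := 0)"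
  have s2: "run b (onesc 24 rE rD) (?r1, [], []) = Some (?r2, [], [])"
    using run_onesc[of rE rD ?r1 b 0 24 "[]" "[]"] b h by simp
  let ?r3 = "?r2(rE := ?e - 1, rCNT := 0)"
  have s3: "run b (onesc 24 rE rH) (?r2, [], []) = Some (?r3, [], [])"
    using run_onesc[of rE rH ?r2 b "24 * bl d" 24 "[]" "[]"] b h by (simp add: size_of_def add_mult_distrib2)
  let ?r4 = "?r3(rTH := 2 ^ (22 * bl d) - 1, rCNT := 0)"
  have s4: "run b (onesc 22 rTH rD) (?r3, [], []) = Some (?r4, [], [])"
    using run_onesc[of rTH rD ?r3 b 0 22 "[]" "[]"] b h by simp
  let ?r5 = "?r4(rTH := ?t, rCNT := 0)"
  have s5: "run b (onesc 22 rTH rH) (?r4, [], []) = Some (?r5, [], [])"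
    using run_onesc[of rTH rH ?r4 b "22 * bl d" 22 "[]" "[]"] b h by (simp add: size_of_def add_mult_distrib2)
  let ?r6 = "?r5(rONE := 1, rDD := ?e)"
  have eb: "?e < 2 ^ b" using b(7) by simp
  have e1: "?e - Suc 0 < 2 ^ b" using eb by linarith
  have b1: "1 < (2::nat) ^ b" using eb by (metis le_less_trans one_le_numeral one_le_power)
  have "run b (Push True rONE ;; mov rDD rE ;; Add rDD rONE) (?r5, [], []) = Some (?r6, [], [])"
    using eb b1 e1 by (simp add: fun_upd_twist)
  then have "run b setupc (?r0, [c1, c2, c3, int a, int d, int H], []) = Some (?r6, [], [])"
    using g s2 s3 s4 s5 by (simp only: setupc_def run.simps bind.simps bind_eq_Some_conv)
  moreover have "St ?r6 c1 c2 c3 a d (24 * ?h) ?t"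
    by (simp add: St_def coef_def consts_ok_def)
  ultimately show ?thesis by blast
qed

definition all_fr :: "nat \<Rightarrow> nat \<Rightarrow> int \<Rightarrow> int \<Rightarrow> int \<Rightarrow> nat \<Rightarrow> nat \<Rightarrow> (int \<times> int) list" where
  "all_fr p th c1 c2 c3 a d = half_fr False p th c1 c2 c3 a d @
     half_fr True p th c1 ((- 1) ^ a * c2) ((- 1) ^ d * c3) a d"

lemma nsub_flip: "c1 \<noteq> 0 \<Longrightarrow> nsub p th (flip e c1) (flip e c2) (flip e c3) a d = nsub p th c1 c2 c3 a d"
  by (auto simp: nsub_def flip_def)

lemma half_fr_flip:
  "c1 \<noteq> 0 \<Longrightarrow> c3 \<noteq> 0 \<Longrightarrow> half_fr sg p th (flip e c1) (flip e c2) (flip e c3) a d = half_fr sg p th c1 c2 c3 a d"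
proof -
  assume "c1 \<noteq> 0" "c3 \<noteq> 0"
  moreover have "flip e c1 + flip e c2 + flip e c3 = 0 \<longleftrightarrow> c1 + c2 + c3 = 0"
    by (cases "e < 0") (auto simp: flip_def)
  ultimately show ?thesis by (simp add: half_fr_def nsub_flip one_root_def)
qed

text \<open>
  Fractions with numerator or denominator 0 would not be written correctly. That bisection
  never stops at 0 follows later from the properties of the trinomial.
\<close>

definition all_pos :: "nat \<Rightarrow> nat \<Rightarrow> int \<Rightarrow> int \<Rightarrow> int \<Rightarrow> nat \<Rightarrow> nat \<Rightarrow> bool" where
  "all_pos p th c1 c2 c3 a d \<longleftrightarrow>
    (\<forall>y\<in>set (nsub p th c1 c2 c3 a d) \<union> set (nsub p th c3 c2 c1 (d - a) d). y > 0)"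

lemma run_mainc:
  assumes c: "c1 \<noteq> 0" "c2 \<noteq> 0" "c3 \<noteq> 0" "0 < a" "a < d" "nat \<bar>c1\<bar> \<le> H" "nat \<bar>c2\<bar> \<le> H" "nat \<bar>c3\<bar> \<le> H"
    and p: "p = 24 * size_of d H" "th = 2 ^ (22 * size_of d H) - 1"
    and pos: "all_pos p th c1 c2 c3 a d" "all_pos p th c1 ((- 1) ^ a * c2) ((- 1) ^ d * c3) a d"
  shows "\<exists>r'. run (25 * size_of d H + 2) mainc (\<lambda>_. 0, [c1, c2, c3, int a, int d, int H], []) =
    Some (r', [], encode_fractions (all_fr p th c1 c2 c3 a d))"
proof -
  let ?h = "size_of d H"
  define b where "b = 25 * ?h + 2"
  have H: "H > 0" using c(1,6) by auto
  have dh: "d < 2 ^ bl d" "H < 2 ^ bl H" using less_length_bits by (simp_all add: bl_def)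
  have M: "d * H < 2 ^ ?h" using mult_strict_mono[OF dh] H by (simp add: size_of_def power_add)
  have B: "bounds b p th c1 c2 c3 a d"
    unfolding bounds_def
  proof (intro exI conjI)
    show "1 \<le> d * H" using c(5) H by simp
    have "4 * (d * H * 2 ^ p) < 4 * (2 ^ ?h * 2 ^ p)" using M by simp
    also have "\<dots> = 2 ^ b" by (simp add: b_def p(1) power_add[symmetric] power2_eq_square[symmetric])
    finally show "4 * (d * H * 2 ^ p) < 2 ^ b" .
    show "d \<le> d * H" using H by simp
    show "d * nat \<bar>c1\<bar> \<le> d * H" "d * nat \<bar>c2\<bar> \<le> d * H" "d * nat \<bar>c3\<bar> \<le> d * H" using c by simp_all
    have "th \<le> 2 ^ (22 * ?h)" using p(2) by simp
    also have "\<dots> \<le> 2 ^ p" unfolding p(1) by (intro power_increasing) auto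
    also have "\<dots> \<le> d * H * 2 ^ p" using c(5) H by simp
    finally show "th \<le> d * H * 2 ^ p" .
  qed (rule c)
  have hb: "2 ^ ?h \<le> (2::nat) ^ b" unfolding b_def by (intro power_increasing) auto
  have dH: "d \<le> d * H" "H \<le> d * H" using c(5) H by simp_all
  have less: "nat \<bar>c1\<bar> < 2 ^ b" "nat \<bar>c2\<bar> < 2 ^ b" "nat \<bar>c3\<bar> < 2 ^ b" "a < 2 ^ b" "d < 2 ^ b" "H < 2 ^ b"
    using c dH M hb by linarith+
  have pb: "24 * ?h < b" by (simp add: b_def)
  obtain r1 where r1: "run b setupc (\<lambda>_. 0, [c1, c2, c3, int a, int d, int H], []) = Some (r1, [], [])"
    "St r1 c1 c2 c3 a d p th"
    using run_setupc[OF c(1-4) _ H less pb] c(5) unfolding p by auto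
  let ?o1 = "encode_fractions (half_fr False p th c1 c2 c3 a d)"
  obtain r2 where r2: "run b (halfc False) (r1, [], []) = Some (r2, [], ?o1)"
    "St r2 (flip c3 c1) (flip c3 c2) (flip c3 c3) a d p th"
    using run_halfc[OF r1(2) B c(1,3,4), of False "[]" "[]"] pos(1) unfolding all_pos_def by auto
  let ?s = "(- 1) ^ a * c2" and ?t = "(- 1) ^ d * c3"
  have B2: "bounds b p th (flip c3 c1) (flip c3 c2) (flip c3 c3) a d" using B by (simp add: bounds_flip)
  obtain r3 where r3: "run b negc (r2, [], ?o1) = Some (r3, [], ?o1)"
    "St r3 (flip c3 c1) ((- 1) ^ a * flip c3 c2) ((- 1) ^ d * flip c3 c3) a d p th"
    using run_negc[OF r2(2) B2, of "[]" ?o1] by blast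
  have fl: "(- 1) ^ k * flip e x = flip e ((- 1) ^ k * x)" for k e x by (simp add: flip_def)
  have ab: "\<bar>(- 1) ^ k * x\<bar> = \<bar>x\<bar>" for k and x :: int by (simp add: abs_mult power_abs)
  have B3: "bounds b p th (flip c3 c1) (flip c3 ?s) (flip c3 ?t) a d"
    unfolding bounds_flip using B unfolding bounds_def ab .
  have c3: "?t \<noteq> 0" using c(3) by simp
  have fnz: "flip c3 c1 \<noteq> 0" "flip c3 ?t \<noteq> 0" using c(1) c3 by (auto simp: flip_def)
  have pos3: "\<forall>y\<in>set (nsub p th (flip c3 c1) (flip c3 ?s) (flip c3 ?t) a d) \<union>
     set (nsub p th (flip c3 ?t) (flip c3 ?s) (flip c3 c1) (d - a) d). y > 0"
    using pos(2) unfolding all_pos_def nsub_flip[OF c(1)] nsub_flip[OF c3] .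
  obtain r4 where r4: "run b (halfc True) (r3, [], ?o1) =
      Some (r4, [], ?o1 @ encode_fractions (half_fr True p th (flip c3 c1) (flip c3 ?s) (flip c3 ?t) a d))"
    using run_halfc[OF r3(2)[unfolded fl] B3 fnz c(4) pos3, of True "[]" ?o1] by auto
  have "run b mainc (\<lambda>_. 0, [c1, c2, c3, int a, int d, int H], []) =
    Some (r4, [], encode_fractions (all_fr p th c1 c2 c3 a d))"
    using r1(1) r2(1) r3(1) r4 half_fr_flip[OF c(1) c3]
    by (simp add: mainc_def all_fr_def encode_fractions_append)
  then show ?thesis unfolding b_def by blast
qed

lemma okc_pushn: "is_reg i \<Longrightarrow> okc (pushn K i)"
  by (induction K) (simp_all add: pushn_def)

lemma depth_pushn: "depth (pushn K i) = 1"
  by (induction K) (simp_all add: pushn_def)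

lemmas program_defs = mainc_def setupc_def getc_def onesc_def halfc_def onec_def sumc_def normc_def revc_def
  negc_def swap_def subc_def twoc_def minc_def mulc_def bis_out_def bis_out_neg_def outc_def bisc_def
  evalc_def shiftc_def fmulc_def mov_def clr_def
  tr1_def tr2_def tr3_def tn1_def tn2_def tn3_def td1_def td2_def td3_def

lemma okc_mainc: "okc mainc"
  by (simp add: program_defs okc_pushn is_reg_def ntapes_def)

lemma depth_mainc: "depth mainc = 4"
  by (simp add: program_defs depth_pushn)

lemma compile_mainc: "compile mainc \<noteq> PSkip"
  by (simp add: mainc_def)

theorem root_finding_machine:
  obtains M C where "valid_tm M"
    and "\<And>c1 c2 c3 a d H p th. \<lbrakk>c1 \<noteq> 0; c2 \<noteq> 0; c3 \<noteq> 0; 0 < a; a < d;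
        nat \<bar>c1\<bar> \<le> H; nat \<bar>c2\<bar> \<le> H; nat \<bar>c3\<bar> \<le> H;
        p = 24 * size_of d H; th = 2 ^ (22 * size_of d H) - 1;
        all_pos p th c1 c2 c3 a d; all_pos p th c1 ((- 1) ^ a * c2) ((- 1) ^ d * c3) a d\<rbrakk> \<Longrightarrow>
      \<exists>t \<le> C * (25 * size_of d H + 3) ^ 4.
        computes_within M (encode_ints [c1, c2, c3, int a, int d, int H])
          (encode_fractions (all_fr p th c1 c2 c3 a d)) t"
proof -
  obtain M where M: "valid_tm M"
    "\<And>b inp r' inp' out. run b mainc (\<lambda>_. 0, inp, []) = Some (r', inp', out) \<Longrightarrow>
           \<exists>t\<le>cost b mainc. computes_within M (encode_ints inp) out t"
    using program_machine[OF okc_mainc compile_mainc] by blast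
  obtain C where C: "\<And>b. cost b mainc \<le> C * (b + 1) ^ 4"
    using cost_bound[of mainc] unfolding depth_mainc by blast
  show thesis
  proof (rule that[OF M(1), of C])
    fix c1 c2 c3 :: int and a d H p th :: nat
    assume h: "c1 \<noteq> 0" "c2 \<noteq> 0" "c3 \<noteq> 0" "0 < a" "a < d"
        "nat \<bar>c1\<bar> \<le> H" "nat \<bar>c2\<bar> \<le> H" "nat \<bar>c3\<bar> \<le> H"
        "p = 24 * size_of d H" "th = 2 ^ (22 * size_of d H) - 1"
        "all_pos p th c1 c2 c3 a d" "all_pos p th c1 ((- 1) ^ a * c2) ((- 1) ^ d * c3) a d"
    obtain r' where "run (25 * size_of d H + 2) mainc (\<lambda>_. 0, [c1, c2, c3, int a, int d, int H], []) =
        Some (r', [], encode_fractions (all_fr p th c1 c2 c3 a d))"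
      using run_mainc[OF h] by blast
    from M(2)[OF this] obtain t where t: "t \<le> cost (25 * size_of d H + 2) mainc"
      "computes_within M (encode_ints [c1, c2, c3, int a, int d, int H])
          (encode_fractions (all_fr p th c1 c2 c3 a d)) t" by blast
    have e: "25 * size_of d H + 2 + 1 = 25 * size_of d H + 3" by simp
    have "t \<le> C * (25 * size_of d H + 3) ^ 4"
      using order.trans[OF t(1) C[of "25 * size_of d H + 2"]] unfolding e .
    then show "\<exists>t \<le> C * (25 * size_of d H + 3) ^ 4.
        computes_within M (encode_ints [c1, c2, c3, int a, int d, int H])
          (encode_fractions (all_fr p th c1 c2 c3 a d)) t" using t(2) by blast
  qed
qed

section \<open>Quadratic convergence of Newton's method\<close>

lemma taylor_quadratic:
  fixes F F' F'' :: "real \<Rightarrow> real"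
  assumes "\<And>x. (F has_real_derivative F' x) (at x)" "\<And>x. (F' has_real_derivative F'' x) (at x)"
    and M: "\<And>t. min x c \<le> t \<Longrightarrow> t \<le> max x c \<Longrightarrow> \<bar>F'' t\<bar> \<le> M"
  shows "\<bar>F x - F c - F' c * (x - c)\<bar> \<le> M / 2 * (x - c)\<^sup>2"
proof (cases "x = c")
  case False
  let ?diff = "\<lambda>k::nat. if k = 0 then F else if k = 1 then F' else F''"
  have D: "\<forall>m t. m < 2 \<and> min x c \<le> t \<and> t \<le> max x c \<longrightarrow>
      (?diff m has_real_derivative ?diff (Suc m) t) (at t)"
    using assms(1,2) by (auto simp: less_2_cases_iff)
  have "\<exists>t. (if x < c then x < t \<and> t < c else c < t \<and> t < x) \<and>
    F x = (\<Sum>m<2. ?diff m c / fact m * (x - c) ^ m) + ?diff 2 t / fact 2 * (x - c) ^ 2"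
    by (rule Taylor[OF _ _ D]) (use False in auto)
  then obtain t where t: "if x < c then x < t \<and> t < c else c < t \<and> t < x"
    "F x = (\<Sum>m<2. ?diff m c / fact m * (x - c) ^ m) + ?diff 2 t / fact 2 * (x - c) ^ 2"
    by blast
  have eq: "F x - F c - F' c * (x - c) = F'' t * ((x - c)\<^sup>2 / 2)"
    using t(2) by (simp add: numeral_2_eq_2)
  have "\<bar>F'' t\<bar> \<le> M" using t(1) by (intro M) (auto split: if_splits)
  then have "\<bar>F'' t\<bar> * ((x - c)\<^sup>2 / 2) \<le> M * ((x - c)\<^sup>2 / 2)" by (intro mult_right_mono) auto
  then show ?thesis unfolding eq abs_mult by simp
qed simp

lemma derivative_variation:
  fixes F' F'' :: "real \<Rightarrow> real"
  assumes D: "\<And>x. (F' has_real_derivative F'' x) (at x)"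
    and M: "\<And>t. min x c \<le> t \<Longrightarrow> t \<le> max x c \<Longrightarrow> \<bar>F'' t\<bar> \<le> M"
  shows "\<bar>F' x - F' c\<bar> \<le> M * \<bar>x - c\<bar>"
proof -
  consider "x = c" | "x < c" | "c < x" by linarith
  then have "\<exists>t. min x c \<le> t \<and> t \<le> max x c \<and> F' x - F' c = F'' t * (x - c)"
  proof cases
    case 2
    then obtain t where "x < t" "t < c" "F' c - F' x = (c - x) * F'' t" using MVT2[of x c F' F''] D by blast
    then show ?thesis by (intro exI[of _ t]) (auto simp: algebra_simps)
  next
    case 3
    then obtain t where "c < t" "t < x" "F' x - F' c = (x - c) * F'' t" using MVT2[of c x F' F''] D by blast
    then show ?thesis by (intro exI[of _ t]) (auto simp: algebra_simps)
  qed auto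
  then obtain t where t: "min x c \<le> t" "t \<le> max x c" "F' x - F' c = F'' t * (x - c)" by blast
  show ?thesis unfolding t(3) abs_mult using M[OF t(1,2)] by (intro mult_right_mono) auto
qed

text \<open>
  If \<open>F'\<close> varies by at most half of its value at the root on the interval considered, then a
  Newton step maps the error \<open>e\<close> to at most \<open>e\<^sup>2 M / \<bar>F' \<zeta>\<bar>\<close>, which is at most
  \<open>e / 2 \<cdot> e / r\<close>. The claim follows by induction.
\<close>

lemma newton_quadratic:
  fixes F F' F'' :: "real \<Rightarrow> real"
  assumes DF: "\<And>x. (F has_real_derivative F' x) (at x)" "\<And>x. (F' has_real_derivative F'' x) (at x)"
    and root: "F \<zeta> = 0" "F' \<zeta> \<noteq> 0"
    and M: "\<And>t. \<bar>t - \<zeta>\<bar> \<le> r \<Longrightarrow> \<bar>F'' t\<bar> \<le> M" "M * r \<le> \<bar>F' \<zeta>\<bar> / 2" "M \<ge> 0"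
    and z0: "\<bar>z0 - \<zeta>\<bar> \<le> r"
  shows "newton_converges F z0 \<zeta>"
proof -
  have der: "deriv F x = F' x" for x using DF(1) by (rule DERIV_imp_deriv)
  define m where "m = \<bar>F' \<zeta>\<bar>"
  have m: "m > 0" using root(2) by (simp add: m_def)
  have lower: "\<bar>F' x\<bar> \<ge> m / 2" if "\<bar>x - \<zeta>\<bar> \<le> r" for x
  proof -
    have "\<bar>F' x - F' \<zeta>\<bar> \<le> M * \<bar>x - \<zeta>\<bar>"
      by (rule derivative_variation[OF DF(2)]) (use that in \<open>auto intro!: M(1)\<close>)
    also have "\<dots> \<le> M * r" using that M(3) by (intro mult_left_mono)
    finally show ?thesis using M(2) unfolding m_def by linarith
  qed
  have stp: "\<bar>newton F x - \<zeta>\<bar> \<le> M / m * \<bar>x - \<zeta>\<bar>\<^sup>2" if x: "\<bar>x - \<zeta>\<bar> \<le> r" for x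
  proof -
    have l: "\<bar>F' x\<bar> \<ge> m / 2" by (rule lower[OF x])
    then have nz: "F' x \<noteq> 0" using m by auto
    have "\<bar>F \<zeta> - F x - F' x * (\<zeta> - x)\<bar> \<le> M / 2 * (\<zeta> - x)\<^sup>2"
      by (rule taylor_quadratic[OF DF]) (use x in \<open>auto intro!: M(1)\<close>)
    then have "\<bar>F \<zeta> - F x - F' x * (\<zeta> - x)\<bar> / \<bar>F' x\<bar> \<le> (M / 2 * (\<zeta> - x)\<^sup>2) / \<bar>F' x\<bar>"
      by (rule divide_right_mono) simp
    moreover have "newton F x - \<zeta> = (F \<zeta> - F x - F' x * (\<zeta> - x)) / F' x"
      using nz root(1) by (simp add: newton_def der field_simps)
    ultimately have "\<bar>newton F x - \<zeta>\<bar> \<le> (M / 2 * (\<zeta> - x)\<^sup>2) / \<bar>F' x\<bar>"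
      by simp
    also have "\<dots> \<le> (M / 2 * (\<zeta> - x)\<^sup>2) / (m / 2)"
      using l m M(3) nz by (intro divide_left_mono mult_nonneg_nonneg) auto
    finally show ?thesis using m by (simp add: power2_commute)
  qed
  define e0 where "e0 = \<bar>z0 - \<zeta>\<bar>"
  have e0: "0 \<le> e0" "e0 \<le> r" using z0 by (auto simp: e0_def)
  have B: "M / m * e0 \<le> 1 / 2"
  proof -
    have "M / m * e0 \<le> M / m * r" using e0 M(3) m by (intro mult_left_mono) auto
    also have "\<dots> \<le> 1 / 2" using M(2) m by (simp add: field_simps m_def)
    finally show ?thesis .
  qed
  have main: "\<bar>(newton F ^^ i) z0 - \<zeta>\<bar> \<le> (1/2) ^ (2 ^ i - 1) * e0" for i
  proof (induction i)
    case 0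
    then show ?case by (simp add: e0_def)
  next
    case (Suc i)
    let ?x = "(newton F ^^ i) z0"
    have pw: "(1/2::real) ^ Suc (k + k) = 1/2 * ((1/2) ^ k * (1/2) ^ k)" for k by (simp add: power_add)
    have p: "2 ^ Suc i - 1 = Suc ((2 ^ i - 1) + (2 ^ i - 1) :: nat)"
    proof -
      obtain k where "(2::nat) ^ i = Suc k" by (metis not0_implies_Suc power_not_zero zero_neq_numeral)
      then show ?thesis by simp
    qed
    have "(1/2) ^ (2 ^ i - 1) * e0 \<le> 1 * e0" using e0 by (intro mult_right_mono) (auto simp: power_le_one)
    then have "\<bar>?x - \<zeta>\<bar> \<le> r" using Suc e0 by linarith
    from stp[OF this] have "\<bar>newton F ?x - \<zeta>\<bar> \<le> M / m * \<bar>?x - \<zeta>\<bar>\<^sup>2" .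
    also have "\<dots> \<le> M / m * ((1/2) ^ (2 ^ i - 1) * e0)\<^sup>2"
      using Suc M(3) m by (intro mult_left_mono power_mono) auto
    also have "\<dots> = (M / m * e0) * ((1/2) ^ (2 ^ i - 1) * (1/2) ^ (2 ^ i - 1) * e0)"
      by (simp add: power2_eq_square)
    also have "\<dots> \<le> 1 / 2 * ((1/2) ^ (2 ^ i - 1) * (1/2) ^ (2 ^ i - 1) * e0)"
      using B e0 by (intro mult_right_mono) auto
    also have "\<dots> = (1/2) ^ (2 ^ Suc i - 1) * e0" unfolding p pw by (simp only: mult.assoc)
    finally show ?case by simp
  qed
  show ?thesis unfolding newton_converges_def
  proof (intro conjI allI impI)
    fix i
    have "(1/2) ^ (2 ^ i - 1) * e0 \<le> 1 * e0" using e0 by (intro mult_right_mono) (auto simp: power_le_one)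
    then have "\<bar>(newton F ^^ i) z0 - \<zeta>\<bar> \<le> r" using main[of i] e0 by linarith
    from lower[OF this] show "deriv F ((newton F ^^ i) z0) \<noteq> 0" using m unfolding der by auto
  next
    fix i :: nat assume "i \<ge> 1"
    then obtain j where j: "i = Suc j" by (cases i) auto
    have "(2::nat) ^ (i - 1) \<le> 2 ^ i - 1" using one_le_power[of "2::nat" j] unfolding j by simp
    then have "(1/2::real) ^ (2 ^ i - 1) \<le> (1/2) ^ (2 ^ (i - 1))" by (intro power_decreasing) auto
    then have "(1/2) ^ (2 ^ i - 1) * e0 \<le> (1/2) ^ (2 ^ (i - 1)) * e0" using e0 by (intro mult_right_mono)
    then show "\<bar>(newton F ^^ i) z0 - \<zeta>\<bar> \<le> (1/2) ^ 2 ^ (i - 1) * \<bar>z0 - \<zeta>\<bar>"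
      using main[of i] unfolding e0_def by linarith
  qed
qed

text \<open>
  The linear part of \<open>F\<close> changes sign within distance \<open>r\<close> of \<open>x\<close>, and it dominates the
  quadratic remainder.
\<close>

lemma root_near:
  fixes F F' F'' :: "real \<Rightarrow> real"
  assumes DF: "\<And>x. (F has_real_derivative F' x) (at x)" "\<And>x. (F' has_real_derivative F'' x) (at x)"
    and M: "\<And>t. \<bar>t - x\<bar> \<le> r \<Longrightarrow> \<bar>F'' t\<bar> \<le> M" "M * r \<le> \<bar>F' x\<bar> / 2" "r \<ge> 0"
    and small: "\<bar>F x\<bar> \<le> \<bar>F' x\<bar> * r / 2"
  obtains \<zeta> where "\<bar>\<zeta> - x\<bar> \<le> r" "F \<zeta> = 0" "\<bar>F' \<zeta>\<bar> \<ge> \<bar>F' x\<bar> / 2"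
proof -
  have Mr: "M / 2 * r\<^sup>2 \<le> \<bar>F' x\<bar> * r / 4"
    using mult_right_mono[OF M(2,3)] by (simp add: power2_eq_square field_simps)
  have t1: "\<bar>F (x + r) - F x - F' x * r\<bar> \<le> M / 2 * r\<^sup>2"
    using taylor_quadratic[OF DF, of "x + r" x M] M(1,3) by simp
  have t2: "\<bar>F (x - r) - F x + F' x * r\<bar> \<le> M / 2 * r\<^sup>2"
    using taylor_quadratic[OF DF, of "x - r" x M] M(1,3) by simp
  have cont: "continuous_on A F" for A
    using DF(1) by (meson DERIV_isCont continuous_at_imp_continuous_on)
  have F'r: "0 \<le> \<bar>F' x\<bar> * r" using M(3) by simp
  have "\<exists>\<zeta>. x - r \<le> \<zeta> \<and> \<zeta> \<le> x + r \<and> F \<zeta> = 0"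
  proof (cases "F' x \<ge> 0")
    case True
    then have "F (x + r) \<ge> 0" "F (x - r) \<le> 0"
      using t1 t2 Mr small F'r unfolding abs_of_nonneg[OF True] by linarith+
    then show ?thesis using IVT'[of F "x - r" 0 "x + r"] cont M(3) by auto
  next
    case False
    then have n: "\<bar>F' x\<bar> = - F' x" by simp
    have "F (x + r) \<le> 0" "F (x - r) \<ge> 0"
      using t1 t2 Mr small F'r unfolding n by linarith+
    then show ?thesis using IVT2'[of F "x + r" 0 "x - r"] cont M(3) by auto
  qed
  then obtain \<zeta> where "x - r \<le> \<zeta>" "\<zeta> \<le> x + r" and z0: "F \<zeta> = 0" by blast
  then have z: "\<bar>\<zeta> - x\<bar> \<le> r" "F \<zeta> = 0" by (auto simp: abs_le_iff)
  have "\<bar>F' \<zeta> - F' x\<bar> \<le> M * \<bar>\<zeta> - x\<bar>"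
    by (rule derivative_variation[OF DF(2)]) (use z(1) in \<open>auto intro!: M(1)\<close>)
  also have "\<dots> \<le> M * r"
  proof -
    have "M \<ge> 0" using M(1)[of x] M(3) by auto
    then show ?thesis using z(1) by (intro mult_left_mono)
  qed
  finally have "\<bar>F' \<zeta>\<bar> \<ge> \<bar>F' x\<bar> / 2" using M(2) by linarith
  then show thesis using that z by blast
qed

section \<open>Newton's method for trinomials\<close>

definition tri :: "real \<Rightarrow> real \<Rightarrow> real \<Rightarrow> nat \<Rightarrow> nat \<Rightarrow> real \<Rightarrow> real" where
  "tri A B C m n x = A + B * x ^ m + C * x ^ n"

definition tri' :: "real \<Rightarrow> real \<Rightarrow> nat \<Rightarrow> nat \<Rightarrow> real \<Rightarrow> real" where
  "tri' B C m n x = B * (m * x ^ (m - 1)) + C * (n * x ^ (n - 1))"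

definition tri'' :: "real \<Rightarrow> real \<Rightarrow> nat \<Rightarrow> nat \<Rightarrow> real \<Rightarrow> real" where
  "tri'' B C m n x = B * (m * (real (m - 1) * x ^ (m - 1 - 1))) + C * (n * (real (n - 1) * x ^ (n - 1 - 1)))"

lemma DERIV_tri: "(tri A B C m n has_real_derivative tri' B C m n x) (at x)"
  unfolding tri_def tri'_def by (auto intro!: derivative_eq_intros)

lemma DERIV_tri': "(tri' B C m n has_real_derivative tri'' B C m n x) (at x)"
  unfolding tri'_def tri''_def by (auto intro!: derivative_eq_intros)

text \<open>
  This is where multiplicative closeness is used: a change by a factor \<open>1 + 1 / d\<close> changes
  powers up to the degree by at most a factor \<open>e\<close>.
\<close>

lemma power_near:
  fixes x z :: real and d k :: nat
  assumes "\<bar>x\<bar> \<le> (1 + 1 / d) * \<bar>z\<bar>" "k \<le> d" "0 < d"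
  shows "\<bar>x ^ k\<bar> \<le> 3 * \<bar>z\<bar> ^ k"
proof -
  have "\<bar>x ^ k\<bar> \<le> ((1 + 1 / d) * \<bar>z\<bar>) ^ k" unfolding power_abs using assms(1) by (intro power_mono) auto
  also have "\<dots> = (1 + 1 / d) ^ k * \<bar>z\<bar> ^ k" by (rule power_mult_distrib)
  also have "(1 + 1 / d) ^ k \<le> (1 + 1 / real d) ^ d" using assms(2) by (intro power_increasing) auto
  also have "\<dots> \<le> exp (1 / real d) ^ d" by (intro power_mono exp_ge_add_one_self) auto
  also have "\<dots> = exp 1" using assms(3) by (simp add: exp_of_nat_mult[symmetric])
  also have "\<dots> \<le> 3" by (rule exp_le)
  finally show ?thesis by (simp add: mult_right_mono)
qed

lemma tri''_bound:
  fixes d :: nat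
  assumes "\<bar>x\<bar> \<le> (1 + 1 / d) * \<bar>z\<bar>" "m \<le> d" "n \<le> d" "0 < d" "z \<noteq> 0"
  shows "\<bar>tri'' B C m n x\<bar> \<le> 3 * real d ^ 2 * (\<bar>B * z ^ m\<bar> + \<bar>C * z ^ n\<bar>) / z\<^sup>2"
proof -
  have one: "\<bar>B * (k * (real (k - 1) * x ^ (k - 1 - 1)))\<bar> \<le> 3 * real d ^ 2 * \<bar>B * z ^ k\<bar> / z\<^sup>2" if k: "k \<le> d" for B and k :: nat
  proof (cases "k < 2")
    case True
    then have "k = 0 \<or> k = 1" by auto
    then show ?thesis by auto
  next
    case False
    then obtain j where j: "k = Suc (Suc j)" by (metis add_2_eq_Suc le_Suc_ex not_less)
    have "\<bar>x ^ j\<bar> \<le> 3 * \<bar>z\<bar> ^ j" using power_near[OF assms(1), of j] k j assms(4) by simp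
    moreover have "real k * real (k - 1) \<le> real d ^ 2"
      unfolding power2_eq_square using k by (intro mult_mono) auto
    ultimately have "\<bar>B\<bar> * (real k * real (k - 1) * \<bar>x ^ j\<bar>) \<le> \<bar>B\<bar> * (real d ^ 2 * (3 * \<bar>z\<bar> ^ j))"
      by (intro mult_left_mono mult_mono) auto
    moreover have "\<bar>B * (k * (real (k - 1) * x ^ (k - 1 - 1)))\<bar> = \<bar>B\<bar> * (real k * real (k - 1) * \<bar>x ^ j\<bar>)"
      using j by (simp add: abs_mult mult.assoc)
    moreover have "\<bar>B\<bar> * (real d ^ 2 * (3 * \<bar>z\<bar> ^ j)) = 3 * real d ^ 2 * \<bar>B * z ^ k\<bar> / z\<^sup>2"
      using assms(5) by (simp add: j abs_mult power_abs field_simps power2_eq_square)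
    ultimately show ?thesis by linarith
  qed
  have "\<bar>tri'' B C m n x\<bar> \<le> \<bar>B * (m * (real (m - 1) * x ^ (m - 1 - 1)))\<bar> + \<bar>C * (n * (real (n - 1) * x ^ (n - 1 - 1)))\<bar>"
    unfolding tri''_def by (rule abs_triangle_ineq)
  then show ?thesis using one[OF assms(2), of B] one[OF assms(3), of C] by (simp add: distrib_left add_divide_distrib)
qed

text \<open>
  \<open>\<mu>\<close> is the relative slope of the trinomial at the root. The admissible relative error of
  the starting point depends only on \<open>\<mu>\<close> and the degree.
\<close>

lemma newton_tri:
  assumes mn: "m \<le> d" "n \<le> d" "0 < d" and root: "tri A B C m n z = 0" "z \<noteq> 0"
    and mu: "0 < \<mu>" "\<mu> \<le> 1" "\<bar>z * tri' B C m n z\<bar> \<ge> \<mu> * (\<bar>B * z ^ m\<bar> + \<bar>C * z ^ n\<bar>)"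
    and T: "\<bar>B * z ^ m\<bar> + \<bar>C * z ^ n\<bar> > 0"
    and z0: "\<bar>z0 - z\<bar> \<le> \<mu> / (6 * real d ^ 2) * \<bar>z\<bar>"
  shows "newton_converges (tri A B C m n) z0 z"
proof -
  define T where "T = \<bar>B * z ^ m\<bar> + \<bar>C * z ^ n\<bar>"
  define r where "r = \<mu> / (6 * real d ^ 2) * \<bar>z\<bar>"
  define M where "M = 3 * real d ^ 2 * T / z\<^sup>2"
  have d1: "real d \<ge> 1" using mn(3) by simp
  have "\<mu> / (6 * real d ^ 2) \<le> 1 / real d"
    using mu d1 by (simp add: field_simps power2_eq_square)
  then have rle: "r \<le> 1 / real d * \<bar>z\<bar>" unfolding r_def by (intro mult_right_mono) auto
  have dpos: "\<bar>z * tri' B C m n z\<bar> > 0" using mu(1,3) T by (smt (verit) mult_pos_pos)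
  show ?thesis
  proof (rule newton_quadratic[OF DERIV_tri DERIV_tri' root(1)])
    show "tri' B C m n z \<noteq> 0" using dpos by auto
    show "\<bar>tri'' B C m n t\<bar> \<le> M" if "\<bar>t - z\<bar> \<le> r" for t
    proof -
      have "\<bar>t\<bar> \<le> (1 + 1 / d) * \<bar>z\<bar>" using that rle by (simp add: distrib_right)
      then show ?thesis unfolding M_def T_def using mn root(2) by (intro tri''_bound)
    qed
    have "M * r = \<mu> * T / \<bar>z\<bar> / 2"
      unfolding M_def r_def using root(2) d1 by (simp add: field_simps power2_eq_square)
    also have "\<dots> \<le> \<bar>z * tri' B C m n z\<bar> / \<bar>z\<bar> / 2"
      using mu(3) unfolding T_def by (intro divide_right_mono) auto
    also have "\<dots> = \<bar>tri' B C m n z\<bar> / 2" using root(2) by (simp add: abs_mult)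
    finally show "M * r \<le> \<bar>tri' B C m n z\<bar> / 2" .
    show "M \<ge> 0" unfolding M_def T_def by simp
    show "\<bar>z0 - z\<bar> \<le> r" using z0 unfolding r_def .
  qed
qed

section \<open>Positive roots of trinomials\<close>

text \<open>
  For positive \<open>A\<close> and negative \<open>C\<close> the monomials satisfy
  \<open>m B x ^ m + n C x ^ n \<le> B x ^ m + C x ^ n\<close> as soon as the right-hand side is at most 0.
  So the slope is of the order of \<open>A\<close> wherever the value is small.
\<close>

lemma tri_slope_one_change:
  assumes "A > 0" "C < 0" "0 < x" "0 < m" "m < n" "tri A B C m n x \<le> A"
  shows "x * tri' B C m n x \<le> tri A B C m n x - A"
proof -
  have xf: "x * tri' B C m n x = real m * (B * x ^ m) + real n * (C * x ^ n)"
    using assms(4,5) by (cases m; cases n) (auto simp: tri'_def algebra_simps)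
  have C: "C * x ^ n \<le> 0" using assms(2,3) by (simp add: mult_le_0_iff)
  have s: "B * x ^ m + C * x ^ n \<le> 0" using assms(6) by (simp add: tri_def)
  have "real m * (B * x ^ m) + real n * (C * x ^ n) \<le> B * x ^ m + C * x ^ n"
  proof (cases "B \<ge> 0")
    case True
    then have "real m * (B * x ^ m) \<le> real n * (B * x ^ m)" using assms by (intro mult_right_mono) auto
    then have "real m * (B * x ^ m) + real n * (C * x ^ n) \<le> real n * (B * x ^ m + C * x ^ n)"
      by (simp add: distrib_left)
    also have "\<dots> \<le> 1 * (B * x ^ m + C * x ^ n)" using s assms by (intro mult_right_mono_neg) auto
    finally show ?thesis by simp
  next
    case False
    then have B: "B * x ^ m \<le> 0" using assms(3) by (simp add: mult_le_0_iff)
    have "real m * (B * x ^ m) \<le> 1 * (B * x ^ m)" using B assms(4) by (intro mult_right_mono_neg) auto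
    moreover have "real n * (C * x ^ n) \<le> 1 * (C * x ^ n)" using C assms by (intro mult_right_mono_neg) auto
    ultimately show ?thesis by simp
  qed
  then show ?thesis unfolding xf by (simp add: tri_def)
qed

lemma tri_one_change_unique:
  assumes "A > 0" "C < 0" "0 < m" "m < n" "0 < x" "x < y" "tri A B C m n x = 0"
  shows "tri A B C m n y < 0"
proof (cases "B > 0")
  case False
  have "x ^ m \<le> y ^ m" "x ^ n < y ^ n" using assms by (auto intro!: power_mono power_strict_mono)
  then have "B * y ^ m \<le> B * x ^ m" "C * y ^ n < C * x ^ n"
    using False assms(2) by (auto intro: mult_left_mono_neg)
  then show ?thesis using assms(7) by (simp add: tri_def)
next
  case True
  define l where "l = y / x"
  have l: "l > 1" "y = l * x" using assms by (auto simp: l_def)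
  have "C * x ^ n = - A - B * x ^ m" using assms(7) by (simp add: tri_def)
  then have "C * y ^ n = l ^ n * (- A - B * x ^ m)" by (simp add: l(2) power_mult_distrib mult.left_commute)
  then have "tri A B C m n y = A * (1 - l ^ n) + B * x ^ m * (l ^ m - l ^ n)"
    by (simp add: tri_def l(2) power_mult_distrib algebra_simps)
  moreover have "l ^ n > 1" "l ^ m < l ^ n" using l(1) assms(3,4) by (auto intro: one_less_power power_strict_increasing)
  moreover have "B * x ^ m > 0" using True assms(5) by simp
  ultimately show ?thesis using assms(1) by (smt (verit) mult_pos_neg)
qed

text \<open>
  In the variable \<open>u = ln x\<close> the function \<open>f(x) / x ^ m\<close> is strictly convex when the outer
  coefficients are positive, so it lies above its tangent at \<open>ln x\<close>.
\<close>

lemma tri_tangent: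
  assumes "A > 0" "C > 0" "0 < m" "m < n" "0 < x" "0 < p" "x \<noteq> p"
  shows "(x / p) ^ m * tri A B C m n p >
    tri A B C m n x + (x * tri' B C m n x - m * tri A B C m n x) * (ln p - ln x)"
proof -
  define s where "s = ln p - ln x"
  have s0: "s \<noteq> 0" using assms by (simp add: s_def)
  have xp: "x / p = exp (- s)" "p / x = exp s"
    using assms(5,6) by (simp_all add: s_def exp_diff)
  obtain k where k: "n = m + k" "k > 0" using assms(4) less_imp_add_positive by blast
  have e0: "(x / p) ^ m * tri A B C m n p = A * (x / p) ^ m + B * x ^ m + C * x ^ n * (p / x) ^ k"
    using assms(5,6) by (simp add: tri_def k power_add power_divide field_simps)
  have e1: "(x / p) ^ m = exp (- (m * s))" unfolding xp by (simp add: exp_of_nat_mult[symmetric])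
  have e2: "(p / x) ^ k = exp (k * s)" unfolding xp by (simp add: exp_of_nat_mult[symmetric])
  have e: "(x / p) ^ m * tri A B C m n p = A * exp (- (m * s)) + B * x ^ m + C * x ^ n * exp (k * s)"
    using e0 by (simp only: e1 e2)
  have xf: "x * tri' B C m n x = real m * (B * x ^ m) + real n * (C * x ^ n)"
    using assms(3,4) by (cases m; cases n) (auto simp: tri'_def algebra_simps)
  have strict: "exp t > 1 + t" if "t \<noteq> 0" for t :: real
    using exp_minus_greater[of "- t"] that by simp
  have "exp (- (m * s)) > 1 - m * s" "exp (k * s) > 1 + k * s"
    using strict[of "- (m * s)"] strict[of "k * s"] s0 assms(3) k(2) by simp_all
  then have "A * (1 - m * s) < A * exp (- (m * s))" "C * x ^ n * (1 + k * s) < C * x ^ n * exp (k * s)"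
    using assms(1,2,5) by (auto intro!: mult_strict_left_mono)
  moreover have "tri A B C m n x + (x * tri' B C m n x - m * tri A B C m n x) * s =
     A * (1 - m * s) + B * x ^ m + C * x ^ n * (1 + k * s)"
    unfolding xf by (simp add: tri_def k algebra_simps)
  ultimately show ?thesis unfolding e s_def[symmetric] by linarith
qed

lemma tri_sign_scale: "0 < x \<Longrightarrow> 0 < p \<Longrightarrow> 0 < (x / p) ^ m * (v :: real) \<longleftrightarrow> 0 < v"
  by (metis divide_pos_pos mult_pos_pos zero_less_mult_pos zero_less_power)

text \<open>
  A strictly convex function that vanishes twice is positive to the right of its second
  zero.
\<close>

lemma tri_outside_roots:
  assumes "A > 0" "C > 0" "0 < m" "m < n" "0 < x" "x < y" "tri A B C m n x = 0" "tri A B C m n y = 0" "y < p"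
  shows "tri A B C m n p > 0"
proof -
  have y: "0 < y" "0 < p" using assms by auto
  have "(y / x) ^ m * tri A B C m n x > y * tri' B C m n y * (ln x - ln y)"
    using tri_tangent[of A C m n y x B] assms y by simp
  then have "y * tri' B C m n y * (ln y - ln x) > 0" using assms(7) by (simp add: algebra_simps)
  then have g: "y * tri' B C m n y > 0" using assms(5,6) by (simp add: zero_less_mult_iff)
  have "(y / p) ^ m * tri A B C m n p > y * tri' B C m n y * (ln p - ln y)"
    using tri_tangent[of A C m n y p B] assms y by simp
  moreover have "y * tri' B C m n y * (ln p - ln y) > 0" using assms(9) y by (intro mult_pos_pos[OF g]) auto
  ultimately have "(y / p) ^ m * tri A B C m n p > 0" by linarith
  then show ?thesis using tri_sign_scale[of y p] y by simp
qed

text \<open>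
  Apply the tangent inequality to the trinomial from which its value at the critical point
  has been subtracted: the tangent is then the axis.
\<close>

lemma tri_minimum:
  assumes "A > 0" "B < 0" "C > 0" "0 < m" "m < n" "0 < x" "real n * C * x ^ (n - m) = real m * (- B)" "0 < p" "p \<noteq> x"
  shows "tri A B C m n p > tri A B C m n x"
proof -
  let ?v = "tri A B C m n x"
  let ?A = "A - ?v"
  have xn: "x ^ n = x ^ m * x ^ (n - m)" using assms(5) by (simp add: power_add[symmetric])
  have "real n * (C * x ^ n) = x ^ m * (real n * C * x ^ (n - m))" by (simp add: xn algebra_simps)
  also have "\<dots> = - (real m * (B * x ^ m))" unfolding assms(7) by simp
  finally have e: "real n * (C * x ^ n) = - (real m * (B * x ^ m))" .
  have xf: "x * tri' B C m n x = real m * (B * x ^ m) + real n * (C * x ^ n)"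
    using assms(4,5) by (cases m; cases n) (auto simp: tri'_def algebra_simps)
  then have f0: "x * tri' B C m n x = 0" using e by simp
  have "?A = - (B * x ^ m) - C * x ^ n" by (simp add: tri_def)
  moreover have "C * x ^ n < - (B * x ^ m)"
  proof -
    have w: "- (B * x ^ m) > 0" using assms(2,6) by (simp add: mult_less_0_iff)
    have "real n * (C * x ^ n) = real m * (- (B * x ^ m))" using e by simp
    also have "\<dots> < real n * (- (B * x ^ m))" using w assms(5) by (intro mult_strict_right_mono) auto
    finally show ?thesis by (rule mult_left_less_imp_less) simp
  qed
  ultimately have A: "?A > 0" by linarith
  have z: "tri ?A B C m n x = 0" by (simp add: tri_def)
  have "(x / p) ^ m * tri ?A B C m n p > 0"
    using tri_tangent[OF A assms(3,4,5,6,8), of B] assms(9) f0 z by simp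
  then have "tri ?A B C m n p > 0" using tri_sign_scale[OF assms(6,8)] by simp
  then show ?thesis by (simp add: tri_def)
qed

text \<open>
  The tangent at 1 is nonnegative at 1 and does not increase with \<open>ln x\<close>.
\<close>

lemma tri_no_root_below_one:
  assumes "A > 0" "C > 0" "0 < m" "m < n" "A + B + C \<ge> 0" "real n * C \<le> real m * (- B)" "0 < p" "p < 1"
  shows "tri A B C m n p > 0"
proof -
  have t: "tri A B C m n 1 = A + B + C" "1 * tri' B C m n 1 = real m * B + real n * C"
    by (simp_all add: tri_def tri'_def)
  have "(1 / p) ^ m * tri A B C m n p > (A + B + C) + (real m * B + real n * C - m * (A + B + C)) * (ln p - ln 1)"
    using tri_tangent[OF assms(1-4) _ assms(7), of 1 B] assms(8) unfolding t by simp
  moreover have "(real m * B + real n * C - m * (A + B + C)) * (ln p - ln 1) \<ge> 0"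
  proof (rule mult_nonpos_nonpos)
    have "real m * (A + B + C) \<ge> 0" using assms(5) by (intro mult_nonneg_nonneg) auto
    then show "real m * B + real n * C - real m * (A + B + C) \<le> 0" using assms(6) by linarith
  qed (use assms(7,8) in simp)
  ultimately have "(1 / p) ^ m * tri A B C m n p > 0" using assms(5) by linarith
  then show ?thesis using tri_sign_scale[of 1 p] assms(7) by simp
qed

lemma tri_lipschitz:
  assumes "0 \<le> x" "x \<le> 1" "0 \<le> y" "y \<le> 1"
  shows "\<bar>tri A B C m n x - tri A B C m n y\<bar> \<le> (m * \<bar>B\<bar> + n * \<bar>C\<bar>) * \<bar>x - y\<bar>"
proof -
  have pl: "\<bar>x ^ k - y ^ k\<bar> \<le> k * \<bar>x - y\<bar>" for k
  proof (induction k)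
    case (Suc k)
    have "x ^ Suc k - y ^ Suc k = x * (x ^ k - y ^ k) + (x - y) * y ^ k" by (simp add: algebra_simps)
    then have "\<bar>x ^ Suc k - y ^ Suc k\<bar> \<le> \<bar>x\<bar> * \<bar>x ^ k - y ^ k\<bar> + \<bar>x - y\<bar> * \<bar>y ^ k\<bar>"
      by (metis abs_mult abs_triangle_ineq)
    also have "\<bar>x\<bar> * \<bar>x ^ k - y ^ k\<bar> \<le> 1 * \<bar>x ^ k - y ^ k\<bar>" using assms by (intro mult_right_mono) auto
    also have "\<bar>x - y\<bar> * \<bar>y ^ k\<bar> \<le> \<bar>x - y\<bar> * 1"
      using assms by (intro mult_left_mono) (auto simp: power_le_one)
    finally show ?case using Suc by (simp add: algebra_simps)
  qed simp
  have "tri A B C m n x - tri A B C m n y = B * (x ^ m - y ^ m) + C * (x ^ n - y ^ n)"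
    by (simp add: tri_def algebra_simps)
  then have "\<bar>tri A B C m n x - tri A B C m n y\<bar> \<le> \<bar>B\<bar> * \<bar>x ^ m - y ^ m\<bar> + \<bar>C\<bar> * \<bar>x ^ n - y ^ n\<bar>"
    by (metis abs_mult abs_triangle_ineq)
  also have "\<dots> \<le> \<bar>B\<bar> * (m * \<bar>x - y\<bar>) + \<bar>C\<bar> * (n * \<bar>x - y\<bar>)"
    using pl by (intro add_mono mult_left_mono) auto
  finally show ?thesis by (simp add: algebra_simps)
qed

text \<open>
  The tangent at \<open>x\<close> passes below the value at the witness \<open>p\<close>, which is clearly negative.
  As \<open>\<bar>ln p - ln x\<bar>\<close> is at most \<open>2 L\<close>, the tangent must be steep. Neither \<open>x\<close> nor \<open>p\<close> is
  close to 0 because the constant coefficient has to be outweighed there.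
\<close>

lemma tri_slope_two_changes:
  assumes pos: "A \<ge> 1" "C > 0" "0 < m" "m < n" and L: "8 \<le> L" "- B \<le> L" "real m \<le> L"
    and x: "0 < x" "x \<le> 1" "\<bar>tri A B C m n x\<bar> \<le> e" and e: "e \<le> 1 / (32 * L ^ 4)"
    and p: "0 < p" "p \<le> 1" "tri A B C m n p \<le> - (1 / (2 * L))"
  shows "\<bar>x * tri' B C m n x\<bar> \<ge> 1 / (32 * L ^ 3)"
proof -
  let ?f = "tri A B C m n"
  have L4: "1 / (32 * L ^ 4) \<le> 1 / (8 * L\<^sup>2)" "1 / (32 * L ^ 4) \<le> 1 / 2"
  proof -
    have l2: "1 \<le> L\<^sup>2" using L(1) by simp
    have "8 * L\<^sup>2 \<le> 32 * L ^ 4" using l2 mult_mono[of 1 "4 * L\<^sup>2" "8 * L\<^sup>2" "8 * L\<^sup>2"]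
      by (simp add: power4_eq_xxxx power2_eq_square)
    then show "1 / (32 * L ^ 4) \<le> 1 / (8 * L\<^sup>2)" using L(1) by (intro divide_left_mono) auto
    have "1 \<le> L ^ 4" using L(1) by simp
    then show "1 / (32 * L ^ 4) \<le> 1 / 2" by (intro divide_left_mono) auto
  qed
  have lower: "w ^ m \<ge> 1 / (2 * L)" if w: "0 < w" "?f w \<le> 1 / 2" for w
  proof -
    have "C * w ^ n > 0" using pos(2) w(1) by simp
    then have "(- B) * w ^ m \<ge> 1 / 2" using w(2) pos(1) by (simp add: tri_def)
    moreover have "(- B) * w ^ m \<le> L * w ^ m" using L(2) w(1) by (intro mult_right_mono) auto
    ultimately have "L * w ^ m \<ge> 1 / 2" by linarith
    then show ?thesis using L(1) by (simp add: field_simps)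
  qed
  have xm: "x ^ m \<ge> 1 / (2 * L)" using x(3) e L4(2) by (intro lower[OF x(1)]) linarith
  have "- (1 / (2 * L)) \<le> 1 / 2" using L(1) by (smt (verit) divide_nonneg_nonneg)
  then have pm: "p ^ m \<ge> 1 / (2 * L)" using p(3) by (intro lower[OF p(1)]) linarith
  have le1: "w ^ m \<le> w" if "0 < w" "w \<le> 1" for w :: real
    using power_decreasing[of 1 m w] that pos(3) by simp
  have xl: "1 / (2 * L) \<le> x" "1 / (2 * L) \<le> p" using xm pm le1[OF x(1,2)] le1[OF p(1,2)] by linarith+
  have lnb: "\<bar>ln w\<bar> \<le> 2 * L" if "1 / (2 * L) \<le> w" "w \<le> 1" "0 < w" for w
  proof -
    have "ln (1 / (2 * L)) \<le> ln w" using that L(1) by simp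
    moreover have "ln (1 / (2 * L)) = - ln (2 * L)" using L(1) by (simp add: ln_div)
    moreover have "ln (2 * L) \<le> 2 * L" using ln_le_minus_one[of "2 * L"] L(1) by linarith
    ultimately show ?thesis using that by simp
  qed
  define s where "s = ln p - ln x"
  have sb: "\<bar>s\<bar> \<le> 2 * L"
    using lnb[OF xl(1) x(2,1)] lnb[OF xl(2) p(2,1)] ln_le_zero_iff[of x] ln_le_zero_iff[of p] x p
    unfolding s_def by linarith
  have "p \<noteq> x"
  proof
    assume "p = x"
    then have "?f x \<le> - (1 / (2 * L))" using p(3) by simp
    then have "1 / (2 * L) \<le> e" using x(3) by linarith
    then have "1 / (2 * L) \<le> 1 / (32 * L ^ 4)" using e by linarith
    moreover have "2 * L * 1 < 2 * L * (16 * L ^ 3)"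
    proof (rule mult_strict_left_mono)
      have "1 \<le> L ^ 3" using L(1) by simp
      then show "1 < 16 * L ^ 3" by linarith
    qed (use L in simp)
    ultimately show False using L(1) by (simp add: field_simps power3_eq_cube power4_eq_xxxx)
  qed
  then have "(x / p) ^ m * ?f p > ?f x + (x * tri' B C m n x - m * ?f x) * s"
    using tri_tangent[of A C m n x p B] pos x(1) p(1) unfolding s_def by simp
  moreover have "(x / p) ^ m * ?f p \<le> - (1 / (4 * L\<^sup>2))"
  proof -
    have "x ^ m \<le> (x / p) ^ m" using x p by (intro power_mono) (auto simp: field_simps)
    then have q: "1 / (2 * L) \<le> (x / p) ^ m" using xm by linarith
    have "(1 / (2 * L)) * (1 / (2 * L)) \<le> (x / p) ^ m * (- ?f p)"
      using q p(3) L(1) x(1) p(1) by (intro mult_mono) auto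
    then show ?thesis by (simp add: power2_eq_square)
  qed
  moreover have "?f x \<ge> - (1 / (8 * L\<^sup>2))" using x(3) e L4(1) by linarith
  moreover have "1 / (4 * L\<^sup>2) = 2 * (1 / (8 * L\<^sup>2))" by simp
  ultimately have "(x * tri' B C m n x - m * ?f x) * s < - (1 / (8 * L\<^sup>2))" by linarith
  then have "1 / (8 * L\<^sup>2) < \<bar>x * tri' B C m n x - m * ?f x\<bar> * \<bar>s\<bar>" by (simp add: abs_mult[symmetric])
  also have "\<dots> \<le> \<bar>x * tri' B C m n x - m * ?f x\<bar> * (2 * L)" using sb by (intro mult_left_mono) auto
  finally have "1 / (16 * L ^ 3) < \<bar>x * tri' B C m n x - m * ?f x\<bar>"
    using L(1) by (simp add: field_simps power2_eq_square power3_eq_cube)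
  moreover have "\<bar>m * ?f x\<bar> \<le> 1 / (32 * L ^ 3)"
  proof -
    have "\<bar>m * ?f x\<bar> \<le> L * (1 / (32 * L ^ 4))"
      unfolding abs_mult using L(3) x(3) e by (intro mult_mono) auto
    also have "\<dots> = 1 / (32 * L ^ 3)" using L(1) by (simp add: field_simps power3_eq_cube power4_eq_xxxx)
    finally show ?thesis .
  qed
  moreover have "1 / (16 * L ^ 3) = 2 * (1 / (32 * L ^ 3))" by simp
  ultimately show ?thesis by linarith
qed

lemma tri_root_near:
  assumes mn: "m \<le> d" "n \<le> d" "0 < d" and L: "8 \<le> L" "real d \<le> L" "real d * \<bar>B\<bar> \<le> L" "real d * \<bar>C\<bar> \<le> L"
    and x: "0 < x" "x \<le> 1" "\<bar>tri A B C m n x\<bar> \<le> 4 / L ^ 23" "\<bar>x * tri' B C m n x\<bar> \<ge> 1 / (32 * L ^ 3)"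
  obtains z where "tri A B C m n z = 0" "\<bar>x - z\<bar> \<le> 2 / L ^ 12 * z" "\<bar>z - x\<bar> \<le> 1 / L ^ 12" "0 < z"
    "\<bar>z * tri' B C m n z\<bar> \<ge> 1 / (128 * L ^ 3)"
proof -
  define r where "r = x / L ^ 12"
  define M where "M = 6 * L\<^sup>2 / x\<^sup>2"
  have Lp: "L > 0" "1 \<le> L" using L(1) by auto
  have big: "8 ^ k \<le> L ^ k" for k using L(1) by (intro power_mono) auto
  have d1: "real d \<ge> 1" using mn(3) by simp
  have "1 / L ^ 12 \<le> 1 / real d"
  proof (intro divide_left_mono)
    have "L ^ 1 \<le> L ^ 12" using Lp by (intro power_increasing) auto
    then show "real d \<le> L ^ 12" using L(2) by simp
  qed (use Lp d1 in auto)
  then have rd: "r \<le> 1 / real d * x" using x(1) mult_right_mono[of "1 / L ^ 12" "1 / real d" x] by (simp add: r_def)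
  have Mb: "\<bar>tri'' B C m n t\<bar> \<le> M" if t: "\<bar>t - x\<bar> \<le> r" for t
  proof -
    have "\<bar>t\<bar> \<le> (1 + 1 / d) * \<bar>x\<bar>" using t rd x(1) by (simp add: distrib_right)
    then have "\<bar>tri'' B C m n t\<bar> \<le> 3 * real d ^ 2 * (\<bar>B * x ^ m\<bar> + \<bar>C * x ^ n\<bar>) / x\<^sup>2"
      using mn x(1) by (intro tri''_bound) auto
    also have "\<dots> \<le> M" unfolding M_def
    proof (intro divide_right_mono)
      have "\<bar>B * x ^ m\<bar> \<le> \<bar>B\<bar>" "\<bar>C * x ^ n\<bar> \<le> \<bar>C\<bar>"
        using x by (auto simp: abs_mult power_le_one intro: mult_left_le)
      then have "3 * real d ^ 2 * (\<bar>B * x ^ m\<bar> + \<bar>C * x ^ n\<bar>) \<le> 3 * real d ^ 2 * (\<bar>B\<bar> + \<bar>C\<bar>)"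
        by (intro mult_left_mono) auto
      also have "\<dots> = 3 * (real d * (real d * \<bar>B\<bar> + real d * \<bar>C\<bar>))" by (simp add: power2_eq_square algebra_simps)
      also have "\<dots> \<le> 3 * (L * (L + L))" using L d1 by (intro mult_left_mono mult_mono add_mono) auto
      finally show "3 * real d ^ 2 * (\<bar>B * x ^ m\<bar> + \<bar>C * x ^ n\<bar>) \<le> 6 * L\<^sup>2" by (simp add: power2_eq_square)
    qed simp
    finally show ?thesis .
  qed
  define g where "g = \<bar>x * tri' B C m n x\<bar>"
  have g: "\<bar>tri' B C m n x\<bar> = g / x" using x(1) by (simp add: g_def abs_mult)
  have g1: "g \<ge> 1 / (32 * L ^ 3)" using x(4) by (simp add: g_def)
  have Mr: "M * r \<le> \<bar>tri' B C m n x\<bar> / 2"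
  proof -
    have "M * r = 6 * L\<^sup>2 / L ^ 12 / x" using x(1) by (simp add: M_def r_def power2_eq_square)
    also have "6 * L\<^sup>2 / L ^ 12 \<le> 1 / (64 * L ^ 3)"
    proof -
      have "384 * L ^ 5 \<le> L ^ 12"
      proof -
        have "384 \<le> L ^ 7" using big[of 7] by simp
        then have "384 * L ^ 5 \<le> L ^ 7 * L ^ 5" using Lp by (intro mult_right_mono) auto
        then show ?thesis by (simp add: power_add[symmetric])
      qed
      then show ?thesis using Lp by (simp add: field_simps power_add[symmetric])
    qed
    also have "1 / (64 * L ^ 3) \<le> g / 2" using g1 by simp
    finally show ?thesis unfolding g using x(1) by (simp add: divide_right_mono)
  qed
  have small: "\<bar>tri A B C m n x\<bar> \<le> \<bar>tri' B C m n x\<bar> * r / 2"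
  proof -
    have "4 / L ^ 23 \<le> 1 / (32 * L ^ 3) / L ^ 12 / 2"
    proof -
      have "256 \<le> L ^ 8" using big[of 8] by simp
      then have "256 * L ^ 15 \<le> L ^ 8 * L ^ 15" using Lp by (intro mult_right_mono) auto
      then show ?thesis using Lp by (simp add: field_simps power_add[symmetric])
    qed
    also have "\<dots> \<le> g / L ^ 12 / 2" using g1 Lp by (intro divide_right_mono) auto
    also have "\<dots> = \<bar>tri' B C m n x\<bar> * r / 2" unfolding g r_def using x(1) by simp
    finally show ?thesis using x(3) by linarith
  qed
  have r0: "r \<ge> 0" using x(1) Lp by (simp add: r_def)
  obtain z where z: "\<bar>z - x\<bar> \<le> r" "tri A B C m n z = 0" "\<bar>tri' B C m n z\<bar> \<ge> \<bar>tri' B C m n x\<bar> / 2"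
    using root_near[OF DERIV_tri DERIV_tri' Mb Mr r0 small] by blast
  have "2 \<le> L ^ 12" using big[of 12] by simp
  then have L12: "1 / L ^ 12 \<le> 1 / 2" using Lp by (intro divide_left_mono) auto
  have "r \<le> x / 2" using mult_left_mono[OF L12, of x] x(1) by (simp add: r_def)
  then have zx: "x / 2 \<le> z" using z(1) by (simp add: abs_le_iff)
  have z0: "z > 0" using zx x(1) by linarith
  show thesis
  proof (rule that[OF z(2) _ _ z0])
    have "r \<le> 2 / L ^ 12 * z" using zx Lp mult_right_mono[of "x" "2 * z" "1 / L ^ 12"] by (simp add: r_def)
    then show "\<bar>x - z\<bar> \<le> 2 / L ^ 12 * z" using z(1) by linarith
    have "r \<le> 1 / L ^ 12" unfolding r_def using x(2) Lp by (intro divide_right_mono) auto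
    then show "\<bar>z - x\<bar> \<le> 1 / L ^ 12" using z(1) by linarith
    have "1 / (128 * L ^ 3) = 1 / 2 * (1 / (32 * L ^ 3) / 2)" by simp
    also have "\<dots> \<le> 1 / 2 * (g / 2)" using g1 by simp
    also have "\<dots> = (x / 2) * (\<bar>tri' B C m n x\<bar> / 2)" unfolding g using x(1) by simp
    also have "\<dots> \<le> z * \<bar>tri' B C m n z\<bar>" using zx z(3) z0 x(1) by (intro mult_mono) auto
    finally show "\<bar>z * tri' B C m n z\<bar> \<ge> 1 / (128 * L ^ 3)" using z0 by (simp add: abs_mult)
  qed
qed

section \<open>Fixed-point evaluation and bisection\<close>

lemma fmul_bounds:
  "real (fmul p u v) \<le> real u * real v / 2 ^ p" "real (fmul p u v) \<ge> real u * real v / 2 ^ p - 1"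
proof -
  have "real (u * v div 2 ^ p) \<le> real (u * v) / real (2 ^ p)" by (rule of_nat_div_le_of_nat)
  then show "real (fmul p u v) \<le> real u * real v / 2 ^ p" by (simp add: fmul_def)
  have "real (u * v) = real (u * v div 2 ^ p) * real (2 ^ p) + real (u * v mod 2 ^ p)"
    by (metis div_mult_mod_eq of_nat_add of_nat_mult)
  moreover have "real (u * v mod 2 ^ p) \<le> real (2 ^ p)" by (simp only: of_nat_le_iff) (simp add: less_imp_le)
  ultimately have "real (u * v) / real (2 ^ p) - real (u * v div 2 ^ p) \<le> 1" by (simp add: field_simps)
  then show "real (fmul p u v) \<ge> real u * real v / 2 ^ p - 1" by (simp add: fmul_def)
qed

lemma power_halves: "e > 0 \<Longrightarrow> (x :: real) ^ e = (if odd e then x else 1) * (x\<^sup>2) ^ (e div 2)"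
  by (cases "odd e") (auto simp: power_mult[symmetric] elim!: oddE evenE)

lemma pw_upper:
  assumes "real base \<le> 2 ^ p * \<beta>" "\<beta> \<ge> 0"
  shows "real (pw p e base t) \<le> t * \<beta> ^ e"
  using assms
proof (induction p e base t arbitrary: \<beta> rule: pw.induct)
  case (1 p e base t)
  show ?case
  proof (cases "e = 0")
    case False
    let ?t = "if odd e then fmul p t base else t"
    have q: "real base * real base \<le> (2 ^ p * \<beta>) * (2 ^ p * \<beta>)" using 1(2) by (intro mult_mono) auto
    have "real (fmul p base base) \<le> 2 ^ p * \<beta>\<^sup>2"
    proof -
      have "real (fmul p base base) \<le> (2 ^ p * \<beta>) * (2 ^ p * \<beta>) / 2 ^ p"
        using fmul_bounds(1)[of p base base] divide_right_mono[OF q, of "2 ^ p"] by simp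
      then show ?thesis by (simp add: power2_eq_square mult_ac)
    qed
    then have "real (pw p (e div 2) (fmul p base base) ?t) \<le> ?t * (\<beta>\<^sup>2) ^ (e div 2)"
      by (intro 1(1)[OF False]) auto
    also have "real ?t \<le> t * (if odd e then \<beta> else 1)"
    proof (cases "odd e")
      case True
      have "real t * real base / 2 ^ p \<le> real t * (2 ^ p * \<beta>) / 2 ^ p"
        using 1(2) by (intro divide_right_mono mult_left_mono) auto
      then show ?thesis using True fmul_bounds(1)[of p t base] by simp
    qed simp
    finally have "real (pw p (e div 2) (fmul p base base) ?t) \<le> t * (if odd e then \<beta> else 1) * (\<beta>\<^sup>2) ^ (e div 2)"
      by (simp add: mult_right_mono)
    then show ?thesis using False power_halves[of e \<beta>] by (simp add: pw.simps[of p e] mult.assoc)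
  qed (simp add: pw.simps)
qed

text \<open>
  Squaring doubles the error of the base and adds 1, so \<open>\<epsilon> + 1\<close> is doubled while the
  exponent is halved. Therefore the error is linear in the exponent \<open>e\<close> and does not grow
  with the number of roundings beyond that.
\<close>

lemma pw_lower:
  fixes P :: nat and \<epsilon> \<beta> :: real
  assumes "2 ^ p * \<beta> - \<epsilon> \<le> real base" "base < 2 ^ p" "0 \<le> \<beta>" "\<beta> \<le> 1" "0 \<le> \<epsilon>" "t \<le> P * 2 ^ p" "P \<ge> 1"
  shows "real t * \<beta> ^ e - P * (e * (\<epsilon> + 1)) \<le> real (pw p e base t)"
  using assms(1-6)
proof (induction p e base t arbitrary: \<beta> \<epsilon> rule: pw.induct)
  case (1 p e base t)
  show ?case
  proof (cases "e = 0")
    case False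
    let ?t = "if odd e then fmul p t base else t" and ?D = "2 ^ p :: real"
    let ?\<epsilon> = "2 * \<epsilon> + 1" and ?\<delta> = "if odd e then 1 else 0 :: real"
    have b: "?D * \<beta>\<^sup>2 - ?\<epsilon> \<le> real (fmul p base base)"
    proof (cases "?D * \<beta> \<ge> \<epsilon>")
      case True
      have "(?D * \<beta>) * (?D * \<beta>) - 2 * (?D * \<beta>) * \<epsilon> \<le> (?D * \<beta> - \<epsilon>) * (?D * \<beta> - \<epsilon>)"
        by (simp add: algebra_simps)
      also have "\<dots> \<le> real base * real base" using True 1(2) by (intro mult_mono) auto
      finally have "((?D * \<beta>) * (?D * \<beta>) - 2 * (?D * \<beta>) * \<epsilon>) / ?D \<le> real base * real base / ?D"
        by (intro divide_right_mono) auto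
      moreover have "((?D * \<beta>) * (?D * \<beta>) - 2 * (?D * \<beta>) * \<epsilon>) / ?D = ?D * \<beta>\<^sup>2 - 2 * (\<beta> * \<epsilon>)"
        by (simp add: field_simps power2_eq_square)
      moreover have "\<beta> * \<epsilon> \<le> \<epsilon>" using 1(4-6) by (simp add: mult_left_le_one_le)
      ultimately show ?thesis using fmul_bounds(2)[of base base p] by simp
    next
      case False
      have "(?D * \<beta>) * \<beta> \<le> (?D * \<beta>) * 1" using 1(4,5) by (intro mult_left_mono) auto
      moreover have "?D * \<beta>\<^sup>2 = (?D * \<beta>) * \<beta>" by (simp add: power2_eq_square)
      ultimately have "?D * \<beta>\<^sup>2 \<le> \<epsilon>" using False by linarith
      then show ?thesis using 1(6) by linarith
    qed
    have tl: "?t \<le> t" using fmul_le[of base p t] 1(3) by simp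
    have ih: "real ?t * (\<beta>\<^sup>2) ^ (e div 2) - P * ((e div 2) * (?\<epsilon> + 1)) \<le> real (pw p (e div 2) (fmul p base base) ?t)"
      using b fmul_less[OF 1(3) 1(3)] 1(4-7) tl by (intro 1(1)[OF False]) (auto simp: power_le_one)
    have tt: "real t * (if odd e then \<beta> else 1) - P * (?\<delta> * (\<epsilon> + 1)) \<le> real ?t"
    proof (cases "odd e")
      case True
      have "real t * (?D * \<beta> - \<epsilon>) / ?D \<le> real t * real base / ?D"
        using 1(2) by (intro divide_right_mono mult_left_mono) auto
      moreover have "real t * (?D * \<beta> - \<epsilon>) / ?D = real t * \<beta> - (real t / ?D) * \<epsilon>" by (simp add: field_simps)
      moreover have "real t \<le> P * ?D" using 1(7) by (metis of_nat_le_iff of_nat_mult of_nat_numeral of_nat_power)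
      then have "(real t / ?D) * \<epsilon> \<le> P * \<epsilon>" using 1(6) by (intro mult_right_mono) (auto simp: field_simps)
      moreover have "1 \<le> real P" using assms(7) by simp
      ultimately have "real t * \<beta> - (P * \<epsilon> + P) \<le> real (fmul p t base)"
        using fmul_bounds(2)[of t base p] by linarith
      then show ?thesis using True by (simp add: distrib_left)
    qed simp
    have b1: "(\<beta>\<^sup>2) ^ (e div 2) \<le> 1" using 1(4,5) by (simp add: power_le_one)
    have "(real t * (if odd e then \<beta> else 1) - P * (?\<delta> * (\<epsilon> + 1))) * (\<beta>\<^sup>2) ^ (e div 2) \<le> real ?t * (\<beta>\<^sup>2) ^ (e div 2)"
      using tt by (intro mult_right_mono) auto
    moreover have "P * (?\<delta> * (\<epsilon> + 1)) * (\<beta>\<^sup>2) ^ (e div 2) \<le> P * (?\<delta> * (\<epsilon> + 1))"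
      using b1 1(6) by (intro mult_left_le) auto
    ultimately have "real t * ((if odd e then \<beta> else 1) * (\<beta>\<^sup>2) ^ (e div 2)) - P * (?\<delta> * (\<epsilon> + 1))
        - P * ((e div 2) * (?\<epsilon> + 1)) \<le> real (pw p (e div 2) (fmul p base base) ?t)"
      using ih by (simp add: left_diff_distrib mult.assoc)
    moreover have "P * (?\<delta> * (\<epsilon> + 1)) + P * ((e div 2) * (?\<epsilon> + 1)) = P * (e * (\<epsilon> + 1))"
    proof -
      have "real e = 2 * real (e div 2) + ?\<delta>" by (cases "odd e") (auto elim!: oddE evenE)
      then show ?thesis by (simp add: algebra_simps)
    qed
    ultimately show ?thesis using False power_halves[of e \<beta>] by (simp add: pw.simps[of p e])
  qed (simp add: pw.simps)
qed

lemma tval_error: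
  assumes "y < 2 ^ p"
  shows "\<bar>real_of_int (tval p y c e) - 2 ^ p * (c * (y / 2 ^ p) ^ e)\<bar> \<le> \<bar>c\<bar> * e"
proof -
  let ?x = "real y / 2 ^ p"
  have x: "0 \<le> ?x" "?x \<le> 1" "real y = 2 ^ p * ?x"
  proof -
    have "real y < 2 ^ p" using assms by (metis of_nat_less_iff of_nat_numeral of_nat_power)
    then show "?x \<le> 1" by simp
  qed auto
  have P: "real P * 2 ^ p * ?x ^ e - P * e \<le> pw p e y (P * 2 ^ p)" "pw p e y (P * 2 ^ p) \<le> real P * 2 ^ p * ?x ^ e" for P
  proof -
    have u: "real (pw p e y (P * 2 ^ p)) \<le> real (P * 2 ^ p) * ?x ^ e" using x by (intro pw_upper) auto
    then show "pw p e y (P * 2 ^ p) \<le> real P * 2 ^ p * ?x ^ e" by simp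
    show "real P * 2 ^ p * ?x ^ e - P * e \<le> pw p e y (P * 2 ^ p)"
    proof (cases "P = 0")
      case False
      have "real (P * 2 ^ p) * ?x ^ e - P * (e * (0 + 1 :: real)) \<le> pw p e y (P * 2 ^ p)"
        using x assms False by (intro pw_lower) auto
      then show ?thesis by simp
    qed simp
  qed
  show ?thesis
  proof (cases "c \<ge> 0")
    case True
    then have "real (nat c) = c" "nat (- c) = 0" by auto
    moreover have "pw p e y 0 = 0" using P(2)[of 0] by simp
    ultimately show ?thesis using P[of "nat c"] True by (simp add: tval_def algebra_simps)
  next
    case False
    then have "real (nat (- c)) = - c" "nat c = 0" by auto
    moreover have "pw p e y 0 = 0" using P(2)[of 0] by simp
    ultimately show ?thesis using P[of "nat (- c)"] False by (simp add: tval_def algebra_simps)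
  qed
qed

lemma evi_error:
  assumes "y < 2 ^ p"
  shows "\<bar>real_of_int (evi p c1 c2 c3 a d y) - 2 ^ p * tri c1 c2 c3 a d (y / 2 ^ p)\<bar> \<le> a * \<bar>c2\<bar> + d * \<bar>c3\<bar>"
proof -
  let ?x = "real y / 2 ^ p"
  have e: "real_of_int (evi p c1 c2 c3 a d y) - 2 ^ p * tri c1 c2 c3 a d ?x =
     (tval p y c1 0 - 2 ^ p * (c1 * ?x ^ 0)) + (tval p y c2 a - 2 ^ p * (c2 * ?x ^ a)) + (tval p y c3 d - 2 ^ p * (c3 * ?x ^ d))"
    by (simp add: evi_def tri_def algebra_simps)
  show ?thesis unfolding e using tval_error[OF assms, of c1 0] tval_error[OF assms, of c2 a] tval_error[OF assms, of c3 d]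
    by (simp add: mult.commute)
qed

lemma bis_result:
  fixes T :: "nat \<Rightarrow> bool" and lo hi k :: nat
  assumes "lo \<le> hi" "hi \<le> lo + 2 ^ k"
  defines "r \<equiv> bis T k lo hi"
  shows "snd r \<le> fst r + 1" "T (fst r) \<or> fst r = lo" "\<not> T (snd r) \<or> snd r = hi"
proof -
  have "snd (bis T k lo hi) \<le> fst (bis T k lo hi) + 1 \<and> (T (fst (bis T k lo hi)) \<or> fst (bis T k lo hi) = lo) \<and>
     (\<not> T (snd (bis T k lo hi)) \<or> snd (bis T k lo hi) = hi)"
    using assms(1,2)
  proof (induction k arbitrary: lo hi)
    case (Suc k)
    let ?m = "(lo + hi) div 2"
    have m: "lo \<le> ?m" "?m \<le> hi" "hi \<le> ?m + 2 ^ k" "?m \<le> lo + 2 ^ k" using Suc.prems by auto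
    show ?case using Suc.IH[OF m(2,3)] Suc.IH[OF m(1,4)] by (auto simp: Let_def)
  qed auto
  then show "snd r \<le> fst r + 1" "T (fst r) \<or> fst r = lo" "\<not> T (snd r) \<or> snd r = hi" unfolding r_def by auto
qed

text \<open>
  The precision of the arithmetic and the Lipschitz constant of the trinomial on \<open>[0, 1]\<close> happen
  to be bounded by the same quantity \<open>a \<bar>c2\<bar> + d \<bar>c3\<bar>\<close> (in units of \<open>2 ^ - p\<close>). It therefore does
  not matter that the sign test of the bisection is unreliable near the root.
\<close>

lemma bisi_root:
  fixes c1 c2 c3 :: int and a d p lo hi :: nat
  assumes "lo < hi" "hi \<le> 2 ^ p"
    and "tri c1 c2 c3 a d (lo / 2 ^ p) \<ge> 0" "tri c1 c2 c3 a d (hi / 2 ^ p) \<le> 0"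
  defines "y \<equiv> bisi p c1 c2 c3 a d lo hi"
  shows "lo \<le> y" "y < hi" "\<bar>tri c1 c2 c3 a d (y / 2 ^ p)\<bar> \<le> 2 * ((real a * \<bar>c2\<bar> + real d * \<bar>c3\<bar>) / 2 ^ p)"
proof -
  define E where "E = (real a * \<bar>c2\<bar> + real d * \<bar>c3\<bar>) / 2 ^ p"
  let ?f = "tri c1 c2 c3 a d" and ?T = "\<lambda>y. evi p c1 c2 c3 a d y > 0"
  let ?w = "snd (bis ?T p lo hi)"
  have y: "y = fst (bis ?T p lo hi)" by (simp add: y_def bisi_def)
  have hi: "hi \<le> lo + 2 ^ p" using assms by simp
  have le: "lo \<le> hi" using assms by simp
  note r = bis_result[OF le hi, of ?T, folded y]
  show l: "lo \<le> y" "y < hi" using bis_range[OF le, of ?T p] bis_less[OF assms(1), of ?T p] by (auto simp: y)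
  have w: "y \<le> ?w" "?w \<le> hi" using bis_range[OF le, of ?T p] by (auto simp: y)
  have E: "E \<ge> 0" by (simp add: E_def)
  have ev: "\<bar>real_of_int (evi p c1 c2 c3 a d u) / 2 ^ p - ?f (u / 2 ^ p)\<bar> \<le> E" if "u < 2 ^ p" for u
  proof -
    have "real_of_int (evi p c1 c2 c3 a d u) / 2 ^ p - ?f (u / 2 ^ p) =
       (real_of_int (evi p c1 c2 c3 a d u) - 2 ^ p * ?f (u / 2 ^ p)) / 2 ^ p" by (simp add: diff_divide_distrib)
    then have "\<bar>real_of_int (evi p c1 c2 c3 a d u) / 2 ^ p - ?f (u / 2 ^ p)\<bar> =
       \<bar>real_of_int (evi p c1 c2 c3 a d u) - 2 ^ p * ?f (u / 2 ^ p)\<bar> / 2 ^ p" by simp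
    also have "\<dots> \<le> E" unfolding E_def using evi_error[OF that, of c1 c2 c3 a d] by (intro divide_right_mono) auto
    finally show ?thesis .
  qed
  have lower: "?f (y / 2 ^ p) \<ge> - E"
  proof (cases "y = lo")
    case False
    then have "real_of_int (evi p c1 c2 c3 a d y) / 2 ^ p \<ge> 0" using r(2) by simp
    moreover have "y < 2 ^ p" using l assms(2) by simp
    ultimately show ?thesis using ev[of y] by linarith
  qed (use assms E in simp)
  have upper: "?f (?w / 2 ^ p) \<le> E"
  proof (cases "?w = hi")
    case False
    then have "real_of_int (evi p c1 c2 c3 a d ?w) / 2 ^ p \<le> 0" using r(3) by (simp add: divide_le_0_iff)
    moreover have "?w < 2 ^ p" using False w assms(2) by simp
    ultimately show ?thesis using ev[of ?w] by linarith
  qed (use assms E in simp)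
  have le1: "real u / 2 ^ p \<le> 1" if "u \<le> 2 ^ p" for u :: nat
  proof -
    have "real u \<le> 2 ^ p" using that by (metis of_nat_le_iff of_nat_numeral of_nat_power)
    then show ?thesis by simp
  qed
  have "\<bar>?f (y / 2 ^ p) - ?f (?w / 2 ^ p)\<bar> \<le> (a * \<bar>real_of_int c2\<bar> + d * \<bar>real_of_int c3\<bar>) * \<bar>y / 2 ^ p - ?w / 2 ^ p\<bar>"
    using le1[of y] le1[of ?w] l w assms(2) by (intro tri_lipschitz) auto
  also have "\<dots> \<le> (a * \<bar>real_of_int c2\<bar> + d * \<bar>real_of_int c3\<bar>) * (1 / 2 ^ p)"
  proof (intro mult_left_mono)
    have "\<bar>real y / 2 ^ p - ?w / 2 ^ p\<bar> = (real ?w - real y) / 2 ^ p"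
      using w by (simp add: diff_divide_distrib divide_right_mono)
    then show "\<bar>real y / 2 ^ p - ?w / 2 ^ p\<bar> \<le> 1 / 2 ^ p" using r(1) by (simp add: divide_right_mono)
  qed simp
  also have "\<dots> = E" by (simp add: E_def)
  finally have "\<bar>?f (y / 2 ^ p)\<bar> \<le> 2 * E" using lower upper by linarith
  then show "\<bar>?f (y / 2 ^ p)\<bar> \<le> 2 * ((real a * \<bar>c2\<bar> + real d * \<bar>c3\<bar>) / 2 ^ p)"
    by (simp only: E_def)
qed

text \<open>
  \<open>x\<close> approximates the root \<open>z\<close>, and \<open>z\<close> is either degenerate or has a slope that is not too
  small.
\<close>

definition close_root :: "real \<Rightarrow> real \<Rightarrow> real \<Rightarrow> nat \<Rightarrow> nat \<Rightarrow> real \<Rightarrow> real \<Rightarrow> bool" where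
  "close_root L B C m n x z \<longleftrightarrow> 0 < z \<and> \<bar>x - z\<bar> \<le> 2 / L ^ 12 * z \<and>
     (z * tri' B C m n z = 0 \<or> \<bar>z * tri' B C m n z\<bar> \<ge> 1 / (128 * L ^ 3))"

text \<open>
  The result of a bisection is turned into a root. A witness \<open>q\<close> with a clearly negative
  value is at a distance from the approximation \<open>x\<close> that exceeds the distance of the root,
  so the root lies on the same side of \<open>q\<close> as \<open>x\<close>.
\<close>

lemma approximate_root:
  assumes mn: "0 < m" "m < n" and A: "A \<ge> 1" and BC: "C < 0 \<or> C > 0 \<and> B < 0"
    and L: "8 \<le> L" "real n \<le> L" "real n * \<bar>B\<bar> \<le> L" "real n * \<bar>C\<bar> \<le> L"
    and x: "0 \<le> x" "x \<le> 1" "\<bar>tri A B C m n x\<bar> \<le> 4 / L ^ 23"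
    and q: "0 < q" "q \<le> 1" "tri A B C m n q \<le> - (1 / (2 * L))"
  obtains z where "tri A B C m n z = 0" "close_root L B C m n x z" "0 < x"
    "x \<le> q \<Longrightarrow> z < q" "q \<le> x \<Longrightarrow> q < z"
proof -
  let ?f = "tri A B C m n"
  have Lp: "L > 0" "1 \<le> L" using L(1) by auto
  have big: "8 ^ k \<le> L ^ k" for k using L(1) by (intro power_mono) auto
  have small: "4 / L ^ 23 \<le> 1 / (32 * L ^ 4)"
  proof -
    have "128 \<le> L ^ 19" using big[of 19] by simp
    then have "128 * L ^ 4 \<le> L ^ 19 * L ^ 4" using Lp by (intro mult_right_mono) auto
    then show ?thesis using Lp by (simp add: field_simps power_add[symmetric])
  qed
  have s4: "1 / (32 * L ^ 4) \<le> 1 / (4 * L)" "1 / (4 * L) \<le> 1 / 32"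
  proof -
    have "L ^ 1 \<le> L ^ 4" using Lp by (intro power_increasing) auto
    then show "1 / (32 * L ^ 4) \<le> 1 / (4 * L)" using Lp by (intro divide_left_mono) auto
    show "1 / (4 * L) \<le> 1 / 32" using L(1) by (intro divide_left_mono) auto
  qed
  have half: "\<bar>?f x\<bar> \<le> 1 / 2" using x(3) small s4 by linarith
  have "x \<noteq> 0"
  proof
    assume "x = 0"
    then have "?f x = A" using mn by (simp add: tri_def power_0_left)
    then show False using half A by simp
  qed
  then have x0: "0 < x" using x(1) by simp
  have Bn: "\<bar>B\<bar> \<le> L"
    using L(3) mn mult_right_mono[of 1 "real n" "\<bar>B\<bar>"] by simp
  have slope: "\<bar>x * tri' B C m n x\<bar> \<ge> 1 / (32 * L ^ 3)"
  proof (cases "C < 0")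
    case True
    have "x * tri' B C m n x \<le> ?f x - A"
      using A half x0 mn True by (intro tri_slope_one_change) auto
    then have "\<bar>x * tri' B C m n x\<bar> \<ge> 1 / 2" using half A by linarith
    moreover have "1 / (32 * L ^ 3) \<le> 1 / 2"
    proof -
      have "1 \<le> L ^ 3" using Lp by simp
      then have "2 \<le> 32 * L ^ 3" by linarith
      then show ?thesis using Lp by (intro divide_left_mono) auto
    qed
    ultimately show ?thesis by linarith
  next
    case False
    then show ?thesis using A BC mn L Bn x0 x(2,3) q small
      by (intro tri_slope_two_changes[where A = A and p = q and e = "4 / L ^ 23"]) auto
  qed
  obtain z where z: "?f z = 0" "\<bar>x - z\<bar> \<le> 2 / L ^ 12 * z" "\<bar>z - x\<bar> \<le> 1 / L ^ 12" "0 < z"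
    "\<bar>z * tri' B C m n z\<bar> \<ge> 1 / (128 * L ^ 3)"
    using tri_root_near[of m n n L B C x A] mn L x0 x(2,3) slope by auto
  have far: "1 / L ^ 12 < \<bar>x - q\<bar>"
  proof -
    have "1 / (4 * L) \<le> ?f x - ?f q"
    proof -
      have "1 / (2 * L) = 2 * (1 / (4 * L))" by simp
      then show ?thesis using q(3) x(3) small s4(1) by linarith
    qed
    also have "\<dots> \<le> (m * \<bar>B\<bar> + n * \<bar>C\<bar>) * \<bar>x - q\<bar>"
      using tri_lipschitz[of x q A B C m n] x q by simp
    also have "\<dots> \<le> (2 * L) * \<bar>x - q\<bar>"
    proof (intro mult_right_mono)
      have "real m * \<bar>B\<bar> \<le> real n * \<bar>B\<bar>" using mn by (intro mult_right_mono) auto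
      then show "m * \<bar>B\<bar> + n * \<bar>C\<bar> \<le> 2 * L" using L by simp
    qed simp
    finally have "1 / (8 * L\<^sup>2) \<le> \<bar>x - q\<bar>" using Lp by (simp add: field_simps power2_eq_square)
    moreover have "1 / L ^ 12 < 1 / (8 * L\<^sup>2)"
    proof -
      have "8 < L ^ 10" using big[of 10] by simp
      then have "8 * L\<^sup>2 < L ^ 10 * L\<^sup>2" using Lp by (intro mult_strict_right_mono) auto
      then show ?thesis using Lp by (simp add: field_simps power_add[symmetric])
    qed
    ultimately show ?thesis by linarith
  qed
  show thesis
  proof (rule that[OF z(1) _ x0])
    show "close_root L B C m n x z" unfolding close_root_def using z by simp
    show "z < q" if "x \<le> q" using that far z(3) by linarith
    show "q < z" if "q \<le> x" using that far z(3) by linarith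
  qed
qed

section \<open>Isolation of the roots in the unit interval\<close>

lemma tri_two_roots:
  assumes "A > 0" "C > 0" "0 < m" "m < n" "0 < u" "u < v" "0 < w"
    "tri A B C m n u = 0" "tri A B C m n v = 0" "tri A B C m n w = 0"
  shows "w = u \<or> w = v"
proof -
  have "\<not> (0 < r \<and> r < s \<and> s < t)" if "tri A B C m n r = 0" "tri A B C m n s = 0" "tri A B C m n t = 0" for r s t
    using tri_outside_roots[OF assms(1-4), of r s B t] that by auto
  note no = this
  consider "w < u" | "w = u" | "u < w" "w < v" | "w = v" | "v < w" by linarith
  then show ?thesis
  proof cases
    case 1
    then show ?thesis using no[of w u v] assms by blast
  next
    case 3
    then show ?thesis using no[of u w v] assms by blast
  next
    case 5
    then show ?thesis using no[of u v w] assms by blast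
  qed auto
qed

lemma tri_unique_below_one:
  assumes "A > 0" "C < 0 \<or> C > 0" "0 < m" "m < n" "tri A B C m n 1 < 0"
    "0 < u" "u < 1" "0 < v" "v < 1" "tri A B C m n u = 0" "tri A B C m n v = 0"
  shows "u = v"
proof -
  have False if "0 < r" "r < s" "s < 1" "tri A B C m n r = 0" "tri A B C m n s = 0" for r s
  proof (cases "C < 0")
    case True
    then show False using tri_one_change_unique[of A C m n r s B] that assms by auto
  next
    case False
    then show False using tri_outside_roots[of A C m n r s B 1] that assms by auto
  qed
  note no = this
  then show ?thesis using no[of u v] no[of v u] assms(6-) by (cases u v rule: linorder_cases) auto
qed

lemma tri_no_root_in_unit_interval:
  assumes "A > 0" "B \<noteq> 0" "C \<noteq> 0" "0 < m" "m < n" "A + B + C \<ge> 0" "\<not> (B < 0 \<and> C > 0 \<and> real m * (- B) < real n * C)"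
    "0 < u" "u < 1"
  shows "tri A B C m n u \<noteq> 0"
proof
  assume u: "tri A B C m n u = 0"
  have one: "tri A B C m n 1 = A + B + C" by (simp add: tri_def)
  show False
  proof (cases "C < 0")
    case True
    then show False using tri_one_change_unique[of A C m n u 1 B] u one assms by auto
  next
    case False
    then have C: "C > 0" using assms by simp
    show False
    proof (cases "B < 0")
      case True
      then show False using tri_no_root_below_one[of A C m n B u] u C assms by auto
    next
      case False
      then have "B * u ^ m > 0" "C * u ^ n > 0" using C assms by auto
      then show False using u assms(1) by (simp add: tri_def)
    qed
  qed
qed

text \<open>
  The bound \<open>2 ^ h\<close> for all quantities in the problem. It is invariant under reversal and
  under changes of signs.
\<close>

definition scaled :: "nat \<Rightarrow> int \<Rightarrow> int \<Rightarrow> int \<Rightarrow> nat \<Rightarrow> nat \<Rightarrow> bool" where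
  "scaled h c1 c2 c3 a d \<longleftrightarrow> 3 \<le> h \<and> 0 < a \<and> a < d \<and> c1 \<noteq> 0 \<and> c2 \<noteq> 0 \<and> c3 \<noteq> 0 \<and>
     int d * \<bar>c1\<bar> \<le> 2 ^ h \<and> int d * \<bar>c2\<bar> \<le> 2 ^ h \<and> int d * \<bar>c3\<bar> \<le> 2 ^ h"

lemma scaledD:
  assumes "scaled h c1 c2 c3 a d"
  shows "0 < a" "a < d" "8 \<le> (2::real) ^ h" "real d \<le> 2 ^ h" "real d * \<bar>real_of_int c1\<bar> \<le> 2 ^ h"
    "real d * \<bar>real_of_int c2\<bar> \<le> 2 ^ h" "real d * \<bar>real_of_int c3\<bar> \<le> 2 ^ h"
    "real a * \<bar>real_of_int c2\<bar> \<le> 2 ^ h"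
proof -
  have le: "real d * \<bar>real_of_int c\<bar> \<le> 2 ^ h" if "int d * \<bar>c\<bar> \<le> 2 ^ h" for c
  proof -
    have "real_of_int (int d * \<bar>c\<bar>) \<le> real_of_int (2 ^ h)" using that by (simp only: of_int_le_iff)
    then show ?thesis by simp
  qed
  show "0 < a" "a < d" "real d * \<bar>real_of_int c1\<bar> \<le> 2 ^ h"
    "real d * \<bar>real_of_int c2\<bar> \<le> 2 ^ h" "real d * \<bar>real_of_int c3\<bar> \<le> 2 ^ h"
    using assms le by (auto simp: scaled_def)
  have "(2::real) ^ 3 \<le> 2 ^ h" using assms by (intro power_increasing) (auto simp: scaled_def)
  then show "8 \<le> (2::real) ^ h" by simp
  have "1 \<le> \<bar>c1\<bar>" using assms by (auto simp: scaled_def)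
  then have "real_of_int 1 \<le> real_of_int \<bar>c1\<bar>" by (simp only: of_int_le_iff)
  then have "1 \<le> \<bar>real_of_int c1\<bar>" by simp
  then have "real d * 1 \<le> real d * \<bar>real_of_int c1\<bar>" by (intro mult_left_mono) auto
  moreover have "real d * \<bar>real_of_int c1\<bar> \<le> 2 ^ h" using le[of c1] assms by (simp add: scaled_def)
  ultimately show "real d \<le> 2 ^ h" by linarith
  have "real a * \<bar>real_of_int c2\<bar> \<le> real d * \<bar>real_of_int c2\<bar>"
    using assms by (intro mult_right_mono) (auto simp: scaled_def)
  moreover have "real d * \<bar>real_of_int c2\<bar> \<le> 2 ^ h" using le[of c2] assms by (simp add: scaled_def)
  ultimately show "real a * \<bar>real_of_int c2\<bar> \<le> 2 ^ h" by linarith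
qed

lemma power_24: "(2::real) ^ (24 * h) = (2 ^ h) ^ 24"
  by (simp add: power_mult[symmetric] mult.commute)

lemma power_24_quotients:
  assumes "(x::real) > 0"
  shows "(x + x) / x ^ 24 = 2 / x ^ 23" "x * x / x ^ 24 = 1 / x ^ 22"
proof -
  have "x ^ 24 = x * x ^ 23" "x ^ 24 = x * x * x ^ 22"
    using power_add[of x 1 23] power_add[of x 2 22] by (simp_all add: power2_eq_square)
  then show "(x + x) / x ^ 24 = 2 / x ^ 23" "x * x / x ^ 24 = 1 / x ^ 22"
    using assms by (simp_all add: field_simps)
qed

lemma bisection_root:
  assumes s: "scaled h c1 c2 c3 a d" and p: "p = 24 * h" and lh: "lo < hi" "hi \<le> 2 ^ p"
    and f: "tri c1 c2 c3 a d (lo / 2 ^ p) \<ge> 0" "tri c1 c2 c3 a d (hi / 2 ^ p) \<le> 0"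
  shows "lo \<le> bisi p c1 c2 c3 a d lo hi" "bisi p c1 c2 c3 a d lo hi < hi"
    "\<bar>tri c1 c2 c3 a d (bisi p c1 c2 c3 a d lo hi / 2 ^ p)\<bar> \<le> 4 / (2 ^ h) ^ 23"
proof -
  let ?E = "(real a * \<bar>c2\<bar> + real d * \<bar>c3\<bar>) / 2 ^ p" and ?L = "(2::real) ^ h"
  note b' = bisi_root[OF lh f]
  show "lo \<le> bisi p c1 c2 c3 a d lo hi" "bisi p c1 c2 c3 a d lo hi < hi" by (fact b')+
  have "?E \<le> (?L + ?L) / 2 ^ p"
    using scaledD[OF s] by (intro divide_right_mono add_mono) auto
  also have "\<dots> = 2 / ?L ^ 23" unfolding p power_24 by (rule power_24_quotients) simp
  finally show "\<bar>tri c1 c2 c3 a d (bisi p c1 c2 c3 a d lo hi / 2 ^ p)\<bar> \<le> 4 / (2 ^ h) ^ 23"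
    using b'(3) by linarith
qed

lemma power_far_from_one: "0 \<le> (t::real) \<Longrightarrow> 0 < k \<Longrightarrow> \<bar>t - 1\<bar> \<le> \<bar>t ^ k - 1\<bar>"
proof -
  assume l: "0 \<le> t" "0 < k"
  show ?thesis
  proof (cases "t \<ge> 1")
    case True
    then show ?thesis using power_increasing[of 1 k t] l by simp
  next
    case False
    then show ?thesis using power_decreasing[of 1 k t] l by simp
  qed
qed

text \<open>
  The value of the binomial \<open>A - C x ^ k\<close> is \<open>A\<close> times \<open>1 - (x / \<xi>) ^ k\<close>, and a power is at
  least as far from 1 as its base. So a small value of the binomial means a small relative
  error of \<open>x\<close>.
\<close>

lemma critical_point_approximation:
  assumes s: "scaled h c1 c2 c3 a d" and p: "p = 24 * h" and c: "c2 < 0" "c3 > 0" "int a * (- c2) < int d * c3"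
  defines "y \<equiv> min_y p c2 c3 a d"
  obtains \<xi> where "0 < \<xi>" "\<xi> < 1" "real d * c3 * \<xi> ^ (d - a) = real a * - real_of_int c2"
    "0 < y" "y < 2 ^ p" "\<bar>y / 2 ^ p - \<xi>\<bar> \<le> 2 / (2 ^ h) ^ 22 * \<xi>"
proof -
  let ?L = "(2::real) ^ h" and ?k = "d - a" and ?x = "y / 2 ^ p"
  note sd = scaledD[OF s]
  define A where "A = int a * (- c2)"
  define C where "C = int d * c3"
  have "0 < int a * (- c2)" using sd(1) c by (intro mult_pos_pos) auto
  then have A: "A \<ge> 1" unfolding A_def by linarith
  have AC: "A < C" using c by (simp add: A_def C_def)
  have rA: "real_of_int A = real a * - real_of_int c2" "real_of_int C = real d * c3" by (simp_all add: A_def C_def)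
  have k: "?k > 0" using sd by simp
  have L: "?L > 0" "?L \<ge> 8" using sd by auto
  define \<xi> where "\<xi> = root ?k (A / C)"
  have q: "0 < real_of_int A / C" "real_of_int A / C < 1" using A AC by auto
  have xi: "0 < \<xi>" "\<xi> < 1" "\<xi> ^ ?k = A / C" using q k by (auto simp: \<xi>_def real_root_lt_1_iff)
  have C0: "real_of_int C > 0" "real_of_int A \<ge> 1" using A AC by linarith+
  have t0: "tri A 0 (- C) 0 ?k (real 0 / 2 ^ p) = A" using k by (simp add: tri_def power_0_left)
  have t1: "tri A 0 (- C) 0 ?k (real (2 ^ p) / 2 ^ p) = A - C" by (simp add: tri_def)
  have y: "y = bisi p A 0 (- C) 0 ?k 0 (2 ^ p)" by (simp add: y_def min_y_def A_def C_def)
  let ?E = "(real 0 * \<bar>0::int\<bar> + real ?k * \<bar>- C\<bar>) / 2 ^ p"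
  have b: "y < 2 ^ p" "\<bar>tri A 0 (- C) 0 ?k ?x\<bar> \<le> 2 * ?E"
    using bisi_root[of 0 "2 ^ p" p A 0 "- C" 0 ?k] t0 t1 AC C0 unfolding y by auto
  have "real ?k * C \<le> ?L * ?L"
  proof (rule mult_mono)
    show "real (d - a) \<le> ?L" using sd(4) by simp
    show "real_of_int C \<le> ?L" using sd(7) c(2) unfolding rA by simp
  qed (use C0 in auto)
  then have "?E \<le> ?L * ?L / 2 ^ p" using C0 by (intro divide_right_mono) auto
  also have "\<dots> = 1 / ?L ^ 22" unfolding p power_24 by (rule power_24_quotients) simp
  finally have "\<bar>A - C * ?x ^ ?k\<bar> \<le> 2 / ?L ^ 22" using b(2) by (simp add: tri_def)
  moreover have "A - C * ?x ^ ?k = - A * ((?x / \<xi>) ^ ?k - 1)"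
    unfolding power_divide xi(3) using C0 by (simp add: field_simps)
  ultimately have "A * \<bar>(?x / \<xi>) ^ ?k - 1\<bar> \<le> 2 / ?L ^ 22" using C0 by (simp add: abs_mult)
  moreover have "1 * \<bar>(?x / \<xi>) ^ ?k - 1\<bar> \<le> A * \<bar>(?x / \<xi>) ^ ?k - 1\<bar>" using C0 by (intro mult_right_mono) auto
  moreover have "\<bar>?x / \<xi> - 1\<bar> \<le> \<bar>(?x / \<xi>) ^ ?k - 1\<bar>" using xi k by (intro power_far_from_one) auto
  ultimately have l: "\<bar>?x / \<xi> - 1\<bar> \<le> 2 / ?L ^ 22" by linarith
  have "?x - \<xi> = (?x / \<xi> - 1) * \<xi>" using xi by (simp add: field_simps)
  then have "\<bar>?x - \<xi>\<bar> = \<bar>?x / \<xi> - 1\<bar> * \<bar>\<xi>\<bar>" by (simp only: abs_mult)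
  also have "\<dots> \<le> 2 / ?L ^ 22 * \<bar>\<xi>\<bar>" by (rule mult_right_mono[OF l]) simp
  finally have near: "\<bar>?x - \<xi>\<bar> \<le> 2 / ?L ^ 22 * \<xi>" using xi(1) by simp
  have "y \<noteq> 0"
  proof
    assume "y = 0"
    then have "1 \<le> 2 / ?L ^ 22" using l by simp
    moreover have "?L ^ 1 \<le> ?L ^ 22" using L by (intro power_increasing) auto
    ultimately show False using L by (simp add: field_simps)
  qed
  then have y0: "0 < y" by simp
  have "real d * c3 * \<xi> ^ ?k = real a * - real_of_int c2" unfolding rA[symmetric] xi(3) using C0 by simp
  with y0 b(1) near xi(1,2) show thesis by (intro that[of \<xi>]) simp_all
qed

definition root_list :: "nat \<Rightarrow> int \<Rightarrow> int \<Rightarrow> int \<Rightarrow> nat \<Rightarrow> nat \<Rightarrow> nat list \<Rightarrow> bool" where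
  "root_list h c1 c2 c3 a d ys \<longleftrightarrow> distinct ys \<and>
     (\<exists>zs. distinct zs \<and> set zs = {x. 0 < x \<and> x < 1 \<and> tri c1 c2 c3 a d x = 0} \<and>
        list_all2 (\<lambda>y z. 0 < y \<and> y < 2 ^ (24 * h) \<and> close_root (2 ^ h) c2 c3 a d (real y / 2 ^ (24 * h)) z) ys zs)"

lemma root_list_one:
  assumes s: "scaled h c1 c2 c3 a d" and c: "c1 > 0" "c1 + c2 + c3 < 0"
  shows "root_list h c1 c2 c3 a d [bisi (24 * h) c1 c2 c3 a d 0 (2 ^ (24 * h))]"
proof -
  let ?f = "tri c1 c2 c3 a d" and ?p = "24 * h" and ?L = "(2::real) ^ h"
  let ?y = "bisi ?p c1 c2 c3 a d 0 (2 ^ ?p)"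
  note sd = scaledD[OF s]
  have f0: "?f (real 0 / 2 ^ ?p) = c1" using sd(1,2) by (simp add: tri_def power_0_left)
  have f1: "?f 1 = real_of_int (c1 + c2 + c3)" by (simp add: tri_def)
  have "real_of_int (c1 + c2 + c3) \<le> real_of_int (- 1)" using c(2) by (simp only: of_int_le_iff)
  then have f1': "?f 1 \<le> - 1" unfolding f1 by simp
  have "real_of_int 1 \<le> real_of_int c1" using c(1) by (simp only: of_int_le_iff)
  then have c1: "1 \<le> real_of_int c1" by simp
  have b: "?y < 2 ^ ?p" "\<bar>?f (?y / 2 ^ ?p)\<bar> \<le> 4 / ?L ^ 23"
    using bisection_root[OF s refl, of 0 "2 ^ ?p"] f0 f1' c1 by auto
  have BC: "real_of_int c3 < 0 \<or> real_of_int c3 > 0 \<and> real_of_int c2 < 0"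
    using c s by (auto simp: scaled_def)
  have "1 / (2 * ?L) \<le> 1 / 1" using sd(3) by (intro divide_left_mono) auto
  then have q: "?f 1 \<le> - (1 / (2 * ?L))" using f1' by linarith
  have x: "0 \<le> real ?y / 2 ^ ?p" "real ?y / 2 ^ ?p \<le> 1" using b(1) by (auto simp: less_imp_le)
  obtain z where z: "?f z = 0" "close_root ?L c2 c3 a d (?y / 2 ^ ?p) z" "0 < real ?y / 2 ^ ?p" "z < 1"
    using approximate_root[OF sd(1,2) c1 BC sd(3,4,6,7) x b(2) _ _ q] x(2) by auto
  have z0: "z > 0" using z(2) by (simp add: close_root_def)
  have unique: "w = z" if "0 < w" "w < 1" "?f w = 0" for w
    using tri_unique_below_one[of c1 c3 a d c2 w z] that z(1,4) z0 f1' sd(1,2) c1 BC by auto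
  have "{z} = {x. 0 < x \<and> x < 1 \<and> ?f x = 0}" using unique z(1,4) z0 by blast
  then have "set [z] = {x. 0 < x \<and> x < 1 \<and> ?f x = 0}" by simp
  moreover have "?y > 0" using z(3) by (simp add: zero_less_divide_iff)
  ultimately show ?thesis unfolding root_list_def using z(2) b(1)
    by (intro conjI exI[of _ "[z]"]) auto
qed

text \<open>
  The condition \<open>gap\<close> says that the minimum of the trinomial is either zero or clearly different
  from zero, so that its sign is revealed by the approximation.
\<close>

lemma root_list_critical:
  assumes s: "scaled h c1 c2 c3 a d" and c: "c1 > 0" "c2 < 0" "c3 > 0" "c1 + c2 + c3 \<ge> 0" "int a * (- c2) < int d * c3"
    and gap: "\<And>x. 0 < x \<Longrightarrow> real d * c3 * x ^ (d - a) = real a * - real_of_int c2 \<Longrightarrow>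
       tri c1 c2 c3 a d x = 0 \<or> \<bar>tri c1 c2 c3 a d x\<bar> \<ge> 1 / 2 ^ h"
  defines "p \<equiv> 24 * h"
  defines "y \<equiv> min_y p c2 c3 a d"
  defines "v \<equiv> evi p c1 c2 c3 a d y"
  shows "v > 2 ^ (22 * h) - 1 \<Longrightarrow> root_list h c1 c2 c3 a d []"
    and "v < - (2 ^ (22 * h) - 1) \<Longrightarrow> root_list h c1 c2 c3 a d (bisi p c1 c2 c3 a d 0 y #
           (if c1 + c2 + c3 > 0 then [bisi p (- c1) (- c2) (- c3) a d y (2 ^ p)] else []))"
    and "\<bar>v\<bar> \<le> 2 ^ (22 * h) - 1 \<Longrightarrow> root_list h c1 c2 c3 a d [y]"
proof -
  define L where "L = (2::real) ^ h"
  let ?f = "tri c1 c2 c3 a d" and ?x = "real y / 2 ^ p"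
  note sd = scaledD[OF s, folded L_def]
  have L: "L > 0" "L \<ge> 1" using sd(3) by auto
  have big: "8 ^ k \<le> L ^ k" for k using sd(3) by (intro power_mono) auto
  have "real_of_int 1 \<le> real_of_int c1" using c(1) by (simp only: of_int_le_iff)
  then have c1: "1 \<le> real_of_int c1" by simp
  have BC: "real_of_int c3 < 0 \<or> real_of_int c3 > 0 \<and> real_of_int c2 < 0" using c by auto
  obtain \<xi> where xi: "0 < \<xi>" "\<xi> < 1" "real d * c3 * \<xi> ^ (d - a) = real a * - real_of_int c2"
    and y: "0 < y" "y < 2 ^ p" "\<bar>?x - \<xi>\<bar> \<le> 2 / L ^ 22 * \<xi>"
    by (rule critical_point_approximation[OF s p_def[THEN meta_eq_to_obj_eq] c(2,3,5)], fold y_def L_def) (rule that; assumption)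
  have x: "0 < ?x" "?x < 1" using y(1,2) by (auto simp: less_imp_le)
  have near: "\<bar>?x - \<xi>\<bar> \<le> 2 / L ^ 22"
    using y(3) mult_left_mono[of \<xi> 1 "2 / L ^ 22"] xi(2) by simp
  have min: "?f w > ?f \<xi>" if "0 < w" "w \<noteq> \<xi>" for w
    by (rule tri_minimum) (use that xi(1,3) c1 c sd(1,2) in auto)
  have lip: "real a * \<bar>real_of_int c2\<bar> + real d * \<bar>real_of_int c3\<bar> \<le> 2 * L" using sd(7,8) by simp
  have f_near: "\<bar>?f ?x - ?f \<xi>\<bar> \<le> 4 / L ^ 21"
  proof -
    have "\<bar>?f ?x - ?f \<xi>\<bar> \<le> (real a * \<bar>real_of_int c2\<bar> + real d * \<bar>real_of_int c3\<bar>) * \<bar>?x - \<xi>\<bar>"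
      using x xi by (intro tri_lipschitz) auto
    also have "\<dots> \<le> (2 * L) * (2 / L ^ 22)" using lip near L by (intro mult_mono) auto
    also have "\<dots> = 4 / L ^ 21" using L(1) power_add[of L 1 21] by (simp add: field_simps)
    finally show ?thesis .
  qed
  have D: "(2::real) ^ p = L ^ 24" unfolding p_def L_def by (rule power_24)
  have v_near: "\<bar>real_of_int v - L ^ 24 * ?f \<xi>\<bar> \<le> 5 * L ^ 3"
  proof -
    have "\<bar>real_of_int v - L ^ 24 * ?f ?x\<bar> \<le> 2 * L"
      using evi_error[OF y(2), of c1 c2 c3 a d] lip unfolding v_def D by simp
    moreover have "\<bar>L ^ 24 * ?f ?x - L ^ 24 * ?f \<xi>\<bar> \<le> 4 * L ^ 3"
    proof -
      have "\<bar>L ^ 24 * ?f ?x - L ^ 24 * ?f \<xi>\<bar> = L ^ 24 * \<bar>?f ?x - ?f \<xi>\<bar>"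
        using L(1) by (simp add: abs_mult right_diff_distrib[symmetric])
      also have "\<dots> \<le> L ^ 24 * (4 / L ^ 21)" using f_near L(1) by (intro mult_left_mono) auto
      also have "\<dots> = 4 * L ^ 3" using L(1) power_add[of L 3 21] by (simp add: field_simps)
      finally show ?thesis .
    qed
    moreover have "2 * L \<le> L ^ 3"
    proof -
      have "2 \<le> L\<^sup>2" using big[of 2] by simp
      then have "2 * L \<le> L\<^sup>2 * L" using L(1) by (intro mult_right_mono) auto
      then show ?thesis by (simp add: power3_eq_cube power2_eq_square)
    qed
    ultimately show ?thesis by linarith
  qed
  have T: "real_of_int (2 ^ (22 * h) - 1) = L ^ 22 - 1" by (simp add: L_def power_mult[symmetric] mult.commute)
  \<comment> \<open>At the scale \<open>L ^ 24\<close> the error is at most \<open>5 L ^ 3\<close>, and a critical value other than 0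
    is at least \<open>L ^ 23\<close>. The threshold is between the two.\<close>
  have T3: "5 * L ^ 3 \<le> L ^ 22 - 1"
  proof -
    have "6 \<le> L ^ 19" using big[of 19] by simp
    then have "6 * L ^ 3 \<le> L ^ 19 * L ^ 3" using L(1) by (intro mult_right_mono) auto
    moreover have "1 \<le> L ^ 3" using L(2) by simp
    ultimately show ?thesis by (simp add: power_add[symmetric])
  qed
  have T23: "L ^ 24 * (1 / L) = L ^ 23" using L(1) power_add[of L 1 23] by (simp add: field_simps)
  have T4: "L ^ 22 - 1 < L ^ 23 - 5 * L ^ 3"
  proof -
    have "2 * L ^ 22 \<le> L * L ^ 22" using sd(3) by (intro mult_right_mono) auto
    also have "\<dots> = L ^ 23" using power_add[of L 1 22] by simp
    finally show ?thesis using T3 by linarith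
  qed
  have gap': "?f \<xi> = 0 \<or> ?f \<xi> \<ge> 1 / L \<or> ?f \<xi> \<le> - (1 / L)" using gap[OF xi(1,3), folded L_def] by linarith
  have vpos: "v > 2 ^ (22 * h) - 1" if "?f \<xi> \<ge> 1 / L"
  proof -
    have "L ^ 23 \<le> L ^ 24 * ?f \<xi>" unfolding T23[symmetric] using that L(1) by (intro mult_left_mono) auto
    then have "real_of_int v > real_of_int (2 ^ (22 * h) - 1)" unfolding T using v_near T4 by linarith
    then show ?thesis by (simp only: of_int_less_iff)
  qed
  have vneg: "v < - (2 ^ (22 * h) - 1)" if "?f \<xi> \<le> - (1 / L)"
  proof -
    have "L ^ 24 * ?f \<xi> \<le> L ^ 24 * - (1 / L)" using that L(1) by (intro mult_left_mono) auto
    then have "L ^ 24 * ?f \<xi> \<le> - (L ^ 23)" using T23 by linarith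
    then have "real_of_int v < - real_of_int (2 ^ (22 * h) - 1)" unfolding T using v_near T4 by linarith
    then have "real_of_int v < real_of_int (- (2 ^ (22 * h) - 1))" by simp
    then show ?thesis by (simp only: of_int_less_iff)
  qed
  have vzero: "\<bar>v\<bar> \<le> 2 ^ (22 * h) - 1" if "?f \<xi> = 0"
  proof -
    have "real_of_int \<bar>v\<bar> \<le> real_of_int (2 ^ (22 * h) - 1)" unfolding T using v_near T3 that by simp
    then show ?thesis by (simp only: of_int_le_iff)
  qed
  have th: "0 \<le> (2::int) ^ (22 * h) - 1" by simp
  show "root_list h c1 c2 c3 a d []" if v: "v > 2 ^ (22 * h) - 1"
  proof -
    have "?f \<xi> \<ge> 1 / L" using gap' vneg vzero v th by linarith
    moreover have "1 / L > 0" using L(1) by simp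
    ultimately have "?f \<xi> > 0" by linarith
    then have "{x. 0 < x \<and> x < 1 \<and> ?f x = 0} = {}" using min by force
    then show ?thesis by (simp add: root_list_def)
  qed
  show "root_list h c1 c2 c3 a d [y]" if v: "\<bar>v\<bar> \<le> 2 ^ (22 * h) - 1"
  proof -
    have f0: "?f \<xi> = 0" using gap' vneg vpos v by linarith
    have "{x. 0 < x \<and> x < 1 \<and> ?f x = 0} = {\<xi>}" using min f0 xi by force
    moreover have "close_root L c2 c3 a d ?x \<xi>"
    proof -
      have "\<xi> ^ d = \<xi> ^ a * \<xi> ^ (d - a)" using sd(2) by (simp add: power_add[symmetric])
      then have "real d * (c3 * \<xi> ^ d) = \<xi> ^ a * (real d * c3 * \<xi> ^ (d - a))" by simp
      also have "\<dots> = - (real a * (c2 * \<xi> ^ a))" unfolding xi(3) by simp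
      finally have "\<xi> * tri' c2 c3 a d \<xi> = 0"
        using sd(1,2) by (cases a; cases d) (auto simp: tri'_def algebra_simps)
      moreover have "2 / L ^ 22 * \<xi> \<le> 2 / L ^ 12 * \<xi>"
        using xi(1) L by (intro mult_right_mono divide_left_mono power_increasing) auto
      ultimately show ?thesis unfolding close_root_def using xi(1) y(3) by auto
    qed
    ultimately show ?thesis unfolding root_list_def L_def[symmetric] using y(1,2)
      by (intro conjI exI[of _ "[\<xi>]"]) (auto simp: p_def[symmetric])
  qed
  let ?y1 = "bisi p c1 c2 c3 a d 0 y" and ?y2 = "bisi p (- c1) (- c2) (- c3) a d y (2 ^ p)"
  show "root_list h c1 c2 c3 a d (?y1 # (if c1 + c2 + c3 > 0 then [?y2] else []))" if v: "v < - (2 ^ (22 * h) - 1)"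
  proof -
    have "?f \<xi> \<le> - (1 / L)" using gap' vpos vzero v th by linarith
    moreover have "4 / L ^ 21 \<le> 1 / (2 * L)"
    proof -
      have "8 \<le> L ^ 20" using big[of 20] by simp
      then have "8 * L \<le> L ^ 20 * L" using L(1) by (intro mult_right_mono) auto
      then have "8 * L \<le> L ^ 21" using power_add[of L 20 1] by simp
      then show ?thesis using L(1) by (simp add: field_simps)
    qed
    moreover have "1 / L = 2 * (1 / (2 * L))" by simp
    ultimately have fx: "?f ?x \<le> - (1 / (2 * L))" using f_near by linarith
    have "1 / (2 * L) > 0" using L(1) by simp
    then have fx0: "?f ?x < 0" using fx by linarith
    have f0: "?f (real 0 / 2 ^ p) \<ge> 0" using sd(1,2) c1 by (simp add: tri_def power_0_left)
    have b1: "?y1 < y" "\<bar>?f (?y1 / 2 ^ p)\<bar> \<le> 4 / L ^ 23"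
      using bisection_root[OF s p_def[THEN meta_eq_to_obj_eq] y(1) less_imp_le[OF y(2)], folded L_def] f0 fx0 by simp_all
    have x1: "0 \<le> real ?y1 / 2 ^ p" "real ?y1 / 2 ^ p \<le> ?x" using b1(1) by (auto intro: divide_right_mono)
    have x1': "real ?y1 / 2 ^ p \<le> 1" using x1 x by linarith
    obtain z1 where z1: "?f z1 = 0" "close_root L c2 c3 a d (?y1 / 2 ^ p) z1" "0 < real ?y1 / 2 ^ p" "z1 < ?x"
      using approximate_root[OF sd(1,2) c1 BC sd(3,4,6,7) x1(1) x1' b1(2) x(1) _ fx] x(2) x1(2) by auto
    have z10: "0 < z1" using z1(2) by (simp add: close_root_def)
    have z1_less: "z1 < 1" using z1(4) x by linarith
    have two: "w = u \<or> w = v" if "0 < u" "u < v" "0 < w" "?f u = 0" "?f v = 0" "?f w = 0" for u v w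
      using tri_two_roots[of c1 c3 a d u v w c2] that c1 c sd(1,2) by auto
    have f1: "?f 1 = real_of_int (c1 + c2 + c3)" by (simp add: tri_def)
    show ?thesis
    proof (cases "c1 + c2 + c3 = 0")
      case True
      have f10: "?f 1 = 0" unfolding f1 True by simp
      have unique: "w = z1" if "0 < w" "w < 1" "?f w = 0" for w
        using two[OF z10 z1_less that(1) z1(1) f10 that(3)] that(2) by linarith
      then have "{x. 0 < x \<and> x < 1 \<and> ?f x = 0} = {z1}" using z1(1) z10 z1_less by blast
      then show ?thesis unfolding root_list_def L_def[symmetric] using True z1 b1(1) y(2)
        by (intro conjI exI[of _ "[z1]"]) (auto simp: p_def[symmetric] zero_less_divide_iff)
    next
      case False
      then have s0: "c1 + c2 + c3 > 0" using c(4) by linarith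
      have f1': "?f 1 > 0" unfolding f1 using s0 by (simp only: of_int_0_less_iff)
      have s': "scaled h (- c1) (- c2) (- c3) a d" using s by (simp add: scaled_def)
      have neg: "tri (real_of_int (- c1)) (real_of_int (- c2)) (real_of_int (- c3)) a d t = - ?f t" for t
        by (simp add: tri_def)
      have b2: "y \<le> ?y2" "?y2 < 2 ^ p" "\<bar>?f (?y2 / 2 ^ p)\<bar> \<le> 4 / L ^ 23"
        using bisection_root[OF s' p_def[THEN meta_eq_to_obj_eq] y(2) order_refl, folded L_def, unfolded neg] fx0 f1'
        by simp_all
      have x2: "?x \<le> real ?y2 / 2 ^ p" "real ?y2 / 2 ^ p \<le> 1"
        using b2(1,2) by (auto intro: divide_right_mono simp: less_imp_le)
      have x2': "0 \<le> real ?y2 / 2 ^ p" by simp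
      obtain z2 where z2: "?f z2 = 0" "close_root L c2 c3 a d (?y2 / 2 ^ p) z2" "0 < real ?y2 / 2 ^ p" "?x < z2"
        using approximate_root[OF sd(1,2) c1 BC sd(3,4,6,7) x2' x2(2) b2(3) x(1) _ fx] x(2) x2(1) by auto
      have "z2 < 1"
      proof (rule ccontr)
        assume "\<not> z2 < 1"
        then have "z2 > 1" using z2(1) f1' by (cases "z2 = 1") auto
        have "\<exists>w\<ge>?x. w \<le> 1 \<and> ?f w = 0"
          using x fx0 f1' by (intro IVT') (auto simp: tri_def intro!: continuous_intros)
        then obtain w where w: "?x \<le> w" "w \<le> 1" "?f w = 0" by blast
        have z12: "z1 < z2" "0 < w" using z1(4) z2(4) w(1) x(1) by linarith+
        have "w = z1 \<or> w = z2" by (rule two[OF z10 z12 z1(1) z2(1) w(3)])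
        then show False using w z1(4) \<open>z2 > 1\<close> by auto
      qed
      note z2_less = this
      have z12: "z1 < z2" "0 < z2" using z1(4) z2(4) x(1) by linarith+
      have "{z1, z2} = {x. 0 < x \<and> x < 1 \<and> ?f x = 0}"
        using two[OF z10 z12(1) _ z1(1) z2(1)] z1(1) z10 z1_less z2(1) z12(2) z2_less by blast
      then have "set [z1, z2] = {x. 0 < x \<and> x < 1 \<and> ?f x = 0}" by simp
      then show ?thesis unfolding root_list_def L_def[symmetric] using s0 z1 z2 b1(1) b2 y(2) z12
        by (intro conjI exI[of _ "[z1, z2]"]) (auto simp: p_def[symmetric] zero_less_divide_iff)
    qed
  qed
qed

theorem root_list_sub_ys:
  assumes s: "scaled h c1 c2 c3 a d" and c: "c1 > 0"
    and gap: "\<And>x. c2 < 0 \<Longrightarrow> c3 > 0 \<Longrightarrow> 0 < x \<Longrightarrow> real d * c3 * x ^ (d - a) = real a * - real_of_int c2 \<Longrightarrow>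
       tri c1 c2 c3 a d x = 0 \<or> \<bar>tri c1 c2 c3 a d x\<bar> \<ge> 1 / 2 ^ h"
  shows "root_list h c1 c2 c3 a d (sub_ys (24 * h) (2 ^ (22 * h) - 1) c1 c2 c3 a d)"
proof -
  consider "c1 + c2 + c3 < 0" | "c1 + c2 + c3 \<ge> 0" "\<not> (c2 < 0 \<and> c3 > 0 \<and> int a * (- c2) < int d * c3)"
    | "c1 + c2 + c3 \<ge> 0" "c2 < 0" "c3 > 0" "int a * (- c2) < int d * c3" by linarith
  then show ?thesis
  proof cases
    case 1
    then show ?thesis using root_list_one[OF s c] by (simp add: sub_ys_def)
  next
    case 2
    have "\<not> (real_of_int c2 < 0 \<and> real_of_int c3 > 0 \<and> real a * (- real_of_int c2) < real d * real_of_int c3)"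
    proof -
      have "real a * (- real_of_int c2) = real_of_int (int a * (- c2))" "real d * real_of_int c3 = real_of_int (int d * c3)"
        by simp_all
      then show ?thesis using 2(2) by (simp only: of_int_less_iff of_int_less_0_iff of_int_0_less_iff) blast
    qed
    moreover have "0 \<le> real_of_int c1 + real_of_int c2 + real_of_int c3" using 2(1) by linarith
    ultimately have "tri c1 c2 c3 a d u \<noteq> 0" if "0 < u" "u < 1" for u
      using tri_no_root_in_unit_interval[of c1 c2 c3 a d u] c s that by (auto simp: scaled_def)
    then have "{x. 0 < x \<and> x < 1 \<and> tri c1 c2 c3 a d x = 0} = {}" by auto
    moreover have "sub_ys (24 * h) (2 ^ (22 * h) - 1) c1 c2 c3 a d = []" using 2 by (auto simp: sub_ys_def)
    ultimately show ?thesis by (simp add: root_list_def)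
  next
    case 3
    let ?v = "evi (24 * h) c1 c2 c3 a d (min_y (24 * h) c2 c3 a d)"
    note r = root_list_critical[OF s c 3(2,3,1,4) gap[OF 3(2,3)]]
    have th: "int (2 ^ (22 * h) - 1) = 2 ^ (22 * h) - 1" by (simp add: of_nat_diff)
    have "\<not> c1 + c2 + c3 < 0" using 3 by simp
    then show ?thesis
      unfolding sub_ys_def th min_y_def[symmetric] Let_def using 3(2-4) r by (auto simp del: of_nat_diff)
  qed
qed

section \<open>Approximate roots and symmetries\<close>

lemma times_tri': "x * tri' B C m n x = m * (B * x ^ m) + n * (C * x ^ n)"
  by (cases m; cases n) (auto simp: tri'_def algebra_simps)

text \<open>
  The form of the approximation that is preserved by all substitutions: distances are
  relative to \<open>z\<close>, and the slope is measured relative to the monomials.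
\<close>

definition apx :: "real \<Rightarrow> real \<Rightarrow> real \<Rightarrow> real \<Rightarrow> nat \<Rightarrow> nat \<Rightarrow> real \<Rightarrow> real \<Rightarrow> bool" where
  "apx L A B C m n x z \<longleftrightarrow> z \<noteq> 0 \<and> tri A B C m n z = 0 \<and> \<bar>x - z\<bar> \<le> 4 / L ^ 12 * \<bar>z\<bar> \<and>
     (z * tri' B C m n z = 0 \<or> \<bar>z * tri' B C m n z\<bar> \<ge> 1 / (256 * L ^ 4) * (\<bar>B * z ^ m\<bar> + \<bar>C * z ^ n\<bar>))"

lemma apx_direct:
  assumes L: "8 \<le> L" "\<bar>B\<bar> \<le> L" "\<bar>C\<bar> \<le> L" and z: "z \<le> 1" "tri A B C m n z = 0" "close_root L B C m n x z"
  shows "apx L A B C m n x z"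
proof -
  have z0: "z > 0" "\<bar>x - z\<bar> \<le> 2 / L ^ 12 * z" using z(3) by (auto simp: close_root_def)
  have "2 / L ^ 12 * z \<le> 4 / L ^ 12 * z" using z0(1) L by (intro mult_right_mono divide_right_mono) auto
  then have near: "\<bar>x - z\<bar> \<le> 4 / L ^ 12 * \<bar>z\<bar>" using z0 by simp
  have "\<bar>B * z ^ m\<bar> \<le> \<bar>B\<bar>" "\<bar>C * z ^ n\<bar> \<le> \<bar>C\<bar>"
    using z0 z(1) by (auto simp: abs_mult power_le_one intro: mult_left_le)
  then have "1 / (256 * L ^ 4) * (\<bar>B * z ^ m\<bar> + \<bar>C * z ^ n\<bar>) \<le> 1 / (256 * L ^ 4) * (2 * L)"
    using L by (intro mult_left_mono) auto
  also have "\<dots> = 1 / (128 * L ^ 3)" using L by (simp add: power4_eq_xxxx power3_eq_cube)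
  finally show ?thesis unfolding apx_def using z z0(1) near by (auto simp: close_root_def)
qed

lemma tri_reverse:
  assumes "z > 0" "m \<le> n"
  shows "tri A B C m n (1 / z) = tri C B A (n - m) n z / z ^ n"
proof -
  have "z ^ n = z ^ m * z ^ (n - m)" using assms(2) by (simp add: power_add[symmetric])
  then show ?thesis using assms(1) by (simp add: tri_def power_divide field_simps)
qed

text \<open>
  From \<open>f(1 / z) = g(z) / z ^ n\<close>, where \<open>g\<close> is the reversed trinomial, the logarithmic
  slopes at corresponding roots agree up to the sign and the factor \<open>z ^ n\<close>. The monomials
  carry the same factor.
\<close>

lemma apx_reverse:
  assumes mn: "0 < m" "m < n" and L: "8 \<le> L" "\<bar>B\<bar> \<le> L" "\<bar>C\<bar> \<le> L"
    and z: "z \<le> 1" "tri C B A (n - m) n z = 0" "close_root L B A (n - m) n x z"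
  shows "apx L A B C m n (1 / x) (1 / z)"
proof -
  have z0: "z > 0" "\<bar>x - z\<bar> \<le> 2 / L ^ 12 * z" using z(3) by (auto simp: close_root_def)
  have zn: "z ^ n = z ^ m * z ^ (n - m)" using mn by (simp add: power_add[symmetric])
  have L12: "2 / L ^ 12 \<le> 1 / 2"
  proof -
    have "8 ^ 12 \<le> L ^ 12" using L by (intro power_mono) auto
    then have "4 \<le> L ^ 12" by simp
    then show ?thesis using L by (simp add: field_simps)
  qed
  have "2 / L ^ 12 * z \<le> 1 / 2 * z" using L12 z0(1) by (intro mult_right_mono) auto
  then have x: "x \<ge> z / 2" using z0 by linarith
  have x0: "x > 0" using x z0 by linarith
  have "1 / x - 1 / z = (z - x) / (x * z)" using x0 z0 by (simp add: field_simps)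
  then have "\<bar>1 / x - 1 / z\<bar> = \<bar>x - z\<bar> / (x * z)" using x0 z0 by (simp add: abs_mult abs_minus_commute)
  also have "\<dots> \<le> (2 / L ^ 12 * z) / (x * z)" using z0 x0 by (intro divide_right_mono) auto
  also have "\<dots> = 2 / L ^ 12 * (1 / x)" using z0 by simp
  also have "\<dots> \<le> 2 / L ^ 12 * (2 / z)"
    using x x0 z0 L by (intro mult_left_mono) (auto simp: field_simps)
  finally have near: "\<bar>1 / x - 1 / z\<bar> \<le> 4 / L ^ 12 * \<bar>1 / z\<bar>" using z0 by simp
  have g: "C = - B * z ^ (n - m) - A * z ^ n" using z(2) by (simp add: tri_def)
  have slope: "(1 / z) * tri' B C m n (1 / z) = - (z * tri' B A (n - m) n z) / z ^ n"
  proof -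
    have "(1 / z) * tri' B C m n (1 / z) = (m * (B * z ^ (n - m)) + n * C) / z ^ n"
      unfolding times_tri' using z0 zn by (simp add: power_divide field_simps)
    also have "m * (B * z ^ (n - m)) + n * C = - (z * tri' B A (n - m) n z)"
      unfolding times_tri' using mn by (subst g) (simp add: of_nat_diff algebra_simps)
    finally show ?thesis by simp
  qed
  have T: "\<bar>B * (1 / z) ^ m\<bar> + \<bar>C * (1 / z) ^ n\<bar> \<le> (2 * L) / z ^ n"
  proof -
    have "\<bar>B * (1 / z) ^ m\<bar> + \<bar>C * (1 / z) ^ n\<bar> = (\<bar>B\<bar> * z ^ (n - m) + \<bar>C\<bar>) / z ^ n"
      using z0 zn by (simp add: power_divide abs_mult abs_divide field_simps)
    also have "\<bar>B\<bar> * z ^ (n - m) \<le> \<bar>B\<bar> * 1" using z0 z(1) by (intro mult_left_mono power_le_one) auto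
    also have "(\<bar>B\<bar> * 1 + \<bar>C\<bar>) / z ^ n \<le> (2 * L) / z ^ n" using L z0 by (intro divide_right_mono) auto
    finally show ?thesis using z0 by (simp add: divide_right_mono)
  qed
  show ?thesis unfolding apx_def
  proof (intro conjI)
    show "tri A B C m n (1 / z) = 0" using tri_reverse[OF z0(1), of m n A B C] mn z(2) by simp
    show "1 / z * tri' B C m n (1 / z) = 0 \<or>
      \<bar>1 / z * tri' B C m n (1 / z)\<bar> \<ge> 1 / (256 * L ^ 4) * (\<bar>B * (1 / z) ^ m\<bar> + \<bar>C * (1 / z) ^ n\<bar>)"
    proof (cases "z * tri' B A (n - m) n z = 0")
      case False
      then have s: "\<bar>z * tri' B A (n - m) n z\<bar> \<ge> 1 / (128 * L ^ 3)" using z(3) by (auto simp: close_root_def)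
      have "1 / (256 * L ^ 4) * (\<bar>B * (1 / z) ^ m\<bar> + \<bar>C * (1 / z) ^ n\<bar>) \<le> 1 / (256 * L ^ 4) * ((2 * L) / z ^ n)"
        using T L by (intro mult_left_mono) auto
      also have "\<dots> = 1 / (128 * L ^ 3) / z ^ n" using L by (simp add: power4_eq_xxxx power3_eq_cube)
      also have "\<dots> \<le> \<bar>z * tri' B A (n - m) n z\<bar> / z ^ n" using s z0 by (intro divide_right_mono) auto
      finally show ?thesis unfolding slope using z0 by (simp add: abs_divide)
    qed (simp only: slope, simp)
  qed (use z0 near in auto)
qed

lemma apx_negate:
  assumes "apx L A ((- 1) ^ m * B) ((- 1) ^ n * C) m n x z"
  shows "apx L A B C m n (- x) (- z)"
proof -
  have e: "tri A B C m n (- z) = tri A ((- 1) ^ m * B) ((- 1) ^ n * C) m n z"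
    by (simp add: tri_def power_minus[of z] mult_ac)
  have s: "(- z) * tri' B C m n (- z) = z * tri' ((- 1) ^ m * B) ((- 1) ^ n * C) m n z"
    unfolding times_tri' by (simp add: power_minus[of z] mult_ac)
  have T: "\<bar>B * (- z) ^ m\<bar> + \<bar>C * (- z) ^ n\<bar> = \<bar>(- 1) ^ m * B * z ^ m\<bar> + \<bar>(- 1) ^ n * C * z ^ n\<bar>"
    by (simp add: abs_mult power_abs)
  have d: "\<bar>- x - - z\<bar> = \<bar>x - z\<bar>" by simp
  show ?thesis using assms unfolding apx_def e s T d by auto
qed

lemma deriv_tri: "deriv (tri A B C m n) = tri' B C m n"
  using DERIV_imp_deriv[OF DERIV_tri] by auto

lemma tri'_eq_tri: "tri' B C m n = tri 0 (m * B) (n * C) (m - 1) (n - 1)"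
  by (auto simp: tri'_def tri_def)

text \<open>
  At a degenerate root the two terms of the derivative cancel, and the relative slope of the
  derivative is at least 1/2: its terms are multiplied by different integers \<open>m - 1\<close> and
  \<open>n - 1\<close>.
\<close>

theorem newton_converges_apx:
  assumes mn: "0 < m" "m < n" and BC: "B \<noteq> 0" and L: "8 \<le> L" "real n \<le> L" and a: "apx L A B C m n x z"
  defines "f \<equiv> tri A B C m n"
  shows "newton_converges (if degenerate_root f z then deriv f else f) x z"
proof -
  have z: "z \<noteq> 0" "f z = 0" "\<bar>x - z\<bar> \<le> 4 / L ^ 12 * \<bar>z\<bar>" using a by (auto simp: apx_def f_def)
  have n1: "real n \<ge> 1" using mn by simp
  have close: "4 / L ^ 12 \<le> 1 / (256 * L ^ 4) / (6 * real n ^ 2)"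
  proof -
    have "8 ^ 6 \<le> L ^ 6" using L by (intro power_mono) auto
    then have "6144 * L ^ 6 \<le> L ^ 6 * L ^ 6" using L by (intro mult_right_mono) auto
    then have "4 / L ^ 12 \<le> 1 / (1536 * L ^ 6)" using L by (simp add: field_simps power_add[symmetric])
    also have "L ^ 4 * real n ^ 2 \<le> L ^ 4 * L ^ 2" using L n1 by (intro mult_left_mono power_mono) auto
    then have "1 / (1536 * L ^ 6) \<le> 1 / (1536 * (L ^ 4 * real n ^ 2))"
      using L n1 by (intro divide_left_mono) (auto simp: power_add[symmetric])
    also have "\<dots> = 1 / (256 * L ^ 4) / (6 * real n ^ 2)" by simp
    finally show ?thesis .
  qed
  have L4: "1 \<le> 256 * L ^ 4"
  proof -
    have "1 \<le> L ^ 4" using L by simp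
    then show ?thesis by linarith
  qed
  have T: "\<bar>B * z ^ m\<bar> > 0" using BC z(1) by simp
  show ?thesis
  proof (cases "degenerate_root f z")
    case True
    then have d: "tri' B C m n z = 0" by (simp add: degenerate_root_def f_def deriv_tri)
    let ?w = "m * B * z ^ (m - 1)"
    have w: "?w \<noteq> 0" using BC z(1) mn by simp
    have e: "n * C * z ^ (n - 1) = - ?w" using d by (simp add: tri'_def algebra_simps)
    have "newton_converges (tri 0 (m * B) (n * C) (m - 1) (n - 1)) x z"
    proof (rule newton_tri[where d = n and \<mu> = "1 / 2"])
      show "tri 0 (m * B) (n * C) (m - 1) (n - 1) z = 0" using d unfolding tri'_eq_tri .
      have "z * tri' (m * B) (n * C) (m - 1) (n - 1) z = real (m - 1) * ?w - real (n - 1) * ?w"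
        unfolding times_tri' using e by simp
      also have "\<dots> = - (real (n - m) * ?w)" using mn by (simp add: of_nat_diff algebra_simps)
      finally have "\<bar>z * tri' (m * B) (n * C) (m - 1) (n - 1) z\<bar> = real (n - m) * \<bar>?w\<bar>" by (simp add: abs_mult)
      moreover have "1 * \<bar>?w\<bar> \<le> real (n - m) * \<bar>?w\<bar>" using mn by (intro mult_right_mono) auto
      ultimately show "1 / 2 * (\<bar>m * B * z ^ (m - 1)\<bar> + \<bar>n * C * z ^ (n - 1)\<bar>) \<le> \<bar>z * tri' (m * B) (n * C) (m - 1) (n - 1) z\<bar>"
        unfolding e by simp
      show "\<bar>m * B * z ^ (m - 1)\<bar> + \<bar>n * C * z ^ (n - 1)\<bar> > 0" unfolding e using w by simp
      have "1 / (256 * L ^ 4) / (6 * real n ^ 2) \<le> 1 / 2 / (6 * real n ^ 2)"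
      proof (intro divide_right_mono divide_left_mono)
        have "1 \<le> L ^ 4" using L by simp
        then show "2 \<le> 256 * L ^ 4" by linarith
      qed (use L in auto)
      then have "4 / L ^ 12 \<le> 1 / 2 / (6 * real n ^ 2)" using close by linarith
      from mult_right_mono[OF this, of "\<bar>z\<bar>"] show "\<bar>x - z\<bar> \<le> 1 / 2 / (6 * (real n)\<^sup>2) * \<bar>z\<bar>" using z(3) by linarith
    qed (use mn z in auto)
    then show ?thesis using True unfolding f_def deriv_tri tri'_eq_tri by simp
  next
    case False
    then have "z * tri' B C m n z \<noteq> 0" using z by (auto simp: degenerate_root_def f_def deriv_tri)
    then have s: "\<bar>z * tri' B C m n z\<bar> \<ge> 1 / (256 * L ^ 4) * (\<bar>B * z ^ m\<bar> + \<bar>C * z ^ n\<bar>)"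
      using a by (auto simp: apx_def)
    have "newton_converges (tri A B C m n) x z"
    proof (rule newton_tri[where d = n and \<mu> = "1 / (256 * L ^ 4)"])
      show "1 / (256 * L ^ 4) \<le> 1" "0 < 1 / (256 * L ^ 4)" using L4 by (auto simp: divide_le_eq)
      show "\<bar>x - z\<bar> \<le> 1 / (256 * L ^ 4) / (6 * (real n)\<^sup>2) * \<bar>z\<bar>"
        using mult_right_mono[OF close, of "\<bar>z\<bar>"] z(3) by linarith
      show "\<bar>B * z ^ m\<bar> + \<bar>C * z ^ n\<bar> > 0" using T by linarith
    qed (use mn z s in \<open>auto simp: f_def\<close>)
    then show ?thesis using False unfolding f_def by simp
  qed
qed

section \<open>The critical value of a trinomial\<close>

text \<open>
  The quantity in the definition of an ill-conditioned trinomial.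
\<close>

definition critical_ratio :: "real \<Rightarrow> real \<Rightarrow> real \<Rightarrow> nat \<Rightarrow> nat \<Rightarrow> real" where
  "critical_ratio A B C m n =
     \<bar>B / n\<bar> * \<bar>(real n - real m) / A\<bar> powr ((real n - real m) / n) * \<bar>m / C\<bar> powr (m / n)"

lemma critical_ratio_reverse:
  assumes "m \<le> n"
  shows "critical_ratio C B A (n - m) n = critical_ratio A B C m n"
  using assms by (simp add: critical_ratio_def of_nat_diff)

lemma critical_ratio_abs:
  "critical_ratio (\<bar>A\<bar>) (\<bar>B\<bar>) (\<bar>C\<bar>) m n = critical_ratio A B C m n"
  by (simp add: critical_ratio_def abs_divide)

text \<open>
  Eliminating \<open>\<xi>\<close> from the value of the trinomial at its critical point leaves a power of
  the critical ratio. The computation is linear in the logarithms.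
\<close>

lemma critical_ratio_powr:
  assumes pos: "A > 0" "B > 0" "C > 0" "0 < m" "m < n" "\<xi> > 0" and c: "n * C * \<xi> ^ (n - m) = m * B"
  shows "(B * \<xi> ^ m * (real n - real m) / (n * A)) powr ((real n - real m) / n) = critical_ratio A B C m n"
proof -
  define R where "R = B * \<xi> ^ m * (real n - real m) / (n * A)"
  let ?k = "real n - real m"
  have k: "?k > 0" "real (n - m) = ?k" using pos by (auto simp: of_nat_diff)
  have n0: "real n > 0" "real m > 0" using pos by auto
  have R0: "R > 0" unfolding R_def using pos k by simp
  have W0: "critical_ratio A B C m n > 0" unfolding critical_ratio_def using pos k by simp
  have "ln (n * C * \<xi> ^ (n - m)) = ln n + ln C + ?k * ln \<xi>"
    using pos k by (simp add: ln_mult ln_realpow)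
  moreover have "ln (m * B) = ln m + ln B" using pos by (simp add: ln_mult)
  ultimately have x: "?k * ln \<xi> = ln m + ln B - ln n - ln C" using c by simp
  have lR: "ln R = ln B + m * ln \<xi> + ln ?k - ln n - ln A"
    unfolding R_def using pos k by (simp add: ln_mult ln_div ln_realpow)
  have "critical_ratio A B C m n = B / n * (?k / A) powr (?k / n) * (m / C) powr (m / n)"
    unfolding critical_ratio_def using pos k by (simp add: abs_of_pos)
  then have lW: "ln (critical_ratio A B C m n) = (ln B - ln n) + ?k / n * (ln ?k - ln A) + m / n * (ln m - ln C)"
    using pos k by (simp add: ln_mult ln_div ln_powr)
  have "n * (?k / n * ln R) = ?k * ln R" using n0 by simp
  also have "\<dots> = ?k * (ln B + ln ?k - ln n - ln A) + m * (?k * ln \<xi>)"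
    unfolding lR by (simp add: algebra_simps)
  also have "\<dots> = ?k * (ln B + ln ?k - ln n - ln A) + m * (ln m + ln B - ln n - ln C)" by (simp only: x)
  also have "\<dots> = n * (ln B - ln n) + ?k * (ln ?k - ln A) + m * (ln m - ln C)" by (simp add: algebra_simps)
  also have "\<dots> = n * ln (critical_ratio A B C m n)"
    unfolding lW using n0 by (simp add: distrib_left)
  finally have "?k / n * ln R = ln (critical_ratio A B C m n)" using n0 by (metis mult_left_cancel less_numeral_extra(3))
  then have "ln (R powr (?k / n)) = ln (critical_ratio A B C m n)" using R0 by (simp add: ln_powr)
  moreover have "R powr (?k / n) > 0" using R0 by simp
  ultimately have "R powr (?k / n) = critical_ratio A B C m n" using W0 by (simp only: ln_inj_iff)
  then show ?thesis unfolding R_def .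
qed

lemma tri_critical_value:
  assumes "0 < m" "m < n" "A \<noteq> 0" "n * C * \<xi> ^ (n - m) = m * (- B)"
  shows "tri A B C m n \<xi> = A * (1 - (- B) * \<xi> ^ m * (real n - real m) / (n * A))"
proof -
  have "\<xi> ^ n = \<xi> ^ m * \<xi> ^ (n - m)" using assms by (simp add: power_add[symmetric])
  then have "n * (C * \<xi> ^ n) = \<xi> ^ m * (n * C * \<xi> ^ (n - m))" by simp
  also have "\<dots> = - (m * (B * \<xi> ^ m))" unfolding assms(4) by simp
  finally have "C * \<xi> ^ n = - (m * (B * \<xi> ^ m)) / n" using assms by (simp add: field_simps)
  then show ?thesis using assms by (simp add: tri_def field_simps)
qed

text \<open>
  A power with exponent at most 1 is not farther from 1 than its base, so the distance of
  the ratio from 1 carries over to the value.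
\<close>

lemma critical_value_gap:
  assumes pos: "A \<ge> 1" "B < 0" "C > 0" "0 < m" "m < n" "\<xi> > 0" and c: "n * C * \<xi> ^ (n - m) = m * (- B)"
    and W: "critical_ratio A B C m n = 1 \<or> \<bar>critical_ratio A B C m n - 1\<bar> \<ge> \<delta>"
  shows "tri A B C m n \<xi> = 0 \<or> \<bar>tri A B C m n \<xi>\<bar> \<ge> \<delta>"
proof -
  let ?W = "critical_ratio A B C m n"
  define R where "R = (- B) * \<xi> ^ m * (real n - real m) / (n * A)"
  define e where "e = (real n - real m) / n"
  have e: "0 < e" "e \<le> 1" using pos by (auto simp: e_def)
  have R0: "R > 0" unfolding R_def using pos by (intro divide_pos_pos mult_pos_pos) auto
  have "R powr e = critical_ratio (\<bar>A\<bar>) (\<bar>B\<bar>) (\<bar>C\<bar>) m n"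
    unfolding R_def e_def using critical_ratio_powr[of A "- B" C m n \<xi>] pos c by simp
  then have RW: "R powr e = ?W" by (simp only: critical_ratio_abs)
  have f: "tri A B C m n \<xi> = A * (1 - R)"
    unfolding R_def using pos c by (intro tri_critical_value) auto
  show ?thesis
  proof (cases "?W = 1")
    case True
    then have "e * ln R = 0" using RW R0 by (metis ln_powr ln_one)
    then have "R = 1" using e R0 by simp
    then show ?thesis using f by simp
  next
    case False
    have "\<bar>?W - 1\<bar> \<le> \<bar>R - 1\<bar>"
    proof (cases "R \<ge> 1")
      case True
      then have "R powr e \<le> R powr 1" "1 \<le> R powr e" using e powr_mono[of e 1 R] ge_one_powr_ge_zero[of R e] by auto
      then show ?thesis using RW R0 by simp
    next
      case False
      then have "R powr 1 \<le> R powr e" "R powr e \<le> 1" using e R0 powr_mono'[of e 1 R] powr_le1[of e R] by auto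
      then show ?thesis using RW R0 False by simp
    qed
    also have "\<dots> \<le> A * \<bar>R - 1\<bar>" using pos(1) mult_right_mono[of 1 A "\<bar>R - 1\<bar>"] by simp
    also have "\<dots> = \<bar>tri A B C m n \<xi>\<bar>" unfolding f using pos(1) by (simp add: abs_mult abs_minus_commute)
    finally show ?thesis using W False by linarith
  qed
qed

text \<open>
  The ratio depends on the absolute values only, so a degenerate root of either sign is as
  good as a critical point with value 0 for the signs \<open>+ - +\<close>.
\<close>

lemma critical_ratio_degenerate:
  assumes "0 < m" "m < n" "A \<noteq> 0" "B \<noteq> 0" "C \<noteq> 0" "tri A B C m n z = 0" "tri' B C m n z = 0"
  shows "critical_ratio A B C m n = 1"
proof -
  have "z \<noteq> 0"
  proof
    assume "z = 0"
    then show False using assms by (simp add: tri_def power_0_left)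
  qed
  let ?u = "\<bar>z\<bar>"
  have s: "m * (B * z ^ m) = - (n * (C * z ^ n))" using times_tri'[of z B C m n] assms(7) by simp
  have un: "?u ^ n = ?u ^ m * ?u ^ (n - m)" using assms by (simp add: power_add[symmetric])
  have "\<bar>m * (B * z ^ m)\<bar> = \<bar>n * (C * z ^ n)\<bar>" using s by simp
  then have "m * \<bar>B\<bar> * ?u ^ m = n * \<bar>C\<bar> * ?u ^ (n - m) * ?u ^ m" by (simp add: abs_mult power_abs un mult_ac)
  then have c: "n * \<bar>C\<bar> * ?u ^ (n - m) = m * \<bar>B\<bar>" using \<open>z \<noteq> 0\<close> by simp
  have "A + B * z ^ m = - (C * z ^ n)" using assms(6) by (simp add: tri_def)
  then have "n * (A + B * z ^ m) = m * (B * z ^ m)" using s by simp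
  then have "n * A = - ((real n - real m) * (B * z ^ m))" by (simp add: algebra_simps)
  then have "\<bar>n * A\<bar> = \<bar>(real n - real m) * (B * z ^ m)\<bar>" by simp
  then have "n * \<bar>A\<bar> = (real n - real m) * (\<bar>B\<bar> * ?u ^ m)" using assms(2) by (simp add: abs_mult power_abs)
  then have "\<bar>B\<bar> * ?u ^ m * (real n - real m) = n * \<bar>A\<bar>" by (simp add: mult_ac)
  moreover have "n * \<bar>A\<bar> \<noteq> 0" using assms(2,3) by simp
  ultimately have R: "\<bar>B\<bar> * ?u ^ m * (real n - real m) / (n * \<bar>A\<bar>) = 1" by simp
  show ?thesis using critical_ratio_powr[of "\<bar>A\<bar>" "\<bar>B\<bar>" "\<bar>C\<bar>" m n ?u] c \<open>z \<noteq> 0\<close> assms(1-5)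
    unfolding R critical_ratio_abs by simp
qed

section \<open>Correctness of the algorithm\<close>

text \<open>
  What is left of the hypothesis that the trinomial is not ill-conditioned. Unlike the
  hypothesis itself, it is preserved by the substitutions.
\<close>

definition separated :: "nat \<Rightarrow> int \<Rightarrow> int \<Rightarrow> int \<Rightarrow> nat \<Rightarrow> nat \<Rightarrow> bool" where
  "separated h c1 c2 c3 a d \<longleftrightarrow> critical_ratio c1 c2 c3 a d = 1 \<or> \<bar>critical_ratio c1 c2 c3 a d - 1\<bar> \<ge> 1 / 2 ^ h"

lemma root_list_neg:
  assumes "root_list h (- c1) (- c2) (- c3) a d ys"
  shows "root_list h c1 c2 c3 a d ys"
proof -
  have t: "tri (- A) (- B) (- C) a d x = - tri A B C a d x" for A B C x by (simp add: tri_def)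
  have t': "tri' (- B) (- C) a d x = - tri' B C a d x" for B C x by (simp add: tri'_def)
  have c: "close_root L (- B) (- C) a d x z = close_root L B C a d x z" for L B C x z
    by (simp add: close_root_def t')
  show ?thesis using assms by (simp add: root_list_def t c)
qed

lemma root_list_nsub:
  assumes s: "scaled h c1 c2 c3 a d" and sep: "separated h c1 c2 c3 a d"
  shows "root_list h c1 c2 c3 a d (nsub (24 * h) (2 ^ (22 * h) - 1) c1 c2 c3 a d)"
proof -
  have pos: "root_list h e1 e2 e3 a d (sub_ys (24 * h) (2 ^ (22 * h) - 1) e1 e2 e3 a d)"
    if e: "scaled h e1 e2 e3 a d" "separated h e1 e2 e3 a d" "e1 > 0" for e1 e2 e3
  proof (rule root_list_sub_ys[OF e(1,3)])
    fix x :: real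
    assume x: "e2 < 0" "e3 > 0" "0 < x" "real d * e3 * x ^ (d - a) = real a * - real_of_int e2"
    have "real_of_int 1 \<le> real_of_int e1" using e(3) by (simp only: of_int_le_iff)
    then show "tri e1 e2 e3 a d x = 0 \<or> 1 / 2 ^ h \<le> \<bar>tri e1 e2 e3 a d x\<bar>"
      using x e(2) scaledD(1,2)[OF e(1)] by (intro critical_value_gap) (auto simp: separated_def)
  qed
  show ?thesis
  proof (cases "c1 > 0")
    case True
    then show ?thesis using pos[OF s sep] by (simp add: nsub_def flip_def)
  next
    case False
    then have "c1 < 0" using s by (auto simp: scaled_def)
    moreover have "scaled h (- c1) (- c2) (- c3) a d" using s by (simp add: scaled_def)
    moreover have "separated h (- c1) (- c2) (- c3) a d" using sep by (simp add: separated_def critical_ratio_def)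
    ultimately have "root_list h (- c1) (- c2) (- c3) a d (sub_ys (24 * h) (2 ^ (22 * h) - 1) (- c1) (- c2) (- c3) a d)"
      by (intro pos) auto
    then show ?thesis using \<open>c1 < 0\<close> by (simp add: nsub_def flip_def root_list_neg)
  qed
qed

definition ratio :: "int \<times> int \<Rightarrow> real" where
  "ratio q = real_of_int (fst q) / real_of_int (snd q)"

definition good_fr :: "nat \<Rightarrow> int \<Rightarrow> int \<Rightarrow> int \<Rightarrow> nat \<Rightarrow> nat \<Rightarrow> int \<times> int \<Rightarrow> real \<Rightarrow> bool" where
  "good_fr h c1 c2 c3 a d q z \<longleftrightarrow> fst q \<noteq> 0 \<and> snd q \<noteq> 0 \<and>
     \<bar>fst q\<bar> \<le> 2 ^ (24 * h) \<and> \<bar>snd q\<bar> \<le> 2 ^ (24 * h) \<and> apx (2 ^ h) c1 c2 c3 a d (ratio q) z"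

text \<open>
  Correctness of a list of fractions for the roots in the set \<open>X\<close>. Since the fractions
  belong to \<open>X\<close> themselves, lists for disjoint sets can be concatenated without producing
  repetitions.
\<close>

definition correct_frs :: "nat \<Rightarrow> int \<Rightarrow> int \<Rightarrow> int \<Rightarrow> nat \<Rightarrow> nat \<Rightarrow> real set \<Rightarrow> (int \<times> int) list \<Rightarrow> bool" where
  "correct_frs h c1 c2 c3 a d X qs \<longleftrightarrow> distinct (map ratio qs) \<and> ratio ` set qs \<subseteq> X \<and>
     (\<exists>zs. list_all2 (good_fr h c1 c2 c3 a d) qs zs \<and> distinct zs \<and> set zs = {x \<in> X. tri c1 c2 c3 a d x = 0})"

lemma correct_frs_append:
  assumes "correct_frs h c1 c2 c3 a d X qs" "correct_frs h c1 c2 c3 a d Y rs" "X \<inter> Y = {}"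
  shows "correct_frs h c1 c2 c3 a d (X \<union> Y) (qs @ rs)"
proof -
  obtain zs where zs: "list_all2 (good_fr h c1 c2 c3 a d) qs zs" "distinct zs" "set zs = {x \<in> X. tri c1 c2 c3 a d x = 0}"
    using assms(1) unfolding correct_frs_def by blast
  obtain ws where ws: "list_all2 (good_fr h c1 c2 c3 a d) rs ws" "distinct ws" "set ws = {x \<in> Y. tri c1 c2 c3 a d x = 0}"
    using assms(2) unfolding correct_frs_def by blast
  have d: "distinct (map ratio qs)" "distinct (map ratio rs)" "ratio ` set qs \<subseteq> X" "ratio ` set rs \<subseteq> Y"
    using assms(1,2) unfolding correct_frs_def by blast+
  have "distinct (map ratio (qs @ rs))" using d assms(3) by (simp, blast)
  moreover have "ratio ` set (qs @ rs) \<subseteq> X \<union> Y" using d(3,4) by (simp add: image_Un, blast)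
  moreover have "list_all2 (good_fr h c1 c2 c3 a d) (qs @ rs) (zs @ ws)" using zs(1) ws(1) by (rule list_all2_appendI)
  moreover have "set zs \<inter> set ws = {}" unfolding zs(3) ws(3) using assms(3) by blast
  then have "distinct (zs @ ws)" using zs(2) ws(2) by simp
  moreover have "set (zs @ ws) = {x \<in> X \<union> Y. tri c1 c2 c3 a d x = 0}" unfolding set_append zs(3) ws(3) by blast
  ultimately show ?thesis unfolding correct_frs_def by blast
qed

lemma fraction_ratio: "ratio (fraction p False False y) = y / 2 ^ p" "ratio (fraction p False True y) = 2 ^ p / y"
  by (simp_all add: ratio_def fraction_def)

lemma coefficient_bounds:
  assumes "scaled h c1 c2 c3 a d"
  shows "\<bar>real_of_int c1\<bar> \<le> 2 ^ h" "\<bar>real_of_int c2\<bar> \<le> 2 ^ h" "\<bar>real_of_int c3\<bar> \<le> 2 ^ h"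
proof -
  have "1 \<le> real d" using scaledD(1,2)[OF assms] by simp
  then have "\<bar>real_of_int c\<bar> \<le> real d * \<bar>real_of_int c\<bar>" for c using mult_right_mono[of 1 "real d" "\<bar>real_of_int c\<bar>"] by simp
  then show "\<bar>real_of_int c1\<bar> \<le> 2 ^ h" "\<bar>real_of_int c2\<bar> \<le> 2 ^ h" "\<bar>real_of_int c3\<bar> \<le> 2 ^ h"
    using scaledD(5-7)[OF assms] by (blast intro: order_trans)+
qed

lemma distinct_map_inj: "distinct ys \<Longrightarrow> (\<And>x y. x \<in> set ys \<Longrightarrow> y \<in> set ys \<Longrightarrow> f x = f y \<Longrightarrow> x = y) \<Longrightarrow> distinct (map f ys)"
  by (simp add: distinct_map inj_on_def)

lemma root_listE:
  assumes "root_list h c1 c2 c3 a d ys" and p: "p = 24 * h"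
  obtains zs where "distinct ys" "distinct zs" "set zs = {x. 0 < x \<and> x < 1 \<and> tri c1 c2 c3 a d x = 0}"
    "list_all2 (\<lambda>y z. 0 < y \<and> y < 2 ^ p \<and> close_root (2 ^ h) c2 c3 a d (real y / 2 ^ p) z \<and> z < 1 \<and> tri c1 c2 c3 a d z = 0) ys zs"
    "\<forall>y\<in>set ys. 0 < y \<and> y < 2 ^ p"
proof -
  have d: "distinct ys" using assms unfolding root_list_def by (elim conjE)
  have "\<exists>zs. distinct zs \<and> set zs = {x. 0 < x \<and> x < 1 \<and> tri c1 c2 c3 a d x = 0} \<and>
        list_all2 (\<lambda>y z. 0 < y \<and> y < 2 ^ p \<and> close_root (2 ^ h) c2 c3 a d (real y / 2 ^ p) z) ys zs"
    using assms unfolding root_list_def by (elim conjE) simp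
  then obtain zs where zs: "distinct zs" "set zs = {x. 0 < x \<and> x < 1 \<and> tri c1 c2 c3 a d x = 0}"
    "list_all2 (\<lambda>y z. 0 < y \<and> y < 2 ^ p \<and> close_root (2 ^ h) c2 c3 a d (real y / 2 ^ p) z) ys zs" by (elim exE conjE)
  show thesis
  proof (rule that[OF d zs(1,2)])
    show "list_all2 (\<lambda>y z. 0 < y \<and> y < 2 ^ p \<and> close_root (2 ^ h) c2 c3 a d (real y / 2 ^ p) z \<and> z < 1 \<and> tri c1 c2 c3 a d z = 0) ys zs"
    proof (rule list_all2_all_nthI)
      fix i assume i: "i < length ys"
      then have "zs ! i \<in> {x. 0 < x \<and> x < 1 \<and> tri c1 c2 c3 a d x = 0}"
        using list_all2_lengthD[OF zs(3)] zs(2) nth_mem[of i zs] by simp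
      then show "0 < ys ! i \<and> ys ! i < 2 ^ p \<and> close_root (2 ^ h) c2 c3 a d (real (ys ! i) / 2 ^ p) (zs ! i) \<and>
          zs ! i < 1 \<and> tri c1 c2 c3 a d (zs ! i) = 0"
        using list_all2_nthD[OF zs(3) i] by blast
    qed (rule list_all2_lengthD[OF zs(3)])
    show "\<forall>y\<in>set ys. 0 < y \<and> y < 2 ^ p"
    proof
      fix y assume y: "y \<in> set ys"
      obtain i where i: "i < length ys" "ys ! i = y" using y unfolding in_set_conv_nth by (elim exE conjE)
      show "0 < y \<and> y < 2 ^ p" using list_all2_nthD[OF zs(3) i(1)] unfolding i(2) by blast
    qed
  qed
qed

lemma correct_below_one:
  assumes s: "scaled h c1 c2 c3 a d" and sep: "separated h c1 c2 c3 a d"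
  shows "correct_frs h c1 c2 c3 a d {0<..<1} (map (fraction (24 * h) False False) (nsub (24 * h) (2 ^ (22 * h) - 1) c1 c2 c3 a d))"
proof -
  define p where "p = 24 * h"
  define ys where "ys = nsub p (2 ^ (22 * h) - 1) c1 c2 c3 a d"
  note b = scaledD[OF s] coefficient_bounds[OF s]
  obtain zs where ys: "distinct ys" and zs: "distinct zs" "set zs = {x. 0 < x \<and> x < 1 \<and> tri c1 c2 c3 a d x = 0}"
    "list_all2 (\<lambda>y z. 0 < y \<and> y < 2 ^ p \<and> close_root (2 ^ h) c2 c3 a d (real y / 2 ^ p) z \<and> z < 1 \<and> tri c1 c2 c3 a d z = 0) ys zs"
    and yb: "\<forall>y\<in>set ys. 0 < y \<and> y < 2 ^ p"
    by (rule root_listE[OF root_list_nsub[OF s sep, folded p_def, folded ys_def] p_def])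
  have "distinct (map (\<lambda>y. ratio (fraction p False False y)) ys)"
    using ys by (intro distinct_map_inj) (simp_all add: fraction_ratio)
  moreover have "ratio ` set (map (fraction p False False) ys) \<subseteq> {0<..<1}"
    using yb by (auto simp: fraction_ratio)
  moreover have "list_all2 (good_fr h c1 c2 c3 a d) (map (fraction p False False) ys) zs"
    unfolding list_all2_map1
  proof (rule list_all2_mono[OF zs(3)])
    fix y z assume "0 < y \<and> y < 2 ^ p \<and> close_root (2 ^ h) c2 c3 a d (real y / 2 ^ p) z \<and> z < 1 \<and> tri c1 c2 c3 a d z = 0"
    then have h: "0 < y" "y < 2 ^ p" "close_root (2 ^ h) c2 c3 a d (real y / 2 ^ p) z" "z < 1" "tri c1 c2 c3 a d z = 0" by blast+
    have "apx (2 ^ h) c1 c2 c3 a d (real y / 2 ^ p) z" using b h by (intro apx_direct) auto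
    moreover have "int y \<le> int (2 ^ p)" using h(2) by (simp only: of_nat_le_iff less_imp_le)
    ultimately show "good_fr h c1 c2 c3 a d (fraction p False False y) z"
      using h(1) unfolding good_fr_def fraction_ratio p_def[symmetric] by (simp add: fraction_def)
  qed
  ultimately show ?thesis
    unfolding correct_frs_def p_def[symmetric] ys_def[symmetric] map_map comp_def using zs(1,2)
    by (intro conjI exI[of _ zs]) auto
qed

lemma separated_reverse:
  "scaled h c1 c2 c3 a d \<Longrightarrow> separated h c1 c2 c3 a d \<Longrightarrow> separated h c3 c2 c1 (d - a) d"
  using critical_ratio_reverse[of a d c3 c2 c1] by (simp add: separated_def scaled_def less_imp_le)

lemma scaled_reverse: "scaled h c1 c2 c3 a d \<Longrightarrow> scaled h c3 c2 c1 (d - a) d"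
  by (auto simp: scaled_def)

lemma correct_above_one:
  assumes s: "scaled h c1 c2 c3 a d" and sep: "separated h c1 c2 c3 a d"
  shows "correct_frs h c1 c2 c3 a d {1<..} (map (fraction (24 * h) False True) (nsub (24 * h) (2 ^ (22 * h) - 1) c3 c2 c1 (d - a) d))"
proof -
  define p where "p = 24 * h"
  define ys where "ys = nsub p (2 ^ (22 * h) - 1) c3 c2 c1 (d - a) d"
  note b = scaledD[OF s] coefficient_bounds[OF s]
  have da: "a \<le> d" using b by simp
  obtain ws where ys: "distinct ys" and ws: "distinct ws" "set ws = {x. 0 < x \<and> x < 1 \<and> tri c3 c2 c1 (d - a) d x = 0}"
    "list_all2 (\<lambda>y z. 0 < y \<and> y < 2 ^ p \<and> close_root (2 ^ h) c2 c1 (d - a) d (real y / 2 ^ p) z \<and> z < 1 \<and> tri c3 c2 c1 (d - a) d z = 0) ys ws"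
    and yb: "\<forall>y\<in>set ys. 0 < y \<and> y < 2 ^ p"
    by (rule root_listE[OF root_list_nsub[OF scaled_reverse[OF s] separated_reverse[OF s sep], folded p_def, folded ys_def] p_def])
  define zs where "zs = map (\<lambda>w. 1 / w) ws"
  have zs: "distinct zs" unfolding zs_def using ws(1) by (intro distinct_map_inj) simp_all
  have zset: "set zs = {x \<in> {1<..}. tri c1 c2 c3 a d x = 0}"
  proof (intro equalityI subsetI)
    fix x assume "x \<in> set zs"
    then obtain w where w: "w \<in> set ws" "x = 1 / w" by (auto simp: zs_def)
    then show "x \<in> {x \<in> {1<..}. tri c1 c2 c3 a d x = 0}"
      using tri_reverse[OF _ da, of w c1 c2 c3] unfolding ws(2) by auto
  next
    fix x assume x: "x \<in> {x \<in> {1<..}. tri c1 c2 c3 a d x = 0}"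
    then have "1 / x \<in> set ws"
      using tri_reverse[OF _ da, of "1 / x" c1 c2 c3] unfolding ws(2) by auto
    then show "x \<in> set zs" unfolding zs_def by (force simp: image_iff)
  qed
  have "distinct (map (\<lambda>y. ratio (fraction p False True y)) ys)"
    using ys yb by (intro distinct_map_inj) (auto simp: fraction_ratio)
  moreover have "ratio ` set (map (fraction p False True) ys) \<subseteq> {1<..}"
    using yb by (auto simp: fraction_ratio)
  moreover have "list_all2 (good_fr h c1 c2 c3 a d) (map (fraction p False True) ys) zs"
    unfolding list_all2_map1 zs_def list_all2_map2
  proof (rule list_all2_mono[OF ws(3)])
    fix y z assume "0 < y \<and> y < 2 ^ p \<and> close_root (2 ^ h) c2 c1 (d - a) d (real y / 2 ^ p) z \<and> z < 1 \<and> tri c3 c2 c1 (d - a) d z = 0"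
    then have h: "0 < y" "y < 2 ^ p" "close_root (2 ^ h) c2 c1 (d - a) d (real y / 2 ^ p) z" "z < 1" "tri c3 c2 c1 (d - a) d z = 0" by blast+
    have "apx (2 ^ h) c1 c2 c3 a d (1 / (y / 2 ^ p)) (1 / z)" using b h by (intro apx_reverse) auto
    moreover have "int y \<le> int (2 ^ p)" using h(2) by (simp only: of_nat_le_iff less_imp_le)
    ultimately show "good_fr h c1 c2 c3 a d (fraction p False True y) (1 / z)"
      using h(1) unfolding good_fr_def fraction_ratio p_def[symmetric] by (simp add: fraction_def)
  qed
  ultimately show ?thesis
    unfolding correct_frs_def p_def[symmetric] ys_def[symmetric] map_map comp_def using zs zset
    by (intro conjI exI[of _ zs])
qed

lemma correct_one:
  assumes s: "scaled h c1 c2 c3 a d"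
  shows "correct_frs h c1 c2 c3 a d {1} (one_root False (c1 + c2 + c3))"
proof -
  have f1: "tri c1 c2 c3 a d 1 = real_of_int (c1 + c2 + c3)" by (simp add: tri_def)
  note b = scaledD[OF s] coefficient_bounds[OF s]
  show ?thesis
  proof (cases "c1 + c2 + c3 = 0")
    case False
    then have "{x \<in> {1::real}. tri c1 c2 c3 a d x = 0} = {}" using f1 by (metis (mono_tags, lifting) Collect_empty_eq of_int_eq_0_iff singletonD)
    then show ?thesis using False by (simp add: correct_frs_def one_root_def)
  next
    case True
    then have root: "{x \<in> {1::real}. tri c1 c2 c3 a d x = 0} = {1}" using f1 by auto
    have s1: "1 * tri' c2 c3 a d 1 = real_of_int (int a * c2 + int d * c3)" by (simp add: times_tri')
    have "1 * tri' c2 c3 a d 1 = 0 \<or> 1 / (256 * (2 ^ h) ^ 4) * (\<bar>real_of_int c2 * 1 ^ a\<bar> + \<bar>real_of_int c3 * 1 ^ d\<bar>) \<le> \<bar>1 * tri' c2 c3 a d 1\<bar>"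
    proof (cases "int a * c2 + int d * c3 = 0")
      case False
      then have "1 \<le> \<bar>int a * c2 + int d * c3\<bar>" by linarith
      then have "real_of_int 1 \<le> real_of_int \<bar>int a * c2 + int d * c3\<bar>" by (simp only: of_int_le_iff)
      then have t: "1 \<le> \<bar>1 * tri' c2 c3 a d 1\<bar>" unfolding s1 by simp
      define L where "L = (2::real) ^ h"
      have L: "8 \<le> L" using b unfolding L_def by simp
      have "1 / (256 * L ^ 4) * (\<bar>real_of_int c2\<bar> + \<bar>real_of_int c3\<bar>) \<le> 1 / (256 * L ^ 4) * (2 * L)"
        using b(9-) L unfolding L_def[symmetric] by (intro mult_left_mono) auto
      also have "\<dots> \<le> 1"
      proof -
        have "L ^ 1 \<le> L ^ 4" using L by (intro power_increasing) auto
        moreover have "L > 0" using L by simp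
        ultimately show ?thesis by (simp add: field_simps)
      qed
      finally have "1 / (256 * L ^ 4) * (\<bar>real_of_int c2\<bar> + \<bar>real_of_int c3\<bar>) \<le> \<bar>1 * tri' c2 c3 a d 1\<bar>"
        using t by linarith
      then show ?thesis unfolding L_def by (intro disjI2) (simp only: power_one mult_1_right)
    qed (unfold s1, simp)
    then have "apx (2 ^ h) c1 c2 c3 a d 1 1" using f1 True by (simp add: apx_def)
    moreover have "ratio (1, 1) = 1" by (simp add: ratio_def)
    ultimately have "correct_frs h c1 c2 c3 a d {1} [(1, 1)]"
      unfolding correct_frs_def root by (intro conjI exI[of _ "[1]"]) (simp_all add: good_fr_def)
    then show ?thesis using True by (simp add: one_root_def)
  qed
qed

lemma correct_half:
  assumes s: "scaled h c1 c2 c3 a d" and sep: "separated h c1 c2 c3 a d"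
  shows "correct_frs h c1 c2 c3 a d {0<..} (half_fr False (24 * h) (2 ^ (22 * h) - 1) c1 c2 c3 a d)"
proof -
  have e: "{0<..} = {1::real} \<union> ({0<..<1} \<union> {1<..})" by auto
  show ?thesis unfolding half_fr_def e
    by (rule correct_frs_append[OF correct_one[OF s] correct_frs_append[OF correct_below_one[OF s sep] correct_above_one[OF s sep]]])
      auto
qed

definition neg_fr :: "int \<times> int \<Rightarrow> int \<times> int" where
  "neg_fr q = (- fst q, snd q)"

lemma half_fr_True: "half_fr True p th c1 c2 c3 a d = map neg_fr (half_fr False p th c1 c2 c3 a d)"
  by (simp add: half_fr_def one_root_def neg_fr_def fraction_def)

lemma ratio_neg_fr: "ratio (neg_fr q) = - ratio q"
  by (simp add: ratio_def neg_fr_def)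

lemma correct_neg:
  assumes "correct_frs h c1 ((- 1) ^ a * c2) ((- 1) ^ d * c3) a d {0<..} qs"
  shows "correct_frs h c1 c2 c3 a d {..<0} (map neg_fr qs)"
proof -
  let ?c2 = "(- 1) ^ a * c2" and ?c3 = "(- 1) ^ d * c3"
  obtain zs where q: "distinct (map ratio qs)" "ratio ` set qs \<subseteq> {0<..}"
    and zs: "list_all2 (good_fr h c1 ?c2 ?c3 a d) qs zs" "distinct zs" "set zs = {x \<in> {0<..}. tri c1 ?c2 ?c3 a d x = 0}"
    using assms unfolding correct_frs_def by blast
  have t: "tri c1 ?c2 ?c3 a d (- x) = tri c1 c2 c3 a d x" for x
  proof -
    have sq: "(- 1) ^ k * u * ((- 1) ^ k * v) = u * v" for k :: nat and u v :: real
      by (cases "even k") simp_all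
    show ?thesis by (simp add: tri_def power_minus[of x] sq)
  qed
  have "distinct (map ratio (map neg_fr qs))"
    using q(1) by (simp add: comp_def ratio_neg_fr distinct_map inj_on_def)
  moreover have "ratio ` set (map neg_fr qs) \<subseteq> {..<0}" using q(2) by (auto simp: ratio_neg_fr)
  moreover have "list_all2 (good_fr h c1 c2 c3 a d) (map neg_fr qs) (map uminus zs)"
    unfolding list_all2_map1 list_all2_map2
  proof (rule list_all2_mono[OF zs(1)])
    fix q z assume "good_fr h c1 ?c2 ?c3 a d q z"
    moreover from this have "apx (2 ^ h) c1 c2 c3 a d (- ratio q) (- z)"
      by (intro apx_negate) (simp add: good_fr_def)
    ultimately show "good_fr h c1 c2 c3 a d (neg_fr q) (- z)"
      by (simp add: good_fr_def ratio_neg_fr) (simp add: neg_fr_def)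
  qed
  moreover have "distinct (map uminus zs)" using zs(2) by (simp add: distinct_map)
  moreover have "set (map uminus zs) = {x \<in> {..<0}. tri c1 c2 c3 a d x = 0}"
  proof -
    have m: "x \<in> set (map uminus zs) \<longleftrightarrow> - x \<in> set zs" for x by force
    show ?thesis
      by (rule set_eqI) (simp only: m zs(3) mem_Collect_eq t greaterThan_iff lessThan_iff neg_0_less_iff_less)
  qed
  ultimately show ?thesis unfolding correct_frs_def by blast
qed

lemma power_neg_one_abs: "\<bar>(- 1) ^ k * c\<bar> = \<bar>c :: 'a :: linordered_idom\<bar>"
  by (simp add: abs_mult power_abs)

lemma scaled_twist: "scaled h c1 c2 c3 a d \<Longrightarrow> scaled h c1 ((- 1) ^ a * c2) ((- 1) ^ d * c3) a d"
  by (simp add: scaled_def power_neg_one_abs)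

lemma separated_twist: "separated h c1 c2 c3 a d \<Longrightarrow> separated h c1 ((- 1) ^ a * c2) ((- 1) ^ d * c3) a d"
proof -
  have "critical_ratio c1 (real_of_int ((- 1) ^ a * c2)) (real_of_int ((- 1) ^ d * c3)) a d = critical_ratio c1 c2 c3 a d"
    by (simp add: critical_ratio_def abs_divide power_neg_one_abs)
  then show "separated h c1 c2 c3 a d \<Longrightarrow> separated h c1 ((- 1) ^ a * c2) ((- 1) ^ d * c3) a d"
    unfolding separated_def by presburger
qed

theorem correct_all_fr:
  assumes s: "scaled h c1 c2 c3 a d" and sep: "separated h c1 c2 c3 a d"
  shows "correct_frs h c1 c2 c3 a d UNIV (all_fr (24 * h) (2 ^ (22 * h) - 1) c1 c2 c3 a d)"
proof -
  have "correct_frs h c1 c2 c3 a d ({0<..} \<union> {..<0}) (all_fr (24 * h) (2 ^ (22 * h) - 1) c1 c2 c3 a d)"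
    unfolding all_fr_def half_fr_True
    by (intro correct_frs_append correct_half correct_neg scaled_twist separated_twist s sep) auto
  moreover have "tri c1 c2 c3 a d 0 \<noteq> 0" using s by (auto simp: scaled_def tri_def power_0_left)
  then have "{x \<in> {0<..} \<union> {..<0}. tri c1 c2 c3 a d x = 0} = {x \<in> UNIV. tri c1 c2 c3 a d x = 0}"
    by (auto simp: neq_iff) (metis linorder_less_linear)+
  ultimately show ?thesis unfolding correct_frs_def by simp
qed

lemma all_pos_scaled:
  assumes s: "scaled h c1 c2 c3 a d" and sep: "separated h c1 c2 c3 a d"
  shows "all_pos (24 * h) (2 ^ (22 * h) - 1) c1 c2 c3 a d"
proof -
  have "y > 0" if "root_list h e1 e2 e3 m n ys" "y \<in> set ys" for e1 e2 e3 m n ys y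
    using that by (auto simp: root_list_def list_all2_conv_all_nth in_set_conv_nth)
  then show ?thesis unfolding all_pos_def
    using root_list_nsub[OF s sep] root_list_nsub[OF scaled_reverse[OF s] separated_reverse[OF s sep]] by blast
qed

section \<open>The algorithm as a Turing machine\<close>

lemma size_of_bounds:
  assumes "0 < d" "0 < H"
  shows "d * H < 2 ^ size_of d H" "2 ^ size_of d H \<le> 4 * (d * H)"
proof -
  have "d * H < 2 ^ bl d * 2 ^ bl H"
    using less_length_bits[of d] less_length_bits[of H] unfolding bl_def by (intro mult_strict_mono) auto
  then show "d * H < 2 ^ size_of d H" by (simp add: size_of_def power_add)
  have "2 ^ bl d * 2 ^ bl H \<le> (2 * d) * (2 * H)"
    using length_bits_ge[of d] length_bits_ge[of H] assms unfolding bl_def by (intro mult_mono) auto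
  then show "2 ^ size_of d H \<le> 4 * (d * H)" by (simp add: size_of_def power_add)
qed

lemma bl_ge: "2 ^ k \<le> n \<Longrightarrow> k < bl n"
  using less_length_bits[of n] unfolding bl_def by (metis le_less_trans nat_power_less_imp_less zero_less_numeral)

lemma scaled_size_of:
  assumes "admissible c1 c2 c3 a d H"
  shows "scaled (size_of d H) c1 c2 c3 a d"
proof -
  have a: "0 < a" "a < d" "c1 \<noteq> 0" "c2 \<noteq> 0" "c3 \<noteq> 0" "\<bar>c1\<bar> \<le> int H" "\<bar>c2\<bar> \<le> int H" "\<bar>c3\<bar> \<le> int H"
    using assms by (auto simp: admissible_def)
  then have H: "0 < H" by linarith
  have "1 < bl d" "0 < bl H" using a H by (auto intro!: bl_ge)
  then have 3: "3 \<le> size_of d H" by (simp add: size_of_def)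
  have "int d * \<bar>c\<bar> \<le> 2 ^ size_of d H" if "\<bar>c\<bar> \<le> int H" for c
  proof -
    have "int d * \<bar>c\<bar> \<le> int (d * H)" using that by (simp add: mult_left_mono)
    also have "\<dots> < int (2 ^ size_of d H)" using size_of_bounds(1)[of d H] a H by (simp only: of_nat_less_iff)
    finally show ?thesis by simp
  qed
  then show ?thesis using a 3 by (simp add: scaled_def)
qed

lemma trinomial_eq_tri: "trinomial c1 c2 c3 a d = tri c1 c2 c3 a d"
  by (auto simp: trinomial_def tri_def)

lemma separated_size_of:
  assumes adm: "admissible c1 c2 c3 a d H" and ill: "\<not> ill_conditioned c1 c2 c3 a d H"
  shows "separated (size_of d H) c1 c2 c3 a d"
proof -
  have a: "0 < a" "a < d" "c1 \<noteq> 0" "c2 \<noteq> 0" "c3 \<noteq> 0" "\<bar>c1\<bar> \<le> int H" using adm by (auto simp: admissible_def)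
  then have H: "0 < H" by linarith
  have N2: "2 \<le> d * H" using a H mult_le_mono[of 2 d 1 H] by simp
  consider "\<bar>critical_ratio c1 c2 c3 a d - 1\<bar> \<ge> 1 / ln (real (d * H))" |
    \<zeta> where "degenerate_root (trinomial c1 c2 c3 a d) \<zeta>"
    using adm ill unfolding ill_conditioned_def critical_ratio_def by fastforce
  then show ?thesis
  proof cases
    case 1
    have "1 < real (d * H)" using N2 by linarith
    then have p: "0 < ln (real (d * H))" by (rule ln_gt_zero)
    have "0 < real (d * H)" using N2 by linarith
    from ln_le_minus_one[OF this] have "ln (real (d * H)) \<le> real (d * H)" by linarith
    also have "\<dots> \<le> real (2 ^ size_of d H)" using size_of_bounds(1)[of d H] a H by (simp only: of_nat_le_iff) simp
    also have "\<dots> = 2 ^ size_of d H" by simp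
    finally have "1 / 2 ^ size_of d H \<le> 1 / ln (real (d * H))" using p by (intro divide_left_mono) auto
    then show ?thesis using 1 unfolding separated_def by linarith
  next
    case 2
    then have "tri c1 c2 c3 a d \<zeta> = 0" "tri' c2 c3 a d \<zeta> = 0"
      by (simp_all add: degenerate_root_def trinomial_eq_tri deriv_tri)
    then have "critical_ratio c1 c2 c3 a d = 1" using a by (intro critical_ratio_degenerate) auto
    then show ?thesis by (simp add: separated_def)
  qed
qed

lemma ln_not_one: "ln (real n) \<noteq> 1" if "2 \<le> n" for n
proof -
  have "ln (2::real) < 1" using ln2_le_25_over_36 by simp
  moreover have "1 < ln (real n)" if "3 \<le> n"
  proof -
    have "exp 1 < (3::real)" using e_less_272 by simp
    then have "exp 1 < real n" using that by linarith
    then show ?thesis using exp_gt_zero[of 1] by (metis ln_exp ln_less_cancel_iff order_less_trans)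
  qed
  ultimately show ?thesis using that by (cases "n = 2") force+
qed

text \<open>
  A constant factor is absorbed into an exponent tending to zero. This works for all arguments
  because no logarithm of an integer equals one.
\<close>

definition extra_exponent :: "real \<Rightarrow> nat \<Rightarrow> real" where
  "extra_exponent c n = ln c / ln (ln (real n))"

lemma extra_exponent:
  assumes "c > 0" "2 \<le> n"
  shows "ln (real n) powr (4 + extra_exponent c n) = c * ln (real n) ^ 4"
proof -
  have "1 < real n" using assms by simp
  then have l: "0 < ln (real n)" by (rule ln_gt_zero)
  have "ln (ln (real n)) \<noteq> 0" using l ln_not_one[OF assms(2)] by simp
  then have "ln (real n) powr extra_exponent c n = c"
    using l assms(1) by (simp add: extra_exponent_def powr_def)
  then show ?thesis using l by (simp add: powr_add powr_numeral)
qed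

lemma extra_exponent_tendsto: "extra_exponent c \<longlonglongrightarrow> 0"
proof -
  have "filterlim (\<lambda>n. ln (ln (real n))) at_top sequentially"
    by (intro filterlim_compose[OF ln_at_top] filterlim_real_sequentially)
  then show ?thesis unfolding extra_exponent_def
    by (intro tendsto_divide_0[OF tendsto_const] filterlim_at_top_imp_at_infinity)
qed

definition finds_roots :: "tm \<Rightarrow> (nat \<Rightarrow> real) \<Rightarrow> real \<Rightarrow> int \<Rightarrow> int \<Rightarrow> int \<Rightarrow> nat \<Rightarrow> nat \<Rightarrow> nat \<Rightarrow> bool" where
  "finds_roots M e K c1 c2 c3 a2 a3 H \<longleftrightarrow>
    (\<exists>(t::nat) (m::nat) (r :: nat \<Rightarrow> int) (s :: nat \<Rightarrow> int) (\<zeta> :: nat \<Rightarrow> real).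
       computes_within M
         (encode_ints [c1, c2, c3, int a2, int a3, int H])
         (encode_fractions (map (\<lambda>j. (r j, s j)) [0..<m])) t \<and>
       real t \<le> ln (real (a3 * H)) powr (4 + e (a3 * H)) \<and>
       (\<forall>j<m. s j \<noteq> 0) \<and>
       card {of_int (r j) / of_int (s j) :: rat | j. j < m} = m \<and>
       (\<forall>j<m. r j \<noteq> 0 \<longrightarrow>
          ln \<bar>real_of_int (r j)\<bar> \<le> K * ln (real (a3 * H)) \<and>
          ln \<bar>real_of_int (s j)\<bar> \<le> K * ln (real (a3 * H))) \<and>
       (\<forall>j<m. trinomial c1 c2 c3 a2 a3 (\<zeta> j) = 0 \<and>
          newton_converges
            (if degenerate_root (trinomial c1 c2 c3 a2 a3) (\<zeta> j)
             then deriv (trinomial c1 c2 c3 a2 a3)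
             else trinomial c1 c2 c3 a2 a3)
            (real_of_int (r j) / real_of_int (s j)) (\<zeta> j)) \<and>
       card (\<zeta> ` {..<m}) = m \<and>
       card {x. trinomial c1 c2 c3 a2 a3 x = 0} = m)"

theorem root_finding:
  obtains M e K where "valid_tm M" "e \<longlonglongrightarrow> 0"
    "\<And>c1 c2 c3 a d H. admissible c1 c2 c3 a d H \<Longrightarrow> \<not> ill_conditioned c1 c2 c3 a d H \<Longrightarrow>
      finds_roots M e K c1 c2 c3 a d H"
proof -
  obtain M C where M: "valid_tm M"
    and run: "\<And>c1 c2 c3 a d H p th. \<lbrakk>c1 \<noteq> 0; c2 \<noteq> 0; c3 \<noteq> 0; 0 < a; a < d;
        nat \<bar>c1\<bar> \<le> H; nat \<bar>c2\<bar> \<le> H; nat \<bar>c3\<bar> \<le> H;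
        p = 24 * size_of d H; th = 2 ^ (22 * size_of d H) - 1;
        all_pos p th c1 c2 c3 a d; all_pos p th c1 ((- 1) ^ a * c2) ((- 1) ^ d * c3) a d\<rbrakk> \<Longrightarrow>
      \<exists>t \<le> C * (25 * size_of d H + 3) ^ 4.
        computes_within M (encode_ints [c1, c2, c3, int a, int d, int H])
          (encode_fractions (all_fr p th c1 c2 c3 a d)) t"
    using root_finding_machine by blast
  define c where "c = (real C + 1) * (25 * (3 / ln 2) + 3 / ln 2) ^ 4"
  have "0 < real C + 1" by linarith
  moreover have "0 < 25 * (3 / ln 2) + 3 / ln (2::real)" by (intro add_pos_pos) auto
  ultimately have c0: "c > 0" unfolding c_def by (intro mult_pos_pos zero_less_power)
  show thesis
  proof (rule that[OF M extra_exponent_tendsto[of c], of 72])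
    fix c1 c2 c3 :: int and a d H :: nat
    assume adm: "admissible c1 c2 c3 a d H" and ill: "\<not> ill_conditioned c1 c2 c3 a d H"
    let ?h = "size_of d H" and ?N = "real (d * H)"
    have ad: "0 < a" "a < d" "c1 \<noteq> 0" "c2 \<noteq> 0" "c3 \<noteq> 0" "nat \<bar>c1\<bar> \<le> H" "nat \<bar>c2\<bar> \<le> H" "nat \<bar>c3\<bar> \<le> H"
      using adm by (auto simp: admissible_def)
    have H: "0 < H" using ad by linarith
    have N2: "2 \<le> d * H" using ad H mult_le_mono[of 2 d 1 H] by simp
    have N0: "0 < ?N" "2 \<le> ?N" using N2 by linarith+
    then have lnN: "ln 2 \<le> ln ?N" by (subst ln_le_cancel_iff) linarith+
    have hN: "real ?h * ln 2 \<le> 3 * ln ?N"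
    proof -
      have "real (2 ^ ?h) \<le> real (4 * (d * H))"
        using size_of_bounds(2)[of d H] ad H by (simp only: of_nat_le_iff)
      then have "2 ^ ?h \<le> 2\<^sup>2 * ?N" by simp
      moreover have "0 < 2\<^sup>2 * ?N" using N0(1) by (intro mult_pos_pos) auto
      ultimately have "ln (2 ^ ?h) \<le> ln (2\<^sup>2 * ?N)" by - (subst ln_le_cancel_iff, simp, assumption+)
      also have "\<dots> = 2 * ln 2 + ln ?N" 
        by (subst ln_mult_pos[OF _ N0(1)]) (simp_all only: ln_realpow zero_less_power zero_less_numeral of_nat_numeral)
      finally show ?thesis using lnN by (simp add: ln_realpow)
    qed
    note sc = scaled_size_of[OF adm] and sep = separated_size_of[OF adm ill]
    define qs where "qs = all_fr (24 * ?h) (2 ^ (22 * ?h) - 1) c1 c2 c3 a d"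
    obtain t where t: "t \<le> C * (25 * ?h + 3) ^ 4"
      "computes_within M (encode_ints [c1, c2, c3, int a, int d, int H]) (encode_fractions qs) t"
      using run[OF ad(3-5,1,2,6-8) refl refl all_pos_scaled[OF sc sep] all_pos_scaled[OF scaled_twist[OF sc] separated_twist[OF sep]]]
      unfolding qs_def by blast
    have time: "real t \<le> ln ?N powr (4 + extra_exponent c (d * H))"
    proof -
      have "real t \<le> real (C * (25 * ?h + 3) ^ 4)" using t(1) by (simp only: of_nat_le_iff)
      also have "\<dots> = real C * (25 * real ?h + 3) ^ 4" by simp
      also have "\<dots> \<le> (real C + 1) * ((25 * (3 / ln 2) + 3 / ln 2) * ln ?N) ^ 4"
      proof (intro mult_mono power_mono)
        have "real ?h \<le> 3 / ln 2 * ln ?N" using hN by (simp add: field_simps)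
        moreover have "3 \<le> 3 / ln 2 * ln ?N" using lnN by (simp add: field_simps)
        ultimately show "25 * real ?h + 3 \<le> (25 * (3 / ln 2) + 3 / ln 2) * ln ?N" by (simp add: distrib_right)
      qed auto
      also have "\<dots> = c * ln ?N ^ 4" unfolding c_def power_mult_distrib by simp
      also have "\<dots> = ln ?N powr (4 + extra_exponent c (d * H))" using extra_exponent[OF c0 N2] by simp
      finally show ?thesis .
    qed
    let ?f = "tri c1 c2 c3 a d"
    obtain zs where q: "distinct (map ratio qs)" and zs: "list_all2 (good_fr ?h c1 c2 c3 a d) qs zs" "distinct zs"
      "set zs = {x \<in> UNIV. ?f x = 0}"
      using correct_all_fr[OF sc sep] unfolding correct_frs_def qs_def[symmetric] by (elim conjE exE)
    have len: "length zs = length qs" using list_all2_lengthD[OF zs(1)] by simp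
    have good: "good_fr ?h c1 c2 c3 a d (qs ! j) (zs ! j)" if "j < length qs" for j
      using list_all2_nthD[OF zs(1) that] .
    have size: "ln \<bar>real_of_int x\<bar> \<le> 72 * ln ?N" if "x \<noteq> 0" "\<bar>x\<bar> \<le> 2 ^ (24 * ?h)" for x
    proof -
      have "real_of_int \<bar>x\<bar> \<le> real_of_int (2 ^ (24 * ?h))" using that(2) by (simp only: of_int_le_iff)
      then have "\<bar>real_of_int x\<bar> \<le> 2 ^ (24 * ?h)" by simp
      then have "ln \<bar>real_of_int x\<bar> \<le> ln (2 ^ (24 * ?h))" using that(1) by (subst ln_le_cancel_iff) auto
      also have "\<dots> = 24 * (real ?h * ln 2)" by (simp add: ln_realpow)
      finally show ?thesis using hN by linarith
    qed
    have L: "real d \<le> 2 ^ ?h" "8 \<le> (2::real) ^ ?h" using scaledD[OF sc] by blast+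
    define r s \<zeta> where "r = (\<lambda>j. fst (qs ! j))" and "s = (\<lambda>j. snd (qs ! j))" and "\<zeta> = (\<lambda>j. zs ! j)"
    let ?m = "length qs"
    have qs: "map (\<lambda>j. (r j, s j)) [0..<?m] = qs" by (simp add: r_def s_def map_nth)
    have inj: "inj_on (\<lambda>j. of_int (r j) / of_int (s j) :: rat) {..<?m}"
    proof (rule inj_onI)
      fix i j assume ij: "i \<in> {..<?m}" "j \<in> {..<?m}" "of_int (r i) / of_int (s i) = (of_int (r j) / of_int (s j) :: rat)"
      then have "of_rat (of_int (r i) / of_int (s i)) = (of_rat (of_int (r j) / of_int (s j)) :: real)" by simp
      then have "ratio (qs ! i) = ratio (qs ! j)" by (simp add: of_rat_divide ratio_def r_def s_def)
      then show "i = j" using q ij(1,2) by (simp add: distinct_conv_nth) (metis nth_map)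
    qed
    have "{of_int (r j) / of_int (s j) :: rat | j. j < ?m} = (\<lambda>j. of_int (r j) / of_int (s j)) ` {..<?m}" by auto
    then have card_fr: "card {of_int (r j) / of_int (s j) :: rat | j. j < ?m} = ?m" using card_image[OF inj] by simp
    have z_image: "\<zeta> ` {..<?m} = set zs" unfolding \<zeta>_def set_conv_nth len[symmetric] by auto
    have card_z: "card (set zs) = ?m" using distinct_card[OF zs(2)] len by simp
    have roots: "{x. trinomial c1 c2 c3 a d x = 0} = set zs" unfolding zs(3) trinomial_eq_tri by simp
    have newton: "trinomial c1 c2 c3 a d (\<zeta> j) = 0 \<and>
                 newton_converges
                   (if degenerate_root (trinomial c1 c2 c3 a d) (\<zeta> j)
                    then deriv (trinomial c1 c2 c3 a d)
                    else trinomial c1 c2 c3 a d)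
                   (real_of_int (r j) / real_of_int (s j)) (\<zeta> j)" if "j < ?m" for j
    proof -
      have a: "apx (2 ^ ?h) c1 c2 c3 a d (real_of_int (r j) / real_of_int (s j)) (\<zeta> j)"
        using good[OF that] by (simp add: good_fr_def ratio_def r_def s_def \<zeta>_def)
      moreover have "?f (\<zeta> j) = 0" using a by (simp add: apx_def)
      moreover have "real_of_int c2 \<noteq> 0" using ad by simp
      ultimately show ?thesis unfolding trinomial_eq_tri
        using newton_converges_apx[OF ad(1,2) _ L(2,1)] by blast
    qed
    show "finds_roots M (extra_exponent c) 72 c1 c2 c3 a d H"
      unfolding finds_roots_def
      apply (rule exI[of _ t], rule exI[of _ ?m], rule exI[of _ r], rule exI[of _ s], rule exI[of _ \<zeta>])
      unfolding qs z_image card_z card_fr roots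
      using t(2) time good size newton by (auto simp: good_fr_def r_def s_def)
  qed
qed

section \<open>Sums of concave functions\<close>

lemma powr_le_tangent:
  fixes x p :: real
  assumes "0 \<le> p" "p \<le> 1" "0 < x"
  shows "x powr p \<le> 1 + p * (x - 1)"
  using Youngs_inequality_0[of p "1 - p" x 1] assms by (simp add: algebra_simps)

lemma powr_ge_tangent:
  fixes x p :: real
  assumes "1 \<le> p" "0 < x"
  shows "1 + p * (x - 1) \<le> x powr p"
proof -
  have "(x powr p) powr (1 / p) \<le> 1 + (1 / p) * (x powr p - 1)"
    using assms by (intro powr_le_tangent) auto
  then have "x \<le> 1 + (1 / p) * (x powr p - 1)" using assms by (simp add: powr_powr)
  then have "p * x \<le> p * (1 + (1 / p) * (x powr p - 1))" using assms by (intro mult_left_mono) auto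
  then show ?thesis using assms by (simp add: algebra_simps)
qed

text \<open>
  Both values are compared with the tangent at the point between them.
\<close>

lemma powr_concave:
  fixes x y t b :: real
  assumes "0 < b" "b \<le> 1" "0 \<le> x" "0 \<le> y" "0 \<le> t" "t \<le> 1"
  shows "(1 - t) * x powr b + t * y powr b \<le> ((1 - t) * x + t * y) powr b"
proof -
  define z where "z = (1 - t) * x + t * y"
  have nn: "0 \<le> (1 - t) * x" "0 \<le> t * y" using assms by auto
  show ?thesis
  proof (cases "z = 0")
    case True
    then have "(1 - t) * x = 0" "t * y = 0" using nn unfolding z_def by linarith+
    then show ?thesis by auto
  next
    case False
    then have z: "z > 0" using nn unfolding z_def by linarith
    have tangent: "u powr b \<le> z powr b * (1 + b * (u / z - 1))" if "0 \<le> u" for u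
    proof (cases "u = 0")
      case True
      then show ?thesis using assms z by simp
    next
      case False
      then have "u powr b = z powr b * (u / z) powr b" using z that by (simp add: powr_divide)
      also have "\<dots> \<le> z powr b * (1 + b * (u / z - 1))"
        using False that z assms by (intro mult_left_mono powr_le_tangent) auto
      finally show ?thesis .
    qed
    have "(1 - t) * x powr b + t * y powr b \<le>
        (1 - t) * (z powr b * (1 + b * (x / z - 1))) + t * (z powr b * (1 + b * (y / z - 1)))"
      using assms by (intro add_mono mult_left_mono tangent) auto
    also have "\<dots> = z powr b * (1 + b * (((1 - t) * x + t * y) / z - 1))"
      using z by (simp add: field_simps)
    also have "((1 - t) * x + t * y) / z = 1" using z by (simp add: z_def)
    finally show ?thesis by (simp add: z_def)
  qed
qed

text \<open>
  The trapezoidal rule underestimates the integral of a concave function.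
\<close>

lemma sum_concave_le_integral:
  fixes f :: "real \<Rightarrow> real"
  assumes cont: "continuous_on {0..real n} f"
    and conc: "\<And>x y t. 0 \<le> x \<Longrightarrow> x \<le> real n \<Longrightarrow> 0 \<le> y \<Longrightarrow> y \<le> real n \<Longrightarrow> 0 \<le> t \<Longrightarrow> t \<le> 1 \<Longrightarrow>
      (1 - t) * f x + t * f y \<le> f ((1 - t) * x + t * y)"
  shows "(\<Sum>j=1..n. f (real j)) \<le> integral {0..real n} f + (f (real n) - f 0) / 2"
  using assms
proof (induction n)
  case (Suc n)
  have c: "continuous_on {0..real n} f" "continuous_on {real n..real (Suc n)} f"
    by (rule continuous_on_subset[OF Suc.prems(1)]; force)+
  have "(\<Sum>j=1..n. f (real j)) \<le> integral {0..real n} f + (f (real n) - f 0) / 2"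
    using Suc.prems(2) by (intro Suc.IH[OF c(1)]) auto
  moreover have "integral {0..real n} f + integral {real n..real (Suc n)} f = integral {0..real (Suc n)} f"
    using Suc.prems(1) by (intro Henstock_Kurzweil_Integration.integral_combine integrable_continuous_interval) auto
  moreover have "(f (real n) + f (real (Suc n))) / 2 \<le> integral {real n..real (Suc n)} f"
  proof -
    let ?l = "\<lambda>x. f (real n) + (f (real (Suc n)) - f (real n)) * (x - real n)"
    have "(?l has_integral ((f (real (Suc n)) - f (real n)) * (1 / 2) + f (real n))) {real n..real (Suc n)}"
    proof -
      have "((\<lambda>x. f (real n) + (f (real (Suc n)) - f (real n)) * (x - real n)) has_integral
          ((\<lambda>x. f (real n) * x + (f (real (Suc n)) - f (real n)) * ((x - real n)\<^sup>2 / 2)) (real (Suc n)) -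
          (\<lambda>x. f (real n) * x + (f (real (Suc n)) - f (real n)) * ((x - real n)\<^sup>2 / 2)) (real n))) {real n..real (Suc n)}"
        by (intro fundamental_theorem_of_calculus)
           (auto simp: has_real_derivative_iff_has_vector_derivative[symmetric] intro!: derivative_eq_intros)
      then show ?thesis by (simp add: algebra_simps)
    qed
    then have "(f (real (Suc n)) - f (real n)) * (1 / 2) + f (real n) \<le> integral {real n..real (Suc n)} f"
    proof (rule has_integral_le)
      show "(f has_integral integral {real n..real (Suc n)} f) {real n..real (Suc n)}"
        using c(2) by (intro integrable_integral integrable_continuous_interval)
      fix x assume x: "x \<in> {real n..real (Suc n)}"
      define t where "t = x - real n"
      have t: "0 \<le> t" "t \<le> 1" "x = (1 - t) * real n + t * real (Suc n)"
        using x by (auto simp: t_def algebra_simps)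
      have "?l x = (1 - t) * f (real n) + t * f (real (Suc n))" by (simp add: t_def algebra_simps)
      also have "\<dots> \<le> f ((1 - t) * real n + t * real (Suc n))" by (rule Suc.prems(2)) (use t in auto)
      finally show "?l x \<le> f x" using t(3) by simp
    qed
    then show ?thesis by (simp add: algebra_simps)
  qed
  ultimately show ?case by (simp add: field_simps)
qed simp

lemma sum_antimono_le_integral:
  fixes f :: "real \<Rightarrow> real"
  assumes cont: "continuous_on {0..real n} f"
    and anti: "\<And>x y. 0 \<le> x \<Longrightarrow> x \<le> y \<Longrightarrow> y \<le> real n \<Longrightarrow> f y \<le> f x"
  shows "(\<Sum>j=1..n. f (real j)) \<le> integral {0..real n} f"
  using assms
proof (induction n)
  case (Suc n)
  have c: "continuous_on {0..real n} f" "continuous_on {real n..real (Suc n)} f"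
    by (rule continuous_on_subset[OF Suc.prems(1)]; force)+
  have "(\<Sum>j=1..n. f (real j)) \<le> integral {0..real n} f"
    using Suc.prems(2) by (intro Suc.IH[OF c(1)]) auto
  moreover have "integral {0..real n} f + integral {real n..real (Suc n)} f = integral {0..real (Suc n)} f"
    using Suc.prems(1) by (intro Henstock_Kurzweil_Integration.integral_combine integrable_continuous_interval) auto
  moreover have "f (real (Suc n)) * (real (Suc n) - real n) \<le> integral {real n..real (Suc n)} f"
  proof (rule has_integral_le)
    show "((\<lambda>_. f (real (Suc n))) has_integral f (real (Suc n)) * (real (Suc n) - real n)) {real n..real (Suc n)}"
      using has_integral_const_real[of "f (real (Suc n))" "real n" "real (Suc n)"] by (simp add: mult.commute)
    show "(f has_integral integral {real n..real (Suc n)} f) {real n..real (Suc n)}"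
      using c(2) by (intro integrable_integral integrable_continuous_interval)
  qed (use Suc.prems(2) in auto)
  ultimately show ?case by simp
qed simp

section \<open>Counting points between two power functions\<close>

text \<open>
  With the first and last coefficient fixed, the middle one is confined to the interval
  between two of these functions of the first or last coefficient, capped at the maximal
  height.
\<close>

definition capped :: "real \<Rightarrow> real \<Rightarrow> real \<Rightarrow> real \<Rightarrow> real" where
  "capped h b w x = min h (w * x powr b)"

definition area :: "real \<Rightarrow> real \<Rightarrow> real" where
  "area b w = (if w \<le> 1 then w / (1 + b) else 1 - b / (1 + b) * w powr (- 1 / b))"

lemma continuous_capped: "0 < b \<Longrightarrow> continuous_on {0..c} (capped h b w)"
  unfolding capped_def
  by (intro continuous_on_min continuous_on_mult continuous_on_powr' continuous_on_const continuous_on_id) auto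

lemma integral_capped:
  assumes b: "0 < b" and w: "0 < w" and h: "0 < h"
  shows "integral {0..h} (capped h b w) = h\<^sup>2 * area b (w * h powr (b - 1))"
proof -
  define s where "s = w * h powr (b - 1)"
  have s: "s > 0" using w h by (simp add: s_def)
  have wh: "w * h powr b = h * s" using h by (simp add: s_def powr_diff)
  show ?thesis
  proof (cases "s \<le> 1")
    case True
    have "capped h b w x = w * x powr b" if "x \<in> {0..h}" for x
    proof -
      have "x powr b \<le> h powr b" using that b by (intro powr_mono2) auto
      then have "w * x powr b \<le> h * s" using w unfolding wh[symmetric] by simp
      also have "\<dots> \<le> h * 1" using True h by (intro mult_left_mono) auto
      finally show ?thesis by (simp add: capped_def)
    qed
    then have "integral {0..h} (capped h b w) = integral {0..h} (\<lambda>x. w * x powr b)"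
      by (rule Henstock_Kurzweil_Integration.integral_cong)
    also have "\<dots> = w * (h powr (b + 1) / (b + 1))"
      using b h by (intro integral_unique has_integral_mult_right has_integral_powr_from_0) auto
    also have "\<dots> = h\<^sup>2 * (s / (1 + b))"
      using h by (simp add: s_def powr_add powr_diff power2_eq_square add.commute)
    finally show ?thesis using True unfolding s_def[symmetric] by (simp add: area_def)
  next
    case False
    define c where "c = h * s powr (- 1 / b)"
    have "s powr (- 1 / b) \<le> 1" using False b powr_mono[of "- 1 / b" 0 s] by simp
    then have c: "0 < c" "c \<le> h" using h s by (auto simp: c_def mult_left_le)
    have cb: "w * c powr b = h"
    proof -
      have "c powr b = h powr b * (s powr (- 1 / b)) powr b" using h s by (simp add: c_def powr_mult)
      also have "(s powr (- 1 / b)) powr b = s powr (- 1 / b * b)" by (rule powr_powr)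
      also have "\<dots> = s powr (- 1)" using b by simp
      also have "\<dots> = 1 / s" using s by (simp add: powr_minus_divide)
      finally have "w * c powr b = (w * h powr b) / s" by simp
      then show ?thesis unfolding wh using s by simp
    qed
    have i1: "(capped h b w has_integral w * (c powr (b + 1) / (b + 1))) {0..c}"
    proof (rule has_integral_eq[OF _ has_integral_mult_right[OF has_integral_powr_from_0[of b c], of w]])
      fix x assume x: "x \<in> {0..c}"
      have "x powr b \<le> c powr b" using x b by (intro powr_mono2) auto
      then have "w * x powr b \<le> h" using w unfolding cb[symmetric] by simp
      then show "w * x powr b = capped h b w x" by (simp add: capped_def)
    qed (use b c in auto)
    have i2: "(capped h b w has_integral h * (h - c)) {c..h}"
    proof (rule has_integral_eq[of _ "\<lambda>_. h"])
      fix x assume x: "x \<in> {c..h}"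
      have "c powr b \<le> x powr b" using x b c by (intro powr_mono2) auto
      then have "h \<le> w * x powr b" using w unfolding cb[symmetric] by simp
      then show "h = capped h b w x" by (simp add: capped_def)
    next
      show "((\<lambda>_. h) has_integral h * (h - c)) {c..h}"
        using has_integral_const_real[of h c h] c by (simp add: mult.commute)
    qed
    have "(capped h b w has_integral w * (c powr (b + 1) / (b + 1)) + h * (h - c)) {0..h}"
      using has_integral_combine[OF _ c(2) i1 i2] c by simp
    then have "integral {0..h} (capped h b w) = w * (c powr (b + 1) / (b + 1)) + h * (h - c)"
      by (rule integral_unique)
    also have "w * (c powr (b + 1) / (b + 1)) = (w * c powr b) * c / (b + 1)" using c by (simp add: powr_add)
    also have "\<dots> = h * c / (b + 1)" unfolding cb ..
    also have "h * c / (b + 1) + h * (h - c) = h\<^sup>2 * (1 - b / (1 + b) * s powr (- 1 / b))"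
      using b by (simp add: c_def field_simps power2_eq_square)
    finally show ?thesis using False unfolding s_def[symmetric] by (simp add: area_def)
  qed
qed

text \<open>
  The upper function is concave, but the lower one enters with the wrong sign. With
  \<open>q = (1 - \<delta>) / (1 + \<delta>)\<close> the difference is \<open>1 - q\<close> times the upper function, to which the
  trapezoidal rule applies, plus a decreasing function, for which the sum is at most the
  integral. The correction from the trapezoidal rule then has the small factor \<open>1 - q\<close>.
\<close>

lemma sum_capped_difference:
  assumes b: "0 < b" "b \<le> 1" and s: "0 < s" and \<delta>: "0 < \<delta>" "\<delta> < 1" and n: "0 < n"
  defines "\<sigma> \<equiv> s * real n powr (b - 1)"
  shows "(\<Sum>j=1..n. capped n b ((1 + \<delta>) * s) (real j) - capped n b ((1 - \<delta>) * s) (real j)) \<le>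
    (real n)\<^sup>2 * (area b ((1 + \<delta>) * \<sigma>) - area b ((1 - \<delta>) * \<sigma>)) + \<delta> * n"
proof -
  let ?f = "capped n b ((1 + \<delta>) * s)" and ?g = "capped n b ((1 - \<delta>) * s)"
  define q where "q = (1 - \<delta>) / (1 + \<delta>)"
  have q: "0 < q" "q < 1" "1 - q = 2 * \<delta> / (1 + \<delta>)" using \<delta> by (auto simp: q_def field_simps)
  define D where "D = (\<lambda>x. q * ?f x - ?g x)"
  have f: "(\<Sum>j=1..n. ?f (real j)) \<le> integral {0..real n} ?f + (?f (real n) - ?f 0) / 2"
  proof (rule sum_concave_le_integral[OF continuous_capped[OF b(1)]])
    fix x y t :: real assume a: "0 \<le> x" "0 \<le> y" "0 \<le> t" "t \<le> 1"
    have "(1 - t) * ?f x + t * ?f y \<le> (1 - t) * n + t * n"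
      using a by (intro add_mono mult_left_mono) (auto simp: capped_def)
    moreover have "(1 - t) * ?f x + t * ?f y \<le> (1 - t) * ((1 + \<delta>) * s * x powr b) + t * ((1 + \<delta>) * s * y powr b)"
      using a by (intro add_mono mult_left_mono) (auto simp: capped_def)
    moreover have "(1 - t) * ((1 + \<delta>) * s * x powr b) + t * ((1 + \<delta>) * s * y powr b) =
        ((1 + \<delta>) * s) * ((1 - t) * x powr b + t * y powr b)" by (simp add: algebra_simps)
    moreover have "\<dots> \<le> ((1 + \<delta>) * s) * ((1 - t) * x + t * y) powr b"
      using a b s \<delta> by (intro mult_left_mono powr_concave) auto
    ultimately show "(1 - t) * ?f x + t * ?f y \<le> ?f ((1 - t) * x + t * y)"
      unfolding capped_def[of _ _ _ "(1 - t) * x + t * y"] by (simp add: algebra_simps)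
  qed
  have D: "(\<Sum>j=1..n. D (real j)) \<le> integral {0..real n} D"
  proof (rule sum_antimono_le_integral)
    show "continuous_on {0..real n} D" unfolding D_def by (intro continuous_intros continuous_capped b(1))
    have e: "D x = min (q * n) ((1 - \<delta>) * s * x powr b) - min n ((1 - \<delta>) * s * x powr b)" for x
    proof -
      have "q * min n ((1 + \<delta>) * s * x powr b) = min (q * n) (q * ((1 + \<delta>) * s * x powr b))"
        using q(1) by (simp add: min_mult_distrib_left)
      moreover have "q * (1 + \<delta>) = 1 - \<delta>" using \<delta> by (simp add: q_def)
      ultimately show ?thesis unfolding D_def capped_def by (simp add: mult.assoc[symmetric])
    qed
    fix x y :: real assume xy: "0 \<le> x" "x \<le> y"
    have "(1 - \<delta>) * s * x powr b \<le> (1 - \<delta>) * s * y powr b"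
      using xy b s \<delta> by (intro mult_left_mono powr_mono2) auto
    moreover have "q * real n \<le> n" using q by (simp add: mult_left_le_one_le)
    ultimately show "D y \<le> D x" unfolding e by (auto simp: min_def)
  qed
  have "?f x - ?g x = (1 - q) * ?f x + D x" for x by (simp add: D_def algebra_simps)
  then have "(\<Sum>j=1..n. ?f (real j) - ?g (real j)) = (1 - q) * (\<Sum>j=1..n. ?f (real j)) + (\<Sum>j=1..n. D (real j))"
    by (simp add: sum.distrib sum_distrib_left)
  also have "\<dots> \<le> (1 - q) * (integral {0..real n} ?f + (?f (real n) - ?f 0) / 2) + integral {0..real n} D"
    using f D q by (intro add_mono mult_left_mono) auto
  also have "integral {0..real n} D = q * integral {0..real n} ?f - integral {0..real n} ?g"
    unfolding D_def
    by (subst Henstock_Kurzweil_Integration.integral_diff)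
       (auto intro!: integrable_continuous_interval continuous_intros continuous_capped b(1))
  also have "(1 - q) * (integral {0..real n} ?f + (?f (real n) - ?f 0) / 2) + (q * integral {0..real n} ?f - integral {0..real n} ?g)
     = integral {0..real n} ?f - integral {0..real n} ?g + (1 - q) * ((?f (real n) - ?f 0) / 2)"
    by (simp add: algebra_simps)
  also have "(1 - q) * ((?f (real n) - ?f 0) / 2) \<le> \<delta> * n"
  proof -
    have "(?f (real n) - ?f 0) / 2 \<le> real n / 2" by (simp add: capped_def)
    then have "(1 - q) * ((?f (real n) - ?f 0) / 2) \<le> (1 - q) * (real n / 2)" using q by (intro mult_left_mono) auto
    also have "\<dots> = \<delta> / (1 + \<delta>) * n" unfolding q(3) using \<delta> by (simp add: field_simps)
    also have "\<delta> / (1 + \<delta>) \<le> \<delta> / 1" using \<delta> by (intro divide_left_mono) auto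
    finally show ?thesis by (simp add: mult_right_mono)
  qed
  also have "integral {0..real n} ?f = (real n)\<^sup>2 * area b ((1 + \<delta>) * \<sigma>)"
    using integral_capped[of b "(1 + \<delta>) * s" "real n"] b s \<delta> n by (simp add: \<sigma>_def mult.assoc)
  also have "integral {0..real n} ?g = (real n)\<^sup>2 * area b ((1 - \<delta>) * \<sigma>)"
    using integral_capped[of b "(1 - \<delta>) * s" "real n"] b s \<delta> n by (simp add: \<sigma>_def mult.assoc)
  finally show ?thesis by (simp add: right_diff_distrib)
qed

section \<open>The average width of the ill-conditioned region\<close>

lemma weighted_mean:
  fixes b v Y :: real
  assumes "0 < b" "0 < v" "0 < Y"
  shows "(1 + b) * (Y / v) powr (1 / (1 + b)) \<le> b * v powr (- 1 / b) + Y"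
proof -
  have w: "b / (1 + b) + 1 / (1 + b) = 1" using assms by (simp add: field_simps)
  have "(v powr (- 1 / b)) powr (b / (1 + b)) = v powr (- 1 / b * (b / (1 + b)))" by (rule powr_powr)
  also have "- 1 / b * (b / (1 + b)) = - (1 / (1 + b))" using assms by simp
  finally have "(v powr (- 1 / b)) powr (b / (1 + b)) * Y powr (1 / (1 + b)) = (Y / v) powr (1 / (1 + b))"
    using assms by (simp add: powr_minus powr_divide field_simps)
  moreover have "(v powr (- 1 / b)) powr (b / (1 + b)) * Y powr (1 / (1 + b)) \<le>
      b / (1 + b) * v powr (- 1 / b) + 1 / (1 + b) * Y"
    using assms w by (intro Youngs_inequality_0) auto
  ultimately have "(Y / v) powr (1 / (1 + b)) \<le> (b * v powr (- 1 / b) + Y) / (1 + b)"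
    by (simp add: add_divide_distrib)
  then show ?thesis using assms by (simp add: pos_le_divide_eq mult.commute)
qed

lemma area_ge:
  assumes "0 < b" "0 < Y"
  shows "1 + b - b * Y powr (- 1 / b) \<le> (1 + b) * area b Y"
proof (cases "Y \<le> 1")
  case True
  then show ?thesis using weighted_mean[of b Y Y] assms by (simp add: area_def)
next
  case False
  then show ?thesis using assms by (simp add: area_def field_simps)
qed

context
  fixes b \<delta> \<sigma> :: real
  assumes b: "0 < b" "b \<le> 1" and \<delta>: "0 < \<delta>" "\<delta> < 1" and \<sigma>: "0 < \<sigma>"
begin

lemma area_difference_small:
  assumes "(1 + \<delta>) * \<sigma> \<le> 1"
  shows "(1 + b) * (area b ((1 + \<delta>) * \<sigma>) - area b ((1 - \<delta>) * \<sigma>)) = 2 * \<delta> * \<sigma>"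
proof -
  have "(1 - \<delta>) * \<sigma> \<le> (1 + \<delta>) * \<sigma>" using \<delta> \<sigma> by (intro mult_right_mono) auto
  then have "(1 - \<delta>) * \<sigma> \<le> 1" using assms by linarith
  then have "area b ((1 + \<delta>) * \<sigma>) - area b ((1 - \<delta>) * \<sigma>) = (2 * \<delta> * \<sigma>) / (1 + b)"
    using assms by (simp add: area_def diff_divide_distrib[symmetric] algebra_simps)
  then show ?thesis using b by simp
qed

lemma area_large:
  assumes "1 < (1 + \<delta>) * \<sigma>"
  shows "(1 + b) * area b ((1 + \<delta>) * \<sigma>) = 1 + b - b * ((1 + \<delta>) * \<sigma>) powr (- 1 / b)"
  using assms b by (simp add: area_def field_simps)

lemma area_difference_peak:
  assumes "1 < (1 + \<delta>) * \<sigma>"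
  shows "area b ((1 + \<delta>) * \<sigma>) - area b ((1 - \<delta>) * \<sigma>) \<le> 1 - ((1 - \<delta>) / (1 + \<delta>)) powr (1 / (1 + b))"
proof -
  define q where "q = (1 - \<delta>) / (1 + \<delta>)"
  let ?v = "(1 + \<delta>) * \<sigma>" and ?Y = "(1 - \<delta>) * \<sigma>"
  have q: "0 < q" "q < 1" using \<delta> by (auto simp: q_def)
  have Y: "?Y > 0" using \<delta> \<sigma> by simp
  have vY: "?v = ?Y / q" "?Y / ?v = q" using \<delta> \<sigma> by (auto simp: q_def)
  have "(1 + b) * (area b ?v - area b ?Y) \<le> (1 + b) * (1 - q powr (1 / (1 + b)))"
  proof (cases "?Y \<le> 1")
    case True
    then have "(1 + b) * area b ?Y = ?Y" using b by (simp add: area_def)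
    moreover have "(1 + b) * q powr (1 / (1 + b)) \<le> b * ?v powr (- 1 / b) + ?Y"
      using weighted_mean[of b ?v ?Y] b Y assms unfolding vY(2) by simp
    ultimately show ?thesis using area_large[OF assms] by (simp add: right_diff_distrib)
  next
    case False
    have "(1 + b) * area b ?Y = 1 + b - b * ?Y powr (- 1 / b)"
      using False b by (simp add: area_def field_simps)
    moreover have "?v powr (- 1 / b) = ?Y powr (- 1 / b) * q powr (1 / b)"
    proof -
      have "?v powr (- 1 / b) = ?Y powr (- 1 / b) / q powr (- 1 / b)" unfolding vY(1) by (rule powr_divide)
      also have "q powr (- 1 / b) = 1 / q powr (1 / b)" using powr_minus_divide[of q "1 / b"] by simp
      finally show ?thesis by simp
    qed
    ultimately have "(1 + b) * (area b ?v - area b ?Y) = ?Y powr (- 1 / b) * (b * (1 - q powr (1 / b)))"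
      using area_large[OF assms] by (simp add: algebra_simps)
    also have "\<dots> \<le> 1 * (b * (1 - q powr (1 / b)))"
    proof (rule mult_right_mono)
      show "?Y powr (- 1 / b) \<le> 1" using False b \<delta> \<sigma> powr_mono[of "- 1 / b" 0 ?Y] by simp
      have "q powr (1 / b) \<le> 1" using q b by (intro powr_le1) auto
      then show "0 \<le> b * (1 - q powr (1 / b))" using b by simp
    qed
    also have "\<dots> \<le> (1 + b) * (1 - q powr (1 / (1 + b)))"
      using weighted_mean[of b "1 / q" 1] b q by (simp add: powr_divide powr_minus algebra_simps)
    finally show ?thesis .
  qed
  then show ?thesis using b unfolding q_def by simp
qed

text \<open>
  For large \<open>\<sigma>\<close> the area between the two curves is that of a thin strip near the ordinate,
  whose width decreases like \<open>\<sigma> powr (- 1 / b)\<close>.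
\<close>

lemma area_difference_tail:
  assumes "1 < (1 + \<delta>) * \<sigma>" "1 / 2 \<le> b"
  shows "(1 + b) * (area b ((1 + \<delta>) * \<sigma>) - area b ((1 - \<delta>) * \<sigma>)) \<le> 2 * \<delta> * (1 - \<delta>\<^sup>2) powr (- 1 / b) * \<sigma> powr (- 1 / b)"
proof -
  define c where "c = 1 / b"
  have c: "1 \<le> c" "c \<le> 2" "b * c = 1" using b assms(2) by (auto simp: c_def field_simps)
  have spread: "(1 + \<delta>) powr c - (1 - \<delta>) powr c \<le> 2 * c * \<delta>"
  proof -
    define g where "g = (\<lambda>x. 2 * c * x - (1 + x) powr c + (1 - x) powr c)"
    have "g 0 \<le> g \<delta>"
    proof (rule DERIV_nonneg_imp_nondecreasing[where f = g])
      fix x assume x: "0 \<le> x" "x \<le> \<delta>"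
      then have x1: "0 < 1 + x" "0 < 1 - x" using \<delta> by auto
      have "(g has_real_derivative (2 * c - c * (1 + x) powr (c - 1) - c * (1 - x) powr (c - 1))) (at x)"
        unfolding g_def using x1 by (auto intro!: derivative_eq_intros simp: algebra_simps)
      moreover have "(1 + x) powr (c - 1) \<le> 1 + (c - 1) * (1 + x - 1)" "(1 - x) powr (c - 1) \<le> 1 + (c - 1) * (1 - x - 1)"
        using c x1 by (intro powr_le_tangent; simp)+
      then have "(1 + x) powr (c - 1) + (1 - x) powr (c - 1) \<le> 2" by (simp add: algebra_simps)
      then have "c * ((1 + x) powr (c - 1) + (1 - x) powr (c - 1)) \<le> c * 2" using c by (intro mult_left_mono) auto
      then have "0 \<le> 2 * c - c * (1 + x) powr (c - 1) - c * (1 - x) powr (c - 1)" by (simp add: algebra_simps)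
      ultimately show "\<exists>y. (g has_real_derivative y) (at x) \<and> 0 \<le> y" by blast
    qed (use \<delta> in simp)
    then show ?thesis by (simp add: g_def)
  qed
  let ?v = "(1 + \<delta>) * \<sigma>" and ?Y = "(1 - \<delta>) * \<sigma>"
  have e: "- 1 / b = - c" by (simp add: c_def)
  have "(1 + b) * (area b ?v - area b ?Y) \<le> b * (?Y powr (- c) - ?v powr (- c))"
    using area_large[OF assms(1)] area_ge[of b ?Y] b \<delta> \<sigma> unfolding e by (simp add: algebra_simps)
  also have "?Y powr (- c) - ?v powr (- c) = ((1 - \<delta>) powr (- c) - (1 + \<delta>) powr (- c)) * \<sigma> powr (- c)"
    unfolding powr_mult by (rule left_diff_distrib[symmetric])
  also have "(1 - \<delta>) powr (- c) - (1 + \<delta>) powr (- c) = ((1 + \<delta>) powr c - (1 - \<delta>) powr c) * (1 - \<delta>\<^sup>2) powr (- c)"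
  proof -
    have "1 - \<delta>\<^sup>2 = (1 - \<delta>) * (1 + \<delta>)" by (simp add: power2_eq_square algebra_simps)
    then have "(1 - \<delta>\<^sup>2) powr (- c) = (1 - \<delta>) powr (- c) * (1 + \<delta>) powr (- c)" using \<delta> by (simp add: powr_mult)
    moreover have "(1 + \<delta>) powr c * (1 + \<delta>) powr (- c) = 1" "(1 - \<delta>) powr c * (1 - \<delta>) powr (- c) = 1"
      using \<delta> by (simp_all add: powr_add[symmetric])
    moreover have "(B - A) * (A' * B') = A' * (B * B') - B' * (A * A')" for A B A' B' :: real
      by (simp add: algebra_simps)
    ultimately show ?thesis by (simp only: mult_1_right)
  qed
  also have "b * (((1 + \<delta>) powr c - (1 - \<delta>) powr c) * (1 - \<delta>\<^sup>2) powr (- c) * \<sigma> powr (- c)) =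
      (b * ((1 + \<delta>) powr c - (1 - \<delta>) powr c)) * ((1 - \<delta>\<^sup>2) powr (- c) * \<sigma> powr (- c))" by simp
  also have "b * ((1 + \<delta>) powr c - (1 - \<delta>) powr c) \<le> b * (2 * c * \<delta>)" using spread b by (intro mult_left_mono) auto
  also have "b * (2 * c * \<delta>) = 2 * \<delta> * (b * c)" by simp
  also have "\<dots> = 2 * \<delta>" unfolding c(3) by simp
  finally show ?thesis unfolding e by (simp add: mult_right_mono mult.assoc)
qed

text \<open>
  If \<open>1 - b\<close> is small compared with \<open>\<delta>\<close>, then \<open>(1 - \<delta>) powr b * (1 + \<delta>) \<le> 1\<close>, and the bound
  of \<open>area_difference_peak\<close> is at most \<open>\<delta>\<close>.
\<close>

lemma area_difference_thin:
  assumes a: "3 * (1 - b) \<le> 2 * \<delta>" "\<delta> \<le> 1 / 2"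
  shows "area b ((1 + \<delta>) * \<sigma>) - area b ((1 - \<delta>) * \<sigma>) \<le> \<delta>"
proof (cases "(1 + \<delta>) * \<sigma> \<le> 1")
  case True
  have "(1 - b) * (1 + \<delta>) \<le> (2 / 3 * \<delta>) * (3 / 2)" using a b \<delta> by (intro mult_mono) auto
  then have "2 \<le> (1 + b) * (1 + \<delta>)" using \<delta> by (simp add: algebra_simps)
  then have "2 * \<sigma> \<le> (1 + b) * (1 + \<delta>) * \<sigma>" using \<sigma> by (intro mult_right_mono) auto
  also have "\<dots> = (1 + b) * ((1 + \<delta>) * \<sigma>)" by simp
  also have "\<dots> \<le> (1 + b) * 1" using True b by (intro mult_left_mono) auto
  finally have "\<delta> * (2 * \<sigma>) \<le> \<delta> * (1 + b)" using \<delta> by (intro mult_left_mono) auto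
  then have "(1 + b) * (area b ((1 + \<delta>) * \<sigma>) - area b ((1 - \<delta>) * \<sigma>)) \<le> (1 + b) * \<delta>"
    unfolding area_difference_small[OF True] by (simp add: mult_ac)
  then show ?thesis using b by simp
next
  case False
  let ?q = "(1 - \<delta>) / (1 + \<delta>)"
  have l1: "ln (1 - \<delta>) \<ge> - (3 / 2) * \<delta>"
  proof -
    have "(1 - 2 * \<delta>) * ln 1 + 2 * \<delta> * ln (1 / 2) \<le> ln ((1 - 2 * \<delta>) * 1 + 2 * \<delta> * (1 / 2))"
      using concave_onD[OF ln_concave, of "2 * \<delta>" 1 "1 / 2"] \<delta> a(2) by simp
    then have "- (2 * \<delta> * ln 2) \<le> ln (1 - \<delta>)" by (simp add: ln_div)
    moreover have "2 * \<delta> * ln 2 \<le> 2 * \<delta> * (3 / 4)" using \<delta> ln2_le_25_over_36 by (intro mult_left_mono) auto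
    ultimately show ?thesis by linarith
  qed
  have l2: "ln (1 - \<delta>) + ln (1 + \<delta>) \<le> - (\<delta>\<^sup>2)"
  proof -
    have d2: "\<delta>\<^sup>2 < 1" using \<delta> by (simp add: power_less_one_iff)
    have "ln (1 - \<delta>) + ln (1 + \<delta>) = ln ((1 - \<delta>) * (1 + \<delta>))" using \<delta> by (simp add: ln_mult_pos)
    also have "(1 - \<delta>) * (1 + \<delta>) = 1 - \<delta>\<^sup>2" by (simp add: power2_eq_square algebra_simps)
    also have "ln (1 - \<delta>\<^sup>2) \<le> - (\<delta>\<^sup>2)" using ln_le_minus_one[of "1 - \<delta>\<^sup>2"] d2 by simp
    finally show ?thesis .
  qed
  have "(1 - b) * (- ln (1 - \<delta>)) \<le> (2 / 3 * \<delta>) * (3 / 2 * \<delta>)"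
    using a b \<delta> l1 by (intro mult_mono) auto
  then have "b * ln (1 - \<delta>) \<le> - ln (1 + \<delta>)" using l2 by (simp add: algebra_simps power2_eq_square)
  then have "(1 + b) * ln (1 - \<delta>) \<le> ln ?q" using \<delta> by (simp add: ln_div algebra_simps)
  then have "ln (1 - \<delta>) \<le> 1 / (1 + b) * ln ?q" using b by (simp add: field_simps)
  then have "exp (ln (1 - \<delta>)) \<le> exp (1 / (1 + b) * ln ?q)" by simp
  then have "1 - \<delta> \<le> ?q powr (1 / (1 + b))" using \<delta> by (simp add: powr_def)
  then show ?thesis using area_difference_peak False by simp
qed

lemma area_difference_flat:
  "(1 + b) * (area b ((1 + \<delta>) * \<sigma>) - area b ((1 - \<delta>) * \<sigma>)) \<le> 2 * \<delta>"
proof (cases "(1 + \<delta>) * \<sigma> \<le> 1")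
  case True
  have "1 * \<sigma> \<le> (1 + \<delta>) * \<sigma>" using \<delta> \<sigma> by (intro mult_right_mono) auto
  then have "\<sigma> \<le> 1" using True by simp
  then show ?thesis unfolding area_difference_small[OF True] using \<delta> by simp
next
  case False
  let ?q = "(1 - \<delta>) / (1 + \<delta>)"
  let ?t = "1 / (1 + b)"
  have t: "1 \<le> 2 * ?t" using b by (simp add: field_simps)
  have "1 - 2 * ?t * \<delta> \<le> (1 - \<delta>) powr (2 * ?t)"
    using powr_ge_tangent[OF t, of "1 - \<delta>"] \<delta> by simp
  also have "(1 - \<delta>) powr (2 * ?t) = ((1 - \<delta>) powr 2) powr ?t" by (simp add: powr_powr)
  also have "\<dots> \<le> ?q powr ?t"
  proof (rule powr_mono2)
    have "(1 - \<delta>)\<^sup>2 * (1 + \<delta>) = (1 - \<delta>) * (1 - \<delta>\<^sup>2)" by (simp add: power2_eq_square algebra_simps)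
    also have "\<dots> \<le> (1 - \<delta>) * 1" using \<delta> by (intro mult_left_mono) auto
    finally show "(1 - \<delta>) powr 2 \<le> ?q" using \<delta> by (simp add: field_simps)
  qed (use b in auto)
  finally have "area b ((1 + \<delta>) * \<sigma>) - area b ((1 - \<delta>) * \<sigma>) \<le> 2 * ?t * \<delta>"
    using area_difference_peak False by linarith
  then show ?thesis using b by (simp add: field_simps)
qed

lemma area_difference_le:
  assumes "1 / 2 \<le> b"
  shows "(1 + b) * (area b ((1 + \<delta>) * \<sigma>) - area b ((1 - \<delta>) * \<sigma>)) \<le>
    2 * \<delta> * min 1 ((1 - \<delta>\<^sup>2) powr (- 1 / b) * \<sigma> powr (- 1 / b))"
proof -
  let ?\<Gamma> = "(1 - \<delta>\<^sup>2) powr (- 1 / b)"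
  have "?\<Gamma> * \<sigma> powr (- 1 / b) \<ge> 1" if "(1 + \<delta>) * \<sigma> \<le> 1"
  proof -
    have "1 * \<sigma> \<le> (1 + \<delta>) * \<sigma>" using \<delta> \<sigma> by (intro mult_right_mono) auto
    then have s: "\<sigma> \<le> 1" using that by simp
    have "\<delta>\<^sup>2 < 1" using \<delta> by (simp add: power_less_one_iff)
    then have "1 \<le> ?\<Gamma>" "1 \<le> \<sigma> powr (- 1 / b)"
      using powr_mono'[of "- 1 / b" 0 "1 - \<delta>\<^sup>2"] powr_mono'[of "- 1 / b" 0 \<sigma>] b s \<sigma> by auto
    then show ?thesis using mult_mono[of 1 ?\<Gamma> 1 "\<sigma> powr (- 1 / b)"] by simp
  qed
  then show ?thesis using area_difference_flat area_difference_tail assms \<delta>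
    by (cases "(1 + \<delta>) * \<sigma> \<le> 1") (auto simp: min_def mult.assoc)
qed

end

text \<open>
  The integral of \<open>1 - \<rho> / x\<close> from \<open>\<rho>\<close> to \<open>n\<close> is \<open>n - \<rho> - \<rho> ln (n / \<rho>)\<close>, and \<open>ln y \<le> y / e\<close>.
\<close>

lemma sum_harmonic_deficit:
  assumes "0 < (\<rho> :: real)"
  shows "(\<Sum>i=1..n. max 0 (1 - \<rho> / real i)) \<ge> real n * (1 - 1 / exp 1) - \<rho>"
proof -
  let ?S = "\<lambda>n. \<Sum>i=1..n. max 0 (1 - \<rho> / real i)"
  have ln_ge: "ln x \<ge> 1 - 1 / x" if "x > 0" for x :: real
    using ln_le_minus_one[of "1 / x"] that by (simp add: ln_div)
  have S: "\<rho> \<le> real n \<longrightarrow> real n - \<rho> - \<rho> * ln (n / \<rho>) \<le> ?S n" for n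
  proof (induction n)
    case 0
    then show ?case using assms by simp
  next
    case (Suc n)
    let ?N = "real (Suc n)"
    have S_Suc: "?S (Suc n) = ?S n + max 0 (1 - \<rho> / ?N)" by simp
    show ?case
    proof
      assume N: "\<rho> \<le> ?N"
      show "?N - \<rho> - \<rho> * ln (?N / \<rho>) \<le> ?S (Suc n)"
      proof (cases "\<rho> \<le> real n")
        case True
        then have n: "real n > 0" using assms by linarith
        have "ln (?N / n) = ln (?N / \<rho>) - ln (n / \<rho>)" using n assms by (simp add: ln_div)
        moreover have "ln (?N / n) \<ge> 1 / ?N" using ln_ge[of "?N / n"] n by (simp add: field_simps)
        ultimately have "\<rho> * (1 / ?N) \<le> \<rho> * (ln (?N / \<rho>) - ln (n / \<rho>))" using assms by (intro mult_left_mono) auto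
        then have "?N - \<rho> - \<rho> * ln (?N / \<rho>) \<le> (real n - \<rho> - \<rho> * ln (n / \<rho>)) + (1 - \<rho> / ?N)"
          by (simp add: right_diff_distrib)
        moreover have "real n - \<rho> - \<rho> * ln (n / \<rho>) \<le> ?S n" using Suc True by (rule mp)
        moreover have "1 - \<rho> / ?N \<le> max 0 (1 - \<rho> / ?N)" by (rule max.cobounded2)
        ultimately show ?thesis unfolding S_Suc by linarith
      next
        case False
        have "ln (?N / \<rho>) \<ge> 1 - \<rho> / ?N" using ln_ge[of "?N / \<rho>"] assms by simp
        then have "\<rho> * (1 - \<rho> / ?N) \<le> \<rho> * ln (?N / \<rho>)" using assms by (intro mult_left_mono) auto
        then have "?N - \<rho> - \<rho> * ln (?N / \<rho>) \<le> ?N - \<rho> - \<rho> * (1 - \<rho> / ?N)" by (rule diff_left_mono)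
        also have "\<dots> = (?N - \<rho>) * (1 - \<rho> / ?N)" by (simp add: field_simps)
        also have "\<dots> \<le> 1 * (1 - \<rho> / ?N)" using False N by (intro mult_right_mono) auto
        also have "\<dots> = 1 - \<rho> / ?N" by (rule mult_1)
        also have "\<dots> \<le> max 0 (1 - \<rho> / ?N)" by (rule max.cobounded2)
        also have "\<dots> \<le> ?S n + max 0 (1 - \<rho> / ?N)" by (simp add: sum_nonneg)
        finally show ?thesis unfolding S_Suc .
      qed
    qed
  qed
  show ?thesis
  proof (cases "\<rho> \<le> real n")
    case True
    have n: "real n > 0" using True assms by linarith
    have "ln ((n / \<rho>) / exp 1) \<le> (n / \<rho>) / exp 1 - 1" using n assms by (intro ln_le_minus_one) auto
    moreover have "ln ((n / \<rho>) / exp 1) = ln (n / \<rho>) - ln (exp 1)" using n assms by (intro ln_divide_pos) auto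
    then have "ln ((n / \<rho>) / exp 1) = ln (n / \<rho>) - 1" by simp
    ultimately have "\<rho> * ln (n / \<rho>) \<le> \<rho> * ((n / \<rho>) / exp 1)" using assms by (intro mult_left_mono) auto
    also have "\<dots> = n * (1 / exp 1)" using assms by simp
    finally show ?thesis using S[of n] True by (simp add: right_diff_distrib)
  next
    case False
    have "real n * (1 - 1 / exp 1) \<le> real n * 1" by (intro mult_left_mono) auto
    moreover have "0 \<le> ?S n" by (intro sum_nonneg) auto
    ultimately show ?thesis using False by linarith
  qed
qed

section \<open>The fraction of ill-conditioned trinomials\<close>

lemma convex_x_ln_x: "convex_on {0<..} (\<lambda>x::real. x * ln x)"
proof (rule f''_ge0_imp_convex)
  fix x :: real assume x: "x \<in> {0<..}"
  show "((\<lambda>x. x * ln x) has_real_derivative ln x + 1) (at x)"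
    using x by (auto intro!: derivative_eq_intros)
  show "((\<lambda>x. ln x + 1) has_real_derivative 1 / x) (at x)"
    using x by (auto intro!: derivative_eq_intros)
  show "0 \<le> 1 / x" using x by simp
qed simp

lemma x_ln_x_chord:
  fixes x y u :: real
  assumes "0 < x" "0 < y" "0 \<le> u" "u \<le> 1"
  shows "((1 - u) * x + u * y) * ln ((1 - u) * x + u * y) \<le> (1 - u) * (x * ln x) + u * (y * ln y)"
  using convex_onD[OF convex_x_ln_x, of u x y] assms by simp

lemma exp_chord: "0 \<le> t \<Longrightarrow> t \<le> 1 \<Longrightarrow> exp ((1 - t) * x + t * y) \<le> (1 - t) * exp x + t * exp (y::real)"
  using convex_onD[OF exp_convex, of t x y] by simp

text \<open>
  The ratio \<open>i / n\<close> at which the two bounds in \<open>area_difference_le\<close> are equal.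
\<close>

definition knee :: "real \<Rightarrow> real \<Rightarrow> real" where
  "knee a \<delta> = a * (1 - a) powr ((1 - a) / a) * (1 - \<delta>\<^sup>2) powr (- 1 / a)"

lemma knee_exp:
  assumes "0 < a" "a < 1" "\<delta>\<^sup>2 < 1"
  shows "knee a \<delta> = a * exp (((1 - a) * ln (1 - a) - ln (1 - \<delta>\<^sup>2)) / a)"
  using assms by (simp add: knee_def powr_def exp_add[symmetric] diff_divide_distrib mult.assoc) (simp add: field_simps)

lemma exp_1_lower: "2717 / 1000 \<le> exp (1::real)" "exp (1::real) \<le> 272 / 100"
proof -
  show "exp (1::real) \<le> 272 / 100" using e_less_272 by simp
  have "\<bar>exp 1 - 5837465777 / 2147483648\<bar> \<le> (1 / 1000 :: real)"
    using e_approx_32 by (rule order_trans) simp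
  then show "2717 / 1000 \<le> exp (1::real)" using abs_le_D2 by fastforce
qed

text \<open>
  For \<open>a \<ge> 1 / 4\<close> the knee is largest when \<open>\<delta>\<close> is. Then it is bounded by a chord, because
  \<open>x ln x\<close> and \<open>exp\<close> are convex, and only the end points \<open>a = 1 / 4\<close> and \<open>a = 1 / 2\<close> have to
  be computed. For smaller \<open>a\<close> the lower bound on \<open>a\<close> in terms of \<open>\<delta>\<close> makes the knee at most
  \<open>a\<close>. The bound \<open>10 / 23\<close> for \<open>\<delta>\<close> is just above \<open>1 / ln 10\<close>.
\<close>

lemma knee_le:
  assumes a: "0 < a" "a \<le> 1 / 2" and \<delta>: "0 < \<delta>" "\<delta> \<le> 10 / 23" "2 * \<delta> < 3 * a"
  shows "knee a \<delta> \<le> 1 / 2 - 1 / exp 1 + a / 2"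
proof -
  have e: "1 / exp (1::real) \<le> 369 / 1000" using exp_1_lower(1) by (simp add: field_simps)
  have d2: "\<delta>\<^sup>2 \<le> (10 / 23)\<^sup>2" using \<delta> by (intro power_mono) auto
  then have d1: "\<delta>\<^sup>2 < 1" by (simp add: power2_eq_square)
  show ?thesis
  proof (cases "a < 1 / 4")
    case True
    have "(1 - a) * ln (1 - a) \<le> - (a * ln 2)"
      using x_ln_x_chord[of 1 "1 / 2" "2 * a"] True a by (simp add: ln_div algebra_simps)
    moreover have "- ln (1 - \<delta>\<^sup>2) \<le> 2 / 3 * a"
    proof -
      have "\<delta> \<le> 3 / 2 * a" using \<delta> by simp
      then have q: "\<delta>\<^sup>2 \<le> (3 / 2 * a)\<^sup>2" using \<delta> by (intro power_mono) auto
      have "a * a \<le> (1 / 4) * a" using True a by (intro mult_right_mono) auto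
      then have q1: "\<delta>\<^sup>2 \<le> 9 / 16 * a" using q by (simp add: power2_eq_square)
      have q2: "\<delta>\<^sup>2 \<le> 9 / 64" using q1 True by linarith
      have "ln (1 / (1 - \<delta>\<^sup>2)) \<le> 1 / (1 - \<delta>\<^sup>2) - 1" using d1 by (intro ln_le_minus_one) auto
      also have "\<dots> = \<delta>\<^sup>2 / (1 - \<delta>\<^sup>2)" using d1 by (simp add: field_simps)
      also have "\<dots> \<le> (9 / 16 * a) / (55 / 64)" using q1 q2 a by (intro frac_le) auto
      finally show ?thesis using d1 a by (simp add: ln_div)
    qed
    ultimately have "((1 - a) * ln (1 - a) - ln (1 - \<delta>\<^sup>2)) / a \<le> (- (a * ln 2) + 2 / 3 * a) / a"
      using a by (intro divide_right_mono) auto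
    also have "\<dots> = 2 / 3 - ln 2" using a by (simp add: field_simps)
    finally have "exp (((1 - a) * ln (1 - a) - ln (1 - \<delta>\<^sup>2)) / a) \<le> exp (2 / 3 - ln 2)" by simp
    also have "\<dots> = exp (2 / 3) / 2" by (simp add: exp_diff)
    also have "exp (2 / 3 :: real) \<le> 2"
    proof (rule power_le_imp_le_base)
      have "exp (2 / 3 :: real) ^ Suc 2 = exp 1 ^ 2" by (simp add: exp_of_nat_mult[symmetric] exp_add[symmetric])
      also have "\<dots> \<le> (272 / 100)\<^sup>2" using exp_1_lower by (intro power_mono) auto
      also have "\<dots> \<le> 2 ^ Suc 2" by (simp add: power2_eq_square)
      finally show "exp (2 / 3 :: real) ^ Suc 2 \<le> 2 ^ Suc 2" .
    qed simp
    finally have "knee a \<delta> \<le> a * 1" unfolding knee_exp[OF a(1) _ d1, simplified] using a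
      by (subst knee_exp[OF a(1) _ d1]) (auto intro: mult_left_mono)
    then show ?thesis using e True by simp
  next
    case False
    define \<Lambda> where "\<Lambda> = ln (529 / 429 :: real)"
    \<comment> \<open>\<open>u\<close> is the position of \<open>a\<close> between \<open>1 / 4\<close> and \<open>1 / 2\<close>. The factor \<open>a\<close> in front of the
      exponential makes the weights of the chord affine functions of \<open>u\<close>.\<close>
    define u where "u = 4 * a - 1"
    have u: "0 \<le> u" "u \<le> 1" "a = (1 - u) * (1 / 4) + u * (1 / 2)" "1 - a = (1 - u) * (3 / 4) + u * (1 / 2)"
      using False a by (auto simp: u_def field_simps)
    have weights: "a * (1 - u * (1 / 2) / a) = (1 - u) * (1 / 4)" "a * (u * (1 / 2) / a) = u * (1 / 2)"
    proof -
      have "a * (1 - u * (1 / 2) / a) = a - u * (1 / 2)" using a by (simp add: right_diff_distrib)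
      also have "\<dots> = (1 - u) * (1 / 4)" by (simp add: u_def field_simps)
      finally show "a * (1 - u * (1 / 2) / a) = (1 - u) * (1 / 4)" .
    qed (use a in simp)
    let ?w1 = "3 / 4 * ln (3 / 4) + \<Lambda>" and ?w2 = "1 / 2 * ln (1 / 2) + \<Lambda>"
    have "429 / 529 \<le> 1 - \<delta>\<^sup>2" using d2 by (simp add: power2_eq_square)
    then have "ln (429 / 529) \<le> ln (1 - \<delta>\<^sup>2)" by simp
    then have l: "- ln (1 - \<delta>\<^sup>2) \<le> \<Lambda>" by (simp add: \<Lambda>_def ln_div)
    have "(1 - a) * ln (1 - a) \<le> (1 - u) * (3 / 4 * ln (3 / 4)) + u * (1 / 2 * ln (1 / 2))"
      unfolding u(4) using u(1,2) by (intro x_ln_x_chord) auto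
    then have "(1 - a) * ln (1 - a) - ln (1 - \<delta>\<^sup>2) \<le> (1 - u) * ?w1 + u * ?w2" using l by (simp add: algebra_simps)
    also have "\<dots> = (a * (1 - u * (1 / 2) / a)) * (4 * ?w1) + (a * (u * (1 / 2) / a)) * (2 * ?w2)"
      unfolding weights by (simp add: field_simps)
    also have "\<dots> = a * ((1 - u * (1 / 2) / a) * (4 * ?w1) + (u * (1 / 2) / a) * (2 * ?w2))"
      by (simp only: distrib_left mult.assoc)
    finally have "((1 - a) * ln (1 - a) - ln (1 - \<delta>\<^sup>2)) / a \<le> (1 - u * (1 / 2) / a) * (4 * ?w1) + (u * (1 / 2) / a) * (2 * ?w2)"
      using a by (simp add: pos_divide_le_eq mult.commute)
    then have "exp (((1 - a) * ln (1 - a) - ln (1 - \<delta>\<^sup>2)) / a) \<le> exp ((1 - u * (1 / 2) / a) * (4 * ?w1) + (u * (1 / 2) / a) * (2 * ?w2))"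
      by simp
    also have "\<dots> \<le> (1 - u * (1 / 2) / a) * exp (4 * ?w1) + (u * (1 / 2) / a) * exp (2 * ?w2)"
    proof -
      have "u * (1 / 2) \<le> a" "0 \<le> u * (1 / 2)" using a u(1) by (auto simp: u_def)
      then have "0 \<le> u * (1 / 2) / a" "u * (1 / 2) / a \<le> 1" using a by (auto simp: field_simps)
      then show ?thesis by (rule exp_chord)
    qed
    finally have "knee a \<delta> \<le> a * ((1 - u * (1 / 2) / a) * exp (4 * ?w1) + (u * (1 / 2) / a) * exp (2 * ?w2))"
      using a d1 by (subst knee_exp) (auto intro: mult_left_mono)
    also have "\<dots> = (a * (1 - u * (1 / 2) / a)) * exp (4 * ?w1) + (a * (u * (1 / 2) / a)) * exp (2 * ?w2)"
      by (simp only: distrib_left mult.assoc)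
    also have "\<dots> = (1 - u) * (1 / 4) * exp (4 * ?w1) + u * (1 / 2) * exp (2 * ?w2)"
      unfolding weights ..
    also have "exp (4 * ?w1) = (3 / 4) ^ 3 * (529 / 429) ^ 4"
    proof -
      have "4 * ?w1 = real 3 * ln (3 / 4) + real 4 * \<Lambda>" by simp
      then show ?thesis by (simp only: exp_add exp_of_nat_mult) (simp add: \<Lambda>_def)
    qed
    also have "exp (2 * ?w2) = (1 / 2) ^ 1 * (529 / 429) ^ 2"
    proof -
      have "2 * ?w2 = real 1 * ln (1 / 2) + real 2 * \<Lambda>" by simp
      then show ?thesis by (simp only: exp_add exp_of_nat_mult) (simp add: \<Lambda>_def)
    qed
    also have "(1 - u) * (1 / 4) * ((3 / 4) ^ 3 * (529 / 429) ^ 4) + u * (1 / 2) * ((1 / 2) ^ 1 * (529 / 429) ^ 2)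
        \<le> (1 - u) * (1 / 8 + 13 / 100) + u * (1 / 4 + 131 / 1000)"
    proof -
      have "1 / 4 * ((3 / 4) ^ 3 * (529 / 429) ^ 4) \<le> (1 / 8 + 13 / 100 :: real)"
        "1 / 2 * ((1 / 2) ^ 1 * (529 / 429) ^ 2) \<le> (1 / 4 + 131 / 1000 :: real)"
        by (simp_all add: power2_eq_square power3_eq_cube power4_eq_xxxx)
      then show ?thesis unfolding mult.assoc using u(1,2) by (intro add_mono mult_left_mono) auto
    qed
    also have "\<dots> \<le> a / 2 + 131 / 1000" using a by (simp add: u_def field_simps)
    also have "131 / 1000 \<le> 1 / 2 - 1 / exp (1::real)"
      using e by simp
    finally show ?thesis by simp
  qed
qed

text \<open>
  Unless \<open>a\<close> is small compared with \<open>\<delta>\<close>, the mean over one coordinate may exceed \<open>\<delta>\<close>, by the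
  factor \<open>2 / (1 + b)\<close> at most. Beyond the knee it decreases like a power with exponent
  \<open>c = a / b \<le> 1\<close>, and by Bernoulli's inequality the deficit is at least \<open>c\<close> times that of a
  hyperbola.
\<close>

lemma sum_area_difference_le:
  fixes a b \<delta> :: real
  assumes ab: "a + b = 1" "0 < a" "a \<le> 1 / 2" and \<delta>: "0 < \<delta>" "\<delta> \<le> 10 / 23" and n: "0 < n"
  defines "\<sigma> \<equiv> \<lambda>i. a powr (- a) * b powr (- b) * (real i / real n) powr a"
  shows "(\<Sum>i=1..n. area b ((1 + \<delta>) * \<sigma> i) - area b ((1 - \<delta>) * \<sigma> i)) \<le> \<delta> * n"
proof -
  have b: "1 / 2 \<le> b" "b < 1" "0 < b" "b = 1 - a" using ab by auto
  have d1: "\<delta> < 1" "\<delta> \<le> 1 / 2" using \<delta> by auto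
  have sig: "0 < \<sigma> i" if "1 \<le> i" for i using that ab b n by (simp add: \<sigma>_def)
  show ?thesis
  proof (cases "3 * a \<le> 2 * \<delta>")
    case True
    have "(\<Sum>i=1..n. area b ((1 + \<delta>) * \<sigma> i) - area b ((1 - \<delta>) * \<sigma> i)) \<le> (\<Sum>i=1..n. \<delta>)"
      using True b sig \<delta> d1 by (intro sum_mono area_difference_thin) auto
    then show ?thesis by (simp add: mult.commute)
  next
    case False
    have d2: "\<delta>\<^sup>2 < 1" using \<delta> d1 by (simp add: power_less_one_iff)
    define r where "r = knee a \<delta>"
    define c where "c = a / b"
    have c: "0 < c" "c \<le> 1" using ab b by (auto simp: c_def)
    have r0: "0 < r" using ab b d2 by (simp add: r_def knee_def)
    have r: "r \<le> 1 / 2 - 1 / exp 1 + a / 2" unfolding r_def using ab \<delta> False by (intro knee_le) auto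
    have tail: "(1 - \<delta>\<^sup>2) powr (- 1 / b) * \<sigma> i powr (- 1 / b) = (r * n / i) powr c" if i: "1 \<le> i" for i
    proof -
      have "\<sigma> i powr (- 1 / b) = a powr c * b * (real i / n) powr (- c)"
      proof -
        have "\<sigma> i powr (- 1 / b) = (a powr (- a)) powr (- 1 / b) * (b powr (- b)) powr (- 1 / b) * ((real i / n) powr a) powr (- 1 / b)"
          unfolding \<sigma>_def by (simp only: powr_mult)
        also have "(a powr (- a)) powr (- 1 / b) = a powr c" by (simp add: powr_powr c_def)
        also have "(b powr (- b)) powr (- 1 / b) = b"
        proof -
          have "(b powr (- b)) powr (- 1 / b) = b powr (- b * (- 1 / b))" by (rule powr_powr)
          also have "- b * (- 1 / b) = 1" using b(3) by simp
          finally show ?thesis using b(3) by simp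
        qed
        also have "((real i / n) powr a) powr (- 1 / b) = (real i / n) powr (- c)" by (simp add: powr_powr c_def)
        finally show ?thesis .
      qed
      moreover have "r powr c = a powr c * b * (1 - \<delta>\<^sup>2) powr (- 1 / b)"
      proof -
        have "r powr c = a powr c * (b powr (b / a)) powr c * ((1 - \<delta>\<^sup>2) powr (- 1 / a)) powr c"
          unfolding r_def knee_def b(4)[symmetric] by (simp only: powr_mult)
        also have "(b powr (b / a)) powr c = b"
        proof -
          have "(b powr (b / a)) powr c = b powr (b / a * c)" by (rule powr_powr)
          also have "b / a * c = 1" using ab(2) b(3) by (simp add: c_def)
          finally show ?thesis using b(3) by simp
        qed
        also have "((1 - \<delta>\<^sup>2) powr (- 1 / a)) powr c = (1 - \<delta>\<^sup>2) powr (- 1 / b)"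
        proof -
          have "((1 - \<delta>\<^sup>2) powr (- 1 / a)) powr c = (1 - \<delta>\<^sup>2) powr (- 1 / a * c)" by (rule powr_powr)
          also have "- 1 / a * c = - 1 / b" using ab(2) b(3) by (simp add: c_def)
          finally show ?thesis .
        qed
        finally show ?thesis .
      qed
      moreover have "(r * n / i) powr c = r powr c * (real i / n) powr (- c)"
      proof -
        have "(r * n / i) powr c = (r / (real i / n)) powr c" by simp
        also have "\<dots> = r powr c / (real i / n) powr c" by (rule powr_divide)
        finally show ?thesis by (simp add: powr_minus divide_inverse)
      qed
      ultimately show ?thesis by simp
    qed
    have width: "(1 + b) * (area b ((1 + \<delta>) * \<sigma> i) - area b ((1 - \<delta>) * \<sigma> i)) \<le> 2 * \<delta> * (1 - c * max 0 (1 - r * n / i))"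
      if i: "1 \<le> i" for i
    proof -
      have "(1 + b) * (area b ((1 + \<delta>) * \<sigma> i) - area b ((1 - \<delta>) * \<sigma> i)) \<le> 2 * \<delta> * min 1 ((r * n / i) powr c)"
        using area_difference_le[OF b(3) _ \<delta>(1) d1(1) sig[OF i] b(1)] b(2) tail[OF i] by simp
      also have "\<dots> \<le> 2 * \<delta> * (1 - c * max 0 (1 - r * n / i))"
      proof (rule mult_left_mono)
        have "0 < r * n / i" using r0 n i by simp
        then have "(r * n / i) powr c \<le> 1 + c * (r * n / i - 1)" using c by (intro powr_le_tangent) auto
        then show "min 1 ((r * n / i) powr c) \<le> 1 - c * max 0 (1 - r * n / i)"
          by (simp add: max_def min_def algebra_simps)
      qed (use \<delta> in simp)
      finally show ?thesis .
    qed
    have "(1 + b) * (\<Sum>i=1..n. area b ((1 + \<delta>) * \<sigma> i) - area b ((1 - \<delta>) * \<sigma> i)) \<le>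
        (\<Sum>i=1..n. 2 * \<delta> * (1 - c * max 0 (1 - r * n / i)))"
      unfolding sum_distrib_left using width by (intro sum_mono) auto
    also have "\<dots> = 2 * \<delta> * (n - c * (\<Sum>i=1..n. max 0 (1 - r * n / i)))"
      by (simp add: sum_distrib_left[symmetric] sum_subtractf)
    also have "\<dots> \<le> 2 * \<delta> * (n - c * (n * (b / 2)))"
    proof -
      have "n * (b / 2) \<le> n * (1 - 1 / exp 1 - r)" using r b by (intro mult_left_mono) auto
      also have "\<dots> \<le> (\<Sum>i=1..n. max 0 (1 - r * n / i))"
        using sum_harmonic_deficit[of "r * n" n] r0 n by (simp add: algebra_simps)
      finally have "c * (n * (b / 2)) \<le> c * (\<Sum>i=1..n. max 0 (1 - r * n / i))" using c by (intro mult_left_mono) auto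
      then show ?thesis using \<delta> by (intro mult_left_mono) auto
    qed
    also have "c * (n * (b / 2)) = n * (a / 2)" using b by (simp add: c_def)
    also have "2 * \<delta> * (n - n * (a / 2)) = (2 - a) * (\<delta> * n)" by (simp add: algebra_simps)
    also have "2 - a = 1 + b" using b(4) by simp
    finally show ?thesis using b by simp
  qed
qed

text \<open>
  The absolute values of the coefficients of ill-conditioned trinomials, with \<open>a\<close> and \<open>b\<close> in
  place of the quotients of the exponents by the degree.
\<close>

definition near_points :: "real \<Rightarrow> real \<Rightarrow> real \<Rightarrow> nat \<Rightarrow> (nat \<times> nat \<times> nat) set" where
  "near_points a b \<delta> n = {(i, k, j). i \<in> {1..n} \<and> k \<in> {1..n} \<and> j \<in> {1..n} \<and>
     \<bar>real k / (a powr (- a) * b powr (- b) * real i powr a * real j powr b) - 1\<bar> < \<delta>}"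

lemma card_near_interval:
  fixes n :: nat and B \<delta> :: real
  assumes "0 < B" "0 < \<delta>" "\<delta> < 1"
  shows "real (card {k \<in> {1..n}. \<bar>real k / B - 1\<bar> < \<delta>}) \<le> 1 + (min n ((1 + \<delta>) * B) - min n ((1 - \<delta>) * B))"
proof -
  let ?y = "min (real n) ((1 + \<delta>) * B)" and ?x = "min (real n) ((1 - \<delta>) * B)"
  have x: "0 \<le> ?x" "?x \<le> ?y" using assms by (auto simp: min_def mult_right_mono intro: order_trans)
  have "{k \<in> {1..n}. \<bar>real k / B - 1\<bar> < \<delta>} \<subseteq> {nat \<lfloor>?x\<rfloor><..nat \<lfloor>?y\<rfloor>}"
  proof
    fix k assume "k \<in> {k \<in> {1..n}. \<bar>real k / B - 1\<bar> < \<delta>}"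
    then have k: "1 \<le> k" "k \<le> n" "\<bar>real k / B - 1\<bar> < \<delta>" by auto
    then have "1 - \<delta> < real k / B" "real k / B < 1 + \<delta>" by linarith+
    then have "(1 - \<delta>) * B < real k" "real k < (1 + \<delta>) * B" using assms(1) by (simp_all add: field_simps)
    then have xy: "?x < real k" "real k \<le> ?y" using k(2) by auto
    have gen: "X < int k \<Longrightarrow> int k \<le> Y \<Longrightarrow> 1 \<le> k \<Longrightarrow> nat X < k \<and> k \<le> nat Y" for X Y by linarith
    have "\<lfloor>?x\<rfloor> < int k" using xy(1) unfolding floor_less_iff by simp
    moreover have "int k \<le> \<lfloor>?y\<rfloor>" using xy(2) unfolding le_floor_iff by simp
    ultimately show "k \<in> {nat \<lfloor>?x\<rfloor><..nat \<lfloor>?y\<rfloor>}" using k(1) unfolding greaterThanAtMost_iff by (rule gen)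
  qed
  then have "card {k \<in> {1..n}. \<bar>real k / B - 1\<bar> < \<delta>} \<le> card {nat \<lfloor>?x\<rfloor><..nat \<lfloor>?y\<rfloor>}" by (intro card_mono) auto
  also have "\<dots> = nat \<lfloor>?y\<rfloor> - nat \<lfloor>?x\<rfloor>" by simp
  finally have "real (card {k \<in> {1..n}. \<bar>real k / B - 1\<bar> < \<delta>}) \<le> real (nat \<lfloor>?y\<rfloor> - nat \<lfloor>?x\<rfloor>)"
    by (simp only: of_nat_le_iff)
  also have "\<dots> = real_of_int (\<lfloor>?y\<rfloor> - \<lfloor>?x\<rfloor>)"
  proof -
    have diff: "real (nat Y - nat X) = real_of_int (Y - X)" if "0 \<le> X" "X \<le> Y" for X Y
      using that by (simp add: of_nat_diff nat_mono)
    show ?thesis by (rule diff[OF _ floor_mono[OF x(2)]]) (use x(1) in simp)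
  qed
  also have "\<dots> \<le> 1 + (?y - ?x)" by linarith
  finally show ?thesis .
qed

lemma finite_near_points: "finite (near_points a b \<delta> n)"
  by (rule finite_subset[of _ "{1..n} \<times> {1..n} \<times> {1..n}"]) (auto simp: near_points_def)

lemma card_near_points:
  assumes ab: "a + b = 1" "0 < a" "a \<le> 1 / 2" and \<delta>: "0 < \<delta>" "\<delta> \<le> 10 / 23" and n: "0 < n"
  shows "real (card (near_points a b \<delta> n)) \<le> real n ^ 2 + \<delta> * real n ^ 3 + \<delta> * real n ^ 2"
proof -
  define K where "K = a powr (- a) * b powr (- b)"
  define S where "S = (\<lambda>i j. {k \<in> {1..n}. \<bar>real k / (K * real i powr a * real j powr b) - 1\<bar> < \<delta>})"
  have b: "0 < b" "b \<le> 1" using ab by auto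
  have d1: "\<delta> < 1" using \<delta> by simp
  have K: "0 < K" using ab b by (simp add: K_def)
  have finS: "finite (S i j)" for i j by (simp add: S_def)
  have "near_points a b \<delta> n = (\<lambda>((i, j), k). (i, k, j)) ` (SIGMA p:{1..n} \<times> {1..n}. S (fst p) (snd p))"
    unfolding near_points_def S_def K_def by (force simp: image_iff)
  then have "card (near_points a b \<delta> n) \<le> card (SIGMA p:{1..n} \<times> {1..n}. S (fst p) (snd p))"
    by (simp only: card_image_le[OF finite_SigmaI] finite_cartesian_product finite_atLeastAtMost finS)
  also have "\<dots> = (\<Sum>p\<in>{1..n} \<times> {1..n}. card (S (fst p) (snd p)))"
    by (rule card_SigmaI) (auto simp: S_def)
  also have "\<dots> = (\<Sum>i=1..n. \<Sum>j=1..n. card (S i j))" by (simp add: sum.cartesian_product case_prod_beta)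
  finally have "real (card (near_points a b \<delta> n)) \<le> real (\<Sum>i=1..n. \<Sum>j=1..n. card (S i j))" by (simp only: of_nat_le_iff)
  also have "\<dots> = (\<Sum>i=1..n. \<Sum>j=1..n. real (card (S i j)))" by simp
  also have "\<dots> \<le> (\<Sum>i=1..n. real n + ((real n)\<^sup>2 * (area b ((1 + \<delta>) * (K * (real i / real n) powr a))
      - area b ((1 - \<delta>) * (K * (real i / real n) powr a))) + \<delta> * n))"
  proof (intro sum_mono)
    fix i assume "i \<in> {1..n}"
    then have i: "1 \<le> i" by simp
    define s where "s = K * real i powr a"
    have s: "0 < s" using K i by (simp add: s_def)
    have "(\<Sum>j=1..n. real (card (S i j))) \<le> (\<Sum>j=1..n. 1 + (capped n b ((1 + \<delta>) * s) (real j) - capped n b ((1 - \<delta>) * s) (real j)))"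
    proof (intro sum_mono)
      fix j assume "j \<in> {1..n}"
      then have "0 < s * real j powr b" using s by simp
      from card_near_interval[OF this \<delta>(1) d1, of n]
      show "real (card (S i j)) \<le> 1 + (capped n b ((1 + \<delta>) * s) (real j) - capped n b ((1 - \<delta>) * s) (real j))"
        by (simp add: S_def capped_def s_def mult.assoc)
    qed
    also have "\<dots> = n + (\<Sum>j=1..n. capped n b ((1 + \<delta>) * s) (real j) - capped n b ((1 - \<delta>) * s) (real j))"
      by (simp add: sum.distrib)
    also have "\<dots> \<le> n + ((real n)\<^sup>2 * (area b ((1 + \<delta>) * (s * real n powr (b - 1))) - area b ((1 - \<delta>) * (s * real n powr (b - 1)))) + \<delta> * n)"
      using sum_capped_difference[OF b s \<delta>(1) d1 n] by simp
    also have "s * real n powr (b - 1) = K * (real i / real n) powr a"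
    proof -
      have "b - 1 = - a" using ab by simp
      then have "real n powr (b - 1) = 1 / real n powr a" by (simp add: powr_minus_divide)
      moreover have "(real i / real n) powr a = real i powr a / real n powr a" by (rule powr_divide)
      ultimately show ?thesis by (simp add: s_def)
    qed
    finally show "(\<Sum>j=1..n. real (card (S i j))) \<le> real n + ((real n)\<^sup>2 * (area b ((1 + \<delta>) * (K * (real i / real n) powr a))
      - area b ((1 - \<delta>) * (K * (real i / real n) powr a))) + \<delta> * n)" .
  qed
  also have "\<dots> = real n ^ 2 + (real n)\<^sup>2 * (\<Sum>i=1..n. area b ((1 + \<delta>) * (K * (real i / real n) powr a))
      - area b ((1 - \<delta>) * (K * (real i / real n) powr a))) + \<delta> * real n ^ 2"
    by (simp add: sum.distrib sum_distrib_left power2_eq_square)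
  also have "\<dots> \<le> real n ^ 2 + (real n)\<^sup>2 * (\<delta> * n) + \<delta> * real n ^ 2"
    unfolding K_def
    by (intro add_right_mono add_left_mono mult_left_mono[OF sum_area_difference_le[OF ab \<delta> n]]) simp
  finally show ?thesis by (simp add: power2_eq_square power3_eq_cube mult_ac)
qed

lemma card_near_points_swap: "card (near_points b a \<delta> n) = card (near_points a b \<delta> n)"
proof -
  have "near_points b a \<delta> n = (\<lambda>(i, k, j). (j, k, i)) ` near_points a b \<delta> n"
    by (force simp: near_points_def mult_ac)
  moreover have "inj_on (\<lambda>(i, k, j). (j, k, i)) (near_points a b \<delta> n)" by (auto simp: inj_on_def)
  ultimately show ?thesis by (simp add: card_image)
qed

lemma ill_conditioned_near:
  fixes c1 c2 c3 :: int and a d n :: nat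
  assumes "ill_conditioned c1 c2 c3 a d n"
  defines "\<alpha> \<equiv> real a / d" and "\<beta> \<equiv> (real d - real a) / d"
  shows "(nat \<bar>c1\<bar>, nat \<bar>c2\<bar>, nat \<bar>c3\<bar>) \<in> near_points \<beta> \<alpha> (1 / ln (real (d * n))) n"
    and "c1 \<noteq> 0" "c2 \<noteq> 0" "c3 \<noteq> 0"
proof -
  have adm: "0 < a" "a < d" "c1 \<noteq> 0" "c2 \<noteq> 0" "c3 \<noteq> 0" "\<bar>c1\<bar> \<le> int n" "\<bar>c2\<bar> \<le> int n" "\<bar>c3\<bar> \<le> int n"
    using assms(1) by (auto simp: ill_conditioned_def admissible_def)
  show "c1 \<noteq> 0" "c2 \<noteq> 0" "c3 \<noteq> 0" by fact+
  have pos: "0 < \<alpha>" "0 < \<beta>" "0 < real d" using adm by (auto simp: \<alpha>_def \<beta>_def)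
  define A B C where "A = \<bar>real_of_int c1\<bar>" and "B = \<bar>real_of_int c2\<bar>" and "C = \<bar>real_of_int c3\<bar>"
  have ABC: "0 < A" "0 < B" "0 < C" using adm by (auto simp: A_def B_def C_def)
  have nat_abs: "real (nat \<bar>c\<bar>) = \<bar>real_of_int c\<bar>" for c :: int by simp
  let ?K = "\<beta> powr (- \<beta>) * \<alpha> powr (- \<alpha>) * A powr \<beta> * C powr \<alpha>"
  have sum1: "\<beta> + \<alpha> = 1" using pos by (simp add: \<alpha>_def \<beta>_def add_divide_distrib[symmetric])
  have "\<bar>real_of_int c2 / real d\<bar> * \<bar>(real d - real a) / real_of_int c1\<bar> powr \<beta> * \<bar>real a / real_of_int c3\<bar> powr \<alpha> = B / ?K"
  proof -
    have e: "\<bar>real_of_int c2 / real d\<bar> = B / d" "\<bar>(real d - real a) / real_of_int c1\<bar> = d * (\<beta> / A)"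
      "\<bar>real a / real_of_int c3\<bar> = d * (\<alpha> / C)"
      using adm pos by (simp_all add: A_def B_def C_def \<alpha>_def \<beta>_def abs_divide)
    have "real d powr \<beta> * real d powr \<alpha> = real d powr (\<beta> + \<alpha>)" by (rule powr_add[symmetric])
    then have dd: "real d powr \<beta> * real d powr \<alpha> = d" using sum1 pos by simp
    have "B / d * (d * (\<beta> / A)) powr \<beta> * (d * (\<alpha> / C)) powr \<alpha> =
        B / d * (real d powr \<beta> * real d powr \<alpha>) * ((\<beta> / A) powr \<beta> * (\<alpha> / C) powr \<alpha>)"
      by (simp only: powr_mult mult_ac)
    also have "\<dots> = B * ((\<beta> / A) powr \<beta> * (\<alpha> / C) powr \<alpha>)" unfolding dd using pos by simp
    also have "(\<beta> / A) powr \<beta> * (\<alpha> / C) powr \<alpha> = (\<beta> powr \<beta> / A powr \<beta>) * (\<alpha> powr \<alpha> / C powr \<alpha>)"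
      by (simp only: powr_divide)
    also have "B * \<dots> = B / ?K" by (simp add: powr_minus divide_inverse mult_ac)
    finally show ?thesis unfolding e .
  qed
  then have "\<bar>B / ?K - 1\<bar> < 1 / ln (real (d * n))"
    using assms(1) unfolding ill_conditioned_def \<alpha>_def \<beta>_def by simp
  moreover have "nat \<bar>c\<bar> \<in> {1..n}" if "c \<noteq> 0" "\<bar>c\<bar> \<le> int n" for c :: int using that by auto
  ultimately show "(nat \<bar>c1\<bar>, nat \<bar>c2\<bar>, nat \<bar>c3\<bar>) \<in> near_points \<beta> \<alpha> (1 / ln (real (d * n))) n"
    using adm unfolding near_points_def by (simp add: A_def B_def C_def)
qed

text \<open>
  There are eight choices of signs. The bound for \<open>near_points\<close> requires \<open>\<delta>\<close> to be at most
  about \<open>1 / ln 10\<close>; the exceptions \<open>d n \<le> 9\<close> have \<open>n \<le> 4\<close>, and then the bound is so weak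
  that counting all triples suffices.
\<close>

theorem ill_conditioned_fraction:
  fixes a d n :: nat
  assumes ad: "0 < a" "a < d" and n: "0 < n"
  defines "S \<equiv> {(c1, c2, c3). c1 \<in> {- int n..int n} \<and> c2 \<in> {- int n..int n} \<and>
                                  c3 \<in> {- int n..int n} \<and> ill_conditioned c1 c2 c3 a d n}"
  shows "real (card S) / real (card ({- int n..int n} \<times> {- int n..int n} \<times> {- int n..int n}))
        \<le> 1 / ln (real (d * n)) + 1 / real n"
proof -
  define \<delta> where "\<delta> = 1 / ln (real (d * n))"
  define \<alpha> \<beta> where "\<alpha> = real a / d" and "\<beta> = (real d - real a) / d"
  let ?T = "near_points \<beta> \<alpha> \<delta> n" and ?sg = "{- 1, 1 :: int}"
  have pos: "0 < \<alpha>" "0 < \<beta>" "\<beta> + \<alpha> = 1" using ad by (auto simp: \<alpha>_def \<beta>_def add_divide_distrib[symmetric])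
  have dn: "2 \<le> d * n" using ad n mult_le_mono[of 2 d 1 n] by simp
  have "1 < real (d * n)" using dn by linarith
  then have ln0: "0 < ln (real (d * n))" by (rule ln_gt_zero)
  then have \<delta>: "0 < \<delta>" by (simp add: \<delta>_def)
  have "S \<subseteq> (\<lambda>((s1, s2, s3), (i, k, j)). (s1 * int i, s2 * int k, s3 * int j)) ` ((?sg \<times> ?sg \<times> ?sg) \<times> ?T)"
  proof
    fix x assume "x \<in> S"
    then obtain c1 c2 c3 where x: "x = (c1, c2, c3)" and ill: "ill_conditioned c1 c2 c3 a d n" by (auto simp: S_def)
    note near = ill_conditioned_near[OF ill]
    have sg: "c = sgn c * int (nat \<bar>c\<bar>)" "c \<noteq> 0 \<Longrightarrow> sgn c \<in> ?sg" for c :: int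
      by (auto simp: sgn_if)
    let ?p = "((sgn c1, sgn c2, sgn c3), (nat \<bar>c1\<bar>, nat \<bar>c2\<bar>, nat \<bar>c3\<bar>))"
    have "x = (\<lambda>((s1, s2, s3), (i, k, j)). (s1 * int i, s2 * int k, s3 * int j)) ?p"
      unfolding x prod.case using sg(1)[of c1] sg(1)[of c2] sg(1)[of c3] by simp
    moreover have "?p \<in> (?sg \<times> ?sg \<times> ?sg) \<times> ?T"
      unfolding \<alpha>_def \<beta>_def \<delta>_def using near sg(2) by (intro SigmaI) simp_all
    ultimately show "x \<in> (\<lambda>((s1, s2, s3), (i, k, j)). (s1 * int i, s2 * int k, s3 * int j)) ` ((?sg \<times> ?sg \<times> ?sg) \<times> ?T)"
      by (rule image_eqI)
  qed
  then have "card S \<le> card ((?sg \<times> ?sg \<times> ?sg) \<times> ?T)"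
    by (rule surj_card_le[rotated]) (auto intro!: finite_cartesian_product finite_near_points)
  also have "\<dots> = 8 * card ?T" by (simp add: card_cartesian_product)
  finally have "real (card S) \<le> real (8 * card ?T)" by (simp only: of_nat_le_iff)
  then have S: "real (card S) \<le> 8 * real (card ?T)" by simp
  have N: "real (card ({- int n..int n} \<times> {- int n..int n} \<times> {- int n..int n})) = (2 * real n + 1) ^ 3"
    by (simp add: card_cartesian_product power3_eq_cube)
  have n1: "1 \<le> real n" using n by simp
  have "8 * real (card ?T) \<le> (2 * real n + 1) ^ 3 * (\<delta> + 1 / n)"
  proof (cases "10 \<le> d * n")
    case True
    have "exp 23 \<le> (10::real) ^ 10"
    proof -
      have "exp 23 = exp (1::real) ^ 23" by (simp add: exp_of_nat_mult[symmetric])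
      also have "\<dots> \<le> (272 / 100) ^ 23" using exp_1_lower by (intro power_mono) auto
      also have "\<dots> \<le> 10 ^ 10" by (simp add: power_divide)
      finally show ?thesis .
    qed
    then have "ln (exp 23) \<le> ln ((10::real) ^ 10)" by (subst ln_le_cancel_iff) auto
    also have "ln ((10::real) ^ 10) = real 10 * ln 10" by (rule ln_realpow)
    finally have "23 / 10 \<le> ln (10::real)" by simp
    also have "10 \<le> real (d * n)" using True by linarith
    then have "ln 10 \<le> ln (real (d * n))" by (subst ln_le_cancel_iff) linarith+
    finally have "\<delta> \<le> 1 / (23 / 10)" unfolding \<delta>_def by (intro divide_left_mono) auto
    then have \<delta>10: "\<delta> \<le> 10 / 23" by simp
    have "real (card ?T) \<le> real n ^ 2 + \<delta> * real n ^ 3 + \<delta> * real n ^ 2"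
    proof (cases "\<beta> \<le> 1 / 2")
      case True
      then show ?thesis using card_near_points[OF pos(3,2) _ \<delta> \<delta>10 n] by simp
    next
      case False
      then have "\<alpha> \<le> 1 / 2" "\<alpha> + \<beta> = 1" using pos(3) by linarith+
      then show ?thesis using card_near_points[OF _ pos(1) _ \<delta> \<delta>10 n, of \<beta>] card_near_points_swap[of \<beta> \<alpha> \<delta> n] by simp
    qed
    then have "8 * real (card ?T) \<le> 8 * (real n ^ 2 + \<delta> * real n ^ 3 + \<delta> * real n ^ 2)" by simp
    also have "\<dots> \<le> (8 * real n ^ 3 + 8 * real n ^ 2) * \<delta> + (8 * real n ^ 3) * (1 / n)"
      using n1 by (simp add: power2_eq_square power3_eq_cube field_simps)
    also have "\<dots> \<le> (2 * real n + 1) ^ 3 * \<delta> + (2 * real n + 1) ^ 3 * (1 / n)"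
    proof -
      have "(2 * real n + 1) ^ 3 = 8 * real n ^ 3 + 12 * real n ^ 2 + 6 * real n + 1"
        by (simp add: power3_eq_cube power2_eq_square algebra_simps)
      then have "8 * real n ^ 3 + 8 * real n ^ 2 \<le> (2 * real n + 1) ^ 3" "8 * real n ^ 3 \<le> (2 * real n + 1) ^ 3" by auto
      then show ?thesis using \<delta> by (intro add_mono mult_right_mono) auto
    qed
    finally show ?thesis by (simp add: distrib_left)
  next
    case False
    have "?T \<subseteq> {1..n} \<times> {1..n} \<times> {1..n}" by (auto simp: near_points_def)
    then have "card ?T \<le> card ({1..n} \<times> {1..n} \<times> {1..n})" by (intro card_mono) auto
    then have "card ?T \<le> n * (n * n)" by (simp add: card_cartesian_product)
    then have "real (card ?T) \<le> real (n * (n * n))" by (simp only: of_nat_le_iff)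
    then have T: "8 * real (card ?T) \<le> 8 * real n ^ 3" by (simp add: power3_eq_cube)
    have "real (d * n) \<le> 9" using False by linarith
    then have "ln (real (d * n)) \<le> ln 16" using dn by (subst ln_le_cancel_iff) linarith+
    also have "ln (16::real) = 4 * ln 2" using ln_realpow[of 2 4] by simp
    also have "\<dots> \<le> 25 / 9" using ln2_le_25_over_36 by simp
    finally have "1 / (25 / 9) \<le> \<delta>" unfolding \<delta>_def using ln0 by (intro divide_left_mono) auto
    then have d1: "9 / 25 \<le> \<delta>" by simp
    \<comment> \<open>For \<open>n = 4\<close> the bound \<open>9 / 25\<close> is not sufficient, but then \<open>d = 2\<close>.\<close>
    have d4: "12 / 25 \<le> \<delta>" if "n = 4"
    proof -
      have "\<not> 10 \<le> d * 4" using False that by simp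
      then have "d \<le> 2" by linarith
      then have "d * n \<le> 8" using that by simp
      then have "real (d * n) \<le> 8" by linarith
      then have "ln (real (d * n)) \<le> ln 8" using dn by (subst ln_le_cancel_iff) linarith+
      also have "ln (8::real) = 3 * ln 2" using ln_realpow[of 2 3] by simp
      also have "\<dots> \<le> 25 / 12" using ln2_le_25_over_36 by simp
      finally have "1 / (25 / 12) \<le> \<delta>" unfolding \<delta>_def using ln0 by (intro divide_left_mono) auto
      then show ?thesis by simp
    qed
    have "2 * n \<le> d * n" using ad by (intro mult_right_mono) auto
    then have "n \<le> 4" using False by linarith
    then consider "n = 1" | "n = 2" | "n = 3" | "n = 4" using n by linarith
    then have "8 * real n ^ 3 \<le> (2 * real n + 1) ^ 3 * (\<delta> + 1 / n)"
    proof cases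
      case 4
      then show ?thesis using d4 by (simp add: power3_eq_cube)
    qed (use d1 in \<open>simp_all add: power3_eq_cube\<close>)
    then show ?thesis using T by linarith
  qed
  then have "real (card S) \<le> (2 * real n + 1) ^ 3 * (\<delta> + 1 / n)" using S by linarith
  moreover have "0 < (2 * real n + 1) ^ 3" using n1 by (intro zero_less_power) linarith
  ultimately show ?thesis unfolding N \<delta>_def[symmetric] by (simp add: pos_divide_le_eq mult.commute)
qed

section \<open>Finding the real roots and counting ill-conditioned trinomials\<close>

theorem theorem1p1:
  shows
    "(\<exists>(M :: tm) (e :: nat \<Rightarrow> real) (K :: real).
        valid_tm M \<and> e \<longlonglongrightarrow> 0 \<and>
        (\<forall>(c1::int) (c2::int) (c3::int) (a2::nat) (a3::nat) (H::nat).
           admissible c1 c2 c3 a2 a3 H \<and> \<not> ill_conditioned c1 c2 c3 a2 a3 H \<longrightarrow>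
           (\<exists>(t::nat) (m::nat) (r :: nat \<Rightarrow> int) (s :: nat \<Rightarrow> int) (\<zeta> :: nat \<Rightarrow> real).
              computes_within M
                (encode_ints [c1, c2, c3, int a2, int a3, int H])
                (encode_fractions (map (\<lambda>j. (r j, s j)) [0..<m])) t \<and>
              real t \<le> ln (real (a3 * H)) powr (4 + e (a3 * H)) \<and>
              (\<forall>j<m. s j \<noteq> 0) \<and>
              card {of_int (r j) / of_int (s j) :: rat | j. j < m} = m \<and>
              (\<forall>j<m. r j \<noteq> 0 \<longrightarrow>
                 ln \<bar>real_of_int (r j)\<bar> \<le> K * ln (real (a3 * H)) \<and>
                 ln \<bar>real_of_int (s j)\<bar> \<le> K * ln (real (a3 * H))) \<and>
              (\<forall>j<m. trinomial c1 c2 c3 a2 a3 (\<zeta> j) = 0 \<and>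
                 newton_converges
                   (if degenerate_root (trinomial c1 c2 c3 a2 a3) (\<zeta> j)
                    then deriv (trinomial c1 c2 c3 a2 a3)
                    else trinomial c1 c2 c3 a2 a3)
                   (real_of_int (r j) / real_of_int (s j)) (\<zeta> j)) \<and>
              card (\<zeta> ` {..<m}) = m \<and>
              card {x. trinomial c1 c2 c3 a2 a3 x = 0} = m)))
     \<and>
     (\<forall>(a2::nat) (a3::nat) (H::nat). 0 < a2 \<and> a2 < a3 \<and> 0 < H \<longrightarrow>
        real (card {(c1, c2, c3). c1 \<in> {- int H..int H} \<and> c2 \<in> {- int H..int H} \<and>
                                  c3 \<in> {- int H..int H} \<and> ill_conditioned c1 c2 c3 a2 a3 H})
          / real (card ({- int H..int H} \<times> {- int H..int H} \<times> {- int H..int H}))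
        \<le> 1 / ln (real (a3 * H)) + 1 / real H)"
proof (rule conjI, goal_cases)
  case 1
  obtain M e K where M: "valid_tm M" "e \<longlonglongrightarrow> 0"
    and roots: "\<And>c1 c2 c3 a d H. admissible c1 c2 c3 a d H \<Longrightarrow> \<not> ill_conditioned c1 c2 c3 a d H \<Longrightarrow>
      finds_roots M e K c1 c2 c3 a d H"
    using root_finding by blast
  show ?case
    by (rule exI[of _ M], rule exI[of _ e], rule exI[of _ K], intro conjI allI impI, rule M(1), rule M(2),
        erule conjE, rule roots[unfolded finds_roots_def])
next
  case 2
  show ?case using ill_conditioned_fraction by blast
qed

end
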